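(* Let $p$ be a prime, let $C_{p^r}$ be a cyclic normal subgroup (of order $p^r$) of a finite $p$-group $G$, and let $k$ be a field of characteristic $p$. Let $M_n$ be an indecomposable $kC_{p^r}$-module of dimension $n$, and write $M = M_n{\uparrow}^G$ for the induced module. Then, for each $x \in G$, one can define the right multiplication map $R_{x-1}: M\to M$ (as a map of left $kG$-modules), and it is a ghost. Moreover, if $n \le \lceil \frac{p^r-1}{2} \rceil$, then the ghost length of $M$, the generating length of $M$ and the radical length of $M$ are all equal.
   Context: Right multiplication on $M$: let $g$ be a generator of $C_{p^r}$. The module $M_n$ is identified with the left submodule of $kC_{p^r}$ generated by $(g-1)^{p^r-n}$, so $M=M_n{\uparrow}^G = kG\otimes_{kC_{p^r}} M_n$ is identified with the left ideal of $kG$ generated by $(g-1)^{p^r-n}$. Since $C_{p^r}$ is normal this is a sub-bimodule of $kG$, and $R_{x-1}(m)=m(x-1)$. The radical length of $M$ is the smallest $n$ with $J(kG)^nM=0$, with $J(kG)$ the Jacobson radical. $\mathrm{StMod}(kG)$ is the stable module category: objects are left $kG$-modules, morphisms are $[M,N] = \mathrm{Hom}_{kG}(M,N)$ modulo maps factoring through a projective. It is triangulated, with desuspension $\Omega M$ the kernel of a surjection from a projective onto $M$, and $\Sigma=\Omega^{-1}$. $\mathrm{Thick}\langle k\rangle$ is the smallest full triangulated subcategory closed under retracts and containing the trivial module $k$; for $G$ a $p$-group it equals $\mathrm{stmod}(kG)$, the full subcategory of modules stably isomorphic to finitely generated ones. A ghost is a map $f$ in $\mathrm{StMod}(kG)$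 with $[\Omega^n k,f]=0$ for all $n\in\mathbb{Z}$. The ghost length of $M\in\mathrm{Thick}\langle k\rangle$ is the smallest $n\ge 0$ such that every composite of $n$ ghosts between objects of $\mathrm{Thick}\langle k\rangle$ with domain $M$ is zero in $\mathrm{StMod}(kG)$ (a composite of $0$ ghosts being any map). The generating length of $M$ is the smallest $n\ge 0$ with $M\in\mathcal{F}_n$, where $\mathcal{F}_0$ consists of the zero objects of $\mathrm{StMod}(kG)$, $\mathcal{F}_1$ consists of retracts of (arbitrary) direct sums of modules $\Omega^i k$, $i\in\mathbb{Z}$, and $X\in\mathcal{F}_n$ iff $X$ is a retract of some $Y$ in a triangle $P\to Y\to Q\to\Sigma P$ with $P\in\mathcal{F}_1$, $Q\in\mathcal{F}_{n-1}$; equivalently it is the smallest $n$ such that every composite of $n$ ghosts in $\mathrm{StMod}(kG)$ with domain $M$ is zero. *)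

theory Defs
  imports "HOL-Algebra.Algebra" "HOL-Library.Extended_Nat"
    "HOL-Computational_Algebra.Primes"
begin

section \<open>Left modules over a not necessarily commutative ring\<close>

text \<open>
  The locale \<open>module\<close> of HOL-Algebra requires a commutative ring of scalars. We keep its
  record type (whose \<open>mult\<close> and \<open>one\<close> fields are never used below) and drop commutativity.
  The library predicate \<open>submodule\<close> does not depend on commutativity and is used as it is.
\<close>

locale left_module = R?: ring R + M?: abelian_group M
  for R :: "('r, 'x) ring_scheme" (structure) and M :: "('r, 'm, 'y) module_scheme" (structure) +
  assumes smult_closed:
      "\<lbrakk>a \<in> carrier R; x \<in> carrier M\<rbrakk> \<Longrightarrow> a \<odot>\<^bsub>M\<^esub> x \<in> carrier M"
    and smult_l_distr:
      "\<lbrakk>a \<in> carrier R; b \<in> carrier R; x \<in> carrier M\<rbrakk> \<Longrightarrow>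
        (a \<oplus> b) \<odot>\<^bsub>M\<^esub> x = (a \<odot>\<^bsub>M\<^esub> x) \<oplus>\<^bsub>M\<^esub> (b \<odot>\<^bsub>M\<^esub> x)"
    and smult_r_distr:
      "\<lbrakk>a \<in> carrier R; x \<in> carrier M; y \<in> carrier M\<rbrakk> \<Longrightarrow>
        a \<odot>\<^bsub>M\<^esub> (x \<oplus>\<^bsub>M\<^esub> y) = (a \<odot>\<^bsub>M\<^esub> x) \<oplus>\<^bsub>M\<^esub> (a \<odot>\<^bsub>M\<^esub> y)"
    and smult_assoc:
      "\<lbrakk>a \<in> carrier R; b \<in> carrier R; x \<in> carrier M\<rbrakk> \<Longrightarrow>
        (a \<otimes> b) \<odot>\<^bsub>M\<^esub> x = a \<odot>\<^bsub>M\<^esub> (b \<odot>\<^bsub>M\<^esub> x)"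
    and smult_one:
      "x \<in> carrier M \<Longrightarrow> \<one> \<odot>\<^bsub>M\<^esub> x = x"

definition lmod_hom :: "'r ring \<Rightarrow> ('r, 'a) module \<Rightarrow> ('r, 'b) module \<Rightarrow> ('a \<Rightarrow> 'b) set" where
  "lmod_hom R M N = {f. f \<in> carrier M \<rightarrow> carrier N
     \<and> (\<forall>x\<in>carrier M. \<forall>y\<in>carrier M. f (x \<oplus>\<^bsub>M\<^esub> y) = f x \<oplus>\<^bsub>N\<^esub> f y)
     \<and> (\<forall>a\<in>carrier R. \<forall>x\<in>carrier M. f (a \<odot>\<^bsub>M\<^esub> x) = a \<odot>\<^bsub>N\<^esub> f x)}"

definition lmod_iso :: "'r ring \<Rightarrow> ('r, 'a) module \<Rightarrow> ('r, 'b) module \<Rightarrow> ('a \<Rightarrow> 'b) set" where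
  "lmod_iso R M N = {f \<in> lmod_hom R M N. bij_betw f (carrier M) (carrier N)}"

definition regular_module :: "'r ring \<Rightarrow> ('r, 'r) module" where
  "regular_module R = \<lparr>carrier = carrier R, monoid.mult = (\<otimes>\<^bsub>R\<^esub>), one = \<one>\<^bsub>R\<^esub>,
     ring.zero = \<zero>\<^bsub>R\<^esub>, add = (\<oplus>\<^bsub>R\<^esub>), smult = (\<otimes>\<^bsub>R\<^esub>)\<rparr>"

definition indecomposable :: "'r ring \<Rightarrow> ('r, 'a) module \<Rightarrow> bool" where
  "indecomposable R M \<longleftrightarrow> left_module R M \<and> carrier M \<noteq> {\<zero>\<^bsub>M\<^esub>}
     \<and> (\<forall>A B. submodule A R M \<and> submodule B R M
          \<and> A <+>\<^bsub>M\<^esub> B = carrier M \<and> A \<inter> B = {\<zero>\<^bsub>M\<^esub>}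
          \<longrightarrow> A = {\<zero>\<^bsub>M\<^esub>} \<or> B = {\<zero>\<^bsub>M\<^esub>})"

definition direct_sum_decomp :: "'r ring \<Rightarrow> ('r, 'a) module \<Rightarrow> 'a set set \<Rightarrow> bool" where
  "direct_sum_decomp R M \<S> \<longleftrightarrow> left_module R M \<and> (\<forall>A\<in>\<S>. submodule A R M)
     \<and> (\<forall>x\<in>carrier M. \<exists>F s. finite F \<and> F \<subseteq> \<S> \<and> (\<forall>A\<in>F. s A \<in> A) \<and> x = (\<Oplus>\<^bsub>M\<^esub>A\<in>F. s A))
     \<and> (\<forall>F s. finite F \<and> F \<subseteq> \<S> \<and> (\<forall>A\<in>F. s A \<in> A) \<and> (\<Oplus>\<^bsub>M\<^esub>A\<in>F. s A) = \<zero>\<^bsub>M\<^esub>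
          \<longrightarrow> (\<forall>A\<in>F. s A = \<zero>\<^bsub>M\<^esub>))"


section \<open>Jacobson radical and radical length\<close>

definition left_ideal :: "'r ring \<Rightarrow> 'r set \<Rightarrow> bool" where
  "left_ideal R I \<longleftrightarrow> submodule I R (regular_module R)"

definition maximal_left_ideal :: "'r ring \<Rightarrow> 'r set \<Rightarrow> bool" where
  "maximal_left_ideal R I \<longleftrightarrow> left_ideal R I \<and> I \<noteq> carrier R
     \<and> (\<forall>J. left_ideal R J \<and> I \<subseteq> J \<longrightarrow> J = I \<or> J = carrier R)"

definition jacobson_radical :: "'r ring \<Rightarrow> 'r set" where
  "jacobson_radical R = {a \<in> carrier R. \<forall>I. maximal_left_ideal R I \<longrightarrow> a \<in> I}"

definition ideal_power :: "'r ring \<Rightarrow> 'r set \<Rightarrow> nat \<Rightarrow> 'r set" where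
  "ideal_power R J n = (ideal_prod R J ^^ n) (carrier R)"

text \<open>All three lengths take values in \<^typ>\<open>enat\<close>: the infimum of a nonempty set is its least
  element, and the infimum is \<open>\<infinity>\<close> if there is no \<open>n\<close> with the required property.\<close>

definition radical_length :: "'r ring \<Rightarrow> ('r, 'a) module \<Rightarrow> enat" where
  "radical_length R M = Inf {enat n | n.
     \<forall>a \<in> ideal_power R (jacobson_radical R) n. \<forall>m \<in> carrier M. a \<odot>\<^bsub>M\<^esub> m = \<zero>\<^bsub>M\<^esub>}"


section \<open>The stable module category\<close>

text \<open>
  The objects of the stable category are the left modules whose carrier is a subset of a fixed
  type \<open>'u\<close>, which plays the role of the universe. If \<open>'u\<close> is infinite and its cardinality is
  at least that of \<open>R\<close>, then every left module of cardinality at most that of \<open>'u\<close> has an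
  isomorphic copy on a subset of \<open>'u\<close>, so the choice of
  \<open>'u\<close> only bounds the cardinality of the objects. Morphisms are represented by functions between carriers.
\<close>

definition projective :: "'r ring \<Rightarrow> ('r, 'u) module \<Rightarrow> bool" where
  "projective R P \<longleftrightarrow> left_module R P \<and>
     (\<forall>(A :: ('r, 'u) module) (B :: ('r, 'u) module) q f.
        left_module R A \<and> left_module R B
        \<and> q \<in> lmod_hom R A B \<and> q ` carrier A = carrier B \<and> f \<in> lmod_hom R P B
        \<longrightarrow> (\<exists>h \<in> lmod_hom R P A. \<forall>x\<in>carrier P. q (h x) = f x))"

definition stably_zero ::
    "'r ring \<Rightarrow> ('r, 'u) module \<Rightarrow> ('r, 'u) module \<Rightarrow> ('u \<Rightarrow> 'u) \<Rightarrow> bool" where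
  "stably_zero R M N f \<longleftrightarrow> (\<exists>(P :: ('r, 'u) module) a b.
     projective R P \<and> a \<in> lmod_hom R M P \<and> b \<in> lmod_hom R P N
     \<and> (\<forall>m\<in>carrier M. f m = b (a m)))"

definition stably_equal ::
    "'r ring \<Rightarrow> ('r, 'u) module \<Rightarrow> ('r, 'u) module \<Rightarrow> ('u \<Rightarrow> 'u) \<Rightarrow> ('u \<Rightarrow> 'u) \<Rightarrow> bool" where
  "stably_equal R M N f g \<longleftrightarrow> stably_zero R M N (\<lambda>m. f m \<ominus>\<^bsub>N\<^esub> g m)"

definition stable_zero_object :: "'r ring \<Rightarrow> ('r, 'u) module \<Rightarrow> bool" where
  "stable_zero_object R M \<longleftrightarrow> left_module R M \<and> stably_zero R M M id"

definition stable_iso :: "'r ring \<Rightarrow> ('r, 'u) module \<Rightarrow> ('r, 'u) module \<Rightarrow> ('u \<Rightarrow> 'u) \<Rightarrow> bool" where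
  "stable_iso R M N f \<longleftrightarrow> left_module R M \<and> left_module R N \<and> f \<in> lmod_hom R M N
     \<and> (\<exists>g \<in> lmod_hom R N M. stably_equal R M M (g \<circ> f) id \<and> stably_equal R N N (f \<circ> g) id)"

definition stable_retract :: "'r ring \<Rightarrow> ('r, 'u) module \<Rightarrow> ('r, 'u) module \<Rightarrow> bool" where
  "stable_retract R M N \<longleftrightarrow> left_module R M \<and> left_module R N
     \<and> (\<exists>i \<in> lmod_hom R M N. \<exists>r \<in> lmod_hom R N M. stably_equal R M M (r \<circ> i) id)"

definition short_exact :: "'r ring \<Rightarrow> ('r, 'u) module \<Rightarrow> ('u \<Rightarrow> 'u) \<Rightarrow> ('r, 'u) module
    \<Rightarrow> ('u \<Rightarrow> 'u) \<Rightarrow> ('r, 'u) module \<Rightarrow> bool" where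
  "short_exact R A i B q C \<longleftrightarrow> left_module R A \<and> left_module R B \<and> left_module R C
     \<and> i \<in> lmod_hom R A B \<and> q \<in> lmod_hom R B C
     \<and> inj_on i (carrier A) \<and> q ` carrier B = carrier C
     \<and> i ` carrier A = {b \<in> carrier B. q b = \<zero>\<^bsub>C\<^esub>}"

text \<open>\<open>syzygy R A B\<close>: the module \<open>A\<close> is (a choice of) \<open>\<Omega>B\<close>; equivalently \<open>B\<close> is \<open>\<Sigma>A\<close>.\<close>

definition syzygy :: "'r ring \<Rightarrow> ('r, 'u) module \<Rightarrow> ('r, 'u) module \<Rightarrow> bool" where
  "syzygy R A B \<longleftrightarrow> (\<exists>(P :: ('r, 'u) module) i q. projective R P \<and> short_exact R A i P q B)"

text \<open>
  Distinguished triangles \<open>A \<rightarrow> B \<rightarrow> D \<rightarrow> S\<close> with \<open>S = \<Sigma>A\<close>, for \<open>R\<close> a self-injective ring such as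
  a group algebra: \<open>S\<close> is the cokernel of an embedding \<open>a\<close> of \<open>A\<close> into a projective (hence
  injective) module \<open>I\<close>, the standard triangle on \<open>f\<close> is the one to the cone \<open>C\<close> of \<open>f\<close>, the
  pushout of \<open>a\<close> along \<open>f\<close>, given by the morphism of short exact sequences
    \<open>0 \<rightarrow> A \<rightarrow> I \<rightarrow> S \<rightarrow> 0\<close>
    \<open>0 \<rightarrow> B \<rightarrow> C \<rightarrow> S \<rightarrow> 0\<close>
  which is \<open>f\<close> on \<open>A\<close>, \<open>u\<close> on \<open>I\<close> and the identity on \<open>S\<close>; and a triangle starting with \<open>f\<close> is
  distinguished iff it is isomorphic in the stable category to the standard triangle on \<open>f\<close>.
\<close>

definition triangle :: "'r ring \<Rightarrow> ('r, 'u) module \<Rightarrow> ('u \<Rightarrow> 'u) \<Rightarrow> ('r, 'u) module \<Rightarrow> ('u \<Rightarrow> 'u)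
    \<Rightarrow> ('r, 'u) module \<Rightarrow> ('u \<Rightarrow> 'u) \<Rightarrow> ('r, 'u) module \<Rightarrow> bool" where
  "triangle R A f B g D h S \<longleftrightarrow>
     f \<in> lmod_hom R A B \<and> g \<in> lmod_hom R B D \<and> h \<in> lmod_hom R D S \<and>
     (\<exists>(I :: ('r, 'u) module) (C :: ('r, 'u) module) a b j q u w.
        projective R I \<and> short_exact R A a I b S
        \<and> short_exact R B j C q S
        \<and> u \<in> lmod_hom R I C
        \<and> (\<forall>x\<in>carrier A. u (a x) = j (f x)) \<and> (\<forall>y\<in>carrier I. q (u y) = b y)
        \<and> stable_iso R C D w
        \<and> stably_equal R B D (w \<circ> j) g \<and> stably_equal R C S (h \<circ> w) q)"


section \<open>Group algebras and induced modules\<close>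

text \<open>
  For a finite group \<open>G\<close>, elements of the group algebra are the functions on the ambient type of
  \<open>G\<close> vanishing off \<open>G\<close>. Hence for a subgroup \<open>H\<close> the group algebra of \<open>H\<close> is literally a subring
  of that of \<open>G\<close>.
\<close>

definition group_algebra :: "('g, 'x) monoid_scheme \<Rightarrow> ('g \<Rightarrow> 'k::field) ring" where
  "group_algebra G = \<lparr>carrier = {a. \<forall>x. x \<notin> carrier G \<longrightarrow> a x = 0},
     monoid.mult = (\<lambda>a b x. if x \<in> carrier G then \<Sum>y\<in>carrier G. a y * b (inv\<^bsub>G\<^esub> y \<otimes>\<^bsub>G\<^esub> x) else 0),
     one = (\<lambda>x. if x = \<one>\<^bsub>G\<^esub> then 1 else 0),
     ring.zero = (\<lambda>x. 0),
     add = (\<lambda>a b x. a x + b x)\<rparr>"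

text \<open>The element \<open>c x\<close> of the group algebra, for \<open>c\<close> in the field and \<open>x\<close> in the group.\<close>

definition ga_single :: "'g \<Rightarrow> 'k::field \<Rightarrow> 'g \<Rightarrow> 'k" where
  "ga_single x c = (\<lambda>y. if y = x then c else 0)"

text \<open>The element \<open>x - 1\<close> of the group algebra.\<close>

definition minus_one :: "('g, 'x) monoid_scheme \<Rightarrow> 'g \<Rightarrow> 'g \<Rightarrow> 'k::field" where
  "minus_one G x = ga_single x 1 \<ominus>\<^bsub>group_algebra G\<^esub> \<one>\<^bsub>group_algebra G\<^esub>"

definition trivial_module :: "('g, 'x) monoid_scheme \<Rightarrow> ('g \<Rightarrow> 'k::field, 'k) module" where
  "trivial_module G = \<lparr>carrier = UNIV, monoid.mult = (*), one = 1, ring.zero = 0, add = (+),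
     smult = (\<lambda>a c. (\<Sum>x\<in>carrier G. a x) * c)\<rparr>"

text \<open>\<open>V\<close> has a basis of \<open>n\<close> elements as a vector space over the field.\<close>

definition has_dimension ::
    "('g, 'x) monoid_scheme \<Rightarrow> ('g \<Rightarrow> 'k::field, 'v) module \<Rightarrow> nat \<Rightarrow> bool" where
  "has_dimension G V n \<longleftrightarrow> (\<exists>b. b \<in> {..<n} \<rightarrow> carrier V \<and>
     (\<forall>v\<in>carrier V. \<exists>!c. c \<in> {..<n} \<rightarrow>\<^sub>E (UNIV :: 'k set)
        \<and> v = (\<Oplus>\<^bsub>V\<^esub>i\<in>{..<n}. ga_single \<one>\<^bsub>G\<^esub> (c i) \<odot>\<^bsub>V\<^esub> b i)))"

text \<open>
  The tensor product of \<open>S\<close> and \<open>V\<close> over \<open>R\<close>, as a left module over \<open>S\<close>, for \<open>R\<close> a subring of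
  \<open>S\<close> and \<open>V\<close> a left module over \<open>R\<close>: the quotient of the free abelian group on pairs by the
  usual relations.
\<close>

definition tensor_free :: "'r ring \<Rightarrow> ('r, 'v) module \<Rightarrow> ('r \<times> 'v \<Rightarrow>\<^sub>0 int) monoid" where
  "tensor_free S V = free_Abelian_group (carrier S \<times> carrier V)"

definition tensor_relations ::
    "'r ring \<Rightarrow> 'r ring \<Rightarrow> ('r, 'v) module \<Rightarrow> ('r \<times> 'v \<Rightarrow>\<^sub>0 int) set" where
  "tensor_relations S R V = generate (tensor_free S V)
     ({frag_of (a \<oplus>\<^bsub>S\<^esub> b, v) - frag_of (a, v) - frag_of (b, v) | a b v.
         a \<in> carrier S \<and> b \<in> carrier S \<and> v \<in> carrier V}
    \<union> {frag_of (a, v \<oplus>\<^bsub>V\<^esub> w) - frag_of (a, v) - frag_of (a, w) | a v w.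
         a \<in> carrier S \<and> v \<in> carrier V \<and> w \<in> carrier V}
    \<union> {frag_of (a \<otimes>\<^bsub>S\<^esub> r, v) - frag_of (a, r \<odot>\<^bsub>V\<^esub> v) | a r v.
         a \<in> carrier S \<and> r \<in> carrier R \<and> v \<in> carrier V})"

definition extend_scalars ::
    "'r ring \<Rightarrow> 'r ring \<Rightarrow> ('r, 'v) module \<Rightarrow> ('r, ('r \<times> 'v \<Rightarrow>\<^sub>0 int) set) module" where
  "extend_scalars S R V =
     (let F = tensor_free S V; N = tensor_relations S R V; Q = F Mod N in
      \<lparr>carrier = carrier Q, monoid.mult = undefined, one = undefined, ring.zero = \<one>\<^bsub>Q\<^esub>, add = (\<otimes>\<^bsub>Q\<^esub>),
       smult = (\<lambda>s T. \<Union>z\<in>T. N #>\<^bsub>F\<^esub> frag_extend (\<lambda>(a, v). frag_of (s \<otimes>\<^bsub>S\<^esub> a, v)) z)\<rparr>)"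

definition induced_module :: "('g, 'x) monoid_scheme \<Rightarrow> 'g set \<Rightarrow> ('g \<Rightarrow> 'k::field, 'v) module
    \<Rightarrow> ('g \<Rightarrow> 'k, (('g \<Rightarrow> 'k) \<times> 'v \<Rightarrow>\<^sub>0 int) set) module" where
  "induced_module G H V = extend_scalars (group_algebra G) (group_algebra (G\<lparr>carrier := H\<rparr>)) V"

text \<open>The left ideal generated by \<open>a\<close>, as a left module.\<close>

definition principal_left_ideal :: "'r ring \<Rightarrow> 'r \<Rightarrow> ('r, 'r) module" where
  "principal_left_ideal R a = (regular_module R)\<lparr>carrier := {b \<otimes>\<^bsub>R\<^esub> a | b. b \<in> carrier R}\<rparr>"


section \<open>Ghosts, ghost length and generating length\<close>

text \<open>\<open>omega_trivial G i A\<close>: the module \<open>A\<close> is (a choice of) \<open>\<Omega>\<^sup>i k\<close>, where \<open>i\<close> is an integer.\<close>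

inductive omega_trivial ::
    "('g, 'x) monoid_scheme \<Rightarrow> int \<Rightarrow> ('g \<Rightarrow> 'k::field, 'u) module \<Rightarrow> bool"
  for G :: "('g, 'x) monoid_scheme" where
  omega_zero: "omega_trivial G 0 A"
    if "left_module (group_algebra G) A" "lmod_iso (group_algebra G) A (trivial_module G) \<noteq> {}"
| omega_succ: "omega_trivial G (i + 1) B"
    if "omega_trivial G i A" "syzygy (group_algebra G) B A"
| omega_pred: "omega_trivial G (i - 1) B"
    if "omega_trivial G i A" "syzygy (group_algebra G) A B"

definition ghost :: "('g, 'x) monoid_scheme \<Rightarrow> ('g \<Rightarrow> 'k::field, 'u) module
    \<Rightarrow> ('g \<Rightarrow> 'k, 'u) module \<Rightarrow> ('u \<Rightarrow> 'u) \<Rightarrow> bool" where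
  "ghost G M N f \<longleftrightarrow>
     left_module (group_algebra G) M \<and> left_module (group_algebra G) N
     \<and> f \<in> lmod_hom (group_algebra G) M N
     \<and> (\<forall>i A. omega_trivial G i A \<longrightarrow>
          (\<forall>h \<in> lmod_hom (group_algebra G) A M. stably_zero (group_algebra G) A N (f \<circ> h)))"

text \<open>\<open>Thick\<langle>k\<rangle>\<close>: closure under \<open>\<Sigma>\<close>, \<open>\<Omega>\<close> and cones makes it a triangulated subcategory;
  closure under stable retracts includes closure under stable isomorphism.\<close>

inductive thick_trivial :: "('g, 'x) monoid_scheme \<Rightarrow> ('g \<Rightarrow> 'k::field, 'u) module \<Rightarrow> bool"
  for G :: "('g, 'x) monoid_scheme" where
  thick_unit: "thick_trivial G A"
    if "omega_trivial G 0 A"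
| thick_Sigma: "thick_trivial G B"
    if "thick_trivial G A" "syzygy (group_algebra G) A B"
| thick_Omega: "thick_trivial G B"
    if "thick_trivial G A" "syzygy (group_algebra G) B A"
| thick_cone: "thick_trivial G D"
    if "triangle (group_algebra G) A f B g D h S" "thick_trivial G A" "thick_trivial G B"
| thick_retract: "thick_trivial G A"
    if "thick_trivial G B" "stable_retract (group_algebra G) A B"

text \<open>\<open>ghost_composite G n M N f\<close>: the map \<open>f\<close> is a composite of \<open>n\<close> ghosts between objects of
  \<open>Thick\<langle>k\<rangle>\<close>, with domain \<open>M\<close> and codomain \<open>N\<close>. In the successor case the base map at the
  end of the composite is harmless: a ghost followed by any map is a ghost.\<close>

inductive ghost_composite :: "('g, 'x) monoid_scheme \<Rightarrow> nat \<Rightarrow> ('g \<Rightarrow> 'k::field, 'u) module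
    \<Rightarrow> ('g \<Rightarrow> 'k, 'u) module \<Rightarrow> ('u \<Rightarrow> 'u) \<Rightarrow> bool"
  for G :: "('g, 'x) monoid_scheme" where
  composite_0: "ghost_composite G 0 M N f"
    if "thick_trivial G M" "thick_trivial G N" "f \<in> lmod_hom (group_algebra G) M N"
| composite_Suc: "ghost_composite G (Suc n) M N (f \<circ> e)"
    if "thick_trivial G M" "thick_trivial G L" "ghost G M L e" "ghost_composite G n L N f"

definition ghost_length :: "('g, 'x) monoid_scheme \<Rightarrow> ('g \<Rightarrow> 'k::field, 'u) module \<Rightarrow> enat" where
  "ghost_length G M = Inf {enat n | n.
     \<forall>N f. ghost_composite G n M N f \<longrightarrow> stably_zero (group_algebra G) M N f}"

text \<open>The classes \<open>\<F>\<^sub>n\<close>. The direct sums are arbitrary (any set of summands), given as internal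
  direct sums.\<close>

fun gen_class :: "('g, 'x) monoid_scheme \<Rightarrow> nat \<Rightarrow> ('g \<Rightarrow> 'k::field, 'u) module \<Rightarrow> bool" where
  "gen_class G 0 A \<longleftrightarrow> stable_zero_object (group_algebra G) A"
| "gen_class G (Suc 0) A \<longleftrightarrow> (\<exists>(B :: ('g \<Rightarrow> 'k, 'u) module) \<S>.
     direct_sum_decomp (group_algebra G) B \<S> \<and> (\<forall>E\<in>\<S>. \<exists>i. omega_trivial G i (B\<lparr>carrier := E\<rparr>))
     \<and> stable_retract (group_algebra G) A B)"
| "gen_class G (Suc (Suc n)) A \<longleftrightarrow> (\<exists>P f B g Q h S.
     triangle (group_algebra G) P f B g Q h S \<and> gen_class G (Suc 0) P \<and> gen_class G (Suc n) Q
     \<and> stable_retract (group_algebra G) A B)"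

definition generating_length :: "('g, 'x) monoid_scheme \<Rightarrow> ('g \<Rightarrow> 'k::field, 'u) module \<Rightarrow> enat" where
  "generating_length G M = Inf {enat n | n. gen_class G n M}"

end

theory Submission
  imports Defs "HOL-Computational_Algebra.Polynomial"
begin

text \<open>
  Write \<open>q = p\<^sup>r\<close>, \<open>t = g - 1\<close> and \<open>J\<close> for the augmentation ideal of \<open>kG\<close>, which is its Jacobson
  radical. In characteristic \<open>p\<close> one has \<open>t\<^sup>q = 0\<close>, an element \<open>a\<close> satisfies \<open>a t\<^sup>e = 0\<close>
  iff it lies in \<open>kG t\<^sup>q\<^sup>-\<^sup>e\<close>, and by normality of the cyclic subgroup \<open>kG t\<^sup>e = t\<^sup>e kG\<close>. An
  indecomposable module of dimension \<open>n\<close> over the cyclic subgroup is generated by one element whose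
  annihilator is generated by \<open>t\<^sup>n\<close> (\<open>indecomposable_has_cyclic_generator\<close>), so the induced module is
  isomorphic to \<open>kG t\<^sup>e\<close> with \<open>e = q - n\<close> (\<open>induced_module_iso\<close>).

  The stable category is accessible through Higman's criterion (\<open>stably_zero_iff\<close>): a homomorphism
  factors through a projective module iff it is the sum of the conjugates of a linear map under the
  group, that is, a trace. Linear maps extend along injections and lift along surjections, hence so
  do traces; this replaces all arguments with injective and projective modules.

  \<^item> Ghosts (\<open>right_mult_ghost_Nt\<close>). The image of a map from \<open>k\<close> to \<open>kG t\<^sup>e\<close> consists of fixed vectors
    of \<open>kG\<close>, which are multiples of the sum of all group elements and are annihilated by \<open>J\<close> on the
    right. So right multiplication by \<open>y \<in> J\<close> kills all maps from \<open>k\<close>. As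
    \<open>kG t\<^sup>e \<rightarrow> kG \<rightarrow> kG t\<^sup>q\<^sup>-\<^sup>e\<close> is exact, maps from a shift of \<open>k\<close> to \<open>kG t\<^sup>e\<close> correspond to maps from
    the next shift to \<open>kG t\<^sup>q\<^sup>-\<^sup>e\<close>, and right multiplication by \<open>y\<close> to right multiplication by another
    element of \<open>J\<close>.

  \<^item> Lower bound (\<open>right_mult_trace_zero\<close>). If right multiplication by \<open>z\<close> on \<open>kG t\<^sup>e\<close> is stably zero,
    it lifts along \<open>kG \<rightarrow> kG t\<^sup>e\<close> and extends over \<open>kG\<close>, so \<open>t\<^sup>e z = t\<^sup>e c t\<^sup>e\<close> for some \<open>c\<close>. The bound
    on \<open>n\<close> says \<open>2 n \<le> q\<close>, that is \<open>2 e \<ge> q\<close>, and then \<open>t\<^sup>e c t\<^sup>e\<close> is a multiple of \<open>t\<^sup>2\<^sup>e = 0\<close>. Hence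
    if all \<open>m\<close>-fold composites of ghosts from \<open>M\<close> vanish, then so does \<open>t\<^sup>e J\<^sup>m\<close>, and \<open>J\<^sup>m M = 0\<close>. The
    objects involved lie in the thick subcategory generated by \<open>k\<close>, since a finite-dimensional
    module of a \<open>p\<close>-group has a filtration with quotients \<open>k\<close> (\<open>thick_trivial_if_spans\<close>).

  \<^item> Upper bound (\<open>gen_class_if_ideal_power_annihilates\<close>). If \<open>J\<^sup>m M = 0\<close>, the socle series exhibits \<open>M\<close>
    as built from \<open>m\<close> modules with trivial action, so \<open>M\<close> lies in the class \<open>\<F>\<^sub>m\<close>.

  \<^item> Ghost lemma (\<open>ghost_lemma\<close>). If \<open>M\<close> lies in \<open>\<F>\<^sub>m\<close>, all \<open>m\<close>-fold composites of ghosts from \<open>M\<close> vanish.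

  So the three lengths are infima of one and the same set of numbers \<open>m\<close>
  (\<open>lengths_equal\<close>).
\<close>

(* order and smult are the order of a group and the scalar multiplication of a module. *)
hide_const (open) Polynomial.order Polynomial.smult

section \<open>Modules, homomorphisms and constructions of modules\<close>

context left_module
begin

lemma smult_zero_right:
  assumes a: "a \<in> carrier R"
  shows "a \<odot>\<^bsub>M\<^esub> \<zero>\<^bsub>M\<^esub> = \<zero>\<^bsub>M\<^esub>"
proof -
  have "a \<odot>\<^bsub>M\<^esub> \<zero>\<^bsub>M\<^esub> \<oplus>\<^bsub>M\<^esub> a \<odot>\<^bsub>M\<^esub> \<zero>\<^bsub>M\<^esub> = a \<odot>\<^bsub>M\<^esub> (\<zero>\<^bsub>M\<^esub> \<oplus>\<^bsub>M\<^esub> \<zero>\<^bsub>M\<^esub>)"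
    using a by (simp only: smult_r_distr M.zero_closed)
  also have "\<dots> = a \<odot>\<^bsub>M\<^esub> \<zero>\<^bsub>M\<^esub>" by simp
  finally show ?thesis
    using a by (metis M.add.l_cancel_one M.zero_closed smult_closed)
qed

lemma smult_zero_left:
  assumes x: "x \<in> carrier M"
  shows "\<zero> \<odot>\<^bsub>M\<^esub> x = \<zero>\<^bsub>M\<^esub>"
proof -
  have "\<zero> \<odot>\<^bsub>M\<^esub> x \<oplus>\<^bsub>M\<^esub> \<zero> \<odot>\<^bsub>M\<^esub> x = (\<zero> \<oplus> \<zero>) \<odot>\<^bsub>M\<^esub> x"
    using x by (simp only: smult_l_distr R.zero_closed)
  also have "\<dots> = \<zero> \<odot>\<^bsub>M\<^esub> x" by simp
  finally show ?thesis
    using x by (metis M.add.l_cancel_one R.zero_closed smult_closed)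
qed

lemma smult_neg_right:
  assumes "a \<in> carrier R" "x \<in> carrier M"
  shows "a \<odot>\<^bsub>M\<^esub> (\<ominus>\<^bsub>M\<^esub> x) = \<ominus>\<^bsub>M\<^esub> (a \<odot>\<^bsub>M\<^esub> x)"
  using assms smult_zero_right smult_r_distr[of a "\<ominus>\<^bsub>M\<^esub> x" x]
  by (metis M.add.inv_closed M.l_neg M.minus_equality smult_closed)

lemma smult_neg_left:
  assumes "a \<in> carrier R" "x \<in> carrier M"
  shows "(\<ominus> a) \<odot>\<^bsub>M\<^esub> x = \<ominus>\<^bsub>M\<^esub> (a \<odot>\<^bsub>M\<^esub> x)"
  using assms smult_zero_left smult_l_distr[of "\<ominus> a" a x]
  by (metis R.add.inv_closed R.l_neg M.minus_equality smult_closed)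

lemma smult_diff_left:
  assumes "a \<in> carrier R" "b \<in> carrier R" "x \<in> carrier M"
  shows "(a \<ominus> b) \<odot>\<^bsub>M\<^esub> x = (a \<odot>\<^bsub>M\<^esub> x) \<ominus>\<^bsub>M\<^esub> (b \<odot>\<^bsub>M\<^esub> x)"
  using assms by (simp add: a_minus_def smult_l_distr smult_neg_left)

lemma smult_diff_right:
  assumes "a \<in> carrier R" "x \<in> carrier M" "y \<in> carrier M"
  shows "a \<odot>\<^bsub>M\<^esub> (x \<ominus>\<^bsub>M\<^esub> y) = (a \<odot>\<^bsub>M\<^esub> x) \<ominus>\<^bsub>M\<^esub> (a \<odot>\<^bsub>M\<^esub> y)"
  using assms by (simp add: a_minus_def smult_r_distr smult_neg_right)

lemma finsum_smult:
  assumes "finite I" "a \<in> carrier R" "f \<in> I \<rightarrow> carrier M"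
  shows "a \<odot>\<^bsub>M\<^esub> (\<Oplus>\<^bsub>M\<^esub>i\<in>I. f i) = (\<Oplus>\<^bsub>M\<^esub>i\<in>I. a \<odot>\<^bsub>M\<^esub> f i)"
  using assms
proof (induction I)
  case (insert i I)
  have c: "f \<in> I \<rightarrow> carrier M" "(\<lambda>i. a \<odot>\<^bsub>M\<^esub> f i) \<in> I \<rightarrow> carrier M"
    using insert smult_closed by (auto simp: Pi_iff)
  with insert show ?case
    by (simp add: M.finsum_insert smult_r_distr M.finsum_closed smult_closed Pi_iff)
qed (simp add: smult_zero_right)

end

lemma (in abelian_group) minus_self: "x \<in> carrier G \<Longrightarrow> x \<ominus> x = \<zero>"
  by (simp add: a_minus_def r_neg)

lemma (in abelian_group) minus_eq_zero_iff:
  "x \<in> carrier G \<Longrightarrow> y \<in> carrier G \<Longrightarrow> x \<ominus> y = \<zero> \<longleftrightarrow> x = y"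
  by (metis a_minus_def add.inv_closed minus_equality minus_minus r_neg)

lemma (in abelian_group) diff_add_cancel:
  "x \<in> carrier G \<Longrightarrow> y \<in> carrier G \<Longrightarrow> (x \<ominus> y) \<oplus> y = x"
  by (simp add: a_minus_def a_assoc l_neg)

lemma (in abelian_group) add_diff_cancel_right:
  "x \<in> carrier G \<Longrightarrow> y \<in> carrier G \<Longrightarrow> (x \<oplus> y) \<ominus> y = x"
  by (simp add: a_minus_def a_assoc r_neg)

lemma (in abelian_group) add_diff_cancel_left:
  "x \<in> carrier G \<Longrightarrow> y \<in> carrier G \<Longrightarrow> (x \<oplus> y) \<ominus> x = y"
  by (metis a_comm add_diff_cancel_right)

lemma (in abelian_group) diff_diff_add:
  "\<lbrakk>x \<in> carrier G; y \<in> carrier G; z \<in> carrier G; w \<in> carrier G\<rbrakk> \<Longrightarrow>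
    (x \<oplus> y) \<ominus> (z \<oplus> w) = (x \<ominus> z) \<oplus> (y \<ominus> w)"
  by (simp add: a_minus_def minus_add a_ac)

lemma left_module_abelian_group: "left_module R M \<Longrightarrow> abelian_group M"
  by (simp add: left_module_def)

lemma lmod_homI:
  assumes "\<And>x. x \<in> carrier M \<Longrightarrow> f x \<in> carrier N"
    and "\<And>x y. x \<in> carrier M \<Longrightarrow> y \<in> carrier M \<Longrightarrow> f (x \<oplus>\<^bsub>M\<^esub> y) = f x \<oplus>\<^bsub>N\<^esub> f y"
    and "\<And>a x. a \<in> carrier R \<Longrightarrow> x \<in> carrier M \<Longrightarrow> f (a \<odot>\<^bsub>M\<^esub> x) = a \<odot>\<^bsub>N\<^esub> f x"
  shows "f \<in> lmod_hom R M N"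
  using assms by (auto simp: lmod_hom_def)

lemma lmod_hom_closed: "f \<in> lmod_hom R M N \<Longrightarrow> x \<in> carrier M \<Longrightarrow> f x \<in> carrier N"
  and lmod_hom_add: "f \<in> lmod_hom R M N \<Longrightarrow> x \<in> carrier M \<Longrightarrow> y \<in> carrier M \<Longrightarrow>
    f (x \<oplus>\<^bsub>M\<^esub> y) = f x \<oplus>\<^bsub>N\<^esub> f y"
  and lmod_hom_smult: "f \<in> lmod_hom R M N \<Longrightarrow> a \<in> carrier R \<Longrightarrow> x \<in> carrier M \<Longrightarrow>
    f (a \<odot>\<^bsub>M\<^esub> x) = a \<odot>\<^bsub>N\<^esub> f x"
  by (auto simp: lmod_hom_def)

lemma lmod_hom_comp:
  "f \<in> lmod_hom R M N \<Longrightarrow> h \<in> lmod_hom R N P \<Longrightarrow> (\<lambda>x. h (f x)) \<in> lmod_hom R M P"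
  by (auto simp: lmod_hom_def Pi_iff)

lemma lmod_hom_o:
  "f \<in> lmod_hom R M N \<Longrightarrow> h \<in> lmod_hom R N P \<Longrightarrow> h \<circ> f \<in> lmod_hom R M P"
  using lmod_hom_comp by (simp add: comp_def)

lemma lmod_hom_id: "(\<lambda>x. x) \<in> lmod_hom R M M"
  by (simp add: lmod_hom_def)

lemma lmod_hom_zero:
  assumes "abelian_group M" "abelian_group N" "f \<in> lmod_hom R M N"
  shows "f \<zero>\<^bsub>M\<^esub> = \<zero>\<^bsub>N\<^esub>"
proof -
  interpret M: abelian_group M by fact
  interpret N: abelian_group N by fact
  have "f \<zero>\<^bsub>M\<^esub> \<oplus>\<^bsub>N\<^esub> f \<zero>\<^bsub>M\<^esub> = f \<zero>\<^bsub>M\<^esub>"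
    using lmod_hom_add[OF assms(3), of "\<zero>\<^bsub>M\<^esub>" "\<zero>\<^bsub>M\<^esub>"] by simp
  then show ?thesis
    using lmod_hom_closed[OF assms(3)] by (metis M.zero_closed N.add.l_cancel_one)
qed

lemma lmod_hom_neg:
  assumes "abelian_group M" "abelian_group N" "f \<in> lmod_hom R M N" "x \<in> carrier M"
  shows "f (\<ominus>\<^bsub>M\<^esub> x) = \<ominus>\<^bsub>N\<^esub> f x"
proof -
  interpret M: abelian_group M by fact
  interpret N: abelian_group N by fact
  have "f (\<ominus>\<^bsub>M\<^esub> x) \<oplus>\<^bsub>N\<^esub> f x = \<zero>\<^bsub>N\<^esub>"
    using lmod_hom_add[OF assms(3), of "\<ominus>\<^bsub>M\<^esub> x" x] assms lmod_hom_zero[OF assms(1-3)]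
    by (simp add: M.l_neg)
  then show ?thesis
    using assms(4) lmod_hom_closed[OF assms(3)] by (metis M.add.inv_closed N.minus_equality)
qed

lemma lmod_hom_diff:
  assumes "abelian_group M" "abelian_group N" "f \<in> lmod_hom R M N" "x \<in> carrier M" "y \<in> carrier M"
  shows "f (x \<ominus>\<^bsub>M\<^esub> y) = f x \<ominus>\<^bsub>N\<^esub> f y"
proof -
  interpret M: abelian_group M by fact
  show ?thesis
    using assms lmod_hom_neg[OF assms(1-3)] by (simp add: a_minus_def lmod_hom_add)
qed

lemma lmod_hom_finsum:
  assumes "abelian_group M" "abelian_group N" "f \<in> lmod_hom R M N"
    and "finite I" "s \<in> I \<rightarrow> carrier M"
  shows "f (\<Oplus>\<^bsub>M\<^esub>i\<in>I. s i) = (\<Oplus>\<^bsub>N\<^esub>i\<in>I. f (s i))"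
  using assms(4,5)
proof (induction I)
  case empty
  then show ?case
    using lmod_hom_zero[OF assms(1-3)] assms(1,2)
    by (simp add: abelian_group_def abelian_monoid.finsum_empty)
next
  case (insert i I)
  interpret M: abelian_group M by fact
  interpret N: abelian_group N by fact
  have "s \<in> I \<rightarrow> carrier M" "(\<lambda>i. f (s i)) \<in> I \<rightarrow> carrier N"
    using insert lmod_hom_closed[OF assms(3)] by (auto simp: Pi_iff)
  with insert show ?case
    using lmod_hom_closed[OF assms(3)]
    by (simp add: M.finsum_insert N.finsum_insert lmod_hom_add[OF assms(3)] M.finsum_closed Pi_iff)
qed

lemma lmod_hom_cong:
  assumes "left_module R M" "f \<in> lmod_hom R M N" "\<And>x. x \<in> carrier M \<Longrightarrow> h x = f x"
  shows "h \<in> lmod_hom R M N"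
proof -
  interpret left_module R M by fact
  show ?thesis
    using assms(2,3) by (auto simp: lmod_hom_def smult_closed)
qed

lemma lmod_hom_add_fun:
  assumes "left_module R N" "f \<in> lmod_hom R M N" "h \<in> lmod_hom R M N"
  shows "(\<lambda>x. f x \<oplus>\<^bsub>N\<^esub> h x) \<in> lmod_hom R M N"
proof -
  interpret left_module R N by fact
  show ?thesis
    using assms(2,3) by (auto simp: lmod_hom_def Pi_iff M.a_ac smult_r_distr)
qed

lemma lmod_hom_diff_fun:
  assumes "left_module R N" "f \<in> lmod_hom R M N" "h \<in> lmod_hom R M N"
  shows "(\<lambda>x. f x \<ominus>\<^bsub>N\<^esub> h x) \<in> lmod_hom R M N"
proof -
  interpret left_module R N by fact
  show ?thesis
    using assms(2,3)
    by (auto simp: lmod_hom_def Pi_iff a_minus_def M.minus_add M.a_ac smult_r_distr smult_neg_right)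
qed

lemma lmod_hom_zero_fun:
  assumes "left_module R N"
  shows "(\<lambda>x. \<zero>\<^bsub>N\<^esub>) \<in> lmod_hom R M N"
proof -
  interpret left_module R N by fact
  show ?thesis
    by (auto simp: lmod_hom_def smult_zero_right)
qed

lemma lmod_isoD:
  assumes "\<phi> \<in> lmod_iso R M N"
  shows "\<phi> \<in> lmod_hom R M N" "bij_betw \<phi> (carrier M) (carrier N)"
    "inj_on \<phi> (carrier M)" "\<phi> ` carrier M = carrier N"
  using assms by (auto simp: lmod_iso_def bij_betw_def)

lemma inv_into_lmod_iso:
  assumes "\<phi> \<in> lmod_iso R M N" "left_module R M"
  shows "inv_into (carrier M) \<phi> \<in> lmod_iso R N M"
proof -
  interpret left_module R M by fact
  note b = lmod_isoD[OF assms(1)]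
  have r: "\<phi> (inv_into (carrier M) \<phi> y) = y" "inv_into (carrier M) \<phi> y \<in> carrier M"
    if "y \<in> carrier N" for y
    using that b by (metis f_inv_into_f, metis inv_into_into)
  have l: "inv_into (carrier M) \<phi> (\<phi> x) = x" if "x \<in> carrier M" for x
    using that b by simp
  have "inv_into (carrier M) \<phi> \<in> lmod_hom R N M"
  proof (rule lmod_homI)
    fix x y assume "x \<in> carrier N" "y \<in> carrier N"
    then show "inv_into (carrier M) \<phi> (x \<oplus>\<^bsub>N\<^esub> y) =
        inv_into (carrier M) \<phi> x \<oplus>\<^bsub>M\<^esub> inv_into (carrier M) \<phi> y"
      using r l[of "inv_into (carrier M) \<phi> x \<oplus>\<^bsub>M\<^esub> inv_into (carrier M) \<phi> y"]
      by (simp add: lmod_hom_add[OF b(1)])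
  next
    fix a x assume "a \<in> carrier R" "x \<in> carrier N"
    then show "inv_into (carrier M) \<phi> (a \<odot>\<^bsub>N\<^esub> x) = a \<odot>\<^bsub>M\<^esub> inv_into (carrier M) \<phi> x"
      using r l[of "a \<odot>\<^bsub>M\<^esub> inv_into (carrier M) \<phi> x"]
      by (simp add: lmod_hom_smult[OF b(1)] smult_closed)
  qed (use r in blast)
  then show ?thesis
    using b bij_betw_inv_into by (auto simp: lmod_iso_def)
qed

lemma lmod_iso_comp:
  assumes "\<phi> \<in> lmod_iso R M N" "\<psi> \<in> lmod_iso R N P"
  shows "(\<lambda>x. \<psi> (\<phi> x)) \<in> lmod_iso R M P"
  using assms lmod_hom_comp[of \<phi> R M N \<psi> P] bij_betw_trans[of \<phi> _ _ \<psi>]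
  by (auto simp: lmod_iso_def comp_def)

text \<open>The module axioms carry over along a map compatible with the operations. Isomorphic copies and
  quotients are obtained from this.\<close>

lemma left_module_image:
  assumes M: "left_module R M"
    and c: "carrier N = f ` carrier M"
    and z: "\<zero>\<^bsub>N\<^esub> = f \<zero>\<^bsub>M\<^esub>"
    and a: "\<And>x y. x \<in> carrier M \<Longrightarrow> y \<in> carrier M \<Longrightarrow> f x \<oplus>\<^bsub>N\<^esub> f y = f (x \<oplus>\<^bsub>M\<^esub> y)"
    and s: "\<And>r x. r \<in> carrier R \<Longrightarrow> x \<in> carrier M \<Longrightarrow> r \<odot>\<^bsub>N\<^esub> f x = f (r \<odot>\<^bsub>M\<^esub> x)"
  shows "left_module R N" "f \<in> lmod_hom R M N"
proof -
  interpret left_module R M by fact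
  have "abelian_group N"
  proof (rule abelian_groupI)
    fix x assume "x \<in> carrier N"
    then obtain u where u: "u \<in> carrier M" "x = f u" using c by auto
    then have "f (\<ominus>\<^bsub>M\<^esub> u) \<oplus>\<^bsub>N\<^esub> x = \<zero>\<^bsub>N\<^esub>"
      using a[of "\<ominus>\<^bsub>M\<^esub> u" u] z by (simp add: M.l_neg)
    then show "\<exists>y\<in>carrier N. y \<oplus>\<^bsub>N\<^esub> x = \<zero>\<^bsub>N\<^esub>" using u c by auto
  qed (auto simp: c a z M.a_ac)
  then show "left_module R N"
    unfolding left_module_def left_module_axioms_def
    by (auto simp: c a s R.ring_axioms smult_closed smult_l_distr smult_r_distr smult_assoc smult_one)
  show "f \<in> lmod_hom R M N"
    by (auto simp: lmod_hom_def c a s)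
qed

lemma copy_exists:
  fixes N :: "('r, 'w) module" and e :: "'w \<Rightarrow> 'u"
  assumes "left_module R N" "inj_on e (carrier N)"
  obtains N' :: "('r, 'u) module" and \<phi>
  where "left_module R N'" "\<phi> \<in> lmod_iso R N N'"
proof -
  define i where "i = inv_into (carrier N) e"
  define N' :: "('r, 'u) module" where "N' = \<lparr>carrier = e ` carrier N, monoid.mult = undefined,
    one = undefined, ring.zero = e \<zero>\<^bsub>N\<^esub>, add = (\<lambda>x y. e (i x \<oplus>\<^bsub>N\<^esub> i y)),
    smult = (\<lambda>a x. e (a \<odot>\<^bsub>N\<^esub> i x))\<rparr>"
  have i: "i (e x) = x" if "x \<in> carrier N" for x
    using that assms(2) by (simp add: i_def)
  have "left_module R N'" "e \<in> lmod_hom R N N'"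
    by (rule left_module_image[OF assms(1), of N' e]; simp add: N'_def i)+
  moreover have "bij_betw e (carrier N) (carrier N')"
    using assms(2) by (simp add: N'_def bij_betw_def)
  ultimately show ?thesis
    using that by (auto simp: lmod_iso_def)
qed

lemma submoduleD:
  assumes "submodule E R M"
  shows "E \<subseteq> carrier M" "\<zero>\<^bsub>M\<^esub> \<in> E"
    "\<And>x y. x \<in> E \<Longrightarrow> y \<in> E \<Longrightarrow> x \<oplus>\<^bsub>M\<^esub> y \<in> E"
    "\<And>a x. a \<in> carrier R \<Longrightarrow> x \<in> E \<Longrightarrow> a \<odot>\<^bsub>M\<^esub> x \<in> E"
    "\<And>x. x \<in> E \<Longrightarrow> \<ominus>\<^bsub>M\<^esub> x \<in> E"
proof -
  interpret submodule E R M by fact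
  show "E \<subseteq> carrier M" "\<zero>\<^bsub>M\<^esub> \<in> E" using subset one_closed by auto
  show "\<And>x y. x \<in> E \<Longrightarrow> y \<in> E \<Longrightarrow> x \<oplus>\<^bsub>M\<^esub> y \<in> E" using m_closed by simp
  show "\<And>a x. a \<in> carrier R \<Longrightarrow> x \<in> E \<Longrightarrow> a \<odot>\<^bsub>M\<^esub> x \<in> E" by simp
  show "\<And>x. x \<in> E \<Longrightarrow> \<ominus>\<^bsub>M\<^esub> x \<in> E" using m_inv_closed by (simp add: a_inv_def)
qed

lemma submoduleI:
  assumes M: "left_module R M" and E: "E \<subseteq> carrier M" "\<zero>\<^bsub>M\<^esub> \<in> E"
    and a: "\<And>x y. x \<in> E \<Longrightarrow> y \<in> E \<Longrightarrow> x \<oplus>\<^bsub>M\<^esub> y \<in> E"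
    and s: "\<And>a x. a \<in> carrier R \<Longrightarrow> x \<in> E \<Longrightarrow> a \<odot>\<^bsub>M\<^esub> x \<in> E"
  shows "submodule E R M"
proof -
  interpret left_module R M by fact
  have n: "\<ominus>\<^bsub>M\<^esub> x \<in> E" if "x \<in> E" for x
  proof -
    have "(\<ominus>\<^bsub>R\<^esub> \<one>\<^bsub>R\<^esub>) \<odot>\<^bsub>M\<^esub> x = \<ominus>\<^bsub>M\<^esub> x"
      using that E by (subst smult_neg_left) (auto simp: smult_one)
    then show ?thesis using s[of "\<ominus>\<^bsub>R\<^esub> \<one>\<^bsub>R\<^esub>" x] that by simp
  qed
  show ?thesis
    by (intro submodule.intro subgroup.intro submodule_axioms.intro)
      (use E a s n in \<open>auto simp: a_inv_def[symmetric]\<close>)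
qed

lemma submodule_left_module:
  assumes M: "left_module R M" and E: "submodule E R M"
  shows "left_module R (M\<lparr>carrier := E\<rparr>)"
proof -
  interpret left_module R M by fact
  note E = submoduleD[OF E]
  have i: "x \<in> carrier M" if "x \<in> E" for x using that E(1) by auto
  have "abelian_group (M\<lparr>carrier := E\<rparr>)"
  proof (rule abelian_groupI)
    fix x assume "x \<in> carrier (M\<lparr>carrier := E\<rparr>)"
    then have "\<ominus>\<^bsub>M\<^esub> x \<in> E" "\<ominus>\<^bsub>M\<^esub> x \<oplus>\<^bsub>M\<^esub> x = \<zero>\<^bsub>M\<^esub>" using E i by (auto simp: M.l_neg)
    then show "\<exists>y\<in>carrier (M\<lparr>carrier := E\<rparr>). y \<oplus>\<^bsub>M\<lparr>carrier := E\<rparr>\<^esub> x = \<zero>\<^bsub>M\<lparr>carrier := E\<rparr>\<^esub>"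
      by auto
  qed (use E i in \<open>auto simp: M.a_ac\<close>)
  then show ?thesis
    unfolding left_module_def left_module_axioms_def
    using E by (auto simp: i R.ring_axioms smult_l_distr smult_r_distr smult_assoc smult_one)
qed

lemma incl_lmod_hom: "E \<subseteq> carrier M \<Longrightarrow> (\<lambda>x. x) \<in> lmod_hom R (M\<lparr>carrier := E\<rparr>) M"
  by (auto simp: lmod_hom_def)

lemma image_submodule:
  assumes A: "left_module R A" and B: "left_module R B" and i: "i \<in> lmod_hom R A B"
  shows "submodule (i ` carrier A) R B"
proof (rule submoduleI[OF B])
  interpret A: left_module R A by (rule A)
  show "i ` carrier A \<subseteq> carrier B" using lmod_hom_closed[OF i] by auto
  show "\<zero>\<^bsub>B\<^esub> \<in> i ` carrier A"
    using lmod_hom_zero[OF A.M.abelian_group_axioms left_module_abelian_group[OF B] i]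
    by (metis A.M.zero_closed imageI)
  fix x y assume "x \<in> i ` carrier A" "y \<in> i ` carrier A"
  then show "x \<oplus>\<^bsub>B\<^esub> y \<in> i ` carrier A" using lmod_hom_add[OF i, symmetric] by auto
next
  interpret A: left_module R A by (rule A)
  fix a x assume "a \<in> carrier R" "x \<in> i ` carrier A"
  then show "a \<odot>\<^bsub>B\<^esub> x \<in> i ` carrier A"
    using lmod_hom_smult[OF i, symmetric] by (auto simp: A.smult_closed)
qed

lemma kernel_submodule:
  assumes "left_module R M" "left_module R N" "f \<in> lmod_hom R M N"
  shows "submodule {x \<in> carrier M. f x = \<zero>\<^bsub>N\<^esub>} R M"
proof -
  interpret M: left_module R M by fact
  interpret N: left_module R N by fact
  show ?thesis
    using lmod_hom_zero[OF _ _ assms(3)] assms(1,2)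
    by (intro submoduleI)
      (auto simp: lmod_hom_add[OF assms(3)] lmod_hom_smult[OF assms(3)] N.smult_zero_right
        M.smult_closed left_module_abelian_group)
qed

lemma lmod_hom_inj_onI:
  assumes "abelian_group M" "abelian_group N" "f \<in> lmod_hom R M N"
    and "\<And>x. x \<in> carrier M \<Longrightarrow> f x = \<zero>\<^bsub>N\<^esub> \<Longrightarrow> x = \<zero>\<^bsub>M\<^esub>"
  shows "inj_on f (carrier M)"
proof (rule inj_onI)
  interpret M: abelian_group M by fact
  interpret N: abelian_group N by fact
  fix x y assume xy: "x \<in> carrier M" "y \<in> carrier M" "f x = f y"
  then have "f (x \<ominus>\<^bsub>M\<^esub> y) = \<zero>\<^bsub>N\<^esub>"
    using lmod_hom_closed[OF assms(3)] by (simp add: lmod_hom_diff[OF assms(1-3)] N.minus_self)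
  then have "x \<ominus>\<^bsub>M\<^esub> y = \<zero>\<^bsub>M\<^esub>" using xy assms(4)[of "x \<ominus>\<^bsub>M\<^esub> y"] by simp
  then show "x = y" using xy by (simp add: M.minus_eq_zero_iff)
qed

text \<open>The quotient of \<open>M\<close> by \<open>E\<close>, realised on a set of coset representatives, so that it lives in
  the same type as \<open>M\<close>.\<close>

lemma quotient_exists:
  fixes M :: "('r, 'a) module"
  assumes M: "left_module R M" and E: "submodule E R M"
  obtains Q :: "('r, 'a) module" and q where "left_module R Q" "q \<in> lmod_hom R M Q"
    "q ` carrier M = carrier Q" "{x \<in> carrier M. q x = \<zero>\<^bsub>Q\<^esub>} = E"
proof -
  interpret left_module R M by fact
  note ED = submoduleD[OF E]
  define rel where "rel x y \<longleftrightarrow> x \<in> carrier M \<and> y \<in> carrier M \<and> x \<ominus>\<^bsub>M\<^esub> y \<in> E" for x y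
  have rel_refl: "rel x x" if "x \<in> carrier M" for x
    using that ED by (simp add: rel_def M.minus_self)
  have rel_sym: "rel y x" if "rel x y" for x y
  proof -
    have "\<ominus>\<^bsub>M\<^esub> (x \<ominus>\<^bsub>M\<^esub> y) \<in> E" using that ED by (simp add: rel_def)
    then show ?thesis
      using that by (simp add: rel_def a_minus_def M.minus_add M.a_ac)
  qed
  have rel_trans: "rel x z" if "rel x y" "rel y z" for x y z
  proof -
    have "(x \<ominus>\<^bsub>M\<^esub> y) \<oplus>\<^bsub>M\<^esub> (y \<ominus>\<^bsub>M\<^esub> z) \<in> E" using that ED by (simp add: rel_def)
    moreover have "(x \<ominus>\<^bsub>M\<^esub> y) \<oplus>\<^bsub>M\<^esub> (y \<ominus>\<^bsub>M\<^esub> z) = x \<ominus>\<^bsub>M\<^esub> z"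
      using that by (metis M.diff_add_cancel M.minus_closed M.a_assoc M.add.inv_closed a_minus_def rel_def)
    ultimately show ?thesis using that by (simp add: rel_def)
  qed
  have rel_add: "rel (x \<oplus>\<^bsub>M\<^esub> y) (x' \<oplus>\<^bsub>M\<^esub> y')" if "rel x x'" "rel y y'" for x y x' y'
    using that ED by (simp add: rel_def M.diff_diff_add)
  have rel_smult: "rel (r \<odot>\<^bsub>M\<^esub> x) (r \<odot>\<^bsub>M\<^esub> x')" if "rel x x'" "r \<in> carrier R" for r x x'
    using that ED by (auto simp: rel_def smult_closed smult_diff_right[symmetric])
  define q where "q x = (SOME y. rel x y)" for x
  have q: "rel x (q x)" if "x \<in> carrier M" for x
    unfolding q_def using rel_refl[OF that] by (rule someI)
  have q_eq: "q x = q y" if "rel x y" for x y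
  proof -
    have "rel x = rel y" using that rel_sym rel_trans by blast
    then show ?thesis by (simp add: q_def)
  qed
  have qM: "q x \<in> carrier M" if "x \<in> carrier M" for x using q[OF that] by (simp add: rel_def)
  define Q :: "('r, 'a) module" where "Q = \<lparr>carrier = q ` carrier M, monoid.mult = undefined,
    one = undefined, ring.zero = q \<zero>\<^bsub>M\<^esub>, add = (\<lambda>x y. q (x \<oplus>\<^bsub>M\<^esub> y)),
    smult = (\<lambda>a x. q (a \<odot>\<^bsub>M\<^esub> x))\<rparr>"
  have Q: "left_module R Q" "q \<in> lmod_hom R M Q"
    by (rule left_module_image[OF M, of Q q];
      auto simp: Q_def intro!: q_eq rel_add rel_smult rel_sym[OF q])+
  moreover have "q ` carrier M = carrier Q" by (simp add: Q_def)
  moreover have "{x \<in> carrier M. q x = \<zero>\<^bsub>Q\<^esub>} = E"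
  proof -
    have m0: "x \<ominus>\<^bsub>M\<^esub> \<zero>\<^bsub>M\<^esub> = x" if "x \<in> carrier M" for x
      using that M.add.inv_one by (simp add: a_minus_def a_inv_def)
    have "q x = q \<zero>\<^bsub>M\<^esub> \<longleftrightarrow> x \<in> E" if x: "x \<in> carrier M" for x
    proof
      assume "q x = q \<zero>\<^bsub>M\<^esub>"
      then have "rel x \<zero>\<^bsub>M\<^esub>" using x q rel_sym rel_trans by (metis M.zero_closed)
      then show "x \<in> E" by (auto simp: rel_def m0)
    next
      assume "x \<in> E"
      then have "rel x \<zero>\<^bsub>M\<^esub>" using x by (simp add: rel_def m0)
      then show "q x = q \<zero>\<^bsub>M\<^esub>" by (rule q_eq)
    qed
    then show ?thesis using ED(1) by (auto simp: Q_def)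
  qed
  ultimately show ?thesis using that by blast
qed

lemma factor_through_surjection:
  assumes M: "left_module R M" and Q: "left_module R Q" and N: "left_module R N"
    and q: "q \<in> lmod_hom R M Q" "q ` carrier M = carrier Q"
    and f: "f \<in> lmod_hom R M N"
    and k: "\<And>x. x \<in> carrier M \<Longrightarrow> q x = \<zero>\<^bsub>Q\<^esub> \<Longrightarrow> f x = \<zero>\<^bsub>N\<^esub>"
  obtains h where "h \<in> lmod_hom R Q N" "\<And>x. x \<in> carrier M \<Longrightarrow> h (q x) = f x"
proof -
  interpret M: left_module R M by fact
  interpret Q: left_module R Q by fact
  interpret N: left_module R N by fact
  note gM = left_module_abelian_group[OF M] and gQ = left_module_abelian_group[OF Q]
    and gN = left_module_abelian_group[OF N]
  define h where "h = (\<lambda>y. f (inv_into (carrier M) q y))"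
  have e: "f x = f y" if "x \<in> carrier M" "y \<in> carrier M" "q x = q y" for x y
  proof -
    have "q (x \<ominus>\<^bsub>M\<^esub> y) = \<zero>\<^bsub>Q\<^esub>"
      using that lmod_hom_closed[OF q(1)]
      by (simp add: lmod_hom_diff[OF gM gQ q(1)] Q.M.minus_self)
    then have "f x \<ominus>\<^bsub>N\<^esub> f y = \<zero>\<^bsub>N\<^esub>"
      using that k[of "x \<ominus>\<^bsub>M\<^esub> y"] by (simp add: lmod_hom_diff[OF gM gN f])
    then show ?thesis
      using that lmod_hom_closed[OF f] N.M.minus_eq_zero_iff by blast
  qed
  have hq: "h (q x) = f x" if "x \<in> carrier M" for x
    unfolding h_def by (rule e) (use that q in \<open>auto simp: inv_into_into f_inv_into_f\<close>)
  have "h \<in> lmod_hom R Q N"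
  proof (rule lmod_homI)
    fix x assume "x \<in> carrier Q"
    then obtain u where "u \<in> carrier M" "x = q u" using q(2) by auto
    then show "h x \<in> carrier N" using hq lmod_hom_closed[OF f] by simp
  next
    fix x y assume "x \<in> carrier Q" "y \<in> carrier Q"
    then obtain u v where "x = q u" "y = q v" "u \<in> carrier M" "v \<in> carrier M"
      using q(2) by (metis imageE)
    then show "h (x \<oplus>\<^bsub>Q\<^esub> y) = h x \<oplus>\<^bsub>N\<^esub> h y"
      using hq[of "u \<oplus>\<^bsub>M\<^esub> v"] by (simp add: lmod_hom_add[OF q(1)] lmod_hom_add[OF f] hq)
  next
    fix a x assume "a \<in> carrier R" "x \<in> carrier Q"
    then obtain u where "x = q u" "u \<in> carrier M" "a \<in> carrier R" using q(2) by auto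
    then show "h (a \<odot>\<^bsub>Q\<^esub> x) = a \<odot>\<^bsub>N\<^esub> h x"
      using hq[of "a \<odot>\<^bsub>M\<^esub> u"]
      by (simp add: lmod_hom_smult[OF q(1)] lmod_hom_smult[OF f] hq M.smult_closed)
  qed
  with hq that show ?thesis by blast
qed

definition dsum :: "('r, 'a) module \<Rightarrow> ('r, 'b) module \<Rightarrow> ('r, 'a \<times> 'b) module" where
  "dsum M N = \<lparr>carrier = carrier M \<times> carrier N, monoid.mult = undefined, one = undefined,
     ring.zero = (\<zero>\<^bsub>M\<^esub>, \<zero>\<^bsub>N\<^esub>), add = (\<lambda>x y. (fst x \<oplus>\<^bsub>M\<^esub> fst y, snd x \<oplus>\<^bsub>N\<^esub> snd y)),
     smult = (\<lambda>a x. (a \<odot>\<^bsub>M\<^esub> fst x, a \<odot>\<^bsub>N\<^esub> snd x))\<rparr>"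

lemma dsum_sel [simp]:
  "carrier (dsum M N) = carrier M \<times> carrier N" "\<zero>\<^bsub>dsum M N\<^esub> = (\<zero>\<^bsub>M\<^esub>, \<zero>\<^bsub>N\<^esub>)"
  "x \<oplus>\<^bsub>dsum M N\<^esub> y = (fst x \<oplus>\<^bsub>M\<^esub> fst y, snd x \<oplus>\<^bsub>N\<^esub> snd y)"
  "a \<odot>\<^bsub>dsum M N\<^esub> x = (a \<odot>\<^bsub>M\<^esub> fst x, a \<odot>\<^bsub>N\<^esub> snd x)"
  by (simp_all add: dsum_def)

lemma dsum_left_module:
  assumes "left_module R M" "left_module R N"
  shows "left_module R (dsum M N)"
proof -
  interpret M: left_module R M by fact
  interpret N: left_module R N by fact
  have "abelian_group (dsum M N)"
  proof (rule abelian_groupI)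
    fix x assume "x \<in> carrier (dsum M N)"
    then have "(\<ominus>\<^bsub>M\<^esub> fst x, \<ominus>\<^bsub>N\<^esub> snd x) \<oplus>\<^bsub>dsum M N\<^esub> x = \<zero>\<^bsub>dsum M N\<^esub>"
        "(\<ominus>\<^bsub>M\<^esub> fst x, \<ominus>\<^bsub>N\<^esub> snd x) \<in> carrier (dsum M N)"
      by (auto simp: M.M.l_neg N.M.l_neg)
    then show "\<exists>y\<in>carrier (dsum M N). y \<oplus>\<^bsub>dsum M N\<^esub> x = \<zero>\<^bsub>dsum M N\<^esub>" by blast
  qed (auto simp: M.M.a_ac N.M.a_ac)
  then show ?thesis
    unfolding left_module_def left_module_axioms_def
    by (auto simp: M.R.ring_axioms M.smult_closed N.smult_closed M.smult_l_distr N.smult_l_distr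
       M.smult_r_distr N.smult_r_distr M.smult_assoc N.smult_assoc M.smult_one N.smult_one)
qed

lemma regular_module_sel [simp]:
  "carrier (regular_module R) = carrier R" "\<zero>\<^bsub>regular_module R\<^esub> = \<zero>\<^bsub>R\<^esub>"
  "x \<oplus>\<^bsub>regular_module R\<^esub> y = x \<oplus>\<^bsub>R\<^esub> y" "a \<odot>\<^bsub>regular_module R\<^esub> x = a \<otimes>\<^bsub>R\<^esub> x"
  by (simp_all add: regular_module_def)

lemma regular_left_module:
  assumes "ring R"
  shows "left_module R (regular_module R)"
proof -
  interpret ring R by fact
  have "abelian_group (regular_module R)"
    by (rule abelian_groupI) (auto simp: a_ac intro: bexI[of _ "\<ominus>\<^bsub>R\<^esub> _"] l_neg)
  then show ?thesis
    unfolding left_module_def left_module_axioms_def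
    by (auto simp: ring_axioms l_distr r_distr m_assoc)
qed


section \<open>Linear algebra over a division ring\<close>

text \<open>By Zorn's lemma there is a maximal submodule \<open>T\<close> that meets \<open>W\<close> trivially. A vector \<open>x\<close> outside
  \<open>W + T\<close> could be added to it: a relation \<open>w = t + a x\<close> with \<open>a \<noteq> 0\<close> can be solved for \<open>x\<close>.\<close>

lemma submodule_complement:
  assumes M: "left_module K M" and W: "submodule W K M"
    and div: "\<And>a. a \<in> carrier K \<Longrightarrow> a \<noteq> \<zero>\<^bsub>K\<^esub> \<Longrightarrow> \<exists>b\<in>carrier K. b \<otimes>\<^bsub>K\<^esub> a = \<one>\<^bsub>K\<^esub>"
  obtains T where "submodule T K M" "W \<inter> T = {\<zero>\<^bsub>M\<^esub>}"
    "\<And>x. x \<in> carrier M \<Longrightarrow> \<exists>w\<in>W. \<exists>t\<in>T. x = w \<oplus>\<^bsub>M\<^esub> t"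
proof -
  interpret left_module K M by fact
  note WD = submoduleD[OF W]
  define A where "A = {T. submodule T K M \<and> W \<inter> T = {\<zero>\<^bsub>M\<^esub>}}"
  have z: "{\<zero>\<^bsub>M\<^esub>} \<in> A"
    unfolding A_def using WD M by (auto intro!: submoduleI simp: smult_zero_right)
  have "\<exists>T\<in>A. \<forall>U\<in>A. T \<subseteq> U \<longrightarrow> U = T"
  proof (rule subset_Zorn)
    fix \<C> assume ch: "subset.chain A \<C>"
    show "\<exists>U\<in>A. \<forall>Z\<in>\<C>. Z \<subseteq> U"
    proof (cases "\<C> = {}")
      case True
      then show ?thesis using z by auto
    next
      case False
      have sub: "submodule T K M" "W \<inter> T = {\<zero>\<^bsub>M\<^esub>}" if "T \<in> \<C>" for T
        using ch that by (auto simp: subset.chain_def A_def)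
      have "submodule (\<Union>\<C>) K M"
      proof (rule submoduleI[OF M])
        show "\<Union>\<C> \<subseteq> carrier M" using submoduleD(1)[OF sub(1)] by blast
        show "\<zero>\<^bsub>M\<^esub> \<in> \<Union>\<C>" using submoduleD(2)[OF sub(1)] False by blast
        fix x y assume "x \<in> \<Union>\<C>" "y \<in> \<Union>\<C>"
        then obtain U Y where "U \<in> \<C>" "Y \<in> \<C>" "x \<in> U" "y \<in> Y" by auto
        moreover then have "U \<subseteq> Y \<or> Y \<subseteq> U" using ch by (auto simp: subset.chain_def)
        ultimately obtain T where "T \<in> \<C>" "x \<in> T" "y \<in> T" by blast
        then show "x \<oplus>\<^bsub>M\<^esub> y \<in> \<Union>\<C>" using submoduleD(3)[OF sub(1)] by blast
      next
        fix a x assume "a \<in> carrier K" "x \<in> \<Union>\<C>"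
        then show "a \<odot>\<^bsub>M\<^esub> x \<in> \<Union>\<C>" using submoduleD(4)[OF sub(1)] by blast
      qed
      moreover have "W \<inter> \<Union>\<C> = {\<zero>\<^bsub>M\<^esub>}" using sub(2) False by blast
      ultimately show ?thesis unfolding A_def by blast
    qed
  qed
  then obtain T where T: "T \<in> A" and max: "\<And>U. U \<in> A \<Longrightarrow> T \<subseteq> U \<Longrightarrow> U = T" by blast
  have TD: "submodule T K M" "W \<inter> T = {\<zero>\<^bsub>M\<^esub>}" using T by (auto simp: A_def)
  note TD' = submoduleD[OF TD(1)]
  have "\<exists>w\<in>W. \<exists>t\<in>T. x = w \<oplus>\<^bsub>M\<^esub> t" if x: "x \<in> carrier M" for x
  proof (rule ccontr)
    assume neg: "\<not> ?thesis"
    define U where "U = {t \<oplus>\<^bsub>M\<^esub> a \<odot>\<^bsub>M\<^esub> x | t a. t \<in> T \<and> a \<in> carrier K}"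
    have tM: "t \<in> carrier M" if "t \<in> T" for t using that TD' by auto
    have wM: "t \<in> carrier M" if "t \<in> W" for t using that WD by auto
    have U: "submodule U K M"
    proof (rule submoduleI[OF M])
      show "U \<subseteq> carrier M" using x tM by (auto simp: U_def smult_closed)
      show "\<zero>\<^bsub>M\<^esub> \<in> U" unfolding U_def using TD' x
        by (auto intro!: exI[of _ "\<zero>\<^bsub>M\<^esub>"] exI[of _ "\<zero>\<^bsub>K\<^esub>"] simp: smult_zero_left)
      fix u v assume "u \<in> U" "v \<in> U"
      then obtain s a t b where "u = s \<oplus>\<^bsub>M\<^esub> a \<odot>\<^bsub>M\<^esub> x" "v = t \<oplus>\<^bsub>M\<^esub> b \<odot>\<^bsub>M\<^esub> x"
        "s \<in> T" "t \<in> T" "a \<in> carrier K" "b \<in> carrier K" by (auto simp: U_def)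
      then have "u \<oplus>\<^bsub>M\<^esub> v = (s \<oplus>\<^bsub>M\<^esub> t) \<oplus>\<^bsub>M\<^esub> (a \<oplus>\<^bsub>K\<^esub> b) \<odot>\<^bsub>M\<^esub> x" "s \<oplus>\<^bsub>M\<^esub> t \<in> T"
          "a \<oplus>\<^bsub>K\<^esub> b \<in> carrier K"
        using x tM TD' by (auto simp: smult_l_distr smult_closed M.a_ac)
      then show "u \<oplus>\<^bsub>M\<^esub> v \<in> U" unfolding U_def by blast
    next
      fix c u assume "c \<in> carrier K" "u \<in> U"
      then obtain s a where "u = s \<oplus>\<^bsub>M\<^esub> a \<odot>\<^bsub>M\<^esub> x" "s \<in> T" "a \<in> carrier K" "c \<in> carrier K"
        by (auto simp: U_def)
      then have "c \<odot>\<^bsub>M\<^esub> u = (c \<odot>\<^bsub>M\<^esub> s) \<oplus>\<^bsub>M\<^esub> (c \<otimes>\<^bsub>K\<^esub> a) \<odot>\<^bsub>M\<^esub> x" "c \<odot>\<^bsub>M\<^esub> s \<in> T"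
          "c \<otimes>\<^bsub>K\<^esub> a \<in> carrier K"
        using x tM TD' by (auto simp: smult_r_distr smult_closed smult_assoc)
      then show "c \<odot>\<^bsub>M\<^esub> u \<in> U" unfolding U_def by blast
    qed
    have TX: "T \<subseteq> U"
    proof
      fix t assume "t \<in> T"
      then show "t \<in> U" unfolding U_def using x tM
        by (auto intro!: exI[of _ t] exI[of _ "\<zero>\<^bsub>K\<^esub>"] simp: smult_zero_left)
    qed
    have "x \<in> U" unfolding U_def using x TD'
      by (auto intro!: exI[of _ "\<zero>\<^bsub>M\<^esub>"] exI[of _ "\<one>\<^bsub>K\<^esub>"] simp: smult_one)
    have "W \<inter> U \<subseteq> {\<zero>\<^bsub>M\<^esub>}"
    proof
      fix w assume "w \<in> W \<inter> U"
      then obtain t a where w: "w \<in> W" "w = t \<oplus>\<^bsub>M\<^esub> a \<odot>\<^bsub>M\<^esub> x" "t \<in> T" "a \<in> carrier K"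
        by (auto simp: U_def)
      show "w \<in> {\<zero>\<^bsub>M\<^esub>}"
      proof (cases "a = \<zero>\<^bsub>K\<^esub>")
        case True
        then have "w = t" using w x tM by (simp add: smult_zero_left)
        then show ?thesis using w TD(2) by auto
      next
        case False
        then obtain b where b: "b \<in> carrier K" "b \<otimes>\<^bsub>K\<^esub> a = \<one>\<^bsub>K\<^esub>" using div w by blast
        have "a \<odot>\<^bsub>M\<^esub> x = w \<oplus>\<^bsub>M\<^esub> \<ominus>\<^bsub>M\<^esub> t"
          using w x tM M.add_diff_cancel_left[of t "a \<odot>\<^bsub>M\<^esub> x"]
          by (simp add: a_minus_def smult_closed)
        then have "x = b \<odot>\<^bsub>M\<^esub> (w \<oplus>\<^bsub>M\<^esub> \<ominus>\<^bsub>M\<^esub> t)"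
          using b w x by (metis smult_assoc smult_one)
        also have "\<dots> = b \<odot>\<^bsub>M\<^esub> w \<oplus>\<^bsub>M\<^esub> b \<odot>\<^bsub>M\<^esub> (\<ominus>\<^bsub>M\<^esub> t)"
          using b w tM wM by (simp add: smult_r_distr)
        finally show ?thesis using neg b w WD(4) TD'(4,5) by blast
      qed
    qed
    then have "U \<in> A" using U submoduleD(2)[OF U] WD(2) by (auto simp: A_def)
    then have "U = T" using max TX by blast
    then have "x \<in> T" using \<open>x \<in> U\<close> by simp
    then show False using neg WD(2) x by (metis M.l_zero)
  qed
  with TD that show ?thesis by blast
qed

text \<open>A surjection is an isomorphism on a complement of its kernel.\<close>

lemma lmod_hom_section:
  assumes A: "left_module K A" and B: "left_module K B"
    and q: "q \<in> lmod_hom K A B" "q ` carrier A = carrier B"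
    and div: "\<And>a. a \<in> carrier K \<Longrightarrow> a \<noteq> \<zero>\<^bsub>K\<^esub> \<Longrightarrow> \<exists>b\<in>carrier K. b \<otimes>\<^bsub>K\<^esub> a = \<one>\<^bsub>K\<^esub>"
  obtains s where "s \<in> lmod_hom K B A" "\<And>y. y \<in> carrier B \<Longrightarrow> q (s y) = y"
proof -
  interpret A: left_module K A by fact
  interpret B: left_module K B by fact
  note gA = left_module_abelian_group[OF A] and gB = left_module_abelian_group[OF B]
  define E where "E = {x \<in> carrier A. q x = \<zero>\<^bsub>B\<^esub>}"
  have E: "submodule E K A" unfolding E_def by (rule kernel_submodule[OF A B q(1)])
  obtain T where T: "submodule T K A" "E \<inter> T = {\<zero>\<^bsub>A\<^esub>}"
    "\<And>x. x \<in> carrier A \<Longrightarrow> \<exists>w\<in>E. \<exists>t\<in>T. x = w \<oplus>\<^bsub>A\<^esub> t"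
    using submodule_complement[OF A E div] by blast
  note TD = submoduleD[OF T(1)]
  let ?T = "A\<lparr>carrier := T\<rparr>"
  have T': "left_module K ?T" by (rule submodule_left_module[OF A T(1)])
  have qT: "q \<in> lmod_hom K ?T B"
    using lmod_hom_comp[OF incl_lmod_hom[OF TD(1)] q(1)] by simp
  have "inj_on q (carrier ?T)"
    by (rule lmod_hom_inj_onI[OF left_module_abelian_group[OF T'] gB qT])
      (use T(2) TD(1) in \<open>auto simp: E_def\<close>)
  moreover have "q ` carrier ?T = carrier B"
  proof
    show "q ` carrier ?T \<subseteq> carrier B" using TD(1) q(2) by auto
    show "carrier B \<subseteq> q ` carrier ?T"
    proof
      fix y assume "y \<in> carrier B"
      then obtain x where x: "x \<in> carrier A" "y = q x" using q(2) by auto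
      then obtain w t where wt: "w \<in> E" "t \<in> T" "x = w \<oplus>\<^bsub>A\<^esub> t" using T(3) by blast
      moreover then have "t \<in> carrier A" using TD by auto
      ultimately have "y = q t"
        using x lmod_hom_closed[OF q(1)] by (auto simp: E_def lmod_hom_add[OF q(1)])
      then show "y \<in> q ` carrier ?T" using wt by auto
    qed
  qed
  ultimately have iso: "q \<in> lmod_iso K ?T B" using qT by (auto simp: lmod_iso_def bij_betw_def)
  define s where "s = inv_into T q"
  have "s \<in> lmod_hom K B ?T"
    using lmod_isoD(1)[OF inv_into_lmod_iso[OF iso T']] by (simp add: s_def)
  then have "s \<in> lmod_hom K B A" using lmod_hom_comp[OF _ incl_lmod_hom[OF TD(1)]] by blast
  moreover have "q (s y) = y" if "y \<in> carrier B" for y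
    using lmod_isoD(4)[OF iso] that by (simp add: s_def f_inv_into_f)
  ultimately show ?thesis using that by blast
qed

lemma lmod_hom_extension:
  assumes A: "left_module K A" and B: "left_module K B" and N: "left_module K N"
    and i: "i \<in> lmod_hom K A B" "inj_on i (carrier A)" and f: "f \<in> lmod_hom K A N"
    and div: "\<And>a. a \<in> carrier K \<Longrightarrow> a \<noteq> \<zero>\<^bsub>K\<^esub> \<Longrightarrow> \<exists>b\<in>carrier K. b \<otimes>\<^bsub>K\<^esub> a = \<one>\<^bsub>K\<^esub>"
  obtains F where "F \<in> lmod_hom K B N" "\<And>x. x \<in> carrier A \<Longrightarrow> F (i x) = f x"
proof -
  interpret A: left_module K A by fact
  interpret B: left_module K B by fact
  note gA = left_module_abelian_group[OF A] and gB = left_module_abelian_group[OF B]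
  have W: "submodule (i ` carrier A) K B" by (rule image_submodule[OF A B i(1)])
  obtain T where T: "submodule T K B" "i ` carrier A \<inter> T = {\<zero>\<^bsub>B\<^esub>}"
    "\<And>x. x \<in> carrier B \<Longrightarrow> \<exists>w\<in>i ` carrier A. \<exists>t\<in>T. x = w \<oplus>\<^bsub>B\<^esub> t"
    using submodule_complement[OF B W div] by blast
  note TD = submoduleD[OF T(1)]
  let ?T = "B\<lparr>carrier := T\<rparr>"
  have T': "left_module K ?T" by (rule submodule_left_module[OF B T(1)])
  define s where "s = (\<lambda>x. i (fst x) \<oplus>\<^bsub>B\<^esub> snd x)"
  have tB: "t \<in> carrier B" if "t \<in> T" for t using that TD by auto
  have D: "left_module K (dsum A ?T)" by (rule dsum_left_module[OF A T'])
  \<comment> \<open>\<open>s\<close> maps the direct sum of \<open>A\<close> and a complement of its image onto \<open>B\<close>.\<close>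
  have s: "s \<in> lmod_hom K (dsum A ?T) B"
    using lmod_hom_closed[OF i(1)] tB
    by (intro lmod_homI) (auto simp: s_def lmod_hom_add[OF i(1)] lmod_hom_smult[OF i(1)]
        B.smult_r_distr B.smult_closed B.M.a_ac)
  have sur: "s ` carrier (dsum A ?T) = carrier B"
  proof
    show "s ` carrier (dsum A ?T) \<subseteq> carrier B" using lmod_hom_closed[OF s] by blast
    show "carrier B \<subseteq> s ` carrier (dsum A ?T)"
    proof
      fix x assume "x \<in> carrier B"
      then obtain a t where "a \<in> carrier A" "t \<in> T" "x = s (a, t)" using T(3) by (force simp: s_def)
      then show "x \<in> s ` carrier (dsum A ?T)" by auto
    qed
  qed
  have k: "f (fst x) = \<zero>\<^bsub>N\<^esub>" if h: "x \<in> carrier (dsum A ?T)" "s x = \<zero>\<^bsub>B\<^esub>" for x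
  proof -
    obtain a t where x: "x = (a, t)" "a \<in> carrier A" "t \<in> T" using h(1) by auto
    have "i a = \<ominus>\<^bsub>B\<^esub> t"
      using h x tB lmod_hom_closed[OF i(1)] by (simp add: s_def B.M.minus_equality)
    then have "i a \<in> i ` carrier A \<inter> T" using x TD(5) by (metis IntI imageI)
    then have "i a = i \<zero>\<^bsub>A\<^esub>" using T(2) lmod_hom_zero[OF gA gB i(1)] by auto
    then have "a = \<zero>\<^bsub>A\<^esub>" using i(2) x by (auto dest: inj_onD)
    then show ?thesis
      using lmod_hom_zero[OF gA left_module_abelian_group[OF N] f] x by simp
  qed
  have f1: "(\<lambda>x. f (fst x)) \<in> lmod_hom K (dsum A ?T) N"
    using f by (auto simp: lmod_hom_def)
  obtain F where F: "F \<in> lmod_hom K B N"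
    "\<And>x. x \<in> carrier (dsum A ?T) \<Longrightarrow> F (s x) = f (fst x)"
    using factor_through_surjection[OF D B N s sur f1 k] by blast
  have "F (i x) = f x" if "x \<in> carrier A" for x
    using F(2)[of "(x, \<zero>\<^bsub>B\<^esub>)"] that TD(2) lmod_hom_closed[OF i(1)] by (simp add: s_def)
  with F(1) that show ?thesis by blast
qed

section \<open>The group algebra of a finite group\<close>

locale finite_group_algebra = group G for G :: "('g, 'x) monoid_scheme" (structure) +
  fixes R :: "('g \<Rightarrow> 'k::field) ring"
  assumes finite_G: "finite (carrier G)" and R_def: "R = group_algebra G"
begin

lemma carrier_R: "a \<in> carrier R \<longleftrightarrow> (\<forall>x. x \<notin> carrier G \<longrightarrow> a x = 0)"
  by (simp add: R_def group_algebra_def)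

lemma carrier_R_D: "a \<in> carrier R \<Longrightarrow> x \<notin> carrier G \<Longrightarrow> a x = 0"
  by (simp add: carrier_R)

lemma mult_R: "(a \<otimes>\<^bsub>R\<^esub> b) x =
    (if x \<in> carrier G then \<Sum>y\<in>carrier G. a y * b (inv y \<otimes> x) else 0)"
  by (simp add: R_def group_algebra_def)

lemma add_R: "(a \<oplus>\<^bsub>R\<^esub> b) x = a x + b x"
  by (simp add: R_def group_algebra_def)

lemma zero_R: "\<zero>\<^bsub>R\<^esub> = (\<lambda>x. 0)"
  by (simp add: R_def group_algebra_def)

lemma one_R: "\<one>\<^bsub>R\<^esub> = ga_single \<one> 1"
  by (simp add: R_def group_algebra_def ga_single_def)

lemma single_R [simp]: "x \<in> carrier G \<Longrightarrow> ga_single x c \<in> carrier R"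
  by (auto simp: carrier_R ga_single_def)

lemma sum_left_translate:
  assumes "y \<in> carrier G"
  shows "(\<Sum>x\<in>carrier G. f (y \<otimes> x)) = (\<Sum>x\<in>carrier G. f x)"
  by (rule sum.reindex_bij_witness[of _ "\<lambda>x. inv y \<otimes> x" "\<lambda>x. y \<otimes> x"])
    (use assms in \<open>auto simp: m_assoc[symmetric]\<close>)

lemma ring_R: "ring R"
proof (rule ringI)
  show "abelian_group R"
  proof (rule abelian_groupI)
    fix a assume "a \<in> carrier R"
    then show "\<exists>b\<in>carrier R. b \<oplus>\<^bsub>R\<^esub> a = \<zero>\<^bsub>R\<^esub>"
      by (intro bexI[of _ "\<lambda>x. - a x"]) (auto simp: carrier_R add_R zero_R fun_eq_iff)
  qed (auto simp: carrier_R add_R zero_R fun_eq_iff algebra_simps)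
  show "monoid R"
  proof (rule monoidI)
    fix a b c assume a: "a \<in> carrier R" and b: "b \<in> carrier R" and c: "c \<in> carrier R"
    show "(a \<otimes>\<^bsub>R\<^esub> b) \<otimes>\<^bsub>R\<^esub> c = a \<otimes>\<^bsub>R\<^esub> (b \<otimes>\<^bsub>R\<^esub> c)"
    proof
      fix x
      show "((a \<otimes>\<^bsub>R\<^esub> b) \<otimes>\<^bsub>R\<^esub> c) x = (a \<otimes>\<^bsub>R\<^esub> (b \<otimes>\<^bsub>R\<^esub> c)) x"
      proof (cases "x \<in> carrier G")
        case x: True
        have "((a \<otimes>\<^bsub>R\<^esub> b) \<otimes>\<^bsub>R\<^esub> c) x =
            (\<Sum>y\<in>carrier G. \<Sum>z\<in>carrier G. a z * b (inv z \<otimes> y) * c (inv y \<otimes> x))"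
          using x by (simp add: mult_R sum_distrib_right)
        also have "\<dots> = (\<Sum>z\<in>carrier G. \<Sum>y\<in>carrier G. a z * b (inv z \<otimes> y) * c (inv y \<otimes> x))"
          by (rule sum.swap)
        also have "\<dots> = (\<Sum>z\<in>carrier G. \<Sum>y\<in>carrier G. a z * (b y * c (inv y \<otimes> (inv z \<otimes> x))))"
        proof (rule sum.cong[OF refl])
          fix z assume z: "z \<in> carrier G"
          have "(\<Sum>y\<in>carrier G. a z * b (inv z \<otimes> y) * c (inv y \<otimes> x)) =
              (\<Sum>y\<in>carrier G. a z * b (inv z \<otimes> (z \<otimes> y)) * c (inv (z \<otimes> y) \<otimes> x))"
            by (rule sum_left_translate[OF z, symmetric])
          also have "\<dots> = (\<Sum>y\<in>carrier G. a z * (b y * c (inv y \<otimes> (inv z \<otimes> x))))"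
            using z x by (intro sum.cong refl) (auto simp: m_assoc[symmetric] inv_mult_group)
          finally show "(\<Sum>y\<in>carrier G. a z * b (inv z \<otimes> y) * c (inv y \<otimes> x)) =
              (\<Sum>y\<in>carrier G. a z * (b y * c (inv y \<otimes> (inv z \<otimes> x))))" .
        qed
        also have "\<dots> = (a \<otimes>\<^bsub>R\<^esub> (b \<otimes>\<^bsub>R\<^esub> c)) x"
          using x by (simp add: mult_R sum_distrib_left)
        finally show ?thesis .
      qed (simp add: mult_R)
    qed
  next
    fix a assume a: "a \<in> carrier R"
    show "\<one>\<^bsub>R\<^esub> \<otimes>\<^bsub>R\<^esub> a = a"
    proof
      fix x
      have "(\<Sum>y\<in>carrier G. \<one>\<^bsub>R\<^esub> y * a (inv y \<otimes> x)) =
          (\<Sum>y\<in>carrier G. if \<one> = y then a (inv y \<otimes> x) else 0)"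
        by (intro sum.cong) (auto simp: one_R ga_single_def)
      then show "(\<one>\<^bsub>R\<^esub> \<otimes>\<^bsub>R\<^esub> a) x = a x"
        using finite_G carrier_R_D[OF a] by (auto simp: mult_R)
    qed
    show "a \<otimes>\<^bsub>R\<^esub> \<one>\<^bsub>R\<^esub> = a"
    proof
      fix x
      have "(\<Sum>y\<in>carrier G. a y * \<one>\<^bsub>R\<^esub> (inv y \<otimes> x)) =
          (\<Sum>y\<in>carrier G. if x = y then a y else 0)" if "x \<in> carrier G"
        using that by (intro sum.cong) (auto simp: one_R ga_single_def inv_equality dest: inv_equality
             intro: inv_solve_left')
      then show "(a \<otimes>\<^bsub>R\<^esub> \<one>\<^bsub>R\<^esub>) x = a x"
        using finite_G carrier_R_D[OF a] by (auto simp: mult_R)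
    qed
  qed (auto simp: carrier_R mult_R one_R ga_single_def)
qed (auto simp: mult_R add_R fun_eq_iff algebra_simps sum.distrib)

sublocale R: ring R by (rule ring_R)

lemma minus_R: "a \<in> carrier R \<Longrightarrow> (\<ominus>\<^bsub>R\<^esub> a) = (\<lambda>x. - a x)"
  by (rule R.minus_equality) (auto simp: carrier_R add_R zero_R fun_eq_iff)

lemma diff_R: "a \<in> carrier R \<Longrightarrow> b \<in> carrier R \<Longrightarrow> (a \<ominus>\<^bsub>R\<^esub> b) x = a x - b x"
  by (simp add: a_minus_def add_R minus_R)

lemma mult_single_left:
  assumes "z \<in> carrier G" "x \<in> carrier G"
  shows "(ga_single z c \<otimes>\<^bsub>R\<^esub> a) x = c * a (inv z \<otimes> x)"
proof -
  have "(\<Sum>y\<in>carrier G. ga_single z c y * a (inv y \<otimes> x)) =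
      (\<Sum>y\<in>carrier G. if z = y then c * a (inv y \<otimes> x) else 0)"
    by (intro sum.cong) (auto simp: ga_single_def)
  then show ?thesis using assms finite_G by (simp add: mult_R)
qed

lemma mult_single_right:
  assumes "z \<in> carrier G" "x \<in> carrier G"
  shows "(a \<otimes>\<^bsub>R\<^esub> ga_single z c) x = a (x \<otimes> inv z) * c"
proof -
  have "(inv y \<otimes> x = z) = (y = x \<otimes> inv z)" if "y \<in> carrier G" for y
    using that assms by (metis inv_closed inv_solve_left inv_solve_right inv_inv m_closed)
  then have "(\<Sum>y\<in>carrier G. a y * ga_single z c (inv y \<otimes> x)) =
      (\<Sum>y\<in>carrier G. if x \<otimes> inv z = y then a y * c else 0)"
    by (intro sum.cong) (auto simp: ga_single_def)
  then show ?thesis using assms finite_G by (simp add: mult_R)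
qed

lemma single_mult:
  assumes "x \<in> carrier G" "y \<in> carrier G"
  shows "ga_single x c \<otimes>\<^bsub>R\<^esub> ga_single y d = ga_single (x \<otimes> y) (c * d)"
proof
  fix z
  show "(ga_single x c \<otimes>\<^bsub>R\<^esub> ga_single y d) z = ga_single (x \<otimes> y) (c * d) z"
  proof (cases "z \<in> carrier G")
    case True
    have "inv x \<otimes> z = y \<longleftrightarrow> z = x \<otimes> y"
      using True assms by (metis inv_closed inv_solve_left inv_inv m_closed)
    then show ?thesis using True assms by (simp add: mult_single_left) (simp add: ga_single_def)
  next
    case False
    then show ?thesis using assms by (auto simp: mult_R ga_single_def)
  qed
qed

lemma single_add: "ga_single x c \<oplus>\<^bsub>R\<^esub> ga_single x d = ga_single x (c + d)"
  by (auto simp: add_R ga_single_def)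

lemma single_zero: "ga_single x 0 = \<zero>\<^bsub>R\<^esub>"
  by (auto simp: zero_R ga_single_def)

lemma R_induct [consumes 1, case_names zero single add]:
  assumes a: "a \<in> carrier R"
    and "P \<zero>\<^bsub>R\<^esub>" "\<And>x c. x \<in> carrier G \<Longrightarrow> P (ga_single x c)"
    and "\<And>a b. a \<in> carrier R \<Longrightarrow> b \<in> carrier R \<Longrightarrow> P a \<Longrightarrow> P b \<Longrightarrow> P (a \<oplus>\<^bsub>R\<^esub> b)"
  shows "P a"
proof -
  have "P (\<lambda>x. if x \<in> S then a x else 0)" if "finite S" "S \<subseteq> carrier G" for S
    using that
  proof (induction S)
    case empty
    then show ?case using assms(2) by (simp add: zero_R)
  next
    case (insert y S)
    have e: "(\<lambda>x. if x \<in> insert y S then a x else 0) =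
        ga_single y (a y) \<oplus>\<^bsub>R\<^esub> (\<lambda>x. if x \<in> S then a x else 0)"
      using insert by (auto simp: add_R ga_single_def fun_eq_iff)
    show ?case
      unfolding e by (rule assms(4)) (use insert assms(3) in \<open>auto simp: carrier_R subset_iff ga_single_def\<close>)
  qed
  from this[OF finite_G] have "P (\<lambda>x. if x \<in> carrier G then a x else 0)" by simp
  moreover have "(\<lambda>x. if x \<in> carrier G then a x else 0) = a"
    using carrier_R_D[OF a] by auto
  ultimately show ?thesis by simp
qed

subsection \<open>The augmentation\<close>

definition aug :: "('g \<Rightarrow> 'k) \<Rightarrow> 'k" where "aug a = (\<Sum>x\<in>carrier G. a x)"

lemma aug_add: "aug (a \<oplus>\<^bsub>R\<^esub> b) = aug a + aug b"
  by (simp add: aug_def add_R sum.distrib)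

lemma aug_zero: "aug \<zero>\<^bsub>R\<^esub> = 0"
  by (simp add: aug_def zero_R)

lemma aug_diff: "a \<in> carrier R \<Longrightarrow> b \<in> carrier R \<Longrightarrow> aug (a \<ominus>\<^bsub>R\<^esub> b) = aug a - aug b"
  by (simp add: aug_def diff_R sum_subtractf)

lemma aug_single: "x \<in> carrier G \<Longrightarrow> aug (ga_single x c) = c"
  using finite_G by (simp add: aug_def ga_single_def)

lemma aug_one: "aug \<one>\<^bsub>R\<^esub> = 1"
  by (simp add: one_R aug_single)

lemma aug_mult: "aug (a \<otimes>\<^bsub>R\<^esub> b) = aug a * aug b"
proof -
  have "aug (a \<otimes>\<^bsub>R\<^esub> b) = (\<Sum>x\<in>carrier G. \<Sum>y\<in>carrier G. a y * b (inv y \<otimes> x))"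
    by (simp add: aug_def mult_R)
  also have "\<dots> = (\<Sum>y\<in>carrier G. a y * (\<Sum>x\<in>carrier G. b (inv y \<otimes> x)))"
    by (subst sum.swap) (simp add: sum_distrib_left)
  also have "\<dots> = (\<Sum>y\<in>carrier G. a y * (\<Sum>x\<in>carrier G. b x))"
    using sum_left_translate[OF inv_closed] by (intro sum.cong) auto
  finally show ?thesis by (simp add: aug_def sum_distrib_right)
qed

definition J :: "('g \<Rightarrow> 'k) set" where "J = {a \<in> carrier R. aug a = 0}"

lemma J_R: "a \<in> J \<Longrightarrow> a \<in> carrier R"
  by (simp add: J_def)

lemma J_mult_left: "a \<in> carrier R \<Longrightarrow> b \<in> J \<Longrightarrow> a \<otimes>\<^bsub>R\<^esub> b \<in> J"
  and J_mult_right: "b \<in> J \<Longrightarrow> a \<in> carrier R \<Longrightarrow> b \<otimes>\<^bsub>R\<^esub> a \<in> J"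
  and J_add: "b \<in> J \<Longrightarrow> c \<in> J \<Longrightarrow> b \<oplus>\<^bsub>R\<^esub> c \<in> J"
  and J_zero: "\<zero>\<^bsub>R\<^esub> \<in> J"
  by (auto simp: J_def aug_mult aug_add aug_zero)

lemma minus_one_R: "x \<in> carrier G \<Longrightarrow> minus_one G x = ga_single x 1 \<ominus>\<^bsub>R\<^esub> \<one>\<^bsub>R\<^esub>"
  by (simp add: minus_one_def R_def)

lemma minus_one_J: "x \<in> carrier G \<Longrightarrow> minus_one G x \<in> J"
  by (simp add: J_def minus_one_R aug_diff aug_single aug_one)

subsection \<open>The scalars\<close>

text \<open>The field as a subring of its group algebra, so that the linear maps between modules over the
  group algebra are the homomorphisms over \<open>K\<close>.\<close>

definition K :: "('g \<Rightarrow> 'k) ring" where "K = R\<lparr>carrier := range (ga_single \<one>)\<rparr>"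

lemma K_sel [simp]: "carrier K = range (ga_single \<one>)" "\<zero>\<^bsub>K\<^esub> = \<zero>\<^bsub>R\<^esub>" "\<one>\<^bsub>K\<^esub> = \<one>\<^bsub>R\<^esub>"
  "a \<oplus>\<^bsub>K\<^esub> b = a \<oplus>\<^bsub>R\<^esub> b" "a \<otimes>\<^bsub>K\<^esub> b = a \<otimes>\<^bsub>R\<^esub> b"
  by (simp_all add: K_def)

lemma K_R: "a \<in> carrier K \<Longrightarrow> a \<in> carrier R"
  by auto

lemma ring_K: "ring K"
proof (rule ringI)
  show "abelian_group K"
  proof (rule abelian_groupI)
    fix a assume "a \<in> carrier K"
    then obtain c where "a = ga_single \<one> c" by auto
    then have "ga_single \<one> (- c) \<oplus>\<^bsub>K\<^esub> a = \<zero>\<^bsub>K\<^esub>" by (simp add: single_add single_zero)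
    then show "\<exists>b\<in>carrier K. b \<oplus>\<^bsub>K\<^esub> a = \<zero>\<^bsub>K\<^esub>" by auto
  next
    show "\<zero>\<^bsub>K\<^esub> \<in> carrier K" using single_zero by (metis K_sel(1,2) rangeI)
  qed (auto simp: single_add add_ac single_zero[of \<one>, symmetric])
  show "monoid K"
    by (rule monoidI) (auto simp: single_mult one_R ac_simps)
qed (auto simp: single_mult single_add algebra_simps)

lemma division_K:
  assumes "a \<in> carrier K" "a \<noteq> \<zero>\<^bsub>K\<^esub>"
  shows "\<exists>b\<in>carrier K. b \<otimes>\<^bsub>K\<^esub> a = \<one>\<^bsub>K\<^esub>"
proof -
  obtain c where c: "a = ga_single \<one> c" using assms by auto
  then have "c \<noteq> 0" using assms(2) single_zero by auto
  then have "ga_single \<one> (inverse c) \<otimes>\<^bsub>K\<^esub> a = \<one>\<^bsub>K\<^esub>" using c by (simp add: single_mult one_R)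
  then show ?thesis by auto
qed

lemma left_module_K: "left_module R M \<Longrightarrow> left_module K M"
  unfolding left_module_def left_module_axioms_def
  using ring_K by (auto simp: K_def)

lemma lmod_hom_K: "f \<in> lmod_hom R M N \<Longrightarrow> f \<in> lmod_hom K M N"
  by (auto simp: lmod_hom_def K_def)

text \<open>Additively the group algebra is generated by the elements \<open>c x\<close>.\<close>

lemma lmod_hom_R_I:
  assumes M: "left_module R M" and N: "left_module R N"
    and c: "\<And>x. x \<in> carrier M \<Longrightarrow> f x \<in> carrier N"
    and a: "\<And>x y. x \<in> carrier M \<Longrightarrow> y \<in> carrier M \<Longrightarrow> f (x \<oplus>\<^bsub>M\<^esub> y) = f x \<oplus>\<^bsub>N\<^esub> f y"
    and s: "\<And>x c m. x \<in> carrier G \<Longrightarrow> m \<in> carrier M \<Longrightarrow>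
      f (ga_single x c \<odot>\<^bsub>M\<^esub> m) = ga_single x c \<odot>\<^bsub>N\<^esub> f m"
  shows "f \<in> lmod_hom R M N"
proof (rule lmod_homI[OF c a])
  interpret M: left_module R M by fact
  interpret N: left_module R N by fact
  fix r m assume r: "r \<in> carrier R" and m: "m \<in> carrier M"
  from r show "f (r \<odot>\<^bsub>M\<^esub> m) = r \<odot>\<^bsub>N\<^esub> f m"
  proof (induction r rule: R_induct)
    case zero
    have "f \<zero>\<^bsub>M\<^esub> \<oplus>\<^bsub>N\<^esub> f \<zero>\<^bsub>M\<^esub> = f \<zero>\<^bsub>M\<^esub>" using a[of "\<zero>\<^bsub>M\<^esub>" "\<zero>\<^bsub>M\<^esub>"] by simp
    then have "f \<zero>\<^bsub>M\<^esub> = \<zero>\<^bsub>N\<^esub>" using c by (metis M.M.zero_closed N.M.add.l_cancel_one)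
    then show ?case using m c by (simp add: M.smult_zero_left N.smult_zero_left)
  next
    case (add a b)
    then show ?case using m c
      by (simp add: M.smult_l_distr N.smult_l_distr assms(4) M.smult_closed)
  qed (use s m in auto)
qed

end

section \<open>Traces of linear maps and the stable category\<close>

context finite_group_algebra
begin

lemma scalar_central:
  assumes "a \<in> carrier R"
  shows "ga_single \<one> c \<otimes>\<^bsub>R\<^esub> a = a \<otimes>\<^bsub>R\<^esub> ga_single \<one> c"
proof
  fix x
  show "(ga_single \<one> c \<otimes>\<^bsub>R\<^esub> a) x = (a \<otimes>\<^bsub>R\<^esub> ga_single \<one> c) x"
    by (cases "x \<in> carrier G") (simp_all add: mult_single_left mult_single_right, simp add: mult_R)
qed

lemma finsum_R:
  assumes "finite I" "f \<in> I \<rightarrow> carrier R"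
  shows "(\<Oplus>\<^bsub>R\<^esub>i\<in>I. f i) y = (\<Sum>i\<in>I. f i y)"
  using assms
  by (induction I) (auto simp: zero_R R.finsum_insert add_R Pi_iff)

text \<open>The sum of the conjugates of a linear map under the group: the image of \<open>\<phi>\<close> under the relative
  trace map \<open>Hom\<^sub>k(M, N) \<rightarrow> Hom\<^sub>k\<^sub>G(M, N)\<close>.\<close>

definition tr :: "('g \<Rightarrow> 'k, 'a) module \<Rightarrow> ('g \<Rightarrow> 'k, 'b) module \<Rightarrow> ('a \<Rightarrow> 'b) \<Rightarrow> 'a \<Rightarrow> 'b" where
  "tr M N \<phi> m = (\<Oplus>\<^bsub>N\<^esub>x\<in>carrier G. ga_single x 1 \<odot>\<^bsub>N\<^esub> \<phi> (ga_single (inv x) 1 \<odot>\<^bsub>M\<^esub> m))"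

lemma tr_closed_aux:
  assumes M: "left_module R M" and N: "left_module R N" and "\<phi> \<in> lmod_hom K M N" "m \<in> carrier M"
    "x \<in> carrier G" "y \<in> carrier G"
  shows "ga_single x c \<odot>\<^bsub>N\<^esub> \<phi> (ga_single y d \<odot>\<^bsub>M\<^esub> m) \<in> carrier N"
proof -
  interpret M: left_module R M by fact
  interpret N: left_module R N by fact
  show ?thesis
    using assms lmod_hom_closed[of \<phi> K M N] by (intro N.smult_closed) (auto simp: M.smult_closed)
qed

text \<open>Multiplication by a group element permutes the conjugates.\<close>

lemma tr_hom:
  assumes M: "left_module R M" and N: "left_module R N" and \<phi>: "\<phi> \<in> lmod_hom K M N"
  shows "tr M N \<phi> \<in> lmod_hom R M N"
proof (rule lmod_hom_R_I[OF M N])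
  interpret M: left_module R M by fact
  interpret N: left_module R N by fact
  note cl = tr_closed_aux[OF M N \<phi>] and c = lmod_hom_closed[OF \<phi>]
  fix m assume m: "m \<in> carrier M"
  show "tr M N \<phi> m \<in> carrier N"
    unfolding tr_def by (rule N.M.finsum_closed) (use cl m in auto)
  {
    fix m' assume m': "m' \<in> carrier M"
    show "tr M N \<phi> (m \<oplus>\<^bsub>M\<^esub> m') = tr M N \<phi> m \<oplus>\<^bsub>N\<^esub> tr M N \<phi> m'"
    proof -
      have "tr M N \<phi> (m \<oplus>\<^bsub>M\<^esub> m') = (\<Oplus>\<^bsub>N\<^esub>x\<in>carrier G.
          ga_single x 1 \<odot>\<^bsub>N\<^esub> \<phi> (ga_single (inv x) 1 \<odot>\<^bsub>M\<^esub> m) \<oplus>\<^bsub>N\<^esub>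
          ga_single x 1 \<odot>\<^bsub>N\<^esub> \<phi> (ga_single (inv x) 1 \<odot>\<^bsub>M\<^esub> m'))"
        unfolding tr_def
        by (rule N.M.finsum_cong') (use m m' c in \<open>auto simp: M.smult_r_distr lmod_hom_add[OF \<phi>]
          N.smult_r_distr M.smult_closed N.smult_closed\<close>)
      also have "\<dots> = tr M N \<phi> m \<oplus>\<^bsub>N\<^esub> tr M N \<phi> m'"
        unfolding tr_def by (rule N.M.finsum_addf) (use cl m m' in auto)
      finally show ?thesis .
    qed
  }
  fix y c assume y: "y \<in> carrier G"
  let ?s = "\<lambda>m x. ga_single x 1 \<odot>\<^bsub>N\<^esub> \<phi> (ga_single (inv x) 1 \<odot>\<^bsub>M\<^esub> m)"
  have inj: "inj_on ((\<otimes>) y) (carrier G)" using y by (auto intro: inj_onI)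
  have img: "(\<otimes>) y ` carrier G = carrier G"
    using surj_const_mult[OF y] by simp
  have ym: "ga_single y c \<odot>\<^bsub>M\<^esub> m \<in> carrier M" using y m by (simp add: M.smult_closed)
  have "tr M N \<phi> (ga_single y c \<odot>\<^bsub>M\<^esub> m) = (\<Oplus>\<^bsub>N\<^esub>x\<in>(\<otimes>) y ` carrier G. ?s (ga_single y c \<odot>\<^bsub>M\<^esub> m) x)"
    by (simp add: tr_def img)
  also have "\<dots> = (\<Oplus>\<^bsub>N\<^esub>x\<in>carrier G. ?s (ga_single y c \<odot>\<^bsub>M\<^esub> m) (y \<otimes> x))"
    by (rule N.M.finsum_reindex[OF _ inj]) (use cl ym y in auto)
  also have "\<dots> = (\<Oplus>\<^bsub>N\<^esub>x\<in>carrier G. ga_single y c \<odot>\<^bsub>N\<^esub> ?s m x)"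
  proof (rule N.M.finsum_cong')
    fix x assume x: "x \<in> carrier G"
    have "ga_single (inv (y \<otimes> x)) 1 \<odot>\<^bsub>M\<^esub> (ga_single y c \<odot>\<^bsub>M\<^esub> m) =
        ga_single (inv x) c \<odot>\<^bsub>M\<^esub> m"
      using x y m by (simp add: M.smult_assoc[symmetric] single_mult inv_mult_group m_assoc)
    also have "\<dots> = ga_single \<one> c \<odot>\<^bsub>M\<^esub> (ga_single (inv x) 1 \<odot>\<^bsub>M\<^esub> m)"
      using x y m by (simp add: M.smult_assoc[symmetric] single_mult)
    finally have "\<phi> (ga_single (inv (y \<otimes> x)) 1 \<odot>\<^bsub>M\<^esub> (ga_single y c \<odot>\<^bsub>M\<^esub> m)) =
        ga_single \<one> c \<odot>\<^bsub>N\<^esub> \<phi> (ga_single (inv x) 1 \<odot>\<^bsub>M\<^esub> m)"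
      using x m by (simp add: lmod_hom_smult[OF \<phi>] M.smult_closed)
    then show "?s (ga_single y c \<odot>\<^bsub>M\<^esub> m) (y \<otimes> x) = ga_single y c \<odot>\<^bsub>N\<^esub> ?s m x"
      using x y m lmod_hom_closed[OF \<phi>]
      by (simp add: N.smult_assoc[symmetric] single_mult M.smult_closed)
  qed (use lmod_hom_closed[OF \<phi>] m y in \<open>auto intro!: N.smult_closed simp: M.smult_closed\<close>)
  also have "\<dots> = ga_single y c \<odot>\<^bsub>N\<^esub> tr M N \<phi> m"
    unfolding tr_def by (rule N.finsum_smult[symmetric]) (use finite_G y cl m in auto)
  finally show "tr M N \<phi> (ga_single y c \<odot>\<^bsub>M\<^esub> m) = ga_single y c \<odot>\<^bsub>N\<^esub> tr M N \<phi> m" .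
qed

lemma tr_comp_left:
  assumes M: "left_module R M" and N: "left_module R N" and P: "left_module R P"
    and \<phi>: "\<phi> \<in> lmod_hom K M N" and b: "b \<in> lmod_hom R N P" and m: "m \<in> carrier M"
  shows "b (tr M N \<phi> m) = tr M P (\<lambda>m. b (\<phi> m)) m"
proof -
  interpret M: left_module R M by fact
  interpret N: left_module R N by fact
  interpret P: left_module R P by fact
  note cl = tr_closed_aux[OF M N \<phi> m]
  have "b (tr M N \<phi> m) = (\<Oplus>\<^bsub>P\<^esub>x\<in>carrier G. b (ga_single x 1 \<odot>\<^bsub>N\<^esub> \<phi> (ga_single (inv x) 1 \<odot>\<^bsub>M\<^esub> m)))"
    unfolding tr_def
    by (rule lmod_hom_finsum[OF _ _ b]) (use cl finite_G in \<open>auto intro: N.M.abelian_group_axioms P.M.abelian_group_axioms\<close>)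
  also have "\<dots> = tr M P (\<lambda>m. b (\<phi> m)) m"
    unfolding tr_def
    by (rule P.M.finsum_cong') (use m lmod_hom_closed[OF \<phi>] lmod_hom_closed[OF b] in
      \<open>auto simp: lmod_hom_smult[OF b] M.smult_closed intro!: P.smult_closed\<close>)
  finally show ?thesis .
qed

lemma tr_comp_right:
  assumes L: "left_module R L" and M: "left_module R M" and N: "left_module R N"
    and \<phi>: "\<phi> \<in> lmod_hom K M N" and a: "a \<in> lmod_hom R L M" and l: "l \<in> carrier L"
  shows "tr M N \<phi> (a l) = tr L N (\<lambda>l. \<phi> (a l)) l"
proof -
  interpret L: left_module R L by fact
  interpret N: left_module R N by fact
  show ?thesis
    unfolding tr_def using l lmod_hom_closed[OF a] tr_closed_aux[OF M N \<phi>]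
    by (intro N.M.finsum_cong') (auto simp: lmod_hom_smult[OF a])
qed

lemma tr_add:
  assumes M: "left_module R M" and N: "left_module R N"
    and \<phi>: "\<phi> \<in> lmod_hom K M N" and \<psi>: "\<psi> \<in> lmod_hom K M N" and m: "m \<in> carrier M"
  shows "tr M N (\<lambda>m. \<phi> m \<oplus>\<^bsub>N\<^esub> \<psi> m) m = tr M N \<phi> m \<oplus>\<^bsub>N\<^esub> tr M N \<psi> m"
proof -
  interpret M: left_module R M by fact
  interpret N: left_module R N by fact
  have s: "\<phi> (ga_single (inv x) 1 \<odot>\<^bsub>M\<^esub> m) \<in> carrier N" "\<psi> (ga_single (inv x) 1 \<odot>\<^bsub>M\<^esub> m) \<in> carrier N"
    if "x \<in> carrier G" for x
    using that m lmod_hom_closed[OF \<phi>] lmod_hom_closed[OF \<psi>] by (simp_all add: M.smult_closed)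
  have "tr M N (\<lambda>m. \<phi> m \<oplus>\<^bsub>N\<^esub> \<psi> m) m = (\<Oplus>\<^bsub>N\<^esub>x\<in>carrier G.
      ga_single x 1 \<odot>\<^bsub>N\<^esub> \<phi> (ga_single (inv x) 1 \<odot>\<^bsub>M\<^esub> m) \<oplus>\<^bsub>N\<^esub>
      ga_single x 1 \<odot>\<^bsub>N\<^esub> \<psi> (ga_single (inv x) 1 \<odot>\<^bsub>M\<^esub> m))"
    unfolding tr_def
    by (rule N.M.finsum_cong') (use s in \<open>auto simp: N.smult_r_distr intro!: N.smult_closed\<close>)
  also have "\<dots> = tr M N \<phi> m \<oplus>\<^bsub>N\<^esub> tr M N \<psi> m"
    unfolding tr_def
    by (rule N.M.finsum_addf) (use s in \<open>auto intro!: N.smult_closed\<close>)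
  finally show ?thesis .
qed

text \<open>These are the maps that factor through a projective module; in contrast to a factorisation, a
  linear map \<open>\<phi>\<close> can be extended and lifted by linear algebra.\<close>

definition trace_map :: "('g \<Rightarrow> 'k, 'a) module \<Rightarrow> ('g \<Rightarrow> 'k, 'b) module \<Rightarrow> ('a \<Rightarrow> 'b) \<Rightarrow> bool" where
  "trace_map M N f \<longleftrightarrow> (\<exists>\<phi>\<in>lmod_hom K M N. \<forall>m\<in>carrier M. f m = tr M N \<phi> m)"

lemma trace_map_cong:
  "trace_map M N f \<Longrightarrow> (\<And>m. m \<in> carrier M \<Longrightarrow> f m = f' m) \<Longrightarrow> trace_map M N f'"
  unfolding trace_map_def by (metis (no_types))

lemma trace_map_comp_left:
  assumes "left_module R M" "left_module R N" "left_module R P"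
    and "trace_map M N f" "b \<in> lmod_hom R N P"
  shows "trace_map M P (\<lambda>m. b (f m))"
proof -
  obtain \<phi> where \<phi>: "\<phi> \<in> lmod_hom K M N" "\<And>m. m \<in> carrier M \<Longrightarrow> f m = tr M N \<phi> m"
    using assms(4) by (auto simp: trace_map_def)
  have "(\<lambda>m. b (\<phi> m)) \<in> lmod_hom K M P"
    by (rule lmod_hom_comp[OF \<phi>(1) lmod_hom_K[OF assms(5)]])
  then show ?thesis
    unfolding trace_map_def using \<phi> tr_comp_left[OF assms(1-3) \<phi>(1) assms(5)] by auto
qed

lemma trace_map_comp_right:
  assumes "left_module R L" "left_module R M" "left_module R N"
    and "trace_map M N f" "a \<in> lmod_hom R L M"
  shows "trace_map L N (\<lambda>l. f (a l))"
proof -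
  obtain \<phi> where \<phi>: "\<phi> \<in> lmod_hom K M N" "\<And>m. m \<in> carrier M \<Longrightarrow> f m = tr M N \<phi> m"
    using assms(4) by (auto simp: trace_map_def)
  have "(\<lambda>l. \<phi> (a l)) \<in> lmod_hom K L N"
    by (rule lmod_hom_comp[OF lmod_hom_K[OF assms(5)] \<phi>(1)])
  then show ?thesis
    unfolding trace_map_def
    using \<phi> tr_comp_right[OF assms(1-3) \<phi>(1) assms(5)] lmod_hom_closed[OF assms(5)] by auto
qed

lemma trace_map_add:
  assumes "left_module R M" "left_module R N" "trace_map M N f" "trace_map M N h"
  shows "trace_map M N (\<lambda>m. f m \<oplus>\<^bsub>N\<^esub> h m)"
proof -
  obtain \<phi> \<psi> where \<phi>: "\<phi> \<in> lmod_hom K M N" "\<And>m. m \<in> carrier M \<Longrightarrow> f m = tr M N \<phi> m"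
    and \<psi>: "\<psi> \<in> lmod_hom K M N" "\<And>m. m \<in> carrier M \<Longrightarrow> h m = tr M N \<psi> m"
    using assms(3,4) by (auto simp: trace_map_def)
  show ?thesis
    unfolding trace_map_def
    by (rule bexI[OF _ lmod_hom_add_fun[OF left_module_K[OF assms(2)] \<phi>(1) \<psi>(1)]])
      (simp add: tr_add[OF assms(1,2) \<phi>(1) \<psi>(1)] \<phi>(2) \<psi>(2))
qed

lemma trace_map_zero:
  assumes "left_module R M" "left_module R N"
  shows "trace_map M N (\<lambda>m. \<zero>\<^bsub>N\<^esub>)"
proof -
  interpret N: left_module R N by fact
  have "tr M N (\<lambda>m. \<zero>\<^bsub>N\<^esub>) m = \<zero>\<^bsub>N\<^esub>" for m
    unfolding tr_def
    by (subst N.M.finsum_cong'[where g = "\<lambda>_. \<zero>\<^bsub>N\<^esub>"]) (auto simp: N.smult_zero_right)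
  then show ?thesis
    unfolding trace_map_def
    by (intro bexI[OF _ lmod_hom_zero_fun[OF left_module_K[OF assms(2)]]]) simp
qed

lemma trace_map_diff:
  assumes "left_module R M" "left_module R N" "trace_map M N f" "trace_map M N h"
  shows "trace_map M N (\<lambda>m. f m \<ominus>\<^bsub>N\<^esub> h m)"
proof -
  interpret N: left_module R N by fact
  have "(\<lambda>n. \<ominus>\<^bsub>N\<^esub> n) \<in> lmod_hom R N N"
    by (rule lmod_homI) (auto simp: N.M.minus_add N.smult_neg_right)
  from trace_map_comp_left[OF assms(1,2,2,4) this]
  show ?thesis
    using trace_map_add[OF assms(1,2,3)] by (simp add: a_minus_def)
qed

text \<open>A linear map can be extended along an injection, resp. lifted along a surjection; so the
  same holds for its trace. In this sense traces of linear maps behave like maps through a module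
  which is both injective and projective.\<close>

lemma trace_map_extend:
  assumes A: "left_module R A" and B: "left_module R B" and N: "left_module R N"
    and i: "i \<in> lmod_hom R A B" "inj_on i (carrier A)" and f: "trace_map A N f"
  obtains F where "F \<in> lmod_hom R B N" "trace_map B N F" "\<And>x. x \<in> carrier A \<Longrightarrow> F (i x) = f x"
proof -
  obtain \<phi> where \<phi>: "\<phi> \<in> lmod_hom K A N" "\<And>m. m \<in> carrier A \<Longrightarrow> f m = tr A N \<phi> m"
    using f by (auto simp: trace_map_def)
  obtain \<Phi> where \<Phi>: "\<Phi> \<in> lmod_hom K B N" "\<And>x. x \<in> carrier A \<Longrightarrow> \<Phi> (i x) = \<phi> x"
    using lmod_hom_extension[OF left_module_K[OF A] left_module_K[OF B] left_module_K[OF N]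
      lmod_hom_K[OF i(1)] i(2) \<phi>(1) division_K] by blast
  interpret A: left_module R A by fact
  interpret N: left_module R N by fact
  have "tr B N \<Phi> (i x) = f x" if "x \<in> carrier A" for x
  proof -
    have "tr B N \<Phi> (i x) = tr A N (\<lambda>x. \<Phi> (i x)) x"
      by (rule tr_comp_right[OF A B N \<Phi>(1) i(1) that])
    also have "\<dots> = tr A N \<phi> x"
      unfolding tr_def
      by (rule N.M.finsum_cong') (use that \<Phi>(2) tr_closed_aux[OF A N \<phi>(1)] in \<open>auto simp: A.smult_closed\<close>)
    finally show ?thesis using \<phi>(2) that by simp
  qed
  moreover have "trace_map B N (tr B N \<Phi>)" using \<Phi>(1) by (auto simp: trace_map_def)
  ultimately show ?thesis using that tr_hom[OF B N \<Phi>(1)] by blast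
qed

lemma trace_map_lift:
  assumes A: "left_module R A" and B: "left_module R B" and M: "left_module R M"
    and q: "q \<in> lmod_hom R A B" "q ` carrier A = carrier B" and f: "trace_map M B f"
  obtains F where "F \<in> lmod_hom R M A" "trace_map M A F" "\<And>x. x \<in> carrier M \<Longrightarrow> q (F x) = f x"
proof -
  obtain \<phi> where \<phi>: "\<phi> \<in> lmod_hom K M B" "\<And>m. m \<in> carrier M \<Longrightarrow> f m = tr M B \<phi> m"
    using f by (auto simp: trace_map_def)
  obtain s where s: "s \<in> lmod_hom K B A" "\<And>y. y \<in> carrier B \<Longrightarrow> q (s y) = y"
    using lmod_hom_section[OF left_module_K[OF A] left_module_K[OF B] lmod_hom_K[OF q(1)] q(2)
      division_K] by blast
  let ?\<Phi> = "\<lambda>x. s (\<phi> x)"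
  have \<Phi>: "?\<Phi> \<in> lmod_hom K M A" by (rule lmod_hom_comp[OF \<phi>(1) s(1)])
  interpret M: left_module R M by fact
  interpret B: left_module R B by fact
  have "q (tr M A ?\<Phi> x) = f x" if "x \<in> carrier M" for x
  proof -
    have "q (tr M A ?\<Phi> x) = tr M B (\<lambda>x. q (?\<Phi> x)) x"
      by (rule tr_comp_left[OF M A B \<Phi> q(1) that])
    also have "\<dots> = tr M B \<phi> x"
      unfolding tr_def
      by (rule B.M.finsum_cong') (use that s(2) lmod_hom_closed[OF \<phi>(1)] tr_closed_aux[OF M B \<phi>(1)]
        in \<open>auto simp: M.smult_closed\<close>)
    finally show ?thesis using \<phi>(2) that by simp
  qed
  moreover have "trace_map M A (tr M A ?\<Phi>)" unfolding trace_map_def using \<Phi> by blast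
  ultimately show ?thesis using that tr_hom[OF M A \<Phi>] by blast
qed

abbreviation regR :: "('g \<Rightarrow> 'k, 'g \<Rightarrow> 'k) module" where "regR \<equiv> regular_module R"

lemma regR: "left_module R regR"
  by (rule regular_left_module[OF ring_R])

lemma finsum_regR: "(\<Oplus>\<^bsub>regR\<^esub>x\<in>A. f x) = (\<Oplus>\<^bsub>R\<^esub>x\<in>A. f x)"
  by (simp add: finsum_def regular_module_def finprod_def)

lemma sum_singles:
  assumes "b \<in> carrier R"
  shows "(\<Oplus>\<^bsub>R\<^esub>x\<in>carrier G. ga_single (inv x) (b (inv x))) = b"
proof
  fix y
  have "(\<Oplus>\<^bsub>R\<^esub>x\<in>carrier G. ga_single (inv x) (b (inv x))) y =
      (\<Sum>x\<in>carrier G. ga_single (inv x) (b (inv x)) y)"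
    using finite_G by (simp add: finsum_R)
  also have "\<dots> = (\<Sum>x\<in>carrier G. ga_single x (b x) y)"
    by (rule sum.reindex_bij_witness[of _ "\<lambda>x. inv x" "\<lambda>x. inv x"]) auto
  also have "\<dots> = b y"
    using finite_G carrier_R_D[OF assms] by (auto simp: ga_single_def)
  finally show "(\<Oplus>\<^bsub>R\<^esub>x\<in>carrier G. ga_single (inv x) (b (inv x))) y = b y" .
qed

text \<open>The coinduced module of the vector space underlying \<open>M\<close>. Maps are normalised to be zero off the
  group algebra, so that equal maps are equal functions.\<close>

definition coind :: "('g \<Rightarrow> 'k, 'a) module \<Rightarrow> ('g \<Rightarrow> 'k, ('g \<Rightarrow> 'k) \<Rightarrow> 'a) module" where
  "coind M = \<lparr>carrier = {F \<in> lmod_hom K regR M. \<forall>b. b \<notin> carrier R \<longrightarrow> F b = \<zero>\<^bsub>M\<^esub>},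
     monoid.mult = undefined, one = undefined, ring.zero = (\<lambda>b. \<zero>\<^bsub>M\<^esub>),
     add = (\<lambda>F F' b. F b \<oplus>\<^bsub>M\<^esub> F' b),
     smult = (\<lambda>a F b. if b \<in> carrier R then F (b \<otimes>\<^bsub>R\<^esub> a) else \<zero>\<^bsub>M\<^esub>)\<rparr>"

lemma coind_sel [simp]:
  "F \<in> carrier (coind M) \<longleftrightarrow> F \<in> lmod_hom K regR M \<and> (\<forall>b. b \<notin> carrier R \<longrightarrow> F b = \<zero>\<^bsub>M\<^esub>)"
  "\<zero>\<^bsub>coind M\<^esub> = (\<lambda>b. \<zero>\<^bsub>M\<^esub>)" "F \<oplus>\<^bsub>coind M\<^esub> F' = (\<lambda>b. F b \<oplus>\<^bsub>M\<^esub> F' b)"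
  "a \<odot>\<^bsub>coind M\<^esub> F = (\<lambda>b. if b \<in> carrier R then F (b \<otimes>\<^bsub>R\<^esub> a) else \<zero>\<^bsub>M\<^esub>)"
  by (simp_all add: coind_def)

lemma coind_left_module:
  assumes M: "left_module R M"
  shows "left_module R (coind M)"
proof -
  interpret M: left_module R M by fact
  note KM = left_module_K[OF M]
  have cl: "F b \<in> carrier M" if "F \<in> carrier (coind M)" for F b
    using that lmod_hom_closed[of F K regR M b] by (cases "b \<in> carrier R") auto
  have "abelian_group (coind M)"
  proof (rule abelian_groupI)
    fix F assume F: "F \<in> carrier (coind M)"
    have "(\<lambda>b. \<zero>\<^bsub>M\<^esub> \<ominus>\<^bsub>M\<^esub> F b) \<in> lmod_hom K regR M"
      using F by (intro lmod_hom_diff_fun lmod_hom_zero_fun KM) auto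
    then show "\<exists>F'\<in>carrier (coind M). F' \<oplus>\<^bsub>coind M\<^esub> F = \<zero>\<^bsub>coind M\<^esub>"
      using F cl[OF F] by (intro bexI[of _ "\<lambda>b. \<zero>\<^bsub>M\<^esub> \<ominus>\<^bsub>M\<^esub> F b"])
        (auto simp: M.M.diff_add_cancel M.M.minus_self)
  next
    fix F F' assume "F \<in> carrier (coind M)" "F' \<in> carrier (coind M)"
    then show "F \<oplus>\<^bsub>coind M\<^esub> F' \<in> carrier (coind M)"
      by (auto intro: lmod_hom_add_fun[OF KM])
  next
    show "\<zero>\<^bsub>coind M\<^esub> \<in> carrier (coind M)" by (auto intro: lmod_hom_zero_fun[OF KM])
  qed (use cl in \<open>auto simp: M.M.a_ac\<close>)
  moreover have "a \<odot>\<^bsub>coind M\<^esub> F \<in> carrier (coind M)"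
    if a: "a \<in> carrier R" and F: "F \<in> carrier (coind M)" for a F
  proof -
    have F': "F \<in> lmod_hom K regR M" using F by simp
    have "(\<lambda>b. if b \<in> carrier R then F (b \<otimes>\<^bsub>R\<^esub> a) else \<zero>\<^bsub>M\<^esub>) \<in> lmod_hom K regR M"
      using a lmod_hom_closed[OF F'] lmod_hom_add[OF F'] lmod_hom_smult[OF F']
      by (intro lmod_homI) (auto simp: R.l_distr R.m_assoc)
    then show ?thesis by simp
  qed
  moreover have "F (b \<otimes>\<^bsub>R\<^esub> (a \<oplus>\<^bsub>R\<^esub> a')) = F (b \<otimes>\<^bsub>R\<^esub> a) \<oplus>\<^bsub>M\<^esub> F (b \<otimes>\<^bsub>R\<^esub> a')"
    if "F \<in> carrier (coind M)" "a \<in> carrier R" "a' \<in> carrier R" "b \<in> carrier R" for F a a' b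
    using that lmod_hom_add[of F K regR M] by (simp add: R.r_distr)
  ultimately show ?thesis
    unfolding left_module_def left_module_axioms_def
    using ring_R cl by (auto simp: R.m_assoc fun_eq_iff)
qed

lemma coind_eval:
  assumes M: "left_module R M" and b: "b \<in> carrier R"
  shows "(\<lambda>F. F b) \<in> lmod_hom K (coind M) M"
proof (rule lmod_homI)
  fix a F assume "a \<in> carrier K" and F: "F \<in> carrier (coind M)"
  then obtain c where c: "a = ga_single \<one> c" by auto
  have "F (b \<otimes>\<^bsub>R\<^esub> a) = F (a \<otimes>\<^bsub>R\<^esub> b)" using b c scalar_central by simp
  also have "\<dots> = a \<odot>\<^bsub>M\<^esub> F b" using lmod_hom_smult[of F K regR M a b] F b c by auto
  finally show "(a \<odot>\<^bsub>coind M\<^esub> F) b = a \<odot>\<^bsub>M\<^esub> F b" using b by simp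
qed (use b in \<open>auto intro: lmod_hom_closed[of _ K regR M]\<close>)

lemma coind_scalar_fun:
  assumes M: "left_module R M" and m: "m \<in> carrier M"
  shows "(\<lambda>b. if b \<in> carrier R then ga_single \<one> (b \<one>) \<odot>\<^bsub>M\<^esub> m else \<zero>\<^bsub>M\<^esub>) \<in> carrier (coind M)"
proof -
  interpret M: left_module R M by fact
  have "(\<lambda>b. if b \<in> carrier R then ga_single \<one> (b \<one>) \<odot>\<^bsub>M\<^esub> m else \<zero>\<^bsub>M\<^esub>) \<in> lmod_hom K regR M"
    using m by (intro lmod_homI)
      (auto simp: M.smult_closed add_R M.smult_l_distr mult_single_left M.smult_assoc[symmetric]
        single_mult single_add[symmetric])
  then show ?thesis by simp
qed

text \<open>The linear map \<open>\<theta>\<close> keeps the value of a map \<open>kG \<rightarrow> M\<close> at the identity of the group and replaces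
  its values at the other group elements by zero. The conjugates of \<open>\<theta>\<close> do the same for the other
  group elements, and they add up to the identity.\<close>

lemma trace_map_id_coind:
  assumes M: "left_module R M"
  shows "trace_map (coind M) (coind M) (\<lambda>F. F)"
proof -
  interpret M: left_module R M by fact
  let ?C = "coind M"
  have C: "left_module R ?C" by (rule coind_left_module[OF M])
  interpret C: left_module R ?C by (rule C)
  define \<theta> where "\<theta> = (\<lambda>F b. if b \<in> carrier R then ga_single \<one> (b \<one>) \<odot>\<^bsub>M\<^esub> F \<one>\<^bsub>R\<^esub> else \<zero>\<^bsub>M\<^esub>)"
  have cl: "F b \<in> carrier M" if "F \<in> carrier ?C" "b \<in> carrier R" for F b
    using that lmod_hom_closed[of F K regR M b] by auto
  have \<theta>c: "\<theta> F \<in> carrier ?C" if "F \<in> carrier ?C" for F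
    unfolding \<theta>_def by (rule coind_scalar_fun[OF M cl[OF that]]) simp
  have \<theta>: "\<theta> \<in> lmod_hom K ?C ?C"
  proof (rule lmod_homI[OF \<theta>c])
    fix F F' assume "F \<in> carrier ?C" "F' \<in> carrier ?C"
    then show "\<theta> (F \<oplus>\<^bsub>?C\<^esub> F') = \<theta> F \<oplus>\<^bsub>?C\<^esub> \<theta> F'"
      using cl[of _ "\<one>\<^bsub>R\<^esub>"] by (auto simp: \<theta>_def M.smult_r_distr fun_eq_iff)
  next
    fix a F assume a: "a \<in> carrier K" and F: "F \<in> carrier ?C"
    then obtain c where c: "a = ga_single \<one> c" by auto
    have "(a \<odot>\<^bsub>?C\<^esub> F) \<one>\<^bsub>R\<^esub> = a \<odot>\<^bsub>M\<^esub> F \<one>\<^bsub>R\<^esub>"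
      using lmod_hom_smult[OF coind_eval[OF M, of "\<one>\<^bsub>R\<^esub>"] a F] by simp
    then have "\<theta> (a \<odot>\<^bsub>?C\<^esub> F) b = (a \<odot>\<^bsub>?C\<^esub> \<theta> F) b" for b
      using c cl[OF F, of "\<one>\<^bsub>R\<^esub>"]
      by (simp add: \<theta>_def M.smult_assoc[symmetric] single_mult mult_single_right del: coind_sel(4))
        (simp add: \<theta>_def mult_single_right)
    then show "\<theta> (a \<odot>\<^bsub>?C\<^esub> F) = a \<odot>\<^bsub>?C\<^esub> \<theta> F" by (rule ext)
  qed simp
  have "tr ?C ?C \<theta> F = F" if F: "F \<in> carrier ?C" for F
  proof
    fix b
    have t: "tr ?C ?C \<theta> F \<in> carrier ?C" using lmod_hom_closed[OF tr_hom[OF C C \<theta>] F] .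
    show "tr ?C ?C \<theta> F b = F b"
    proof (cases "b \<in> carrier R")
      case False
      then show ?thesis using t F by simp
    next
      case b: True
      have "tr ?C ?C \<theta> F b = (\<Oplus>\<^bsub>M\<^esub>x\<in>carrier G.
          (ga_single x 1 \<odot>\<^bsub>?C\<^esub> \<theta> (ga_single (inv x) 1 \<odot>\<^bsub>?C\<^esub> F)) b)"
        unfolding tr_def
        by (rule lmod_hom_finsum[OF C.M.abelian_group_axioms M.M.abelian_group_axioms coind_eval[OF M b] finite_G])
          (intro Pi_I C.smult_closed \<theta>c F single_R inv_closed)
      also have "\<dots> = (\<Oplus>\<^bsub>M\<^esub>x\<in>carrier G. F (ga_single (inv x) (b (inv x))))"
      proof (rule M.M.finsum_cong')
        fix x assume x: "x \<in> carrier G"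
        have "F (ga_single (inv x) (b (inv x))) =
            F (ga_single \<one> (b (inv x)) \<odot>\<^bsub>regR\<^esub> ga_single (inv x) 1)"
          using x by (simp add: single_mult)
        also have "\<dots> = ga_single \<one> (b (inv x)) \<odot>\<^bsub>M\<^esub> F (ga_single (inv x) 1)"
          by (rule lmod_hom_smult[of F K regR M]) (use F x in auto)
        finally show "(ga_single x 1 \<odot>\<^bsub>?C\<^esub> \<theta> (ga_single (inv x) 1 \<odot>\<^bsub>?C\<^esub> F)) b =
            F (ga_single (inv x) (b (inv x)))"
          using x b by (simp add: \<theta>_def mult_single_right)
      qed (use F cl in auto)
      also have "\<dots> = F (\<Oplus>\<^bsub>regR\<^esub>x\<in>carrier G. ga_single (inv x) (b (inv x)))"
        by (rule lmod_hom_finsum[of regR M F K, symmetric])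
          (use F finite_G left_module_abelian_group[OF regR] left_module_abelian_group[OF M] in auto)
      also have "(\<Oplus>\<^bsub>regR\<^esub>x\<in>carrier G. ga_single (inv x) (b (inv x))) = b"
        using sum_singles[OF b] by (simp add: finsum_regR)
      finally show ?thesis .
    qed
  qed
  then show ?thesis unfolding trace_map_def by (intro bexI[OF _ \<theta>]) (metis (no_types))
qed

lemma trace_map_id_reg: "trace_map regR regR (\<lambda>a. a)"
proof -
  interpret L: left_module R regR by (rule regR)
  define \<theta> where "\<theta> a = ga_single \<one> (a \<one>)" for a :: "'g \<Rightarrow> 'k"
  have \<theta>: "\<theta> \<in> lmod_hom K regR regR"
    by (rule lmod_homI) (auto simp: \<theta>_def add_R single_add mult_single_left single_mult)
  have "tr regR regR \<theta> a = a" if a: "a \<in> carrier R" for a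
  proof
    fix y
    have "tr regR regR \<theta> a = (\<Oplus>\<^bsub>R\<^esub>x\<in>carrier G. ga_single x (a x))"
      unfolding tr_def finsum_regR
      by (rule R.finsum_cong') (auto simp: \<theta>_def mult_single_left single_mult)
    then show "tr regR regR \<theta> a y = a y"
      using finite_G carrier_R_D[OF a] by (simp add: finsum_R, simp add: ga_single_def)
  qed
  then show ?thesis unfolding trace_map_def regular_module_sel by (intro bexI[OF _ \<theta>]) (metis (no_types))
qed

lemma coind_unit:
  assumes M: "left_module R M"
  obtains \<eta> where "\<eta> \<in> lmod_hom R M (coind M)" "inj_on \<eta> (carrier M)"
proof -
  interpret M: left_module R M by fact
  define \<eta> where "\<eta> m b = (if b \<in> carrier R then b \<odot>\<^bsub>M\<^esub> m else \<zero>\<^bsub>M\<^esub>)" for m b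
  have "\<eta> m \<in> carrier (coind M)" if "m \<in> carrier M" for m
  proof -
    have "\<eta> m \<in> lmod_hom K regR M"
      using that by (intro lmod_homI)
        (auto simp: \<eta>_def M.smult_closed M.smult_l_distr M.smult_assoc)
    then show ?thesis by (simp add: \<eta>_def)
  qed
  then have "\<eta> \<in> lmod_hom R M (coind M)"
    by (intro lmod_homI) (auto simp: \<eta>_def fun_eq_iff M.smult_r_distr M.smult_assoc)
  moreover have "inj_on \<eta> (carrier M)"
  proof (rule inj_onI)
    fix x y assume "x \<in> carrier M" "y \<in> carrier M" "\<eta> x = \<eta> y"
    have "\<eta> x \<one>\<^bsub>R\<^esub> = \<eta> y \<one>\<^bsub>R\<^esub>" using \<open>\<eta> x = \<eta> y\<close> by simp
    then show "x = y" using \<open>x \<in> carrier M\<close> \<open>y \<in> carrier M\<close> by (simp add: \<eta>_def M.smult_one)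
  qed
  ultimately show ?thesis using that by blast
qed

text \<open>The trace of the evaluation at the identity. It takes the map that is \<open>m\<close> at the identity of the
  group and zero at the other group elements to \<open>m\<close>.\<close>

lemma coind_counit:
  assumes M: "left_module R M"
  obtains T where "T \<in> lmod_hom R (coind M) M" "T ` carrier (coind M) = carrier M"
proof -
  interpret M: left_module R M by fact
  let ?C = "coind M"
  have C: "left_module R ?C" by (rule coind_left_module[OF M])
  let ?T = "tr ?C M (\<lambda>F. F \<one>\<^bsub>R\<^esub>)"
  have T: "?T \<in> lmod_hom R ?C M" by (rule tr_hom[OF C M coind_eval[OF M R.one_closed]])
  have "m \<in> ?T ` carrier ?C" if m: "m \<in> carrier M" for m
  proof -
    let ?F = "\<lambda>b. if b \<in> carrier R then ga_single \<one> (b \<one>) \<odot>\<^bsub>M\<^esub> m else \<zero>\<^bsub>M\<^esub>"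
    have "?T ?F = (\<Oplus>\<^bsub>M\<^esub>x\<in>carrier G. if \<one> = x then m else \<zero>\<^bsub>M\<^esub>)"
      unfolding tr_def
    proof (rule M.M.finsum_cong')
      fix x assume x: "x \<in> carrier G"
      have "inv x = \<one> \<longleftrightarrow> x = \<one>" using x by (metis inv_inv inv_one)
      then have "ga_single (inv x) (1::'k) \<one> = (if \<one> = x then 1 else 0)"
        by (auto simp: ga_single_def)
      then show "ga_single x 1 \<odot>\<^bsub>M\<^esub> (ga_single (inv x) 1 \<odot>\<^bsub>?C\<^esub> ?F) \<one>\<^bsub>R\<^esub> =
          (if \<one> = x then m else \<zero>\<^bsub>M\<^esub>)"
        using x m by (auto simp: single_zero M.smult_zero_left M.smult_zero_right M.smult_one
            one_R[symmetric] single_mult)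
    qed (use m in auto)
    also have "\<dots> = m" using m finite_G by (intro M.M.finsum_singleton) auto
    finally show ?thesis using coind_scalar_fun[OF M m] by (intro image_eqI[of m ?T ?F]) (rule sym)
  qed
  then have "?T ` carrier ?C = carrier M" using lmod_hom_closed[OF T] by auto
  with T that show ?thesis by blast
qed

lemma trace_map_id_iso:
  assumes "left_module R M" "left_module R N" "\<phi> \<in> lmod_iso R M N" "trace_map M M (\<lambda>x. x)"
  shows "trace_map N N (\<lambda>x. x)"
proof -
  let ?\<psi> = "inv_into (carrier M) \<phi>"
  have \<psi>: "?\<psi> \<in> lmod_hom R N M" using inv_into_lmod_iso[OF assms(3,1)] by (rule lmod_isoD)
  have "trace_map M N \<phi>"
    using trace_map_comp_left[OF assms(1,1,2,4) lmod_isoD(1)[OF assms(3)]] by simp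
  from trace_map_comp_right[OF assms(2,1,2) this \<psi>]
  show ?thesis
    by (rule trace_map_cong) (use lmod_isoD(4)[OF assms(3)] f_inv_into_f in metis)
qed

end

subsection \<open>Functions from a finite set to an infinite type\<close>

lemma inj_pair:
  assumes inf: "infinite (UNIV :: 'u set)"
  obtains p :: "'u \<times> 'u \<Rightarrow> 'u" where "inj p"
proof -
  have "\<exists>p :: 'u \<times> 'u \<Rightarrow> 'u. bij_betw p (UNIV \<times> UNIV) UNIV"
    by (rule iffD2[OF card_of_ordIso card_of_Times_same_infinite[OF inf]])
  then obtain p :: "'u \<times> 'u \<Rightarrow> 'u" where p: "bij_betw p (UNIV \<times> UNIV) UNIV" ..
  have "inj p" using bij_betw_imp_inj_on[OF p] by simp
  then show ?thesis by (rule that)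
qed

lemma inj_on_finite_functions:
  assumes inf: "infinite (UNIV :: 'u set)" and "finite A"
  shows "\<exists>e :: ('a \<Rightarrow> 'u) \<Rightarrow> 'u. inj_on e (A \<rightarrow>\<^sub>E UNIV)"
  using assms(2)
proof (induction A)
  case empty
  then show ?case by (simp add: inj_on_def)
next
  case (insert a A)
  then obtain e :: "('a \<Rightarrow> 'u) \<Rightarrow> 'u" where e: "inj_on e (A \<rightarrow>\<^sub>E UNIV)" by blast
  obtain p :: "'u \<times> 'u \<Rightarrow> 'u" where p: "inj p" using inj_pair[OF inf] .
  have pi: "x = y" if "p x = p y" for x y using p that by (rule injD)
  have "inj_on (\<lambda>f. p (f a, e (restrict f A))) (insert a A \<rightarrow>\<^sub>E UNIV)"
  proof (rule inj_onI)
    fix f f' :: "'a \<Rightarrow> 'u"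
    assume f: "f \<in> insert a A \<rightarrow>\<^sub>E UNIV" "f' \<in> insert a A \<rightarrow>\<^sub>E UNIV"
      and "p (f a, e (restrict f A)) = p (f' a, e (restrict f' A))"
    then have "f a = f' a" "e (restrict f A) = e (restrict f' A)" by (auto dest: pi)
    then have "f a = f' a" "restrict f A = restrict f' A"
      using e by (auto simp: inj_on_def)
    then show "f = f'" using f by (intro PiE_ext[OF f]) (metis insert_iff restrict_apply')
  qed
  then show ?case by blast
qed

text \<open>The type argument \<open>U\<close> fixes the type on which the objects of the stable category live.\<close>

locale finite_group_universe = finite_group_algebra G R for G :: "('g, 'x) monoid_scheme" (structure)
  and R :: "('g \<Rightarrow> 'k::field) ring" +
  fixes U :: "'u itself"
  assumes infinite_U: "infinite (UNIV :: 'u set)"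
begin

text \<open>A linear map on \<open>kG\<close> is determined by its values on the finitely many group elements, and the
  functions from a finite set to an infinite type embed into that type.\<close>

lemma coind_copy:
  fixes M :: "('g \<Rightarrow> 'k, 'u) module"
  assumes M: "left_module R M"
  obtains C :: "('g \<Rightarrow> 'k, 'u) module" and \<phi>
  where "left_module R C" "\<phi> \<in> lmod_iso R (coind M) C" "trace_map C C (\<lambda>x. x)"
proof -
  obtain e :: "('g \<Rightarrow> 'u) \<Rightarrow> 'u" where e: "inj_on e (carrier G \<rightarrow>\<^sub>E UNIV)"
    using inj_on_finite_functions[OF infinite_U finite_G] ..
  let ?v = "\<lambda>F. restrict (\<lambda>x. F (ga_single x 1)) (carrier G)"
  have "inj_on (\<lambda>F. e (?v F)) (carrier (coind M))"
  proof (rule inj_onI)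
    fix F F' assume F: "F \<in> carrier (coind M)" "F' \<in> carrier (coind M)" and "e (?v F) = e (?v F')"
    then have "?v F = ?v F'" using e by (auto simp: inj_on_def)
    then have v: "F (ga_single x 1) = F' (ga_single x 1)" if "x \<in> carrier G" for x
      using that by (metis restrict_apply')
    have h: "F \<in> lmod_hom K regR M" "F' \<in> lmod_hom K regR M" using F by auto
    show "F = F'"
    proof
      fix b
      show "F b = F' b"
      proof (cases "b \<in> carrier R")
        case True
        then show ?thesis
        proof (induction b rule: R_induct)
          case zero
          then show ?case
            using lmod_hom_zero[OF left_module_abelian_group[OF regR] left_module_abelian_group[OF M] h(1)]
              lmod_hom_zero[OF left_module_abelian_group[OF regR] left_module_abelian_group[OF M] h(2)]
            by simp
        next
          case (single x c)
          have "ga_single x c = ga_single \<one> c \<odot>\<^bsub>regR\<^esub> ga_single x 1"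
            using single by (simp add: single_mult)
          then show ?case
            using lmod_hom_smult[OF h(1), of "ga_single \<one> c" "ga_single x 1"]
              lmod_hom_smult[OF h(2), of "ga_single \<one> c" "ga_single x 1"] v single by simp
        next
          case (add a b)
          then show ?case using lmod_hom_add[OF h(1), of a b] lmod_hom_add[OF h(2), of a b] by simp
        qed
      qed (use F in simp)
    qed
  qed
  then obtain C :: "('g \<Rightarrow> 'k, 'u) module" and \<phi> where C: "left_module R C" "\<phi> \<in> lmod_iso R (coind M) C"
    using copy_exists[OF coind_left_module[OF M]] by blast
  with that trace_map_id_iso[OF coind_left_module[OF M] C trace_map_id_coind[OF M]]
  show ?thesis by blast
qed

text \<open>The identity of the coinduced module is a trace, so by \<open>trace_map_extend\<close> and \<open>trace_map_lift\<close> the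
  coinduced module is both injective and projective.\<close>

lemma enough_injectives:
  fixes M :: "('g \<Rightarrow> 'k, 'u) module"
  assumes M: "left_module R M"
  obtains C :: "('g \<Rightarrow> 'k, 'u) module" and i
  where "left_module R C" "trace_map C C (\<lambda>x. x)" "i \<in> lmod_hom R M C" "inj_on i (carrier M)"
proof -
  obtain C :: "('g \<Rightarrow> 'k, 'u) module" and \<phi>
    where C: "left_module R C" "\<phi> \<in> lmod_iso R (coind M) C" "trace_map C C (\<lambda>x. x)"
    using coind_copy[OF M] by blast
  obtain \<eta> where \<eta>: "\<eta> \<in> lmod_hom R M (coind M)" "inj_on \<eta> (carrier M)" using coind_unit[OF M] by blast
  have "inj_on (\<lambda>x. \<phi> (\<eta> x)) (carrier M)"
    using \<eta> lmod_isoD(3)[OF C(2)] lmod_hom_closed[OF \<eta>(1)] by (auto simp: inj_on_def)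
  with that C lmod_hom_comp[OF \<eta>(1) lmod_isoD(1)[OF C(2)]] show ?thesis by blast
qed

lemma enough_projectives:
  fixes M :: "('g \<Rightarrow> 'k, 'u) module"
  assumes M: "left_module R M"
  obtains C :: "('g \<Rightarrow> 'k, 'u) module" and q
  where "left_module R C" "trace_map C C (\<lambda>x. x)" "q \<in> lmod_hom R C M" "q ` carrier C = carrier M"
proof -
  obtain C :: "('g \<Rightarrow> 'k, 'u) module" and \<phi>
    where C: "left_module R C" "\<phi> \<in> lmod_iso R (coind M) C" "trace_map C C (\<lambda>x. x)"
    using coind_copy[OF M] by blast
  obtain T where T: "T \<in> lmod_hom R (coind M) M" "T ` carrier (coind M) = carrier M"
    using coind_counit[OF M] by blast
  have \<psi>: "inv_into (carrier (coind M)) \<phi> \<in> lmod_iso R C (coind M)"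
    by (rule inv_into_lmod_iso[OF C(2) coind_left_module[OF M]])
  have "(\<lambda>x. T (inv_into (carrier (coind M)) \<phi> x)) ` carrier C = carrier M"
    using lmod_isoD(4)[OF \<psi>] T(2) by (metis image_image)
  with that C lmod_hom_comp[OF lmod_isoD(1)[OF \<psi>] T(1)] show ?thesis by blast
qed

text \<open>A projective module is a retract of the module of \<open>enough_projectives\<close>; conversely, if the identity
  is a trace, so is every map out of \<open>P\<close>, and traces lift along surjections.\<close>

lemma projective_iff:
  fixes P :: "('g \<Rightarrow> 'k, 'u) module"
  shows "projective R P \<longleftrightarrow> left_module R P \<and> trace_map P P (\<lambda>x. x)"
proof
  assume p: "projective R P"
  then have P: "left_module R P" by (simp add: projective_def)
  obtain C :: "('g \<Rightarrow> 'k, 'u) module" and q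
    where C: "left_module R C" "trace_map C C (\<lambda>x. x)" "q \<in> lmod_hom R C P" "q ` carrier C = carrier P"
    using enough_projectives[OF P] by blast
  obtain h where h: "h \<in> lmod_hom R P C" "\<And>x. x \<in> carrier P \<Longrightarrow> q (h x) = x"
    using p C P lmod_hom_id[of R P] unfolding projective_def by metis
  have "trace_map P P (\<lambda>x. q (h x))"
    using trace_map_comp_right[OF P C(1) P trace_map_comp_left[OF C(1,1) P C(2,3)] h(1)] .
  then show "left_module R P \<and> trace_map P P (\<lambda>x. x)"
    using P h(2) by (auto elim: trace_map_cong)
next
  assume P: "left_module R P \<and> trace_map P P (\<lambda>x. x)"
  show "projective R P"
    unfolding projective_def
  proof (intro conjI allI impI)
    fix A B :: "('g \<Rightarrow> 'k, 'u) module" and q f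
    assume h: "left_module R A \<and> left_module R B
        \<and> q \<in> lmod_hom R A B \<and> q ` carrier A = carrier B \<and> f \<in> lmod_hom R P B"
    then have "trace_map P B f" using trace_map_comp_left[of P P B "\<lambda>x. x" f] P by auto
    then show "\<exists>h\<in>lmod_hom R P A. \<forall>x\<in>carrier P. q (h x) = f x"
      using trace_map_lift[of A B P q f] h P by metis
  qed (use P in simp)
qed

text \<open>Higman's criterion. A trace extends along an embedding of \<open>M\<close> into the injective module of
  \<open>enough_injectives\<close>, which is projective.\<close>

lemma stably_zero_iff:
  fixes M N :: "('g \<Rightarrow> 'k, 'u) module"
  assumes M: "left_module R M" and N: "left_module R N"
  shows "stably_zero R M N f \<longleftrightarrow> trace_map M N f"
proof
  assume "stably_zero R M N f"
  then obtain P :: "('g \<Rightarrow> 'k, 'u) module" and a b where P: "left_module R P" "trace_map P P (\<lambda>x. x)"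
    and a: "a \<in> lmod_hom R M P" and b: "b \<in> lmod_hom R P N" and f: "\<forall>m\<in>carrier M. f m = b (a m)"
    unfolding stably_zero_def projective_iff by blast
  have "trace_map M N (\<lambda>m. b (a m))"
    using trace_map_comp_right[OF M P(1) N trace_map_comp_left[OF P(1,1) N P(2) b] a] .
  then show "trace_map M N f" by (rule trace_map_cong) (use f in simp)
next
  assume f: "trace_map M N f"
  obtain C :: "('g \<Rightarrow> 'k, 'u) module" and i
    where C: "left_module R C" "trace_map C C (\<lambda>x. x)" "i \<in> lmod_hom R M C" "inj_on i (carrier M)"
    using enough_injectives[OF M] by blast
  obtain F where "F \<in> lmod_hom R C N" "\<And>x. x \<in> carrier M \<Longrightarrow> F (i x) = f x"
    using trace_map_extend[OF M C(1) N C(3,4) f] by blast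
  then show "stably_zero R M N f"
    unfolding stably_zero_def projective_iff using C by (metis (no_types, lifting))
qed

end

section \<open>Ghosts and the generating classes\<close>

lemma short_exactD:
  assumes "short_exact R A i B q C"
  shows "left_module R A" "left_module R B" "left_module R C" "i \<in> lmod_hom R A B"
    "q \<in> lmod_hom R B C" "inj_on i (carrier A)" "q ` carrier B = carrier C"
    "i ` carrier A = {b \<in> carrier B. q b = \<zero>\<^bsub>C\<^esub>}"
  using assms by (simp_all add: short_exact_def)

lemma direct_sum_decomp_rep:
  assumes "direct_sum_decomp R B \<D>" "x \<in> carrier B"
  shows "\<exists>F s. finite F \<and> F \<subseteq> \<D> \<and> (\<forall>A\<in>F. s A \<in> A) \<and> x = (\<Oplus>\<^bsub>B\<^esub>A\<in>F. s A)"
  using assms by (simp add: direct_sum_decomp_def)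

context finite_group_universe
begin

lemma stably_equal_iff:
  fixes M N :: "('g \<Rightarrow> 'k, 'u) module"
  assumes "left_module R M" "left_module R N"
  shows "stably_equal R M N f h \<longleftrightarrow> trace_map M N (\<lambda>m. f m \<ominus>\<^bsub>N\<^esub> h m)"
  unfolding stably_equal_def by (rule stably_zero_iff[OF assms])

text \<open>The cone is a pushout of an embedding of \<open>A\<close> into a projective module \<open>I\<close>. If the restriction of a
  map on \<open>B\<close> to \<open>A\<close> is stably zero, it extends to \<open>I\<close>, and the two maps together define a map on the
  cone.\<close>

lemma triangle_weak_cokernel:
  fixes A B D S L :: "('g \<Rightarrow> 'k, 'u) module"
  assumes t: "triangle R A f B g D h S" and L: "left_module R L"
    and e: "e \<in> lmod_hom R B L" and z: "trace_map A L (\<lambda>x. e (f x))"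
  obtains e' where "e' \<in> lmod_hom R D L" "trace_map B L (\<lambda>y. e' (g y) \<ominus>\<^bsub>L\<^esub> e y)"
proof -
  obtain I C :: "('g \<Rightarrow> 'k, 'u) module" and a b j q u w where
    f: "f \<in> lmod_hom R A B" and g: "g \<in> lmod_hom R B D" and "projective R I"
    and s1: "short_exact R A a I b S" and s2: "short_exact R B j C q S"
    and u: "u \<in> lmod_hom R I C" "\<And>x. x \<in> carrier A \<Longrightarrow> u (a x) = j (f x)"
      "\<And>y. y \<in> carrier I \<Longrightarrow> q (u y) = b y"
    and w: "stable_iso R C D w" "stably_equal R B D (w \<circ> j) g"
    using t unfolding triangle_def by blast
  note s1 = short_exactD[OF s1] and s2 = short_exactD[OF s2]
  interpret A: left_module R A by (rule s1)
  interpret B: left_module R B by (rule s2)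
  interpret I: left_module R I by (rule s1)
  interpret C: left_module R C by (rule s2)
  interpret S: left_module R S by (rule s1)
  interpret L: left_module R L by (rule L)
  obtain c where c: "c \<in> lmod_hom R I L" "\<And>x. x \<in> carrier A \<Longrightarrow> c (a x) = e (f x)"
    using trace_map_extend[OF s1(1,2) L s1(4,6) z] by blast
  let ?D = "dsum B I"
  define p where "p = (\<lambda>x. j (fst x) \<oplus>\<^bsub>C\<^esub> u (snd x))"
  define d where "d = (\<lambda>x. e (fst x) \<oplus>\<^bsub>L\<^esub> c (snd x))"
  have DD: "left_module R ?D" by (rule dsum_left_module[OF s2(1) s1(2)])
  have p: "p \<in> lmod_hom R ?D C"
    using lmod_hom_closed[OF s2(4)] lmod_hom_closed[OF u(1)]
    by (intro lmod_homI) (auto simp: p_def lmod_hom_add[OF s2(4)] lmod_hom_add[OF u(1)]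
      lmod_hom_smult[OF s2(4)] lmod_hom_smult[OF u(1)] C.M.a_ac C.smult_r_distr C.smult_closed)
  have d: "d \<in> lmod_hom R ?D L"
    using lmod_hom_closed[OF e] lmod_hom_closed[OF c(1)]
    by (intro lmod_homI) (auto simp: d_def lmod_hom_add[OF e] lmod_hom_add[OF c(1)]
      lmod_hom_smult[OF e] lmod_hom_smult[OF c(1)] L.M.a_ac L.smult_r_distr L.smult_closed)
  have sur: "p ` carrier ?D = carrier C"
  proof
    show "p ` carrier ?D \<subseteq> carrier C" using lmod_hom_closed[OF p] by blast
    show "carrier C \<subseteq> p ` carrier ?D"
    proof
      fix v assume v: "v \<in> carrier C"
      then have "q v \<in> b ` carrier I" using lmod_hom_closed[OF s2(5)] s1(7) by simp
      then obtain x where x: "x \<in> carrier I" "q v = b x" by auto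
      have ux: "u x \<in> carrier C" using lmod_hom_closed[OF u(1) x(1)] .
      have "q (v \<ominus>\<^bsub>C\<^esub> u x) = \<zero>\<^bsub>S\<^esub>"
        using lmod_hom_diff[OF C.M.abelian_group_axioms S.M.abelian_group_axioms s2(5) v ux] x u(3)
          lmod_hom_closed[OF s1(5)] by (simp add: S.M.minus_self)
      then have "v \<ominus>\<^bsub>C\<^esub> u x \<in> j ` carrier B" using s2(8) v ux by simp
      then obtain y where y: "y \<in> carrier B" "v \<ominus>\<^bsub>C\<^esub> u x = j y" by auto
      then have "v = p (y, x)" using C.M.diff_add_cancel[OF v ux] by (simp add: p_def)
      then show "v \<in> p ` carrier ?D" using x y by auto
    qed
  qed
  have ker: "d x = \<zero>\<^bsub>L\<^esub>" if h: "x \<in> carrier ?D" "p x = \<zero>\<^bsub>C\<^esub>" for x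
  proof -
    obtain y v where x: "x = (y, v)" "y \<in> carrier B" "v \<in> carrier I" using h(1) by auto
    have jy: "j y \<in> carrier C" "u v \<in> carrier C"
      using lmod_hom_closed[OF s2(4)] lmod_hom_closed[OF u(1)] x by auto
    have "j y \<in> j ` carrier B" using x by simp
    then have "q (j y) = \<zero>\<^bsub>S\<^esub>" unfolding s2(8) by simp
    moreover have "q (p x) = \<zero>\<^bsub>S\<^esub>"
      using h lmod_hom_zero[OF C.M.abelian_group_axioms S.M.abelian_group_axioms s2(5)] by simp
    ultimately have "b v = \<zero>\<^bsub>S\<^esub>"
      using x u(3) jy lmod_hom_closed[OF s1(5)] by (simp add: p_def lmod_hom_add[OF s2(5)])
    then have "v \<in> a ` carrier A" unfolding s1(8) using x by simp
    then obtain z where z: "z \<in> carrier A" "v = a z" by auto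
    have fz: "f z \<in> carrier B" using lmod_hom_closed[OF f] z by simp
    have "j (y \<oplus>\<^bsub>B\<^esub> f z) = \<zero>\<^bsub>C\<^esub>"
      using h x z u(2) fz by (simp add: p_def lmod_hom_add[OF s2(4)])
    then have "y \<oplus>\<^bsub>B\<^esub> f z = \<zero>\<^bsub>B\<^esub>"
      using lmod_hom_zero[OF B.M.abelian_group_axioms C.M.abelian_group_axioms s2(4)] s2(6) x fz
      by (metis B.M.a_closed B.M.zero_closed inj_onD)
    then have "e (y \<oplus>\<^bsub>B\<^esub> f z) = \<zero>\<^bsub>L\<^esub>"
      using lmod_hom_zero[OF B.M.abelian_group_axioms L.M.abelian_group_axioms e] by simp
    then show ?thesis using x z c(2) fz by (simp add: d_def lmod_hom_add[OF e])
  qed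
  obtain E where E: "E \<in> lmod_hom R C L" "\<And>x. x \<in> carrier ?D \<Longrightarrow> E (p x) = d x"
    using factor_through_surjection[OF DD s2(2) L p sur d ker] by blast
  have Ej: "E (j y) = e y" if "y \<in> carrier B" for y
    using E(2)[of "(y, \<zero>\<^bsub>I\<^esub>)"] that lmod_hom_closed[OF s2(4)] lmod_hom_closed[OF e]
      lmod_hom_zero[OF I.M.abelian_group_axioms C.M.abelian_group_axioms u(1)]
      lmod_hom_zero[OF I.M.abelian_group_axioms L.M.abelian_group_axioms c(1)]
    by (simp add: p_def d_def)
  have D: "left_module R D" and wh: "w \<in> lmod_hom R C D" using w(1) by (auto simp: stable_iso_def)
  interpret D: left_module R D by (rule D)
  obtain w' where w': "w' \<in> lmod_hom R D C" "stably_equal R C C (w' \<circ> w) id"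
    using w(1) by (auto simp: stable_iso_def)
  have t1: "trace_map C C (\<lambda>x. w' (w x) \<ominus>\<^bsub>C\<^esub> x)"
    using w'(2) unfolding stably_equal_iff[OF s2(2,2)] by simp
  have t2: "trace_map B D (\<lambda>x. w (j x) \<ominus>\<^bsub>D\<^esub> g x)"
    using w(2) unfolding stably_equal_iff[OF s2(1) D] by simp
  have Ew: "(\<lambda>x. E (w' x)) \<in> lmod_hom R D L" by (rule lmod_hom_comp[OF w'(1) E(1)])
  have "trace_map B L (\<lambda>x. E (w' (w (j x)) \<ominus>\<^bsub>C\<^esub> j x))"
    by (rule trace_map_comp_left[OF s2(1,2) L trace_map_comp_right[OF s2(1,2,2) t1 s2(4)] E(1)])
  moreover have "trace_map B L (\<lambda>x. E (w' (w (j x) \<ominus>\<^bsub>D\<^esub> g x)))"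
    by (rule trace_map_comp_left[OF s2(1) D L t2 Ew])
  ultimately have "trace_map B L (\<lambda>x. E (w' (w (j x)) \<ominus>\<^bsub>C\<^esub> j x) \<ominus>\<^bsub>L\<^esub> E (w' (w (j x) \<ominus>\<^bsub>D\<^esub> g x)))"
    by (rule trace_map_diff[OF s2(1) L])
  then have "trace_map B L (\<lambda>y. E (w' (g y)) \<ominus>\<^bsub>L\<^esub> e y)"
  proof (rule trace_map_cong)
    fix y assume y: "y \<in> carrier B"
    have cl: "j y \<in> carrier C" "w (j y) \<in> carrier D" "g y \<in> carrier D" "w' (w (j y)) \<in> carrier C"
      "w' (g y) \<in> carrier C"
      using y lmod_hom_closed[OF s2(4)] lmod_hom_closed[OF wh] lmod_hom_closed[OF g]
        lmod_hom_closed[OF w'(1)] by auto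
    have cl': "E (w' (w (j y))) \<in> carrier L" "E (w' (g y)) \<in> carrier L" "e y \<in> carrier L"
      using cl lmod_hom_closed[OF E(1)] lmod_hom_closed[OF e] y by auto
    have 1: "E (w' (w (j y)) \<ominus>\<^bsub>C\<^esub> j y) = E (w' (w (j y))) \<ominus>\<^bsub>L\<^esub> e y"
      using cl Ej[OF y]
        lmod_hom_diff[OF C.M.abelian_group_axioms L.M.abelian_group_axioms E(1), of "w' (w (j y))" "j y"]
      by simp
    have 2: "E (w' (w (j y) \<ominus>\<^bsub>D\<^esub> g y)) = E (w' (w (j y))) \<ominus>\<^bsub>L\<^esub> E (w' (g y))"
      using lmod_hom_diff[OF D.M.abelian_group_axioms L.M.abelian_group_axioms Ew cl(2,3)] by simp
    show "E (w' (w (j y)) \<ominus>\<^bsub>C\<^esub> j y) \<ominus>\<^bsub>L\<^esub> E (w' (w (j y) \<ominus>\<^bsub>D\<^esub> g y)) = E (w' (g y)) \<ominus>\<^bsub>L\<^esub> e y"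
      unfolding 1 2 using cl'
      by (simp add: a_minus_def L.M.minus_add L.M.a_ac L.M.r_neg L.M.r_neg1 L.M.r_neg2)
  qed
  with Ew that show ?thesis by blast
qed

lemma omega_trivial_left_module:
  assumes "omega_trivial G i (A :: ('g \<Rightarrow> 'k, 'u) module)"
  shows "left_module R A"
  using assms unfolding R_def
  by cases (auto simp: syzygy_def short_exact_def)

lemma thick_trivial_left_module:
  assumes "thick_trivial G (A :: ('g \<Rightarrow> 'k, 'u) module)"
  shows "left_module R A"
  using assms
proof cases
  case thick_unit
  then show ?thesis by (rule omega_trivial_left_module)
qed (auto simp: R_def syzygy_def short_exact_def triangle_def stable_iso_def stable_retract_def)

lemma gen_class_left_module:
  assumes "gen_class G n (A :: ('g \<Rightarrow> 'k, 'u) module)"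
  shows "left_module R A"
  using assms
  by (cases "(G, n, A)" rule: gen_class.cases)
    (auto simp: R_def stable_zero_object_def stable_retract_def)

lemma ghost_iff:
  fixes M N :: "('g \<Rightarrow> 'k, 'u) module"
  shows "ghost G M N f \<longleftrightarrow> left_module R M \<and> left_module R N \<and> f \<in> lmod_hom R M N
    \<and> (\<forall>i (A :: ('g \<Rightarrow> 'k, 'u) module). omega_trivial G i A \<longrightarrow>
         (\<forall>h\<in>lmod_hom R A M. trace_map A N (\<lambda>x. f (h x))))"
  unfolding ghost_def R_def[symmetric] comp_def
  by (intro conj_cong refl iff_allI imp_cong ball_cong,
      rule stably_zero_iff[OF omega_trivial_left_module], assumption+)

lemma ghostD:
  fixes A M N :: "('g \<Rightarrow> 'k, 'u) module"
  assumes "ghost G M N f" "omega_trivial G i A" "h \<in> lmod_hom R A M"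
  shows "trace_map A N (\<lambda>x. f (h x))"
  using assms unfolding ghost_iff by simp

lemma ghost_comp_right:
  fixes L M N :: "('g \<Rightarrow> 'k, 'u) module"
  assumes "ghost G M N f" "left_module R L" "a \<in> lmod_hom R L M"
  shows "ghost G L N (\<lambda>x. f (a x))"
  unfolding ghost_iff
proof (intro conjI allI impI ballI)
  note f = assms(1)[unfolded ghost_iff]
  show "left_module R L" "left_module R N" "(\<lambda>x. f (a x)) \<in> lmod_hom R L N"
    using f assms(2) lmod_hom_comp[OF assms(3)] by auto
  fix i h and A :: "('g \<Rightarrow> 'k, 'u) module"
  assume A: "omega_trivial G i A" and h: "h \<in> lmod_hom R A L"
  have "(\<lambda>x. a (h x)) \<in> lmod_hom R A M" by (rule lmod_hom_comp[OF h assms(3)])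
  then show "trace_map A N (\<lambda>x. f (a (h x)))" by (rule ghostD[OF assms(1) A])
qed

text \<open>Two representations of an element as a sum of elements of the summands differ by zero terms only,
  so the sum of the values does not depend on the representation.\<close>

lemma assemble_linear:
  assumes B: "left_module R B" and L: "left_module R L" and ds: "direct_sum_decomp R B \<D>"
    and \<psi>: "\<And>E. E \<in> \<D> \<Longrightarrow> \<psi> E \<in> lmod_hom K (B\<lparr>carrier := E\<rparr>) L"
  obtains \<phi> where "\<phi> \<in> lmod_hom K B L" "\<And>E x. E \<in> \<D> \<Longrightarrow> x \<in> E \<Longrightarrow> \<phi> x = \<psi> E x"
proof -
  interpret B: left_module R B by (rule B)
  interpret L: left_module R L by (rule L)
  note [simp] = B.M.finsum_closed L.M.finsum_closed
  define rep where "rep F s x \<longleftrightarrow> finite F \<and> F \<subseteq> \<D> \<and> (\<forall>A\<in>F. s A \<in> A) \<and> x = (\<Oplus>\<^bsub>B\<^esub>A\<in>F. s A)" for F s x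
  define val where "val F s = (\<Oplus>\<^bsub>L\<^esub>A\<in>F. \<psi> A (s A))" for F s
  have sub: "submodule E R B" if "E \<in> \<D>" for E using ds that by (simp add: direct_sum_decomp_def)
  note subD = submoduleD[OF sub]
  have ex: "\<exists>F s. rep F s x" if "x \<in> carrier B" for x
    unfolding rep_def using direct_sum_decomp_rep[OF ds that] by simp
  have indep: "s A = \<zero>\<^bsub>B\<^esub>" if "rep F s \<zero>\<^bsub>B\<^esub>" "A \<in> F" for F s A
    using ds that unfolding direct_sum_decomp_def rep_def by metis
  have rB: "s \<in> F \<rightarrow> carrier B" if "rep F s x" for F s x
    using that subD(1) by (auto simp: rep_def)
  have vL: "(\<lambda>A. \<psi> A (s A)) \<in> F \<rightarrow> carrier L" if "rep F s x" for F s x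
    using that lmod_hom_closed[OF \<psi>] by (auto simp: rep_def Pi_iff subset_iff)
  have \<psi>0: "\<psi> E \<zero>\<^bsub>B\<^esub> = \<zero>\<^bsub>L\<^esub>" if "E \<in> \<D>" for E
    using lmod_hom_zero[OF left_module_abelian_group[OF submodule_left_module[OF B sub[OF that]]]
        L.M.abelian_group_axioms \<psi>[OF that]] by simp
  have ext: "rep H (\<lambda>A. if A \<in> F then s A else \<zero>\<^bsub>B\<^esub>) x"
    "val H (\<lambda>A. if A \<in> F then s A else \<zero>\<^bsub>B\<^esub>) = val F s"
    if r: "rep F s x" and H: "finite H" "F \<subseteq> H" "H \<subseteq> \<D>" for F H s x
  proof -
    let ?s = "\<lambda>A. if A \<in> F then s A else \<zero>\<^bsub>B\<^esub>"
    have "(\<Oplus>\<^bsub>B\<^esub>A\<in>F. s A) = (\<Oplus>\<^bsub>B\<^esub>A\<in>H. ?s A)"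
      by (rule B.M.add.finprod_mono_neutral_cong_left) (use H rB[OF r] in auto)
    then show "rep H ?s x" using r H subD(2) by (auto simp: rep_def)
    have "val F s = val H ?s"
      unfolding val_def
      by (rule L.M.add.finprod_mono_neutral_cong_left) (use H vL[OF r] \<psi>0 in \<open>auto simp: subset_iff\<close>)
    then show "val H ?s = val F s" by simp
  qed
  have add: "rep H (\<lambda>A. s A \<oplus>\<^bsub>B\<^esub> s' A) (x \<oplus>\<^bsub>B\<^esub> y)"
    "val H (\<lambda>A. s A \<oplus>\<^bsub>B\<^esub> s' A) = val H s \<oplus>\<^bsub>L\<^esub> val H s'"
    if r: "rep H s x" and r': "rep H s' y" for H s s' x y
  proof -
    have "(\<Oplus>\<^bsub>B\<^esub>A\<in>H. s A \<oplus>\<^bsub>B\<^esub> s' A) = x \<oplus>\<^bsub>B\<^esub> y"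
      using r r' B.M.finsum_addf[OF rB[OF r] rB[OF r']] by (simp add: rep_def)
    then show "rep H (\<lambda>A. s A \<oplus>\<^bsub>B\<^esub> s' A) (x \<oplus>\<^bsub>B\<^esub> y)"
      using r r' subD(3) by (auto simp: rep_def)
    have "val H (\<lambda>A. s A \<oplus>\<^bsub>B\<^esub> s' A) = (\<Oplus>\<^bsub>L\<^esub>A\<in>H. \<psi> A (s A) \<oplus>\<^bsub>L\<^esub> \<psi> A (s' A))"
      unfolding val_def
      by (rule L.M.finsum_cong')
        (use r r' vL[OF r] vL[OF r'] lmod_hom_add[OF \<psi>] in \<open>auto simp: rep_def Pi_iff subset_iff\<close>)
    also have "\<dots> = val H s \<oplus>\<^bsub>L\<^esub> val H s'"
      unfolding val_def by (rule L.M.finsum_addf[OF vL[OF r] vL[OF r']])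
    finally show "val H (\<lambda>A. s A \<oplus>\<^bsub>B\<^esub> s' A) = val H s \<oplus>\<^bsub>L\<^esub> val H s'" .
  qed
  have smult: "rep H (\<lambda>A. c \<odot>\<^bsub>B\<^esub> s A) (c \<odot>\<^bsub>B\<^esub> x)" "val H (\<lambda>A. c \<odot>\<^bsub>B\<^esub> s A) = c \<odot>\<^bsub>L\<^esub> val H s"
    if r: "rep H s x" and c: "c \<in> carrier K" for H s x c
  proof -
    have cR: "c \<in> carrier R" using c by (rule K_R)
    have "(\<Oplus>\<^bsub>B\<^esub>A\<in>H. c \<odot>\<^bsub>B\<^esub> s A) = c \<odot>\<^bsub>B\<^esub> x"
      using r B.finsum_smult[OF _ cR rB[OF r]] by (simp add: rep_def)
    then show "rep H (\<lambda>A. c \<odot>\<^bsub>B\<^esub> s A) (c \<odot>\<^bsub>B\<^esub> x)"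
      using r subD(4)[OF _ cR] by (auto simp: rep_def)
    have "val H (\<lambda>A. c \<odot>\<^bsub>B\<^esub> s A) = (\<Oplus>\<^bsub>L\<^esub>A\<in>H. c \<odot>\<^bsub>L\<^esub> \<psi> A (s A))"
      unfolding val_def
      by (rule L.M.finsum_cong')
        (use r cR vL[OF r] lmod_hom_smult[OF \<psi> c] in \<open>auto simp: rep_def Pi_iff subset_iff L.smult_closed\<close>)
    also have "\<dots> = c \<odot>\<^bsub>L\<^esub> val H s"
      unfolding val_def using r by (intro L.finsum_smult[symmetric] cR vL[OF r]) (simp add: rep_def)
    finally show "val H (\<lambda>A. c \<odot>\<^bsub>B\<^esub> s A) = c \<odot>\<^bsub>L\<^esub> val H s" .
  qed
  have eq: "val F s = val F' s'" if r: "rep F s x" "rep F' s' x" for F s F' s' x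
  proof -
    let ?H = "F \<union> F'"
    have H: "finite ?H" "F \<subseteq> ?H" "F' \<subseteq> ?H" "?H \<subseteq> \<D>" using r by (auto simp: rep_def)
    let ?s = "\<lambda>A. if A \<in> F then s A else \<zero>\<^bsub>B\<^esub>" and ?s' = "\<lambda>A. if A \<in> F' then s' A else \<zero>\<^bsub>B\<^esub>"
    note e1 = ext[OF r(1) H(1,2,4)] and e2 = ext[OF r(2) H(1,3,4)]
    define m where "m = ga_single \<one> (- 1 :: 'k)"
    have m: "m \<in> carrier K" "m \<in> carrier R" by (auto simp: m_def)
    have neg: "m \<odot>\<^bsub>B\<^esub> y = \<ominus>\<^bsub>B\<^esub> y" if "y \<in> carrier B" for y
    proof -
      have "m = \<ominus>\<^bsub>R\<^esub> \<one>\<^bsub>R\<^esub>"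
        unfolding m_def one_R minus_R[OF single_R[OF one_closed]] by (auto simp: ga_single_def)
      then show ?thesis using that by (simp add: B.smult_neg_left B.smult_one)
    qed
    have xB: "x \<in> carrier B" using r(1) rB[OF r(1)] by (simp add: rep_def)
    have "rep ?H (\<lambda>A. ?s A \<oplus>\<^bsub>B\<^esub> m \<odot>\<^bsub>B\<^esub> ?s' A) (x \<oplus>\<^bsub>B\<^esub> m \<odot>\<^bsub>B\<^esub> x)"
      by (rule add(1)[OF e1(1) smult(1)[OF e2(1) m(1)]])
    then have z: "rep ?H (\<lambda>A. ?s A \<oplus>\<^bsub>B\<^esub> m \<odot>\<^bsub>B\<^esub> ?s' A) \<zero>\<^bsub>B\<^esub>"
      using neg[OF xB] xB by (simp add: B.M.r_neg)
    have "?s A = ?s' A" if "A \<in> ?H" for A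
    proof -
      have AB: "?s A \<in> carrier B" "?s' A \<in> carrier B"
        using rB[OF e1(1)] rB[OF e2(1)] that by (auto simp only: Pi_iff)
      then have "?s A \<ominus>\<^bsub>B\<^esub> ?s' A = \<zero>\<^bsub>B\<^esub>" using indep[OF z that] neg by (simp add: a_minus_def)
      then show ?thesis using B.M.minus_eq_zero_iff AB by blast
    qed
    then have "val ?H ?s = val ?H ?s'"
      unfolding val_def by (intro L.M.finsum_cong') (use vL[OF e2(1)] in auto)
    then show ?thesis using e1(2) e2(2) by simp
  qed
  define \<phi> where "\<phi> x = (case SOME Fs. rep (fst Fs) (snd Fs) x of (F, s) \<Rightarrow> val F s)" for x
  have \<phi>: "\<phi> x = val F s" if "rep F s x" for F s x
  proof -
    have "rep (fst (SOME Fs. rep (fst Fs) (snd Fs) x)) (snd (SOME Fs. rep (fst Fs) (snd Fs) x)) x"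
      by (rule someI[where P = "\<lambda>Fs. rep (fst Fs) (snd Fs) x" and x = "(F, s)"]) (use that in simp)
    from eq[OF this that] show ?thesis by (simp add: \<phi>_def case_prod_beta)
  qed
  have "\<phi> \<in> lmod_hom K B L"
  proof (rule lmod_homI)
    fix x assume "x \<in> carrier B"
    then obtain F s where "rep F s x" using ex by blast
    then show "\<phi> x \<in> carrier L" using \<phi> vL by (simp add: val_def)
  next
    fix x y assume "x \<in> carrier B" "y \<in> carrier B"
    then obtain F s F' s' where r: "rep F s x" "rep F' s' y" using ex by metis
    let ?H = "F \<union> F'"
    have H: "finite ?H" "F \<subseteq> ?H" "F' \<subseteq> ?H" "?H \<subseteq> \<D>" using r by (auto simp: rep_def)
    note e1 = ext[OF r(1) H(1,2,4)] and e2 = ext[OF r(2) H(1,3,4)]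
    show "\<phi> (x \<oplus>\<^bsub>B\<^esub> y) = \<phi> x \<oplus>\<^bsub>L\<^esub> \<phi> y"
      using \<phi>[OF add(1)[OF e1(1) e2(1)]] add(2)[OF e1(1) e2(1)] \<phi>[OF e1(1)] \<phi>[OF e2(1)] by simp
  next
    fix c x assume c: "c \<in> carrier K" and "x \<in> carrier B"
    then obtain F s where r: "rep F s x" using ex by blast
    show "\<phi> (c \<odot>\<^bsub>B\<^esub> x) = c \<odot>\<^bsub>L\<^esub> \<phi> x"
      using \<phi>[OF smult(1)[OF r c]] smult(2)[OF r c] \<phi>[OF r] by simp
  qed
  moreover have "\<phi> x = \<psi> E x" if "E \<in> \<D>" "x \<in> E" for E x
  proof -
    have "x \<in> carrier B" using that subD(1) by auto
    then have "rep {E} (\<lambda>_. x) x" using that B.M.finsum_insert[of "{}" E "\<lambda>_. x"] by (simp add: rep_def)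
    from \<phi>[OF this] vL[OF this] show ?thesis by (simp add: val_def)
  qed
  ultimately show ?thesis using that by blast
qed

text \<open>The direct sum may be infinite. Traces on the summands are compatible, since the trace of a linear
  map restricts to a submodule as the trace of the restriction.\<close>

lemma trace_map_direct_sum:
  assumes B: "left_module R B" and L: "left_module R L" and ds: "direct_sum_decomp R B \<D>"
    and e: "e \<in> lmod_hom R B L"
    and z: "\<And>E. E \<in> \<D> \<Longrightarrow> trace_map (B\<lparr>carrier := E\<rparr>) L e"
  shows "trace_map B L e"
proof -
  interpret B: left_module R B by (rule B)
  interpret L: left_module R L by (rule L)
  have sub: "submodule E R B" if "E \<in> \<D>" for E using ds that by (simp add: direct_sum_decomp_def)
  note subD = submoduleD[OF sub]
  obtain \<psi> where \<psi>: "\<And>E. E \<in> \<D> \<Longrightarrow> \<psi> E \<in> lmod_hom K (B\<lparr>carrier := E\<rparr>) L"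
    "\<And>E x. E \<in> \<D> \<Longrightarrow> x \<in> E \<Longrightarrow> e x = tr (B\<lparr>carrier := E\<rparr>) L (\<psi> E) x"
    using z unfolding trace_map_def by simp metis
  obtain \<phi> where \<phi>: "\<phi> \<in> lmod_hom K B L" "\<And>E x. E \<in> \<D> \<Longrightarrow> x \<in> E \<Longrightarrow> \<phi> x = \<psi> E x"
    using assemble_linear[OF B L ds \<psi>(1)] by blast
  have t: "tr B L \<phi> \<in> lmod_hom R B L" by (rule tr_hom[OF B L \<phi>(1)])
  have e1: "e x = tr B L \<phi> x" if E: "E \<in> \<D>" "x \<in> E" for E x
  proof -
    have "tr (B\<lparr>carrier := E\<rparr>) L (\<psi> E) x = tr B L \<phi> x"
      unfolding tr_def
    proof (rule L.M.finsum_cong')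
      fix y assume y: "y \<in> carrier G"
      have "ga_single (inv y) 1 \<odot>\<^bsub>B\<^esub> x \<in> E" using subD(4)[OF E(1)] E(2) y by simp
      then show "ga_single y 1 \<odot>\<^bsub>L\<^esub> \<psi> E (ga_single (inv y) 1 \<odot>\<^bsub>B\<lparr>carrier := E\<rparr>\<^esub> x) =
          ga_single y 1 \<odot>\<^bsub>L\<^esub> \<phi> (ga_single (inv y) 1 \<odot>\<^bsub>B\<^esub> x)"
        using \<phi>(2)[OF E(1)] by simp
    next
      have "x \<in> carrier B" using E subD(1) by auto
      then show "(\<lambda>y. ga_single y 1 \<odot>\<^bsub>L\<^esub> \<phi> (ga_single (inv y) 1 \<odot>\<^bsub>B\<^esub> x)) \<in> carrier G \<rightarrow> carrier L"
        using tr_closed_aux[OF B L \<phi>(1)] by simp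
    qed simp
    then show ?thesis using \<psi>(2) E by simp
  qed
  have "e x = tr B L \<phi> x" if x: "x \<in> carrier B" for x
  proof -
    obtain F s where F: "finite F" "F \<subseteq> \<D>" "\<forall>A\<in>F. s A \<in> A" "x = (\<Oplus>\<^bsub>B\<^esub>A\<in>F. s A)"
      using direct_sum_decomp_rep[OF ds x] by blast
    have s: "s \<in> F \<rightarrow> carrier B" using F subD(1) by auto
    have "e x = (\<Oplus>\<^bsub>L\<^esub>A\<in>F. e (s A))"
      unfolding F(4) by (rule lmod_hom_finsum[OF B.M.abelian_group_axioms L.M.abelian_group_axioms e F(1) s])
    also have "\<dots> = (\<Oplus>\<^bsub>L\<^esub>A\<in>F. tr B L \<phi> (s A))"
      by (rule L.M.finsum_cong') (use F s e1 lmod_hom_closed[OF t] in \<open>auto simp: Pi_iff\<close>)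
    also have "\<dots> = tr B L \<phi> x"
      unfolding F(4) by (rule lmod_hom_finsum[OF B.M.abelian_group_axioms L.M.abelian_group_axioms t F(1) s, symmetric])
    finally show ?thesis .
  qed
  then show ?thesis unfolding trace_map_def using \<phi>(1) by blast
qed

text \<open>In the stable category \<open>e = e r i\<close>, and \<open>e r\<close> vanishes.\<close>

lemma trace_map_retract:
  fixes Y Z L :: "('g \<Rightarrow> 'k, 'u) module"
  assumes Z: "left_module R Z" and Y: "left_module R Y" and L: "left_module R L"
    and i: "i \<in> lmod_hom R Z Y" and r: "r \<in> lmod_hom R Y Z"
    and ri: "trace_map Z Z (\<lambda>x. r (i x) \<ominus>\<^bsub>Z\<^esub> x)" and e: "e \<in> lmod_hom R Z L"
    and t: "trace_map Y L (\<lambda>y. e (r y))"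
  shows "trace_map Z L e"
proof -
  interpret Z: left_module R Z by (rule Z)
  interpret L: left_module R L by (rule L)
  have "trace_map Z L (\<lambda>x. e (r (i x)) \<ominus>\<^bsub>L\<^esub> e (r (i x) \<ominus>\<^bsub>Z\<^esub> x))"
    by (intro trace_map_diff Z L trace_map_comp_right[OF Z Y L t i] trace_map_comp_left[OF Z Z L ri e])
  then show ?thesis
  proof (rule trace_map_cong)
    fix x assume x: "x \<in> carrier Z"
    have c: "r (i x) \<in> carrier Z" using x lmod_hom_closed[OF i] lmod_hom_closed[OF r] by simp
    show "e (r (i x)) \<ominus>\<^bsub>L\<^esub> e (r (i x) \<ominus>\<^bsub>Z\<^esub> x) = e x"
      using lmod_hom_diff[OF Z.M.abelian_group_axioms L.M.abelian_group_axioms e c x]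
        x c lmod_hom_closed[OF e]
      by (simp add: a_minus_def L.M.minus_add L.M.r_neg2)
  qed
qed

lemma ghost_from_F1:
  fixes Z L :: "('g \<Rightarrow> 'k, 'u) module"
  assumes Z: "gen_class G (Suc 0) Z" and e: "ghost G Z L e"
  shows "trace_map Z L e"
proof -
  obtain B :: "('g \<Rightarrow> 'k, 'u) module" and \<D> where ds: "direct_sum_decomp R B \<D>"
    and om: "\<And>E. E \<in> \<D> \<Longrightarrow> \<exists>i. omega_trivial G i (B\<lparr>carrier := E\<rparr>)" and ret: "stable_retract R Z B"
    using Z by (auto simp: R_def)
  obtain i r where i: "i \<in> lmod_hom R Z B" and r: "r \<in> lmod_hom R B Z"
    and ri: "stably_equal R Z Z (r \<circ> i) id" and Zm: "left_module R Z" and B: "left_module R B"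
    using ret by (auto simp: stable_retract_def)
  note e' = e[unfolded ghost_iff]
  have L: "left_module R L" using e' by simp
  have er: "(\<lambda>y. e (r y)) \<in> lmod_hom R B L" using lmod_hom_comp[OF r] e' by blast
  have "trace_map B L (\<lambda>y. e (r y))"
  proof (rule trace_map_direct_sum[OF B L ds er])
    fix E assume E: "E \<in> \<D>"
    then have "E \<subseteq> carrier B" using ds submoduleD(1) by (auto simp: direct_sum_decomp_def)
    then have "r \<in> lmod_hom R (B\<lparr>carrier := E\<rparr>) Z" using lmod_hom_comp[OF incl_lmod_hom r] by auto
    then show "trace_map (B\<lparr>carrier := E\<rparr>) L (\<lambda>y. e (r y))" using om[OF E] ghostD[OF e] by blast
  qed
  then show ?thesis
    using trace_map_retract[OF Zm B L i r _ _] e' ri unfolding stably_equal_iff[OF Zm Zm] by simp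
qed

text \<open>Composites of \<open>n\<close> ghosts through arbitrary objects. The objects of the induction in the
  ghost lemma below need not lie in the thick subcategory generated by \<open>k\<close>.\<close>

primrec ghost_chain :: "nat \<Rightarrow> ('g \<Rightarrow> 'k, 'u) module \<Rightarrow> ('g \<Rightarrow> 'k, 'u) module \<Rightarrow> ('u \<Rightarrow> 'u) \<Rightarrow> bool" where
  "ghost_chain 0 M N f \<longleftrightarrow> left_module R M \<and> left_module R N \<and> f \<in> lmod_hom R M N"
| "ghost_chain (Suc n) M N f \<longleftrightarrow> (\<exists>L e f'. ghost G M L e \<and> ghost_chain n L N f' \<and> f = f' \<circ> e)"

lemma ghost_composite_chain: "ghost_composite G n M N f \<Longrightarrow> ghost_chain n M N f"
proof (induction rule: ghost_composite.induct)
  case (composite_0 M N f)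
  then show ?case using thick_trivial_left_module composite_0(3)[folded R_def] by simp
next
  case (composite_Suc M L e n N f)
  then show ?case unfolding ghost_chain.simps by blast
qed

lemma ghost_chain_hom: "ghost_chain n M N f \<Longrightarrow> left_module R M \<and> left_module R N \<and> f \<in> lmod_hom R M N"
proof (induction n arbitrary: M f)
  case (Suc n)
  then obtain L e f' where "ghost G M L e" "left_module R L \<and> left_module R N \<and> f' \<in> lmod_hom R L N"
    "f = f' \<circ> e" unfolding ghost_chain.simps by blast
  then show ?case using lmod_hom_o[of e R M L f' N] by (simp add: ghost_iff comp_def)
qed auto

lemma ghost_chain_comp_right:
  assumes "ghost_chain n M N f" "left_module R L" "a \<in> lmod_hom R L M"
  shows "ghost_chain n L N (f \<circ> a)"
proof (cases n)
  case 0
  then show ?thesis using assms lmod_hom_o by auto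
next
  case (Suc m)
  then obtain Q e f' where "ghost G M Q e" "ghost_chain m Q N f'" "f = f' \<circ> e"
    using assms(1) unfolding Suc ghost_chain.simps by blast
  moreover then have "ghost G L Q (e \<circ> a)" using ghost_comp_right assms(2,3) by (simp add: comp_def)
  ultimately show ?thesis using Suc by (auto simp: comp_assoc)
qed

text \<open>The ghost lemma. A ghost out of the middle term of a triangle \<open>P \<rightarrow> Y \<rightarrow> Q\<close> vanishes on
  \<open>P\<close>, hence factors through \<open>Q\<close>, which absorbs one of the ghosts.\<close>

lemma ghost_lemma:
  assumes "gen_class G n Z" "ghost_chain n Z N f"
  shows "trace_map Z N f"
  using assms
proof (induction n arbitrary: Z f)
  case 0
  then have "trace_map Z Z (\<lambda>x. x)" and "left_module R Z"
    using stably_zero_iff by (auto simp: stable_zero_object_def R_def[symmetric] id_def)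
  with trace_map_comp_left[of Z Z N "\<lambda>x. x" f] 0 show ?case by simp
next
  case (Suc n)
  obtain L e f' where e: "ghost G Z L e" and f': "ghost_chain n L N f'" and f: "f = f' \<circ> e"
    using Suc.prems(2) unfolding ghost_chain.simps by blast
  have L: "left_module R L" and N: "left_module R N" and f'h: "f' \<in> lmod_hom R L N"
    using ghost_chain_hom[OF f'] by auto
  have Z: "left_module R Z" by (rule gen_class_left_module[OF Suc.prems(1)])
  show ?case
  proof (cases n)
    case 0
    then have "trace_map Z L e" using ghost_from_F1 Suc.prems(1) e by simp
    then show ?thesis using trace_map_comp_left[OF Z L N _ f'h] f by (simp add: comp_def)
  next
    case (Suc m)
    then obtain P a Y b Q c S where tri: "triangle R P a Y b Q c S" and P: "gen_class G (Suc 0) P"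
      and Q: "gen_class G n Q" and ret: "stable_retract R Z Y"
      using Suc.prems(1) unfolding R_def by (simp del: gen_class.simps(2)) blast
    obtain i r where i: "i \<in> lmod_hom R Z Y" and r: "r \<in> lmod_hom R Y Z"
      and ri: "stably_equal R Z Z (r \<circ> i) id" and Y: "left_module R Y"
      using ret by (auto simp: stable_retract_def)
    have a: "a \<in> lmod_hom R P Y" and b: "b \<in> lmod_hom R Y Q" using tri by (auto simp: triangle_def)
    have er: "ghost G Y L (\<lambda>y. e (r y))" by (rule ghost_comp_right[OF e Y r])
    have "trace_map P L (\<lambda>x. e (r (a x)))"
      by (rule ghost_from_F1[OF P ghost_comp_right[OF er gen_class_left_module[OF P] a]])
    then obtain e' where e': "e' \<in> lmod_hom R Q L" "trace_map Y L (\<lambda>y. e' (b y) \<ominus>\<^bsub>L\<^esub> e (r y))"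
      using triangle_weak_cokernel[OF tri L, of "\<lambda>y. e (r y)"] er by (auto simp: ghost_iff)
    have Qm: "left_module R Q" by (rule gen_class_left_module[OF Q])
    interpret L: left_module R L by (rule L)
    interpret N: left_module R N by (rule N)
    have "trace_map Q N (f' \<circ> e')" by (rule Suc.IH[OF Q ghost_chain_comp_right[OF f' Qm e'(1)]])
    then have "trace_map Y N (\<lambda>y. f' (e' (b y)))"
      using trace_map_comp_right[OF Y Qm N _ b] by (simp add: comp_def)
    then have "trace_map Y N (\<lambda>y. f' (e' (b y)) \<ominus>\<^bsub>N\<^esub> f' (e' (b y) \<ominus>\<^bsub>L\<^esub> e (r y)))"
      by (intro trace_map_diff Y N trace_map_comp_left[OF Y L N e'(2) f'h])
    then have "trace_map Y N (\<lambda>y. f (r y))"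
    proof (rule trace_map_cong)
      fix y assume y: "y \<in> carrier Y"
      have cl: "e' (b y) \<in> carrier L" "e (r y) \<in> carrier L"
        using y lmod_hom_closed[OF b] lmod_hom_closed[OF e'(1)] er lmod_hom_closed[of _ R Y L]
        by (auto simp: ghost_iff)
      show "f' (e' (b y)) \<ominus>\<^bsub>N\<^esub> f' (e' (b y) \<ominus>\<^bsub>L\<^esub> e (r y)) = f (r y)"
        using lmod_hom_diff[OF L.M.abelian_group_axioms N.M.abelian_group_axioms f'h cl]
          cl lmod_hom_closed[OF f'h]
        by (simp add: f a_minus_def N.M.minus_add N.M.r_neg2)
    qed
    then show ?thesis
      using trace_map_retract[OF Z Y N i r _ _, of f] ri ghost_chain_hom[OF Suc.prems(2)]
      unfolding stably_equal_iff[OF Z Z] by simp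
  qed
qed

end

lemma factor_through_injection:
  assumes A: "left_module R A" and B: "left_module R B" and M: "left_module R M"
    and j: "j \<in> lmod_hom R A B" "inj_on j (carrier A)"
    and u: "u \<in> lmod_hom R M B" and im: "\<And>x. x \<in> carrier M \<Longrightarrow> u x \<in> j ` carrier A"
  obtains f where "f \<in> lmod_hom R M A" "\<And>x. x \<in> carrier M \<Longrightarrow> j (f x) = u x"
proof -
  let ?B = "B\<lparr>carrier := j ` carrier A\<rparr>"
  have "j \<in> lmod_iso R A ?B"
    using j by (auto simp: lmod_iso_def lmod_hom_def bij_betw_def)
  then have i: "inv_into (carrier A) j \<in> lmod_hom R ?B A"
    using lmod_isoD(1)[OF inv_into_lmod_iso[OF _ A]] by simp
  have "u \<in> lmod_hom R M ?B" using u im by (auto simp: lmod_hom_def)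
  from lmod_hom_comp[OF this i] have "(\<lambda>x. inv_into (carrier A) j (u x)) \<in> lmod_hom R M A" .
  moreover have "j (inv_into (carrier A) j (u x)) = u x" if "x \<in> carrier M" for x
    using im[OF that] by (rule f_inv_into_f)
  ultimately show ?thesis using that by blast
qed

context finite_group_universe
begin

lemma stably_equal_refl:
  fixes M N :: "('g \<Rightarrow> 'k, 'u) module"
  assumes "left_module R M" "left_module R N" "\<And>m. m \<in> carrier M \<Longrightarrow> f m = h m"
    "\<And>m. m \<in> carrier M \<Longrightarrow> h m \<in> carrier N"
  shows "stably_equal R M N f h"
proof -
  interpret N: left_module R N by fact
  show ?thesis
    unfolding stably_equal_iff[OF assms(1,2)]
    by (rule trace_map_cong[OF trace_map_zero[OF assms(1,2)]]) (use assms in \<open>auto simp: N.M.minus_self\<close>)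
qed

lemma stable_retract_refl:
  fixes M :: "('g \<Rightarrow> 'k, 'u) module"
  assumes "left_module R M"
  shows "stable_retract R M M"
proof -
  have i: "id \<in> lmod_hom R M M" using lmod_hom_id[of R M] by (simp add: id_def)
  show ?thesis
    unfolding stable_retract_def
    by (intro conjI assms bexI[OF _ i] stably_equal_refl) simp_all
qed

lemma stable_iso_refl:
  fixes M :: "('g \<Rightarrow> 'k, 'u) module"
  assumes "left_module R M"
  shows "stable_iso R M M id"
proof -
  have i: "id \<in> lmod_hom R M M" using lmod_hom_id[of R M] by (simp add: id_def)
  show ?thesis
    unfolding stable_iso_def
    by (intro conjI assms i bexI[OF _ i] stably_equal_refl) simp_all
qed

text \<open>A short exact sequence \<open>0 \<rightarrow> P \<rightarrow> Y \<rightarrow> Q \<rightarrow> 0\<close> is the beginning of a triangle: embed \<open>P\<close> in an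
  injective \<open>I\<close> and extend the embedding to \<open>e : Y \<rightarrow> I\<close>; then \<open>I \<oplus> Q\<close> is the pushout of \<open>Y\<close> and
  \<open>I\<close> along \<open>P\<close>, and it is stably isomorphic to \<open>Q\<close>.\<close>

lemma triangle_of_short_exact:
  fixes P Y Q :: "('g \<Rightarrow> 'k, 'u) module"
  assumes se: "short_exact R P i Y \<pi> Q"
  obtains h and S :: "('g \<Rightarrow> 'k, 'u) module" where "triangle R P i Y \<pi> Q h S"
proof -
  note se = short_exactD[OF se]
  interpret P: left_module R P by (rule se)
  interpret Y: left_module R Y by (rule se)
  interpret Q: left_module R Q by (rule se)
  note gP = P.M.abelian_group_axioms and gY = Y.M.abelian_group_axioms and gQ = Q.M.abelian_group_axioms
  obtain I :: "('g \<Rightarrow> 'k, 'u) module" and a where I: "left_module R I" "trace_map I I (\<lambda>x. x)"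
    and a: "a \<in> lmod_hom R P I" "inj_on a (carrier P)"
    using enough_injectives[OF se(1)] by blast
  interpret I: left_module R I by (rule I)
  note gI = I.M.abelian_group_axioms
  have ta: "trace_map P I a" using trace_map_comp_right[OF se(1) I(1,1) I(2) a(1)] .
  obtain e where e: "e \<in> lmod_hom R Y I" "\<And>x. x \<in> carrier P \<Longrightarrow> e (i x) = a x"
    using trace_map_extend[OF se(1,2) I(1) se(4,6) ta] by blast
  obtain S :: "('g \<Rightarrow> 'k, 'u) module" and b where S: "left_module R S" and b: "b \<in> lmod_hom R I S"
    "b ` carrier I = carrier S" "{x \<in> carrier I. b x = \<zero>\<^bsub>S\<^esub>} = a ` carrier P"
    using quotient_exists[OF I(1) image_submodule[OF se(1) I(1) a(1)]] by blast
  interpret S: left_module R S by (rule S)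
  note gS = S.M.abelian_group_axioms
  have be: "(\<lambda>y. b (e y)) \<in> lmod_hom R Y S" by (rule lmod_hom_comp[OF e(1) b(1)])
  have bek: "b (e y) = \<zero>\<^bsub>S\<^esub>" if "y \<in> carrier Y" "\<pi> y = \<zero>\<^bsub>Q\<^esub>" for y
  proof -
    have "y \<in> i ` carrier P" unfolding se(8) using that by simp
    then obtain x where "x \<in> carrier P" "y = i x" by auto
    then have "e y \<in> a ` carrier P" using e(2) by auto
    then show ?thesis unfolding b(3)[symmetric] by simp
  qed
  obtain k where k: "k \<in> lmod_hom R Q S" "\<And>y. y \<in> carrier Y \<Longrightarrow> k (\<pi> y) = b (e y)"
    using factor_through_surjection[OF se(2,3) S se(5,7) be bek] by blast
  let ?D = "dsum I Q"
  have D: "left_module R ?D" by (rule dsum_left_module[OF I(1) se(3)])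
  obtain p :: "'u \<times> 'u \<Rightarrow> 'u" where "inj p" using inj_pair[OF infinite_U] .
  then have pD: "inj_on p (carrier ?D)" by (rule inj_on_subset) simp
  obtain C :: "('g \<Rightarrow> 'k, 'u) module" and \<phi> where C: "left_module R C" and \<phi>: "\<phi> \<in> lmod_iso R ?D C"
    using copy_exists[OF D pD] by blast
  interpret C: left_module R C by (rule C)
  note gC = C.M.abelian_group_axioms
  note \<phi>h = lmod_isoD[OF \<phi>]
  define \<psi> where "\<psi> = inv_into (carrier ?D) \<phi>"
  have \<psi>h: "\<psi> \<in> lmod_hom R C ?D"
    unfolding \<psi>_def by (rule lmod_isoD(1)[OF inv_into_lmod_iso[OF \<phi> D]])
  have \<psi>\<phi>: "\<psi> (\<phi> x) = x" if "x \<in> carrier ?D" for x using \<phi>h(3) that by (simp add: \<psi>_def)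
  have \<phi>\<psi>: "\<phi> (\<psi> c) = c" if "c \<in> carrier C" for c using \<phi>h(4) that by (simp add: \<psi>_def f_inv_into_f)
  have fstD: "fst \<in> lmod_hom R ?D I" and sndD: "snd \<in> lmod_hom R ?D Q"
    by (auto simp: lmod_hom_def)
  have w: "(\<lambda>c. snd (\<psi> c)) \<in> lmod_hom R C Q" by (rule lmod_hom_comp[OF \<psi>h sndD])
  have f: "(\<lambda>c. fst (\<psi> c)) \<in> lmod_hom R C I" by (rule lmod_hom_comp[OF \<psi>h fstD])
  have "(\<lambda>z. (z, \<zero>\<^bsub>Q\<^esub>)) \<in> lmod_hom R I ?D" by (rule lmod_homI) (auto simp: Q.smult_zero_right)
  from lmod_hom_comp[OF this \<phi>h(1)] have u: "(\<lambda>z. \<phi> (z, \<zero>\<^bsub>Q\<^esub>)) \<in> lmod_hom R I C" .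
  have "(\<lambda>v. (\<zero>\<^bsub>I\<^esub>, v)) \<in> lmod_hom R Q ?D" by (rule lmod_homI) (auto simp: I.smult_zero_right)
  from lmod_hom_comp[OF this \<phi>h(1)] have s: "(\<lambda>v. \<phi> (\<zero>\<^bsub>I\<^esub>, v)) \<in> lmod_hom R Q C" .
  have "(\<lambda>y. (e y, \<pi> y)) \<in> lmod_hom R Y ?D"
    using lmod_hom_closed[OF e(1)] lmod_hom_closed[OF se(5)]
    by (intro lmod_homI) (auto simp: lmod_hom_add[OF e(1)] lmod_hom_add[OF se(5)]
        lmod_hom_smult[OF e(1)] lmod_hom_smult[OF se(5)])
  from lmod_hom_comp[OF this \<phi>h(1)] have j: "(\<lambda>y. \<phi> (e y, \<pi> y)) \<in> lmod_hom R Y C" .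
  have q: "(\<lambda>c. b (fst (\<psi> c)) \<ominus>\<^bsub>S\<^esub> k (snd (\<psi> c))) \<in> lmod_hom R C S"
    by (rule lmod_hom_diff_fun[OF S lmod_hom_comp[OF f b(1)] lmod_hom_comp[OF w k(1)]])
  let ?q = "\<lambda>c. b (fst (\<psi> c)) \<ominus>\<^bsub>S\<^esub> k (snd (\<psi> c))"
  have k0: "k \<zero>\<^bsub>Q\<^esub> = \<zero>\<^bsub>S\<^esub>" by (rule lmod_hom_zero[OF gQ gS k(1)])
  have b0: "b \<zero>\<^bsub>I\<^esub> = \<zero>\<^bsub>S\<^esub>" by (rule lmod_hom_zero[OF gI gS b(1)])
  have m0: "x \<ominus>\<^bsub>S\<^esub> \<zero>\<^bsub>S\<^esub> = x" if "x \<in> carrier S" for x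
    using that S.M.add_diff_cancel_right[of x "\<zero>\<^bsub>S\<^esub>"] by simp
  have qu: "?q (\<phi> (z, \<zero>\<^bsub>Q\<^esub>)) = b z" if "z \<in> carrier I" for z
    using that \<psi>\<phi>[of "(z, \<zero>\<^bsub>Q\<^esub>)"] lmod_hom_closed[OF b(1)] by (simp add: k0 m0)
  have neg: "(\<lambda>x. \<ominus>\<^bsub>S\<^esub> x) \<in> lmod_hom R S S"
    by (rule lmod_homI) (auto simp: S.M.minus_add S.smult_neg_right)
  have h: "(\<lambda>v. \<ominus>\<^bsub>S\<^esub> k v) \<in> lmod_hom R Q S" by (rule lmod_hom_comp[OF k(1) neg])
  have C_elim: thesis if h: "c \<in> carrier C" "\<And>z v. z \<in> carrier I \<Longrightarrow> v \<in> carrier Q \<Longrightarrow> c = \<phi> (z, v) \<Longrightarrow>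
      \<psi> c = (z, v) \<Longrightarrow> thesis" for c thesis
    using h(1) h(2)[of "fst (\<psi> c)" "snd (\<psi> c)"] \<phi>\<psi>[OF h(1)] lmod_hom_closed[OF \<psi>h h(1)] by auto
  have se1: "short_exact R P a I b S"
    unfolding short_exact_def using se(1) I(1) S a b by simp
  have se2: "short_exact R Y (\<lambda>y. \<phi> (e y, \<pi> y)) C ?q S"
    unfolding short_exact_def
  proof (intro conjI se C S j q)
    show "inj_on (\<lambda>y. \<phi> (e y, \<pi> y)) (carrier Y)"
    proof (rule lmod_hom_inj_onI[OF gY gC j])
      fix y assume y: "y \<in> carrier Y" and "\<phi> (e y, \<pi> y) = \<zero>\<^bsub>C\<^esub>"
      moreover have "\<phi> \<zero>\<^bsub>?D\<^esub> = \<zero>\<^bsub>C\<^esub>"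
        by (rule lmod_hom_zero[OF left_module_abelian_group[OF D] gC \<phi>h(1)])
      ultimately have "(e y, \<pi> y) = \<zero>\<^bsub>?D\<^esub>"
        using \<phi>h(3) lmod_hom_closed[OF e(1)] lmod_hom_closed[OF se(5)]
        by (intro inj_onD[OF \<phi>h(3)]) auto
      then have z: "e y = \<zero>\<^bsub>I\<^esub>" "\<pi> y = \<zero>\<^bsub>Q\<^esub>" by simp_all
      then have "y \<in> i ` carrier P" unfolding se(8) using y by simp
      then obtain x where x: "x \<in> carrier P" "y = i x" by auto
      then have "a x = a \<zero>\<^bsub>P\<^esub>" using z(1) e(2) lmod_hom_zero[OF gP gI a(1)] by simp
      then have "x = \<zero>\<^bsub>P\<^esub>" using a(2) x by (auto dest: inj_onD)
      then show "y = \<zero>\<^bsub>Y\<^esub>" using x lmod_hom_zero[OF gP gY se(4)] by simp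
    qed
    show "?q ` carrier C = carrier S"
    proof
      show "?q ` carrier C \<subseteq> carrier S" using lmod_hom_closed[OF q] by blast
      show "carrier S \<subseteq> ?q ` carrier C"
      proof
        fix x assume "x \<in> carrier S"
        then obtain z where z: "z \<in> carrier I" "x = b z" using b(2) by auto
        then have "x = ?q (\<phi> (z, \<zero>\<^bsub>Q\<^esub>))" using qu by simp
        then show "x \<in> ?q ` carrier C" using lmod_hom_closed[OF u z(1)] by (rule image_eqI)
      qed
    qed
    show "(\<lambda>y. \<phi> (e y, \<pi> y)) ` carrier Y = {c \<in> carrier C. ?q c = \<zero>\<^bsub>S\<^esub>}"
    proof (intro equalityI subsetI)
      fix c assume "c \<in> (\<lambda>y. \<phi> (e y, \<pi> y)) ` carrier Y"
      then obtain y where y: "y \<in> carrier Y" "c = \<phi> (e y, \<pi> y)" by auto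
      have "\<psi> c = (e y, \<pi> y)"
        using y \<psi>\<phi>[of "(e y, \<pi> y)"] lmod_hom_closed[OF e(1)] lmod_hom_closed[OF se(5)] by simp
      then show "c \<in> {c \<in> carrier C. ?q c = \<zero>\<^bsub>S\<^esub>}"
        using y k(2) lmod_hom_closed[OF j] lmod_hom_closed[OF be] by (simp add: S.M.minus_self)
    next
      fix c assume c: "c \<in> {c \<in> carrier C. ?q c = \<zero>\<^bsub>S\<^esub>}"
      then obtain z v where zv: "z \<in> carrier I" "v \<in> carrier Q" "c = \<phi> (z, v)" "\<psi> c = (z, v)"
        using C_elim by blast
      obtain y where y: "y \<in> carrier Y" "v = \<pi> y" using zv(2) se(7) by auto
      have ey: "e y \<in> carrier I" using lmod_hom_closed[OF e(1)] y by simp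
      have "b z \<ominus>\<^bsub>S\<^esub> b (e y) = \<zero>\<^bsub>S\<^esub>" using c zv y k(2) by simp
      then have "b (z \<ominus>\<^bsub>I\<^esub> e y) = \<zero>\<^bsub>S\<^esub>" using lmod_hom_diff[OF gI gS b(1) zv(1) ey] by simp
      then have "z \<ominus>\<^bsub>I\<^esub> e y \<in> a ` carrier P" unfolding b(3)[symmetric] using zv(1) ey by simp
      then obtain x where x: "x \<in> carrier P" "z \<ominus>\<^bsub>I\<^esub> e y = a x" by auto
      have ix: "i x \<in> carrier Y" using lmod_hom_closed[OF se(4) x(1)] .
      have "i x \<in> i ` carrier P" using x by simp
      then have \<pi>ix: "\<pi> (i x) = \<zero>\<^bsub>Q\<^esub>" unfolding se(8) by simp
      have "e (i x \<oplus>\<^bsub>Y\<^esub> y) = z"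
        using x e(2) ix y I.M.diff_add_cancel[OF zv(1) ey] by (simp add: lmod_hom_add[OF e(1)])
      moreover have "\<pi> (i x \<oplus>\<^bsub>Y\<^esub> y) = v"
        using \<pi>ix ix y zv(2) by (simp add: lmod_hom_add[OF se(5)])
      ultimately have "c = \<phi> (e (i x \<oplus>\<^bsub>Y\<^esub> y), \<pi> (i x \<oplus>\<^bsub>Y\<^esub> y))" using zv(3) by simp
      then show "c \<in> (\<lambda>y. \<phi> (e y, \<pi> y)) ` carrier Y" using ix y by (intro image_eqI[of _ _ "i x \<oplus>\<^bsub>Y\<^esub> y"]) simp_all
    qed
  qed
  have tI: "trace_map C I (\<lambda>c. fst (\<psi> c))" using trace_map_comp_right[OF C I(1,1) I(2) f] .
  have \<phi>neg: "\<phi> (\<zero>\<^bsub>I\<^esub>, v) \<ominus>\<^bsub>C\<^esub> \<phi> (z, v) = \<zero>\<^bsub>C\<^esub> \<ominus>\<^bsub>C\<^esub> \<phi> (z, \<zero>\<^bsub>Q\<^esub>)"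
    if "z \<in> carrier I" "v \<in> carrier Q" for z v
  proof -
    have cl: "\<phi> (\<zero>\<^bsub>I\<^esub>, v) \<in> carrier C" "\<phi> (z, \<zero>\<^bsub>Q\<^esub>) \<in> carrier C"
      using that lmod_hom_closed[OF s] lmod_hom_closed[OF u] by auto
    have "\<phi> (z, v) = \<phi> (\<zero>\<^bsub>I\<^esub>, v) \<oplus>\<^bsub>C\<^esub> \<phi> (z, \<zero>\<^bsub>Q\<^esub>)"
      using lmod_hom_add[OF \<phi>h(1), of "(\<zero>\<^bsub>I\<^esub>, v)" "(z, \<zero>\<^bsub>Q\<^esub>)"] that by simp
    then show ?thesis using cl by (simp add: a_minus_def C.M.minus_add C.M.r_neg2)
  qed
  have wiso: "stable_iso R C Q (\<lambda>c. snd (\<psi> c))"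
    unfolding stable_iso_def
  proof (intro conjI bexI[OF _ s] C se w)
    have "trace_map C C (\<lambda>c. \<zero>\<^bsub>C\<^esub> \<ominus>\<^bsub>C\<^esub> \<phi> (fst (\<psi> c), \<zero>\<^bsub>Q\<^esub>))"
      by (intro trace_map_diff trace_map_zero C trace_map_comp_left[OF C I(1) C tI u])
    then have "trace_map C C (\<lambda>c. \<phi> (\<zero>\<^bsub>I\<^esub>, snd (\<psi> c)) \<ominus>\<^bsub>C\<^esub> c)"
    proof (rule trace_map_cong)
      fix c assume "c \<in> carrier C"
      then obtain z v where zv: "z \<in> carrier I" "v \<in> carrier Q" "c = \<phi> (z, v)" "\<psi> c = (z, v)"
        using C_elim by blast
      show "\<zero>\<^bsub>C\<^esub> \<ominus>\<^bsub>C\<^esub> \<phi> (fst (\<psi> c), \<zero>\<^bsub>Q\<^esub>) = \<phi> (\<zero>\<^bsub>I\<^esub>, snd (\<psi> c)) \<ominus>\<^bsub>C\<^esub> c"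
        unfolding zv(4) fst_conv snd_conv unfolding zv(3) by (rule \<phi>neg[OF zv(1,2), symmetric])
    qed
    then show "stably_equal R C C ((\<lambda>v. \<phi> (\<zero>\<^bsub>I\<^esub>, v)) \<circ> (\<lambda>c. snd (\<psi> c))) id"
      unfolding stably_equal_iff[OF C C] by simp
    show "stably_equal R Q Q ((\<lambda>c. snd (\<psi> c)) \<circ> (\<lambda>v. \<phi> (\<zero>\<^bsub>I\<^esub>, v))) id"
      by (rule stably_equal_refl[OF se(3,3)]) (use \<psi>\<phi>[of "(\<zero>\<^bsub>I\<^esub>, _)"] in auto)
  qed
  have g_eq: "stably_equal R Y Q ((\<lambda>c. snd (\<psi> c)) \<circ> (\<lambda>y. \<phi> (e y, \<pi> y))) \<pi>"
    by (rule stably_equal_refl[OF se(2,3)])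
      (use \<psi>\<phi>[of "(e _, \<pi> _)"] lmod_hom_closed[OF e(1)] lmod_hom_closed[OF se(5)] in auto)
  have "trace_map C S (\<lambda>c. \<zero>\<^bsub>S\<^esub> \<ominus>\<^bsub>S\<^esub> b (fst (\<psi> c)))"
    by (intro trace_map_diff trace_map_zero C S trace_map_comp_left[OF C I(1) S tI b(1)])
  then have "trace_map C S (\<lambda>c. \<ominus>\<^bsub>S\<^esub> k (snd (\<psi> c)) \<ominus>\<^bsub>S\<^esub> ?q c)"
  proof (rule trace_map_cong)
    fix c assume c: "c \<in> carrier C"
    have "k (snd (\<psi> c)) \<in> carrier S" "b (fst (\<psi> c)) \<in> carrier S"
      using lmod_hom_closed[OF lmod_hom_comp[OF w k(1)] c] lmod_hom_closed[OF lmod_hom_comp[OF f b(1)] c]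
      by auto
    then show "\<zero>\<^bsub>S\<^esub> \<ominus>\<^bsub>S\<^esub> b (fst (\<psi> c)) = \<ominus>\<^bsub>S\<^esub> k (snd (\<psi> c)) \<ominus>\<^bsub>S\<^esub> ?q c"
      using S.M.a_lcomm[of "\<ominus>\<^bsub>S\<^esub> k (snd (\<psi> c))" "\<ominus>\<^bsub>S\<^esub> b (fst (\<psi> c))" "k (snd (\<psi> c))"]
      by (simp add: a_minus_def S.M.minus_add S.M.l_neg)
  qed
  then have h_eq: "stably_equal R C S ((\<lambda>v. \<ominus>\<^bsub>S\<^esub> k v) \<circ> (\<lambda>c. snd (\<psi> c))) ?q"
    unfolding stably_equal_iff[OF C S] by simp
  have ua: "\<phi> (a x, \<zero>\<^bsub>Q\<^esub>) = \<phi> (e (i x), \<pi> (i x))" if "x \<in> carrier P" for x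
  proof -
    have "i x \<in> i ` carrier P" using that by simp
    then have "\<pi> (i x) = \<zero>\<^bsub>Q\<^esub>" unfolding se(8) by simp
    then show ?thesis using e(2) that by simp
  qed
  have "triangle R P i Y \<pi> Q (\<lambda>v. \<ominus>\<^bsub>S\<^esub> k v) S"
    unfolding triangle_def projective_iff
    by (intro conjI se(4,5) h, rule exI[of _ I], rule exI[of _ C], rule exI[of _ a],
      rule exI[of _ b], rule exI[of _ "\<lambda>y. \<phi> (e y, \<pi> y)"], rule exI[of _ ?q],
      rule exI[of _ "\<lambda>z. \<phi> (z, \<zero>\<^bsub>Q\<^esub>)"], rule exI[of _ "\<lambda>c. snd (\<psi> c)"],
      intro conjI I se1 se2 u wiso g_eq h_eq) (use ua qu in auto)
  then show ?thesis by (rule that)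
qed

text \<open>Let \<open>\<Omega>D \<rightarrow> I \<rightarrow> D\<close> be exact with \<open>I\<close> projective. A lift \<open>I \<rightarrow> B\<close> restricts to a map \<open>\<Omega>D \<rightarrow> A\<close>, and \<open>B\<close>
  is the pushout, that is, the cone of this map.\<close>

lemma thick_trivial_extension:
  fixes A B D :: "('g \<Rightarrow> 'k, 'u) module"
  assumes se: "short_exact R A j B q D" and A: "thick_trivial G A" and D: "thick_trivial G D"
  shows "thick_trivial G B"
proof -
  note se' = short_exactD[OF se]
  obtain I :: "('g \<Rightarrow> 'k, 'u) module" and b where I: "left_module R I" "trace_map I I (\<lambda>x. x)"
    and b: "b \<in> lmod_hom R I D" "b ` carrier I = carrier D"
    using enough_projectives[OF se'(3)] by blast
  interpret I: left_module R I by (rule I)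
  define E where "E = {x \<in> carrier I. b x = \<zero>\<^bsub>D\<^esub>}"
  have E: "submodule E R I" unfolding E_def by (rule kernel_submodule[OF I(1) se'(3) b(1)])
  let ?K = "I\<lparr>carrier := E\<rparr>"
  have K: "left_module R ?K" by (rule submodule_left_module[OF I(1) E])
  have in_E: "(\<lambda>x. x) \<in> lmod_hom R ?K I" by (rule incl_lmod_hom[OF submoduleD(1)[OF E]])
  have seK: "short_exact R ?K (\<lambda>x. x) I b D"
    unfolding short_exact_def using K I(1) se'(3) in_E b by (simp add: E_def)
  have tb: "trace_map I D b" using trace_map_comp_left[OF I(1,1) se'(3) I(2) b(1)] .
  obtain u where u: "u \<in> lmod_hom R I B" "\<And>x. x \<in> carrier I \<Longrightarrow> q (u x) = b x"
    using trace_map_lift[OF se'(2,3) I(1) se'(5,7) tb] by blast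
  have uK: "u \<in> lmod_hom R ?K B" using lmod_hom_comp[OF in_E u(1)] by simp
  have uj: "u x \<in> j ` carrier A" if "x \<in> carrier ?K" for x
    unfolding se'(8) using that u lmod_hom_closed[OF u(1)] by (simp add: E_def)
  obtain f where f: "f \<in> lmod_hom R ?K A" "\<And>x. x \<in> carrier ?K \<Longrightarrow> j (f x) = u x"
    using factor_through_injection[OF se'(1,2) K se'(4,6) uK uj] by blast
  have "triangle R ?K f A j B q D"
    unfolding triangle_def projective_iff
  proof (intro conjI f(1) se'(4,5), rule exI[of _ I], rule exI[of _ B], rule exI[of _ "\<lambda>x. x"],
      rule exI[of _ b], rule exI[of _ j], rule exI[of _ q], rule exI[of _ u], rule exI[of _ id],
      intro conjI I seK se u(1) stable_iso_refl[OF se'(2)])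
    show "stably_equal R A B (id \<circ> j) j" "stably_equal R B D (q \<circ> id) q"
      using lmod_hom_closed[OF se'(4)] lmod_hom_closed[OF se'(5)]
      by (auto intro!: stably_equal_refl se')
  qed (use f(2) u(2) in auto)
  moreover have "thick_trivial G ?K"
    using thick_Omega[OF D, of ?K] seK I unfolding syzygy_def R_def[symmetric] projective_iff by blast
  ultimately show ?thesis using thick_cone[OF _ _ A] unfolding R_def[symmetric] by blast
qed

end

context finite_group_algebra
begin

lemma ideal_power_Suc: "ideal_power R I (Suc n) = ideal_prod R I (ideal_power R I n)"
  by (simp add: ideal_power_def)

lemma ideal_power_J_R: "ideal_power R J n \<subseteq> carrier R"
proof (induction n)
  case (Suc n)
  have "a \<in> carrier R" if "a \<in> ideal_prod R J (ideal_power R J n)" for a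
    using that by induction (use Suc J_R in auto)
  then show ?case by (auto simp: ideal_power_Suc)
qed (simp add: ideal_power_def)

text \<open>Invariance under the group, stated for all elements of the group algebra.\<close>

definition fixed :: "('g \<Rightarrow> 'k, 'a) module \<Rightarrow> 'a \<Rightarrow> bool" where
  "fixed M v \<longleftrightarrow> v \<in> carrier M \<and> (\<forall>a\<in>carrier R. a \<odot>\<^bsub>M\<^esub> v = ga_single \<one> (aug a) \<odot>\<^bsub>M\<^esub> v)"

lemma fixed_carrier: "fixed M v \<Longrightarrow> v \<in> carrier M"
  unfolding fixed_def by blast

lemma fixed_smult:
  "fixed M v \<Longrightarrow> a \<in> carrier R \<Longrightarrow> a \<odot>\<^bsub>M\<^esub> v = ga_single \<one> (aug a) \<odot>\<^bsub>M\<^esub> v"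
  unfolding fixed_def by blast

definition line :: "('g \<Rightarrow> 'k, 'a) module \<Rightarrow> 'a \<Rightarrow> 'a set" where
  "line M v = range (\<lambda>c. ga_single \<one> c \<odot>\<^bsub>M\<^esub> v)"

lemma fixed_iff_J:
  assumes M: "left_module R M"
  shows "fixed M v \<longleftrightarrow> v \<in> carrier M \<and> (\<forall>a\<in>J. a \<odot>\<^bsub>M\<^esub> v = \<zero>\<^bsub>M\<^esub>)"
proof -
  interpret M: left_module R M by (rule M)
  have "a \<odot>\<^bsub>M\<^esub> v = ga_single \<one> (aug a) \<odot>\<^bsub>M\<^esub> v"
    if v: "v \<in> carrier M" "\<forall>a\<in>J. a \<odot>\<^bsub>M\<^esub> v = \<zero>\<^bsub>M\<^esub>" and a: "a \<in> carrier R" for a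
  proof -
    have "a \<ominus>\<^bsub>R\<^esub> ga_single \<one> (aug a) \<in> J" using a by (simp add: J_def aug_diff aug_single)
    then have "(a \<odot>\<^bsub>M\<^esub> v) \<ominus>\<^bsub>M\<^esub> (ga_single \<one> (aug a) \<odot>\<^bsub>M\<^esub> v) = \<zero>\<^bsub>M\<^esub>"
      using v a M.smult_diff_left[of a "ga_single \<one> (aug a)" v] by simp
    then show ?thesis using v a M.M.minus_eq_zero_iff by (simp add: M.smult_closed)
  qed
  moreover have "a \<odot>\<^bsub>M\<^esub> v = \<zero>\<^bsub>M\<^esub>" if "fixed M v" "a \<in> J" for a
    using fixed_smult[OF that(1) J_R[OF that(2)]] that
    by (auto simp: J_def single_zero M.smult_zero_left dest: fixed_carrier)
  ultimately show ?thesis unfolding fixed_def by blast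
qed

lemma line_submodule:
  assumes M: "left_module R M" and v: "fixed M v"
  shows "submodule (line M v) R M"
proof -
  interpret M: left_module R M by (rule M)
  have vM: "v \<in> carrier M" using v unfolding fixed_def by blast
  show ?thesis
  proof (rule submoduleI[OF M])
    show "line M v \<subseteq> carrier M" using vM by (auto simp: line_def M.smult_closed)
    show "\<zero>\<^bsub>M\<^esub> \<in> line M v" unfolding line_def
      using vM by (intro image_eqI[of _ _ 0]) (auto simp: single_zero M.smult_zero_left)
  next
    fix x y assume "x \<in> line M v" "y \<in> line M v"
    then show "x \<oplus>\<^bsub>M\<^esub> y \<in> line M v"
      using vM by (auto simp: line_def M.smult_l_distr[symmetric] single_add)
  next
    fix a x assume a: "a \<in> carrier R" and "x \<in> line M v"
    then obtain c where c: "x = ga_single \<one> c \<odot>\<^bsub>M\<^esub> v" by (auto simp: line_def)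
    have "a \<odot>\<^bsub>M\<^esub> x = (a \<otimes>\<^bsub>R\<^esub> ga_single \<one> c) \<odot>\<^bsub>M\<^esub> v" using a c vM by (simp add: M.smult_assoc)
    also have "\<dots> = ga_single \<one> (aug (a \<otimes>\<^bsub>R\<^esub> ga_single \<one> c)) \<odot>\<^bsub>M\<^esub> v"
      by (rule fixed_smult[OF v]) (use a in simp)
    finally show "a \<odot>\<^bsub>M\<^esub> x \<in> line M v" unfolding line_def by (rule range_eqI)
  qed
qed

end

context finite_group_universe
begin

lemma line_omega_trivial:
  fixes M :: "('g \<Rightarrow> 'k, 'u) module"
  assumes M: "left_module R M" and v: "fixed M v" and nz: "v \<noteq> \<zero>\<^bsub>M\<^esub>"
  shows "omega_trivial G 0 (M\<lparr>carrier := line M v\<rparr>)"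
proof -
  interpret M: left_module R M by (rule M)
  have vM: "v \<in> carrier M" using v unfolding fixed_def by blast
  let ?L = "M\<lparr>carrier := line M v\<rparr>"
  have L: "left_module R ?L" by (rule submodule_left_module[OF M line_submodule[OF M v]])
  interpret L: left_module R ?L by (rule L)
  let ?f = "\<lambda>c. ga_single \<one> c \<odot>\<^bsub>M\<^esub> v"
  have "inj ?f"
  proof (rule injI)
    fix c d assume e: "?f c = ?f d"
    show "c = d"
    proof (rule ccontr)
      assume ne: "c \<noteq> d"
      have "ga_single \<one> (c - d) \<odot>\<^bsub>M\<^esub> v \<oplus>\<^bsub>M\<^esub> ?f d = ?f c"
        using vM by (simp add: M.smult_l_distr[symmetric] single_add)
      then have z: "ga_single \<one> (c - d) \<odot>\<^bsub>M\<^esub> v = \<zero>\<^bsub>M\<^esub>"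
        using e vM M.M.add_diff_cancel_right[of "ga_single \<one> (c - d) \<odot>\<^bsub>M\<^esub> v" "?f d"] M.M.minus_self[of "?f d"]
        by (simp add: M.smult_closed)
      have "v = ga_single \<one> (inverse (c - d)) \<odot>\<^bsub>M\<^esub> (ga_single \<one> (c - d) \<odot>\<^bsub>M\<^esub> v)"
        using ne vM by (simp add: M.smult_assoc[symmetric] single_mult one_R[symmetric] M.smult_one)
      then show False using z nz by (simp add: M.smult_zero_right)
    qed
  qed
  moreover have "?f ` UNIV = line M v" by (simp add: line_def)
  ultimately have b: "bij_betw ?f UNIV (line M v)" by (simp add: bij_betw_def)
  let ?g = "inv_into UNIV ?f"
  have gf: "?g (?f c) = c" for c by (rule inv_f_f[OF \<open>inj ?f\<close>])
  have "?g \<in> lmod_hom R ?L (trivial_module G)"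
  proof (rule lmod_homI)
    fix x y assume "x \<in> carrier ?L" "y \<in> carrier ?L"
    then obtain c d where "x = ?f c" "y = ?f d" by (auto simp: line_def)
    then show "?g (x \<oplus>\<^bsub>?L\<^esub> y) = ?g x \<oplus>\<^bsub>trivial_module G\<^esub> ?g y"
      using vM gf[of "c + d"] by (simp add: M.smult_l_distr[symmetric] single_add gf trivial_module_def)
  next
    fix a x assume a: "a \<in> carrier R" and "x \<in> carrier ?L"
    then obtain c where c: "x = ?f c" by (auto simp: line_def)
    have "a \<odot>\<^bsub>M\<^esub> x = (a \<otimes>\<^bsub>R\<^esub> ga_single \<one> c) \<odot>\<^bsub>M\<^esub> v" using a c vM by (simp add: M.smult_assoc)
    also have "\<dots> = ?f (aug (a \<otimes>\<^bsub>R\<^esub> ga_single \<one> c))"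
      by (rule fixed_smult[OF v]) (use a in simp)
    also have "\<dots> = ?f (aug a * c)" by (simp add: aug_mult aug_single)
    finally show "?g (a \<odot>\<^bsub>?L\<^esub> x) = a \<odot>\<^bsub>trivial_module G\<^esub> ?g x"
      using c gf by (simp add: trivial_module_def aug_def)
  qed (simp add: trivial_module_def)
  moreover have "bij_betw ?g (carrier ?L) (carrier (trivial_module G))"
    using bij_betw_inv_into[OF b] by (simp add: trivial_module_def)
  ultimately have "?g \<in> lmod_iso R ?L (trivial_module G)" by (simp add: lmod_iso_def)
  then show ?thesis using L unfolding R_def by (intro omega_zero) auto
qed

text \<open>A maximal independent set of lines, which exists by Zorn's lemma, spans the module.\<close>

lemma trivial_action_decomp:
  fixes M :: "('g \<Rightarrow> 'k, 'u) module"
  assumes M: "left_module R M" and fx: "\<And>v. v \<in> carrier M \<Longrightarrow> fixed M v"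
  obtains \<D> where "direct_sum_decomp R M \<D>" "\<And>E. E \<in> \<D> \<Longrightarrow> omega_trivial G 0 (M\<lparr>carrier := E\<rparr>)"
proof -
  interpret M: left_module R M by (rule M)
  define lines where "lines = {line M v | v. v \<in> carrier M \<and> v \<noteq> \<zero>\<^bsub>M\<^esub>}"
  define ind where "ind \<D> \<longleftrightarrow> (\<forall>F s. finite F \<and> F \<subseteq> \<D> \<and> (\<forall>A\<in>F. s A \<in> A) \<and> (\<Oplus>\<^bsub>M\<^esub>A\<in>F. s A) = \<zero>\<^bsub>M\<^esub>
     \<longrightarrow> (\<forall>A\<in>F. s A = \<zero>\<^bsub>M\<^esub>))" for \<D>
  have sub: "submodule E R M" if "E \<in> lines" for E
    using that line_submodule[OF M fx] by (auto simp: lines_def)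
  note subD = submoduleD[OF sub]
  have "\<exists>\<D>\<in>{\<D>. \<D> \<subseteq> lines \<and> ind \<D>}. \<forall>\<E>\<in>{\<D>. \<D> \<subseteq> lines \<and> ind \<D>}. \<D> \<subseteq> \<E> \<longrightarrow> \<E> = \<D>"
  proof (rule subset_Zorn)
    fix Ch assume ch: "subset.chain {\<D>. \<D> \<subseteq> lines \<and> ind \<D>} Ch"
    show "\<exists>U\<in>{\<D>. \<D> \<subseteq> lines \<and> ind \<D>}. \<forall>\<E>\<in>Ch. \<E> \<subseteq> U"
    proof (cases "Ch = {}")
      case True
      have "ind {}" by (auto simp: ind_def)
      then show ?thesis using True by auto
    next
      case False
      have Chl: "\<D> \<subseteq> lines" "ind \<D>" if "\<D> \<in> Ch" for \<D> using ch that by (auto simp: subset.chain_def)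
      have "ind (\<Union>Ch)"
        unfolding ind_def
      proof (intro allI impI)
        fix F s assume h: "finite F \<and> F \<subseteq> \<Union>Ch \<and> (\<forall>A\<in>F. s A \<in> A) \<and> (\<Oplus>\<^bsub>M\<^esub>A\<in>F. s A) = \<zero>\<^bsub>M\<^esub>"
        then obtain \<D> where "\<D> \<in> Ch" "F \<subseteq> \<D>"
          using finite_subset_Union_chain[OF _ _ False ch, of F] by blast
        then show "\<forall>A\<in>F. s A = \<zero>\<^bsub>M\<^esub>" using Chl(2) h unfolding ind_def by blast
      qed
      then show ?thesis using Chl(1) by (intro bexI[of _ "\<Union>Ch"]) auto
    qed
  qed
  then obtain \<D> where \<D>': "\<D> \<in> {\<D>. \<D> \<subseteq> lines \<and> ind \<D>}"
    and max': "\<forall>\<E>\<in>{\<D>. \<D> \<subseteq> lines \<and> ind \<D>}. \<D> \<subseteq> \<E> \<longrightarrow> \<E> = \<D>" by (rule bexE)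
  have \<D>: "\<D> \<subseteq> lines" "ind \<D>" using \<D>' by simp_all
  have max: "\<E> = \<D>" if "\<E> \<subseteq> lines" "ind \<E>" "\<D> \<subseteq> \<E>" for \<E>
    using max' that by simp
  have span: "\<exists>F s. finite F \<and> F \<subseteq> \<D> \<and> (\<forall>A\<in>F. s A \<in> A) \<and> x = (\<Oplus>\<^bsub>M\<^esub>A\<in>F. s A)"
    if x: "x \<in> carrier M" for x
  proof (rule ccontr)
    assume neg: "\<not> ?thesis"
    have nz: "x \<noteq> \<zero>\<^bsub>M\<^esub>"
    proof
      assume "x = \<zero>\<^bsub>M\<^esub>"
      then have "finite {} \<and> {} \<subseteq> \<D> \<and> (\<forall>A\<in>{}. undefined A \<in> A) \<and> x = (\<Oplus>\<^bsub>M\<^esub>A\<in>{}. undefined A)" by simp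
      then have "\<exists>F s. finite F \<and> F \<subseteq> \<D> \<and> (\<forall>A\<in>F. s A \<in> A) \<and> x = (\<Oplus>\<^bsub>M\<^esub>A\<in>F. s A)"
        by (intro exI[of _ "{}"] exI[of _ undefined])
      then show False using neg by simp
    qed
    define l where "l = line M x"
    have l: "l \<in> lines" using x nz by (auto simp: l_def lines_def)
    have "ind (insert l \<D>)"
      unfolding ind_def
    proof (intro allI impI)
      fix F s assume h: "finite F \<and> F \<subseteq> insert l \<D> \<and> (\<forall>A\<in>F. s A \<in> A) \<and> (\<Oplus>\<^bsub>M\<^esub>A\<in>F. s A) = \<zero>\<^bsub>M\<^esub>"
      show "\<forall>A\<in>F. s A = \<zero>\<^bsub>M\<^esub>"
      proof (cases "l \<in> F")
        case False
        then show ?thesis using \<D>(2) h unfolding ind_def by (metis subset_insert)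
      next
        case True
        define F' where "F' = F - {l}"
        have F': "finite F'" "F' \<subseteq> \<D>" "l \<notin> F'" "F = insert l F'" "\<forall>A\<in>F'. s A \<in> A"
          using h True by (auto simp: F'_def)
        have sM: "s A \<in> carrier M" if "A \<in> F" for A
          using h that \<D>(1) l subD(1) by blast
        obtain c where c: "s l = ga_single \<one> c \<odot>\<^bsub>M\<^esub> x" using h True by (auto simp: l_def line_def)
        have S': "(\<Oplus>\<^bsub>M\<^esub>A\<in>F'. s A) \<in> carrier M" using sM F' by (intro M.M.finsum_closed) auto
        have "(\<Oplus>\<^bsub>M\<^esub>A\<in>insert l F'. s A) = s l \<oplus>\<^bsub>M\<^esub> (\<Oplus>\<^bsub>M\<^esub>A\<in>F'. s A)"
          using F' sM by (intro M.M.finsum_insert) auto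
        then have sum: "s l \<oplus>\<^bsub>M\<^esub> (\<Oplus>\<^bsub>M\<^esub>A\<in>F'. s A) = \<zero>\<^bsub>M\<^esub>" using h F'(4) by simp
        have "c = 0"
        proof (rule ccontr)
          assume c0: "c \<noteq> 0"
          let ?d = "ga_single \<one> (- inverse c)"
          have "s l = \<ominus>\<^bsub>M\<^esub> (\<Oplus>\<^bsub>M\<^esub>A\<in>F'. s A)"
            using sum S' sM[OF True] by (simp add: M.M.minus_equality)
          then have "(\<Oplus>\<^bsub>M\<^esub>A\<in>F'. s A) = \<ominus>\<^bsub>M\<^esub> s l" using S' by simp
          moreover have "\<ominus>\<^bsub>M\<^esub> s l = ga_single \<one> (- c) \<odot>\<^bsub>M\<^esub> x"
          proof (rule M.M.minus_equality)
            show "ga_single \<one> (- c) \<odot>\<^bsub>M\<^esub> x \<oplus>\<^bsub>M\<^esub> s l = \<zero>\<^bsub>M\<^esub>"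
              unfolding c using x by (simp add: M.smult_l_distr[symmetric] single_add single_zero M.smult_zero_left)
          qed (use x sM[OF True] in \<open>auto simp: M.smult_closed\<close>)
          ultimately have "?d \<odot>\<^bsub>M\<^esub> (\<Oplus>\<^bsub>M\<^esub>A\<in>F'. s A) = x"
            using c0 x by (simp add: M.smult_assoc[symmetric] single_mult one_R[symmetric] M.smult_one)
          moreover have "?d \<odot>\<^bsub>M\<^esub> (\<Oplus>\<^bsub>M\<^esub>A\<in>F'. s A) = (\<Oplus>\<^bsub>M\<^esub>A\<in>F'. ?d \<odot>\<^bsub>M\<^esub> s A)"
            using F' sM by (intro M.finsum_smult) auto
          ultimately have "x = (\<Oplus>\<^bsub>M\<^esub>A\<in>F'. ?d \<odot>\<^bsub>M\<^esub> s A)" by simp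
          moreover have "\<forall>A\<in>F'. ?d \<odot>\<^bsub>M\<^esub> s A \<in> A"
            using F' \<D>(1) subD(4)[OF _ single_R[OF one_closed]] by (metis subsetD)
          ultimately have "finite F' \<and> F' \<subseteq> \<D> \<and> (\<forall>A\<in>F'. (\<lambda>A. ?d \<odot>\<^bsub>M\<^esub> s A) A \<in> A) \<and>
              x = (\<Oplus>\<^bsub>M\<^esub>A\<in>F'. (\<lambda>A. ?d \<odot>\<^bsub>M\<^esub> s A) A)"
            using F'(1,2) by simp
          then have "\<exists>F s. finite F \<and> F \<subseteq> \<D> \<and> (\<forall>A\<in>F. s A \<in> A) \<and> x = (\<Oplus>\<^bsub>M\<^esub>A\<in>F. s A)"
            by (intro exI[of _ F'] exI[of _ "\<lambda>A. ?d \<odot>\<^bsub>M\<^esub> s A"])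
          then show False using neg by simp
        qed
        then have sl: "s l = \<zero>\<^bsub>M\<^esub>" using c x by (simp add: single_zero M.smult_zero_left)
        then have "(\<Oplus>\<^bsub>M\<^esub>A\<in>F'. s A) = \<zero>\<^bsub>M\<^esub>" using sum S' by simp
        then have "\<forall>A\<in>F'. s A = \<zero>\<^bsub>M\<^esub>" using \<D>(2) F' unfolding ind_def by blast
        then show ?thesis using sl F'(4) by simp
      qed
    qed
    then have "l \<in> \<D>" using max[of "insert l \<D>"] \<D>(1) l by auto
    moreover have "x \<in> l"
      unfolding l_def line_def using x by (intro image_eqI[of _ _ 1]) (auto simp: one_R[symmetric] M.smult_one)
    moreover have "x = (\<Oplus>\<^bsub>M\<^esub>A\<in>{l}. x)" using x M.M.finsum_insert[of "{}" l "\<lambda>_. x"] by simp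
    ultimately have "finite {l} \<and> {l} \<subseteq> \<D> \<and> (\<forall>A\<in>{l}. (\<lambda>_. x) A \<in> A) \<and> x = (\<Oplus>\<^bsub>M\<^esub>A\<in>{l}. (\<lambda>_. x) A)" by auto
    then have "\<exists>F s. finite F \<and> F \<subseteq> \<D> \<and> (\<forall>A\<in>F. s A \<in> A) \<and> x = (\<Oplus>\<^bsub>M\<^esub>A\<in>F. s A)"
      by (intro exI[of _ "{l}"] exI[of _ "\<lambda>_. x"])
    then show False using neg by simp
  qed
  have "direct_sum_decomp R M \<D>"
    unfolding direct_sum_decomp_def ind_def[symmetric]
    by (intro conjI ballI M sub span \<D>(2)) (use \<D>(1) in auto)
  moreover have "omega_trivial G 0 (M\<lparr>carrier := E\<rparr>)" if "E \<in> \<D>" for E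
    using that \<D>(1) line_omega_trivial[OF M fx] by (auto simp: lines_def)
  ultimately show ?thesis by (rule that)
qed

text \<open>Induction along the socle series: the fixed vectors form a submodule with trivial action, and
  modulo this submodule the \<open>n\<close>-th power of the augmentation ideal annihilates everything if the
  power \<open>n + 1\<close> annihilates \<open>M\<close>.\<close>

lemma gen_class_if_ideal_power_annihilates:
  fixes M :: "('g \<Rightarrow> 'k, 'u) module"
  assumes M: "left_module R M" and z: "\<And>a m. a \<in> ideal_power R J n \<Longrightarrow> m \<in> carrier M \<Longrightarrow> a \<odot>\<^bsub>M\<^esub> m = \<zero>\<^bsub>M\<^esub>"
  shows "gen_class G n M"
  using assms
proof (induction n arbitrary: M)
  case 0
  interpret M: left_module R M by (rule 0)
  have "m = \<zero>\<^bsub>M\<^esub>" if "m \<in> carrier M" for m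
    using 0(2)[of "\<one>\<^bsub>R\<^esub>" m] that by (simp add: ideal_power_def M.smult_one)
  then have "trace_map M M id" by (intro trace_map_cong[OF trace_map_zero[OF 0(1,1)]]) auto
  then show ?case
    using 0(1) stably_zero_iff[OF 0(1,1)] by (simp add: stable_zero_object_def R_def[symmetric])
next
  case (Suc n)
  note M = Suc.prems(1) and z = Suc.prems(2)
  interpret M: left_module R M by (rule M)
  have F1: "gen_class G (Suc 0) N"
    if N: "left_module R N" "\<And>v. v \<in> carrier N \<Longrightarrow> fixed N v" for N :: "('g \<Rightarrow> 'k, 'u) module"
  proof -
    obtain \<D> where "direct_sum_decomp R N \<D>" "\<And>E. E \<in> \<D> \<Longrightarrow> omega_trivial G 0 (N\<lparr>carrier := E\<rparr>)"
      using trivial_action_decomp[OF N] by blast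
    then show ?thesis
      using stable_retract_refl[OF N(1)] unfolding gen_class.simps R_def[symmetric] by blast
  qed
  show ?case
  proof (cases n)
    case 0
    have "fixed M v" if "v \<in> carrier M" for v
    proof -
      have "a \<odot>\<^bsub>M\<^esub> v = \<zero>\<^bsub>M\<^esub>" if "a \<in> J" for a
      proof -
        have "a \<otimes>\<^bsub>R\<^esub> \<one>\<^bsub>R\<^esub> \<in> ideal_power R J (Suc n)"
          unfolding ideal_power_Suc 0 using that by (intro ideal_prod.prod) (auto simp: ideal_power_def)
        then show ?thesis using z \<open>v \<in> carrier M\<close> J_R[OF that] by simp
      qed
      then show ?thesis using that fixed_iff_J[OF M] by simp
    qed
    then show ?thesis using F1[OF M] 0 by simp
  next
    case (Suc m)
    define P where "P = {v \<in> carrier M. fixed M v}"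
    have P_iff: "v \<in> P \<longleftrightarrow> v \<in> carrier M \<and> (\<forall>a\<in>J. a \<odot>\<^bsub>M\<^esub> v = \<zero>\<^bsub>M\<^esub>)" for v
      using fixed_iff_J[OF M] by (auto simp: P_def)
    have P: "submodule P R M"
      by (rule submoduleI[OF M])
        (auto simp: P_iff M.smult_zero_right M.smult_r_distr M.smult_closed J_R J_mult_right
          M.smult_assoc[symmetric])
    let ?P = "M\<lparr>carrier := P\<rparr>"
    have Pm: "left_module R ?P" by (rule submodule_left_module[OF M P])
    have "fixed ?P v" if "v \<in> carrier ?P" for v
      using that fixed_iff_J[OF Pm] by (simp add: P_iff)
    then have gP: "gen_class G (Suc 0) ?P" by (rule F1[OF Pm])
    obtain Q :: "('g \<Rightarrow> 'k, 'u) module" and q where Q: "left_module R Q" and q: "q \<in> lmod_hom R M Q"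
      "q ` carrier M = carrier Q" "{x \<in> carrier M. q x = \<zero>\<^bsub>Q\<^esub>} = P"
      using quotient_exists[OF M P] by blast
    have "gen_class G n Q"
    proof (rule Suc.IH[OF Q])
      fix b m assume b: "b \<in> ideal_power R J n" and "m \<in> carrier Q"
      then obtain y where y: "y \<in> carrier M" "m = q y" using q(2) by auto
      have bR: "b \<in> carrier R" using b ideal_power_J_R by auto
      have "b \<odot>\<^bsub>M\<^esub> y \<in> P"
        unfolding P_iff
      proof (intro conjI ballI)
        fix a assume a: "a \<in> J"
        have "a \<otimes>\<^bsub>R\<^esub> b \<in> ideal_power R J (Suc n)"
          unfolding ideal_power_Suc by (rule ideal_prod.prod[OF a b])
        then show "a \<odot>\<^bsub>M\<^esub> (b \<odot>\<^bsub>M\<^esub> y) = \<zero>\<^bsub>M\<^esub>"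
          using z[of "a \<otimes>\<^bsub>R\<^esub> b" y] y J_R[OF a] bR by (simp add: M.smult_assoc)
      qed (use y bR in \<open>simp add: M.smult_closed\<close>)
      then have "q (b \<odot>\<^bsub>M\<^esub> y) = \<zero>\<^bsub>Q\<^esub>" unfolding q(3)[symmetric] by simp
      then show "b \<odot>\<^bsub>Q\<^esub> m = \<zero>\<^bsub>Q\<^esub>" using y bR by (simp add: lmod_hom_smult[OF q(1)])
    qed
    moreover have se: "short_exact R ?P (\<lambda>x. x) M q Q"
      unfolding short_exact_def
      using Pm M Q q incl_lmod_hom[OF submoduleD(1)[OF P]] by simp
    then obtain h and S :: "('g \<Rightarrow> 'k, 'u) module" where "triangle R ?P (\<lambda>x. x) M q Q h S"
      using triangle_of_short_exact[OF se] by blast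
    ultimately show ?thesis
      unfolding Suc gen_class.simps(3) R_def[symmetric]
      using gP stable_retract_refl[OF M] by blast
  qed
qed

end

section \<open>Group algebras of p-groups in characteristic p\<close>

text \<open>In a field of characteristic \<open>p\<close> the set \<open>\<int>\<close> is the prime field.\<close>

lemma finite_Ints_CHAR:
  assumes "CHAR('k::ring_1) > 0"
  shows "finite (\<int> :: 'k set)"
proof -
  have "(\<int> :: 'k set) \<subseteq> of_nat ` {..<CHAR('k)}"
  proof
    fix x :: 'k assume "x \<in> \<int>"
    then obtain z where z: "x = of_int z" by (auto elim: Ints_cases)
    let ?p = "CHAR('k)"
    have "(of_int (z mod int ?p) :: 'k) = of_int (z - int ?p * (z div int ?p))"
      by (simp add: minus_mult_div_eq_mod)
    also have "\<dots> = of_int z" by simp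
    finally have "x = of_nat (nat (z mod int ?p))" using z assms by (simp add: of_nat_nat)
    moreover have "nat (z mod int ?p) < ?p" using assms by (simp add: nat_less_iff)
    ultimately show "x \<in> of_nat ` {..<?p}" by blast
  qed
  then show ?thesis by (rule finite_subset) simp
qed

context finite_group_algebra
begin

definition lc :: "('g \<Rightarrow> 'k, 'a) module \<Rightarrow> 'i set \<Rightarrow> ('i \<Rightarrow> 'a) \<Rightarrow> ('i \<Rightarrow> 'k) \<Rightarrow> 'a" where
  "lc M I b c = (\<Oplus>\<^bsub>M\<^esub>i\<in>I. ga_single \<one> (c i) \<odot>\<^bsub>M\<^esub> b i)"

lemma lc_term_closed:
  assumes "left_module R M" "b \<in> I \<rightarrow> carrier M"
  shows "(\<lambda>i. ga_single \<one> (c i) \<odot>\<^bsub>M\<^esub> b i) \<in> I \<rightarrow> carrier M"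
proof -
  interpret M: left_module R M by fact
  show ?thesis using assms(2) by (auto simp: Pi_iff intro!: M.smult_closed)
qed

lemma lc_closed:
  assumes "left_module R M" "b \<in> I \<rightarrow> carrier M"
  shows "lc M I b c \<in> carrier M"
proof -
  interpret M: left_module R M by fact
  show ?thesis unfolding lc_def by (rule M.M.finsum_closed[OF lc_term_closed[OF assms]])
qed

lemma lc_add:
  assumes "left_module R M" "b \<in> I \<rightarrow> carrier M"
  shows "lc M I b (\<lambda>i. c i + d i) = lc M I b c \<oplus>\<^bsub>M\<^esub> lc M I b d"
proof -
  interpret M: left_module R M by fact
  note cl = lc_term_closed[OF assms]
  have "lc M I b (\<lambda>i. c i + d i) =
      (\<Oplus>\<^bsub>M\<^esub>i\<in>I. ga_single \<one> (c i) \<odot>\<^bsub>M\<^esub> b i \<oplus>\<^bsub>M\<^esub> ga_single \<one> (d i) \<odot>\<^bsub>M\<^esub> b i)"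
    unfolding lc_def
    by (rule M.M.finsum_cong')
      (use assms(2) in \<open>auto simp: Pi_iff single_add[symmetric] M.smult_l_distr intro!: M.smult_closed\<close>)
  also have "\<dots> = lc M I b c \<oplus>\<^bsub>M\<^esub> lc M I b d"
    unfolding lc_def by (rule M.M.finsum_addf[OF cl cl])
  finally show ?thesis .
qed

lemma lc_scale:
  assumes "left_module R M" "b \<in> I \<rightarrow> carrier M" "finite I"
  shows "lc M I b (\<lambda>i. l * c i) = ga_single \<one> l \<odot>\<^bsub>M\<^esub> lc M I b c"
proof -
  interpret M: left_module R M by fact
  have "ga_single \<one> l \<odot>\<^bsub>M\<^esub> lc M I b c = (\<Oplus>\<^bsub>M\<^esub>i\<in>I. ga_single \<one> l \<odot>\<^bsub>M\<^esub> (ga_single \<one> (c i) \<odot>\<^bsub>M\<^esub> b i))"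
    unfolding lc_def by (rule M.finsum_smult[OF assms(3) _ lc_term_closed[OF assms(1,2)]]) simp
  also have "\<dots> = lc M I b (\<lambda>i. l * c i)"
    unfolding lc_def
    by (rule M.M.finsum_cong')
      (use assms(2) in \<open>auto simp: Pi_iff M.smult_assoc[symmetric] single_mult intro!: M.smult_closed\<close>)
  finally show ?thesis ..
qed

lemma lc_hom:
  assumes "left_module R M" "left_module R N" "f \<in> lmod_hom R M N" "b \<in> I \<rightarrow> carrier M" "finite I"
  shows "f (lc M I b c) = lc N I (\<lambda>i. f (b i)) c"
proof -
  interpret M: left_module R M by fact
  interpret N: left_module R N by fact
  have "f (lc M I b c) = (\<Oplus>\<^bsub>N\<^esub>i\<in>I. f (ga_single \<one> (c i) \<odot>\<^bsub>M\<^esub> b i))"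
    unfolding lc_def
    by (rule lmod_hom_finsum[OF M.M.abelian_group_axioms N.M.abelian_group_axioms assms(3,5)
          lc_term_closed[OF assms(1,4)]])
  also have "\<dots> = lc N I (\<lambda>i. f (b i)) c"
    unfolding lc_def
    by (rule N.M.finsum_cong')
      (use assms(4) lmod_hom_closed[OF assms(3)] in \<open>auto simp: Pi_iff lmod_hom_smult[OF assms(3)] intro!: N.smult_closed\<close>)
  finally show ?thesis .
qed

lemma lc_subset:
  assumes "left_module R M" "b \<in> I \<rightarrow> carrier M" "finite I" "I' \<subseteq> I" "\<And>i. i \<in> I - I' \<Longrightarrow> c i = 0"
  shows "lc M I b c = lc M I' b c"
proof -
  interpret M: left_module R M by fact
  have "lc M I' b c = lc M I b c"
    unfolding lc_def
    by (rule M.M.add.finprod_mono_neutral_cong_left)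
      (use assms lc_term_closed[OF assms(1,2)] in \<open>auto simp: single_zero M.smult_zero_left Pi_iff\<close>)
  then show ?thesis ..
qed

lemma lc_zero:
  assumes "left_module R M" "b \<in> I \<rightarrow> carrier M" "\<And>i. i \<in> I \<Longrightarrow> c i = 0"
  shows "lc M I b c = \<zero>\<^bsub>M\<^esub>"
proof -
  interpret M: left_module R M by fact
  have "lc M I b c = (\<Oplus>\<^bsub>M\<^esub>i\<in>I. \<zero>\<^bsub>M\<^esub>)"
    unfolding lc_def
    by (rule M.M.finsum_cong') (use assms in \<open>auto simp: single_zero M.smult_zero_left Pi_iff\<close>)
  then show ?thesis by simp
qed

definition spans :: "('g \<Rightarrow> 'k, 'a) module \<Rightarrow> 'i set \<Rightarrow> ('i \<Rightarrow> 'a) \<Rightarrow> bool" where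
  "spans M I b \<longleftrightarrow> finite I \<and> b \<in> I \<rightarrow> carrier M \<and> (\<forall>x\<in>carrier M. \<exists>c. x = lc M I b c)"

lemma fixed_regular:
  assumes "fixed regR v" "x \<in> carrier G"
  shows "v x = v \<one>"
proof -
  have "ga_single (inv x) 1 \<otimes>\<^bsub>R\<^esub> v = \<one>\<^bsub>R\<^esub> \<otimes>\<^bsub>R\<^esub> v"
    using fixed_smult[OF assms(1), of "ga_single (inv x) 1"] assms(2) by (simp add: aug_single one_R)
  then have "(ga_single (inv x) 1 \<otimes>\<^bsub>R\<^esub> v) \<one> = v \<one>"
    using fixed_carrier[OF assms(1)] by simp
  then show ?thesis using assms(2) by (simp add: mult_single_left)
qed

lemma fixed_regular_mult:
  assumes v: "fixed regR v" and x: "x \<in> carrier G"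
  shows "(v \<otimes>\<^bsub>R\<^esub> a) x = v \<one> * aug a"
proof -
  have "(v \<otimes>\<^bsub>R\<^esub> a) x = (\<Sum>y\<in>carrier G. v y * a (inv y \<otimes> x))" using x by (simp add: mult_R)
  also have "\<dots> = (\<Sum>y\<in>carrier G. v \<one> * a (inv y \<otimes> x))"
  proof (rule sum.cong[OF refl])
    fix y assume "y \<in> carrier G"
    from fixed_regular[OF v this] show "v y * a (inv y \<otimes> x) = v \<one> * a (inv y \<otimes> x)" by simp
  qed
  also have "\<dots> = (\<Sum>y\<in>carrier G. v \<one> * a y)"
  proof (rule sum.reindex_bij_witness[of _ "\<lambda>y. x \<otimes> inv y" "\<lambda>y. inv y \<otimes> x"])
    fix y assume y: "y \<in> carrier G"
    show "x \<otimes> inv (inv y \<otimes> x) = y" using x y by (simp add: inv_mult_group m_assoc[symmetric])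
    show "inv (x \<otimes> inv y) \<otimes> x = y" using x y by (simp add: inv_mult_group m_assoc)
  qed (use x in auto)
  also have "\<dots> = v \<one> * aug a" by (simp add: aug_def sum_distrib_left)
  finally show ?thesis .
qed

lemma fixed_regular_mult_J:
  assumes "fixed regR v" "a \<in> J"
  shows "v \<otimes>\<^bsub>R\<^esub> a = \<zero>\<^bsub>R\<^esub>"
proof
  fix x
  show "(v \<otimes>\<^bsub>R\<^esub> a) x = \<zero>\<^bsub>R\<^esub> x"
    using fixed_regular_mult[OF assms(1), of x a] assms(2) by (cases "x \<in> carrier G") (auto simp: zero_R J_def mult_R)
qed

end

locale p_group_algebra = finite_group_algebra G R for G :: "('g, 'x) monoid_scheme" (structure)
  and R :: "('g \<Rightarrow> 'k::field) ring" +
  fixes p :: nat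
  assumes prime_p: "Factorial_Ring.prime p" and char_p: "CHAR('k) = p"
    and order_G: "\<exists>a. order G = p ^ a"
begin

text \<open>The multiples of a nonzero vector by group algebra elements with coefficients in the prime field
  form a finite \<open>G\<close>-stable group of order divisible by \<open>p\<close>. Every orbit other than a fixed point has
  order divisible by \<open>p\<close>, so \<open>0\<close> cannot be the only fixed point.\<close>

lemma fixed_vector_exists:
  assumes M: "left_module R M" and nz: "v0 \<in> carrier M" "v0 \<noteq> \<zero>\<^bsub>M\<^esub>"
  obtains v where "fixed M v" "v \<noteq> \<zero>\<^bsub>M\<^esub>"
proof (rule ccontr)
  assume nt: "\<not> thesis"
  note witness = that
  have nofix: "v = \<zero>\<^bsub>M\<^esub>" if "fixed M v" for v
    using nt witness[OF that] by blast
  interpret M: left_module R M by (rule M)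
  define A where "A = {a :: 'g \<Rightarrow> 'k. \<forall>x. (x \<in> carrier G \<longrightarrow> a x \<in> \<int>) \<and> (x \<notin> carrier G \<longrightarrow> a x = 0)}"
  have p0: "p > 0" using prime_p prime_gt_0_nat by blast
  have finA: "finite A"
    unfolding A_def using finite_G finite_Ints_CHAR[where 'k = 'k] p0
    by (intro finite_set_of_finite_funs) (auto simp: char_p)
  have AR: "a \<in> carrier R" if "a \<in> A" for a using that by (auto simp: A_def carrier_R)
  have A_add: "a \<oplus>\<^bsub>R\<^esub> b \<in> A" if "a \<in> A" "b \<in> A" for a b
    using that by (auto simp: A_def add_R)
  have A_neg: "\<ominus>\<^bsub>R\<^esub> a \<in> A" if "a \<in> A" for a
    using that minus_R[OF AR[OF that]] by (auto simp: A_def)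
  have A_zero: "\<zero>\<^bsub>R\<^esub> \<in> A" by (auto simp: A_def zero_R)
  have A_one: "\<one>\<^bsub>R\<^esub> \<in> A" by (auto simp: A_def one_R ga_single_def)
  have A_single: "ga_single x 1 \<otimes>\<^bsub>R\<^esub> a \<in> A" if "x \<in> carrier G" "a \<in> A" for x a
    using that by (auto simp: A_def mult_single_left) (auto simp: mult_R)
  define W where "W = (\<lambda>a. a \<odot>\<^bsub>M\<^esub> v0) ` A"
  have finW: "finite W" using finA by (simp add: W_def)
  have WM: "w \<in> carrier M" if "w \<in> W" for w using that AR nz by (auto simp: W_def M.smult_closed)
  have W_add: "w \<oplus>\<^bsub>M\<^esub> w' \<in> W" if ww: "w \<in> W" "w' \<in> W" for w w'
  proof -
    obtain a b where "a \<in> A" "b \<in> A" "w = a \<odot>\<^bsub>M\<^esub> v0" "w' = b \<odot>\<^bsub>M\<^esub> v0"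
      using ww unfolding W_def by (elim imageE)
    then have "w \<oplus>\<^bsub>M\<^esub> w' = (a \<oplus>\<^bsub>R\<^esub> b) \<odot>\<^bsub>M\<^esub> v0" "a \<oplus>\<^bsub>R\<^esub> b \<in> A"
      using nz AR A_add by (auto simp: M.smult_l_distr)
    then show ?thesis by (auto simp: W_def)
  qed
  have W_neg: "\<ominus>\<^bsub>M\<^esub> w \<in> W" if ww: "w \<in> W" for w
  proof -
    obtain a where "a \<in> A" "w = a \<odot>\<^bsub>M\<^esub> v0" using ww unfolding W_def by (elim imageE)
    then have "\<ominus>\<^bsub>M\<^esub> w = (\<ominus>\<^bsub>R\<^esub> a) \<odot>\<^bsub>M\<^esub> v0" "\<ominus>\<^bsub>R\<^esub> a \<in> A"
      using nz AR A_neg by (auto simp: M.smult_neg_left)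
    then show ?thesis by (auto simp: W_def)
  qed
  have W_zero: "\<zero>\<^bsub>M\<^esub> \<in> W"
    unfolding W_def using A_zero nz by (intro image_eqI[of _ _ "\<zero>\<^bsub>R\<^esub>"]) (simp_all add: M.smult_zero_left)
  have W_v0: "v0 \<in> W"
    unfolding W_def using A_one nz by (intro image_eqI[of _ _ "\<one>\<^bsub>R\<^esub>"]) (simp_all add: M.smult_one)
  have W_act: "ga_single x 1 \<odot>\<^bsub>M\<^esub> w \<in> W" if "x \<in> carrier G" and ww: "w \<in> W" for x w
  proof -
    obtain a where a: "a \<in> A" "w = a \<odot>\<^bsub>M\<^esub> v0" using ww unfolding W_def by (elim imageE)
    then have "ga_single x 1 \<odot>\<^bsub>M\<^esub> w = (ga_single x 1 \<otimes>\<^bsub>R\<^esub> a) \<odot>\<^bsub>M\<^esub> v0"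
      using nz AR that by (auto simp: M.smult_assoc)
    then show ?thesis using A_single that a by (auto simp: W_def)
  qed
  \<comment> \<open>\<open>p\<close> divides the order of \<open>W\<close>, because \<open>v0\<close> has order \<open>p\<close>.\<close>
  let ?H = "(add_monoid M)\<lparr>carrier := W\<rparr>"
  have sgW: "subgroup W (add_monoid M)"
    by (rule subgroup.intro) (use WM W_add W_zero W_neg in \<open>auto simp: a_inv_def[symmetric]\<close>)
  interpret H: group ?H by (rule M.M.a_group[THEN group.subgroup_imp_group[OF _ sgW]])
  have pow: "v0 [^]\<^bsub>?H\<^esub> n = ga_single \<one> (of_nat n) \<odot>\<^bsub>M\<^esub> v0" for n :: nat
  proof (induction n)
    case 0
    then show ?case using nz by (simp add: single_zero M.smult_zero_left)
  next
    case (Suc n)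
    have "v0 [^]\<^bsub>?H\<^esub> Suc n = ga_single \<one> (of_nat n) \<odot>\<^bsub>M\<^esub> v0 \<oplus>\<^bsub>M\<^esub> ga_single \<one> 1 \<odot>\<^bsub>M\<^esub> v0"
      using Suc nz by (simp add: one_R[symmetric] M.smult_one)
    also have "\<dots> = ga_single \<one> (of_nat n + 1) \<odot>\<^bsub>M\<^esub> v0"
      using nz by (simp add: M.smult_l_distr[symmetric] single_add)
    finally show ?case by (simp add: add.commute)
  qed
  have "v0 [^]\<^bsub>?H\<^esub> p = \<one>\<^bsub>?H\<^esub>"
    unfolding pow using nz of_nat_CHAR[where 'a = 'k] by (simp add: char_p single_zero M.smult_zero_left)
  then have "H.ord v0 dvd p" using H.pow_eq_id W_v0 by simp
  moreover have "H.ord v0 \<noteq> 1" using H.ord_eq_1 W_v0 nz by simp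
  ultimately have "H.ord v0 = p" using prime_p unfolding prime_nat_iff by blast
  then have dvdW: "p dvd card W"
    using H.ord_dvd_group_order[of v0] W_v0 by (simp add: Coset.order_def)
  \<comment> \<open>The orbits of \<open>G\<close> on \<open>W\<close>.\<close>
  define \<phi> where "\<phi> x = restrict (\<lambda>w. ga_single x 1 \<odot>\<^bsub>M\<^esub> w) W" for x
  have \<phi>_mult: "\<phi> (x \<otimes> y) w = \<phi> x (\<phi> y w)" if "x \<in> carrier G" "y \<in> carrier G" "w \<in> W" for x y w
    using that W_act WM by (simp add: \<phi>_def M.smult_assoc[symmetric] single_mult)
  have \<phi>_one: "\<phi> \<one> w = w" if "w \<in> W" for w
    using that WM by (simp add: \<phi>_def one_R[symmetric] M.smult_one)
  have \<phi>W: "\<phi> x w \<in> W" if "x \<in> carrier G" "w \<in> W" for x w using that W_act by (simp add: \<phi>_def)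
  have bij: "bij_betw (\<phi> x) W W" if x: "x \<in> carrier G" for x
    by (rule bij_betw_byWitness[where f' = "\<phi> (inv x)"])
      (use x \<phi>W \<phi>_mult[of "inv x" x, symmetric] \<phi>_mult[of x "inv x", symmetric] \<phi>_one in auto)
  have "\<phi> \<in> hom G (BijGroup W)"
  proof (rule homI)
    fix x assume "x \<in> carrier G"
    then show "\<phi> x \<in> carrier (BijGroup W)" using bij by (auto simp: BijGroup_def Bij_def \<phi>_def)
  next
    fix x y assume xy: "x \<in> carrier G" "y \<in> carrier G"
    then have "\<phi> x \<in> Bij W" "\<phi> y \<in> Bij W" using bij by (auto simp: Bij_def \<phi>_def)
    then show "\<phi> (x \<otimes> y) = \<phi> x \<otimes>\<^bsub>BijGroup W\<^esub> \<phi> y"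
      using \<phi>_mult[OF xy] by (auto simp: BijGroup_def compose_def fun_eq_iff) (simp add: \<phi>_def)
  qed
  then interpret act: group_action G W \<phi>
    by (intro group_action.intro group_hom.intro group_hom_axioms.intro is_group group_BijGroup)
  have "\<phi> x \<zero>\<^bsub>M\<^esub> = \<zero>\<^bsub>M\<^esub>" if "x \<in> carrier G" for x
    using that W_zero by (simp add: \<phi>_def M.smult_zero_right)
  then have orb0: "orbit G \<phi> \<zero>\<^bsub>M\<^esub> = {\<zero>\<^bsub>M\<^esub>}"
    unfolding orbit_def by (auto intro!: exI[of _ \<one>])
  have orbdvd: "p dvd card B" if B: "B \<in> orbits G W \<phi> - {{\<zero>\<^bsub>M\<^esub>}}" for B
  proof (rule ccontr)
    assume np: "\<not> p dvd card B"
    obtain w where w: "w \<in> W" "B = orbit G \<phi> w" using B by (auto simp: orbits_def)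
    obtain a where a: "order G = p ^ a" using order_G by blast
    have "card B dvd p ^ a"
      using act.orbit_stabilizer_theorem[OF w(1)] w(2) a by (metis dvd_triv_left)
    then obtain i where "card B = p ^ i" using prime_p divides_primepow_nat by blast
    then have "card B = 1" using np by (cases i) auto
    then obtain u where "B = {u}" by (auto simp: card_1_singleton_iff)
    then have B': "B = {w}" using act.orbit_refl[OF w(1)] w(2) by auto
    have fx: "ga_single x 1 \<odot>\<^bsub>M\<^esub> w = w" if x: "x \<in> carrier G" for x
    proof -
      have "\<phi> x w \<in> B" using x w(2) by (auto simp: orbit_def)
      then show ?thesis using B' w(1) by (simp add: \<phi>_def)
    qed
    have "fixed M w"
      unfolding fixed_def
    proof (intro conjI ballI)
      fix b assume "b \<in> carrier R"
      then show "b \<odot>\<^bsub>M\<^esub> w = ga_single \<one> (aug b) \<odot>\<^bsub>M\<^esub> w"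
      proof (induction b rule: R_induct)
        case zero
        then show ?case by (simp add: aug_zero single_zero)
      next
        case (single x c)
        have "ga_single x c \<odot>\<^bsub>M\<^esub> w = ga_single \<one> c \<odot>\<^bsub>M\<^esub> (ga_single x 1 \<odot>\<^bsub>M\<^esub> w)"
          using single WM[OF w(1)] by (simp add: M.smult_assoc[symmetric] single_mult)
        then show ?case using fx single by (simp add: aug_single)
      next
        case (add b b')
        then show ?case using WM[OF w(1)] by (simp add: M.smult_l_distr aug_add single_add[symmetric])
      qed
    qed (rule WM[OF w(1)])
    then have "w = \<zero>\<^bsub>M\<^esub>" by (rule nofix)
    then show False using B B' by simp
  qed
  have fino: "finite (orbits G W \<phi>)"
    using finW act.orbits_coverture by (metis finite_UnionD)
  have "{\<zero>\<^bsub>M\<^esub>} \<in> orbits G W \<phi>" using W_zero orb0 by (auto simp: orbits_def)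
  have "card W = (\<Sum>w\<in>W. 1)" by simp
  also have "\<dots> = (\<Sum>B\<in>orbits G W \<phi>. \<Sum>w\<in>B. 1)" by (rule act.disjoint_sum[OF finW, symmetric])
  also have "\<dots> = (\<Sum>B\<in>orbits G W \<phi>. card B)" by simp
  also have "\<dots> = card {\<zero>\<^bsub>M\<^esub>} + (\<Sum>B\<in>orbits G W \<phi> - {{\<zero>\<^bsub>M\<^esub>}}. card B)"
    by (rule sum.remove[OF fino]) fact
  finally have "card W = 1 + (\<Sum>B\<in>orbits G W \<phi> - {{\<zero>\<^bsub>M\<^esub>}}. card B)" by simp
  moreover have "p dvd (\<Sum>B\<in>orbits G W \<phi> - {{\<zero>\<^bsub>M\<^esub>}}. card B)" by (rule dvd_sum) (rule orbdvd)
  ultimately have "p dvd 1" using dvdW by (metis dvd_add_left_iff)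
  then show False using prime_p by auto
qed

text \<open>The group algebra of a \<open>p\<close>-group is local. Right multiplication by an element of nonzero
  augmentation is injective, since its kernel would contain a fixed vector, a multiple of the sum of
  all group elements; and an injective endomorphism of the regular module splits, because the
  identity of the regular module is a trace.\<close>

lemma right_inverse_exists:
  assumes a: "a \<in> carrier R" "aug a \<noteq> 0"
  shows "\<exists>c\<in>carrier R. a \<otimes>\<^bsub>R\<^esub> c = \<one>\<^bsub>R\<^esub>"
proof -
  interpret L: left_module R regR by (rule regR)
  let ?f = "\<lambda>b. b \<otimes>\<^bsub>R\<^esub> a"
  have f: "?f \<in> lmod_hom R regR regR"
    using a by (intro lmod_homI) (auto simp: R.l_distr R.m_assoc)
  have k: "b = \<zero>\<^bsub>R\<^esub>" if b: "b \<in> carrier R" "b \<otimes>\<^bsub>R\<^esub> a = \<zero>\<^bsub>R\<^esub>" for b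
  proof (rule ccontr)
    assume nz: "b \<noteq> \<zero>\<^bsub>R\<^esub>"
    define E where "E = {x \<in> carrier regR. x \<otimes>\<^bsub>R\<^esub> a = \<zero>\<^bsub>regR\<^esub>}"
    have E: "submodule E R regR" unfolding E_def by (rule kernel_submodule[OF regR regR f])
    let ?E = "regR\<lparr>carrier := E\<rparr>"
    have Em: "left_module R ?E" by (rule submodule_left_module[OF regR E])
    obtain v where v: "fixed ?E v" "v \<noteq> \<zero>\<^bsub>?E\<^esub>"
      by (rule fixed_vector_exists[OF Em, of b]) (use b nz in \<open>auto simp: E_def\<close>)
    have vE: "v \<in> carrier R" "v \<otimes>\<^bsub>R\<^esub> a = \<zero>\<^bsub>R\<^esub>" using fixed_carrier[OF v(1)] by (auto simp: E_def)
    have fv: "fixed regR v"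
      unfolding fixed_def
    proof (intro conjI ballI)
      fix r assume "r \<in> carrier R"
      from fixed_smult[OF v(1) this]
      show "r \<odot>\<^bsub>regR\<^esub> v = ga_single \<one> (aug r) \<odot>\<^bsub>regR\<^esub> v" by simp
    qed (use vE(1) in simp)
    note vc = fixed_regular[OF fv]
    have "v \<one> \<noteq> 0"
    proof
      assume "v \<one> = 0"
      then have "v x = 0" for x using vc[of x] carrier_R_D[OF vE(1), of x] by (cases "x \<in> carrier G") auto
      then show False using v(2) by (simp add: zero_R fun_eq_iff)
    qed
    moreover have "(v \<otimes>\<^bsub>R\<^esub> a) \<one> = v \<one> * aug a" by (rule fixed_regular_mult[OF fv one_closed])
    moreover have "(v \<otimes>\<^bsub>R\<^esub> a) \<one> = 0" unfolding vE(2) by (simp add: zero_R)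
    ultimately show False using a(2) by simp
  qed
  have "inj_on ?f (carrier regR)"
    by (rule lmod_hom_inj_onI[OF L.M.abelian_group_axioms L.M.abelian_group_axioms f]) (use k in simp)
  then obtain F where F: "F \<in> lmod_hom R regR regR" "\<And>b. b \<in> carrier regR \<Longrightarrow> F (b \<otimes>\<^bsub>R\<^esub> a) = b"
    using trace_map_extend[OF regR regR regR f _ trace_map_id_reg] by blast
  have "F a = \<one>\<^bsub>R\<^esub>" using F(2)[of "\<one>\<^bsub>R\<^esub>"] a by simp
  moreover have "F (a \<odot>\<^bsub>regR\<^esub> \<one>\<^bsub>R\<^esub>) = a \<odot>\<^bsub>regR\<^esub> F \<one>\<^bsub>R\<^esub>"
    by (rule lmod_hom_smult[OF F(1)]) (use a in simp_all)
  moreover have "F \<one>\<^bsub>R\<^esub> \<in> carrier R" using lmod_hom_closed[OF F(1), of "\<one>\<^bsub>R\<^esub>"] by simp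
  ultimately show ?thesis using a by (intro bexI[of _ "F \<one>\<^bsub>R\<^esub>"]) simp_all
qed

lemma unit_if_aug_nonzero:
  assumes a: "a \<in> carrier R" "aug a \<noteq> 0"
  obtains c where "c \<in> carrier R" "a \<otimes>\<^bsub>R\<^esub> c = \<one>\<^bsub>R\<^esub>" "c \<otimes>\<^bsub>R\<^esub> a = \<one>\<^bsub>R\<^esub>"
proof -
  obtain c where c: "c \<in> carrier R" "a \<otimes>\<^bsub>R\<^esub> c = \<one>\<^bsub>R\<^esub>" using right_inverse_exists[OF a] by blast
  have "aug a * aug c = 1" using c aug_mult aug_one by metis
  then have "aug c \<noteq> 0" by auto
  then obtain d where d: "d \<in> carrier R" "c \<otimes>\<^bsub>R\<^esub> d = \<one>\<^bsub>R\<^esub>" using right_inverse_exists c by blast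
  have "a = a \<otimes>\<^bsub>R\<^esub> (c \<otimes>\<^bsub>R\<^esub> d)" using a d by simp
  also have "\<dots> = (a \<otimes>\<^bsub>R\<^esub> c) \<otimes>\<^bsub>R\<^esub> d" by (rule R.m_assoc[symmetric]) (use a c d in simp_all)
  also have "\<dots> = d" unfolding c(2) using d by simp
  finally have "a = d" .
  with c d that show ?thesis by blast
qed

lemma left_ideal_proper:
  assumes I: "left_ideal R I" and ne: "I \<noteq> carrier R"
  shows "I \<subseteq> J"
proof
  fix a assume a: "a \<in> I"
  note ID = submoduleD[OF I[unfolded left_ideal_def]]
  have aR: "a \<in> carrier R" using a ID(1) by auto
  show "a \<in> J"
  proof (rule ccontr)
    assume "a \<notin> J"
    then have "aug a \<noteq> 0" using aR by (simp add: J_def)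
    then obtain c where c: "c \<in> carrier R" "c \<otimes>\<^bsub>R\<^esub> a = \<one>\<^bsub>R\<^esub>" using unit_if_aug_nonzero[OF aR] by blast
    then have one: "\<one>\<^bsub>R\<^esub> \<in> I" using ID(4)[OF c(1) a] by simp
    have "b \<in> I" if "b \<in> carrier R" for b using ID(4)[OF that one] that by simp
    then show False using ne ID(1) by auto
  qed
qed

lemma left_ideal_J: "left_ideal R J"
  unfolding left_ideal_def
  by (rule submoduleI[OF regR]) (auto simp: J_R J_zero J_add J_mult_left)

text \<open>The augmentation ideal is the only maximal left ideal, because the elements outside it are units.\<close>

lemma jacobson_radical_eq: "jacobson_radical R = J"
proof -
  have neJ: "J \<noteq> carrier R" using aug_one by (metis (mono_tags, lifting) J_def R.one_closed mem_Collect_eq zero_neq_one)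
  have "maximal_left_ideal R J"
    unfolding maximal_left_ideal_def using left_ideal_J neJ left_ideal_proper by blast
  moreover have "I = J" if "maximal_left_ideal R I" for I
  proof -
    have I: "left_ideal R I" "I \<noteq> carrier R"
      "\<And>I'. left_ideal R I' \<Longrightarrow> I \<subseteq> I' \<Longrightarrow> I' = I \<or> I' = carrier R"
      using that by (simp_all add: maximal_left_ideal_def)
    show ?thesis using I(3)[OF left_ideal_J left_ideal_proper[OF I(1,2)]] neJ by simp
  qed
  ultimately have "maximal_left_ideal R I \<longleftrightarrow> I = J" for I by blast
  then show ?thesis using J_R by (auto simp: jacobson_radical_def)
qed

end

locale p_group_universe = p_group_algebra G R p + finite_group_universe G R U
  for G :: "('g, 'x) monoid_scheme" (structure)
    and R :: "('g \<Rightarrow> 'k::field) ring" and p :: nat and U :: "'u itself"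
begin

text \<open>Divide by the line of a fixed vector. If \<open>b i\<close> occurs in this vector with a nonzero coefficient, its
  image in the quotient is a combination of the others, so the quotient has a smaller spanning set.\<close>

lemma thick_trivial_if_spans:
  fixes M :: "('g \<Rightarrow> 'k, 'u) module" and b :: "'i \<Rightarrow> 'u"
  assumes M: "left_module R M" and s: "spans M I b" and nz: "carrier M \<noteq> {\<zero>\<^bsub>M\<^esub>}"
  shows "thick_trivial G M"
  using assms
proof (induction "card I" arbitrary: M I b)
  case 0
  then have I: "I = {}" by (simp add: spans_def)
  interpret M: left_module R M by (rule 0)
  have "x = \<zero>\<^bsub>M\<^esub>" if "x \<in> carrier M" for x
    using 0(3) that lc_zero[OF 0(2), of b I] unfolding spans_def I by auto
  then show ?case using 0(4) by auto
next
  case (Suc n)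
  note M = Suc.prems(1)
  interpret M: left_module R M by (rule M)
  have I: "finite I" "b \<in> I \<rightarrow> carrier M" "\<And>x. x \<in> carrier M \<Longrightarrow> \<exists>c. x = lc M I b c"
    using Suc.prems(2) by (auto simp: spans_def)
  obtain v0 where "v0 \<in> carrier M" "v0 \<noteq> \<zero>\<^bsub>M\<^esub>" using Suc.prems(3) M.M.zero_closed by blast
  then obtain v where v: "fixed M v" "v \<noteq> \<zero>\<^bsub>M\<^esub>" using fixed_vector_exists[OF M] by blast
  have vM: "v \<in> carrier M" using fixed_carrier[OF v(1)] .
  let ?l = "M\<lparr>carrier := line M v\<rparr>"
  have l: "thick_trivial G ?l" by (rule thick_unit[OF line_omega_trivial[OF M v]])
  note sl = line_submodule[OF M v(1)]
  obtain Q :: "('g \<Rightarrow> 'k, 'u) module" and q where Q: "left_module R Q" and q: "q \<in> lmod_hom R M Q"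
    "q ` carrier M = carrier Q" "{x \<in> carrier M. q x = \<zero>\<^bsub>Q\<^esub>} = line M v"
    using quotient_exists[OF M sl] by blast
  interpret Q: left_module R Q by (rule Q)
  have se: "short_exact R ?l (\<lambda>x. x) M q Q"
    unfolding short_exact_def
    using submodule_left_module[OF M sl] M Q q incl_lmod_hom[OF submoduleD(1)[OF sl]] by simp
  show ?case
  proof (cases "carrier Q = {\<zero>\<^bsub>Q\<^esub>}")
    case True
    then have "carrier M = line M v" using q by auto
    then have "?l = M" by simp
    then show ?thesis using l by simp
  next
    case False
    obtain d where d: "v = lc M I b d" using I(3)[OF vM] by blast
    obtain i0 where i0: "i0 \<in> I" "d i0 \<noteq> 0" using d v(2) lc_zero[OF M I(2), of d] by metis
    have qv: "q v = \<zero>\<^bsub>Q\<^esub>"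
    proof -
      have "v \<in> line M v"
        unfolding line_def using vM by (intro image_eqI[of _ _ 1]) (auto simp: one_R[symmetric] M.smult_one)
      then show ?thesis unfolding q(3)[symmetric] by simp
    qed
    have qb: "(\<lambda>i. q (b i)) \<in> I \<rightarrow> carrier Q" using I(2) lmod_hom_closed[OF q(1)] by auto
    have "\<exists>c. y = lc Q (I - {i0}) (\<lambda>i. q (b i)) c" if y: "y \<in> carrier Q" for y
    proof -
      obtain x where x: "x \<in> carrier M" "y = q x" using y q(2) by auto
      obtain c where c: "x = lc M I b c" using I(3)[OF x(1)] by blast
      define l where "l = - c i0 / d i0"
      define c' where "c' = (\<lambda>i. c i + l * d i)"
      have "lc M I b c' = x \<oplus>\<^bsub>M\<^esub> ga_single \<one> l \<odot>\<^bsub>M\<^esub> v"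
        unfolding c'_def lc_add[OF M I(2)] lc_scale[OF M I(2,1)] c d ..
      then have "q (lc M I b c') = y"
        using x vM qv by (simp add: lmod_hom_add[OF q(1)] lmod_hom_smult[OF q(1)] M.smult_closed
          Q.smult_zero_right lmod_hom_closed[OF q(1)])
      then have "y = lc Q I (\<lambda>i. q (b i)) c'" using lc_hom[OF M Q q(1) I(2,1)] by simp
      also have "\<dots> = lc Q (I - {i0}) (\<lambda>i. q (b i)) c'"
        by (rule lc_subset[OF Q qb I(1)]) (use i0 in \<open>auto simp: c'_def l_def\<close>)
      finally show ?thesis by blast
    qed
    then have "spans Q (I - {i0}) (\<lambda>i. q (b i))" using I(1) qb by (auto simp: spans_def)
    moreover have "n = card (I - {i0})" using Suc.hyps(2) i0 I(1) by simp
    ultimately have "thick_trivial G Q" using Suc.hyps(1)[OF _ Q _ False] by blast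
    then show ?thesis by (rule thick_trivial_extension[OF se l])
  qed
qed

end

section \<open>A cyclic normal subgroup\<close>

lemma CHAR_poly_eq: "CHAR('a::comm_ring_1 poly) = CHAR('a)"
  by (rule CHAR_eqI) (auto simp: of_nat_poly of_nat_eq_0_iff_char_dvd)

locale cyclic_normal_subgroup = p_group_algebra G R p
  for G :: "('g, 'x) monoid_scheme" (structure) and R :: "('g \<Rightarrow> 'k::field) ring" and p :: nat +
  fixes C :: "'g set" and g :: 'g and q :: nat
  assumes C_normal: "C \<lhd> G" and card_C: "card C = q" and q_power: "\<exists>r. q = p ^ r"
    and g_C: "g \<in> C" and generate_g: "generate G {g} = C"
begin

definition t :: "'g \<Rightarrow> 'k" where "t = minus_one G g"

abbreviation tpow :: "nat \<Rightarrow> 'g \<Rightarrow> 'k" where "tpow e \<equiv> t [^]\<^bsub>R\<^esub> e"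

lemma C_subset: "C \<subseteq> carrier G"
  using C_normal normal_imp_subgroup subgroup.subset by blast

lemma g_G [simp]: "g \<in> carrier G"
  using C_subset g_C by auto

lemma t_J: "t \<in> J"
  unfolding t_def by (rule minus_one_J) simp

lemma t_R [simp]: "t \<in> carrier R"
  using t_J J_R by blast

lemma tpow_R [simp]: "tpow e \<in> carrier R"
  by (rule R.nat_pow_closed) simp

lemma tpow_add: "tpow e \<otimes>\<^bsub>R\<^esub> tpow d = tpow (e + d)"
  by (rule R.nat_pow_mult) simp

lemma tpow_add': "a \<in> carrier R \<Longrightarrow> (a \<otimes>\<^bsub>R\<^esub> tpow e) \<otimes>\<^bsub>R\<^esub> tpow d = a \<otimes>\<^bsub>R\<^esub> tpow (e + d)"
  by (simp add: R.m_assoc tpow_add)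

lemma ord_g: "ord g = q"
  using generate_pow_card[of g] generate_g card_C by simp

lemma q_pos: "q > 0"
  using q_power prime_p prime_gt_0_nat by auto

lemma g_pow_q: "g [^] q = \<one>"
  using ord_g pow_ord_eq_1[of g] by simp

lemma C_pow: "bij_betw (\<lambda>i. g [^] (i::nat)) {..<q} C"
proof -
  have e: "{0..q - 1} = {..<q}" using q_pos by auto
  have "C = {g [^] k | k. k \<in> (UNIV :: nat set)}"
    using generate_pow_on_finite_carrier[OF finite_G g_G] generate_g by simp
  also have "\<dots> = {g [^] k | k. k \<in> {..<q}}"
    using ord_elems[OF finite_G g_G] unfolding ord_g e .
  finally have "C = (\<lambda>i. g [^] i) ` {..<q}" by auto
  moreover have "inj_on (\<lambda>i::nat. g [^] i) {..<q}" using ord_inj[OF g_G] ord_g e by simp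
  ultimately show ?thesis by (simp add: bij_betw_def)
qed

subsection \<open>Powers of \<open>g - 1\<close>\<close>

text \<open>The evaluation homomorphism from polynomials to the group algebra, at \<open>g\<close>. It turns polynomial
  identities, in which \<open>X - 1\<close> can be cancelled, into identities for the powers of \<open>g - 1\<close>.\<close>

definition ev :: "'k poly \<Rightarrow> 'g \<Rightarrow> 'k" where
  "ev P = (\<lambda>y. \<Sum>i\<le>degree P. if g [^] i = y then coeff P i else 0)"

lemma ev_upto:
  assumes "degree P \<le> N"
  shows "ev P y = (\<Sum>i\<le>N. if g [^] i = y then coeff P i else 0)"
  unfolding ev_def using assms
  by (intro sum.mono_neutral_left) (auto simp: coeff_eq_0)

lemma ev_R: "ev P \<in> carrier R"
proof -
  have "ev P y = 0" if "y \<notin> carrier G" for y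
  proof -
    have "g [^] i \<noteq> y" for i :: nat using that nat_pow_closed[OF g_G] by metis
    then show ?thesis by (simp add: ev_def)
  qed
  then show ?thesis by (simp add: carrier_R)
qed

lemma ev_add: "ev (P + Q) = ev P \<oplus>\<^bsub>R\<^esub> ev Q"
proof
  fix y
  let ?N = "max (degree P) (degree Q)"
  have "ev (P + Q) y = (\<Sum>i\<le>?N. if g [^] i = y then coeff (P + Q) i else 0)"
    by (rule ev_upto[OF degree_add_le_max])
  also have "\<dots> = ev P y + ev Q y"
    unfolding ev_upto[of P ?N y, OF max.cobounded1] ev_upto[of Q ?N y, OF max.cobounded2]
      sum.distrib[symmetric] by (intro sum.cong) auto
  finally show "ev (P + Q) y = (ev P \<oplus>\<^bsub>R\<^esub> ev Q) y" by (simp add: add_R)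
qed

lemma ev_diff: "ev (P - Q) = ev P \<ominus>\<^bsub>R\<^esub> ev Q"
  using ev_add[of "P - Q" Q] R.add_diff_cancel_right[of "ev (P - Q)" "ev Q"] ev_R by simp

lemma ev_pCons: "ev (pCons 0 P) = ev P \<otimes>\<^bsub>R\<^esub> ga_single g 1"
proof
  fix y
  show "ev (pCons 0 P) y = (ev P \<otimes>\<^bsub>R\<^esub> ga_single g 1) y"
  proof (cases "y \<in> carrier G")
    case True
    have e: "g [^] i = y \<otimes> inv g \<longleftrightarrow> g [^] Suc i = y" for i :: nat
      using True inv_solve_right[of "g [^] i" y g] by auto
    have "ev (pCons 0 P) y = (\<Sum>i\<le>Suc (degree P). if g [^] i = y then coeff (pCons 0 P) i else 0)"
      by (rule ev_upto) (rule degree_pCons_le)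
    also have "\<dots> = (\<Sum>i\<le>degree P. if g [^] Suc i = y then coeff P i else 0)"
      by (subst sum.atMost_Suc_shift) (auto intro!: sum.cong)
    also have "\<dots> = ev P (y \<otimes> inv g)" by (simp add: ev_def e del: nat_pow_Suc)
    finally show ?thesis using True by (simp add: mult_single_right)
  next
    case False
    then show ?thesis using ev_R[of "pCons 0 P"] by (simp add: carrier_R_D mult_R)
  qed
qed

lemma ev_one: "ev 1 = \<one>\<^bsub>R\<^esub>"
  by (auto simp: ev_def one_R ga_single_def)

lemma ev_mult_t: "ev ([:- 1, 1:] * P) = ev P \<otimes>\<^bsub>R\<^esub> t"
proof -
  have "[:- 1, 1:] * P = pCons 0 P - P" by simp
  then show ?thesis
    by (simp add: ev_diff ev_pCons t_def minus_one_R a_minus_def R.r_distr R.r_minus ev_R)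
qed

lemma ev_t_power: "ev ([:- 1, 1:] ^ e) = tpow e"
proof (induction e)
  case (Suc e)
  then show ?case unfolding power_Suc ev_mult_t by simp
qed (simp add: ev_one)

lemma ev_var_power: "ev ([:0, 1:] ^ e) = ga_single (g [^] e) 1"
proof (induction e)
  case (Suc e)
  have "[:0, 1:] ^ Suc e = pCons 0 ([:0, 1::'k:] ^ e)" by simp
  then show ?case using Suc by (simp add: ev_pCons single_mult)
qed (simp add: ev_one one_R)

lemma var_minus_one_power: "[:- 1, 1::'k:] ^ q = [:0, 1:] ^ q - 1"
proof -
  obtain r where r: "q = p ^ r" using q_power by blast
  have c: "CHAR('k poly) = p" by (simp add: CHAR_poly_eq char_p)
  have "([:- 1, 1::'k:] + 1) ^ q = [:- 1, 1:] ^ q + 1 ^ q"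
    by (rule freshmans_dream'[where n = r]) (use prime_p r c in auto)
  moreover have "[:- 1, 1::'k:] + 1 = [:0, 1:]" by (simp add: one_pCons)
  ultimately show ?thesis by (simp add: algebra_simps)
qed

lemma tpow_q: "tpow q = \<zero>\<^bsub>R\<^esub>"
  using ev_t_power[of q] unfolding var_minus_one_power ev_diff ev_var_power ev_one g_pow_q one_R
  by (simp add: R.minus_self)

lemma tpow_ge_q: "e \<ge> q \<Longrightarrow> tpow e = \<zero>\<^bsub>R\<^esub>"
  using tpow_add[of q "e - q"] tpow_q by simp

text \<open>In characteristic \<open>p\<close> one has \<open>(X - 1)\<^sup>q\<^sup>-\<^sup>1 = (X\<^sup>q - 1) / (X - 1) = 1 + X + \<dots> + X\<^sup>q\<^sup>-\<^sup>1\<close>, so the power of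
  \<open>g - 1\<close> is the sum of the elements of \<open>C\<close>.\<close>

lemma tpow_q_minus_1: "tpow (q - 1) = (\<lambda>y. if y \<in> C then 1 else 0)"
proof -
  have "[:- 1, 1::'k:] * [:- 1, 1:] ^ (q - 1) = [:- 1, 1:] ^ q"
    using q_pos power_eq_if[of "[:- 1, 1::'k:]" q] by simp
  also have "\<dots> = [:0, 1:] ^ q - 1" by (rule var_minus_one_power)
  also have "\<dots> = ([:0, 1:] - 1) * (\<Sum>i<q. [:0, 1:] ^ i)" by (rule power_diff_1_eq)
  also have "[:0, 1::'k:] - 1 = [:- 1, 1:]" by (simp add: one_pCons)
  finally have "[:- 1, 1::'k:] * [:- 1, 1:] ^ (q - 1) = [:- 1, 1:] * (\<Sum>i<q. [:0, 1:] ^ i)" .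
  moreover have "[:- 1, 1::'k:] \<noteq> 0" by simp
  ultimately have "[:- 1, 1::'k:] ^ (q - 1) = (\<Sum>i<q. [:0, 1:] ^ i)"
    using mult_left_cancel by blast
  moreover have "ev (\<Sum>i<n. [:0, 1:] ^ i) y = (\<Sum>i<n. ga_single (g [^] i) 1 y)" for n y
  proof (induction n)
    case 0
    then show ?case by (auto simp: ev_def intro!: sum.neutral)
  next
    case (Suc n)
    then show ?case by (simp add: ev_add ev_var_power add_R)
  qed
  ultimately have e: "tpow (q - 1) y = (\<Sum>i<q. ga_single (g [^] i) 1 y)" for y
    using ev_t_power[of "q - 1"] by metis
  have "(\<Sum>i<q. ga_single (g [^] i) (1::'k) y) = (\<Sum>c\<in>C. ga_single c 1 y)" for y
    by (rule sum.reindex_bij_betw[OF C_pow])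
  moreover have "finite C" using C_subset finite_G finite_subset by blast
  ultimately show ?thesis unfolding fun_eq_iff e by (simp add: ga_single_def)
qed

lemma tpow_nonzero: "e < q \<Longrightarrow> tpow e \<noteq> \<zero>\<^bsub>R\<^esub>"
proof
  assume e: "e < q" and z: "tpow e = \<zero>\<^bsub>R\<^esub>"
  have "tpow (q - 1) = tpow e \<otimes>\<^bsub>R\<^esub> tpow (q - 1 - e)" using e by (simp add: tpow_add)
  then have "tpow (q - 1) = \<zero>\<^bsub>R\<^esub>" using z by simp
  then have "tpow (q - 1) g = 0" by (simp add: zero_R)
  then show False using g_C unfolding tpow_q_minus_1 by simp
qed

text \<open>An element annihilated by \<open>g - 1\<close> on the right is constant on the left cosets of \<open>C\<close>. The factor
  \<open>b\<close> takes the values of \<open>a\<close> on a set of representatives.\<close>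

lemma annihilator_t:
  assumes a: "a \<in> carrier R" "a \<otimes>\<^bsub>R\<^esub> t = \<zero>\<^bsub>R\<^esub>"
  shows "\<exists>b\<in>carrier R. a = b \<otimes>\<^bsub>R\<^esub> tpow (q - 1)"
proof -
  interpret C: normal C G by (rule C_normal)
  have "a \<otimes>\<^bsub>R\<^esub> ga_single g 1 \<ominus>\<^bsub>R\<^esub> a = \<zero>\<^bsub>R\<^esub>"
    using a by (simp add: t_def minus_one_R a_minus_def R.r_distr R.r_minus)
  then have ag: "a \<otimes>\<^bsub>R\<^esub> ga_single g 1 = a" using a by (simp add: R.minus_eq_zero_iff)
  have step: "a (y \<otimes> g) = a y" if "y \<in> carrier G" for y
    using mult_single_right[of g "y \<otimes> g" a 1] ag that by (simp add: m_assoc)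
  have pow: "a (y \<otimes> g [^] i) = a y" if "y \<in> carrier G" for y and i :: nat
  proof (induction i)
    case (Suc i)
    have "a (y \<otimes> g [^] Suc i) = a ((y \<otimes> g [^] i) \<otimes> g)" using that by (simp add: m_assoc)
    then show ?case using step[of "y \<otimes> g [^] i"] Suc that by simp
  qed (use that in simp)
  have const: "a y = a z" if yz: "y \<in> carrier G" "z \<in> carrier G" "inv z \<otimes> y \<in> C" for y z
  proof -
    obtain i :: nat where "inv z \<otimes> y = g [^] i" using yz(3) C_pow by (auto simp: bij_betw_def)
    then have "y = z \<otimes> g [^] i" using yz by (metis g_G inv_solve_left nat_pow_closed)
    then show ?thesis using pow yz by simp
  qed
  define rep where "rep y = (SOME z. z \<in> carrier G \<and> inv z \<otimes> y \<in> C)" for y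
  have rep: "rep y \<in> carrier G \<and> inv (rep y) \<otimes> y \<in> C" if "y \<in> carrier G" for y
    unfolding rep_def by (rule someI[of _ y]) (use that C.one_closed in simp)
  have rep_eq: "rep y = rep z" if yz: "y \<in> carrier G" "z \<in> carrier G" "inv z \<otimes> y \<in> C" for y z
  proof -
    have "inv w \<otimes> y \<in> C \<longleftrightarrow> inv w \<otimes> z \<in> C" if w: "w \<in> carrier G" for w
    proof -
      have 1: "inv w \<otimes> y = (inv w \<otimes> z) \<otimes> (inv z \<otimes> y)"
        using yz w by (simp add: m_assoc) (simp add: m_assoc[symmetric])
      have 2: "inv w \<otimes> z = (inv w \<otimes> y) \<otimes> inv (inv z \<otimes> y)"
        using yz w by (simp add: inv_mult_group m_assoc) (simp add: m_assoc[symmetric])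
      show ?thesis
      proof
        assume "inv w \<otimes> y \<in> C"
        then show "inv w \<otimes> z \<in> C" unfolding 2 by (rule C.m_closed[OF _ C.m_inv_closed[OF yz(3)]])
      next
        assume "inv w \<otimes> z \<in> C"
        then show "inv w \<otimes> y \<in> C" unfolding 1 by (rule C.m_closed[OF _ yz(3)])
      qed
    qed
    then have "(\<lambda>w. w \<in> carrier G \<and> inv w \<otimes> y \<in> C) = (\<lambda>w. w \<in> carrier G \<and> inv w \<otimes> z \<in> C)" by auto
    then show ?thesis by (simp add: rep_def)
  qed
  define b where "b y = (if y \<in> carrier G \<and> y = rep y then a y else 0)" for y
  have b: "b \<in> carrier R" by (auto simp: carrier_R b_def)
  have "a y = (b \<otimes>\<^bsub>R\<^esub> tpow (q - 1)) y" for y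
  proof (cases "y \<in> carrier G")
    case y: True
    have r: "rep y \<in> carrier G" "inv (rep y) \<otimes> y \<in> C" using rep[OF y] by auto
    have rr: "rep (rep y) = rep y" using rep_eq[OF y r(1) r(2)] by simp
    have "(b \<otimes>\<^bsub>R\<^esub> tpow (q - 1)) y = (\<Sum>z\<in>carrier G. b z * (if inv z \<otimes> y \<in> C then 1 else 0))"
      using y unfolding tpow_q_minus_1 by (simp add: mult_R)
    also have "\<dots> = (\<Sum>z\<in>carrier G. if z = rep y then a y else 0)"
    proof (rule sum.cong[OF refl])
      fix z assume z: "z \<in> carrier G"
      show "b z * (if inv z \<otimes> y \<in> C then 1 else 0) = (if z = rep y then a y else 0)"
      proof (cases "inv z \<otimes> y \<in> C")
        case True
        then show ?thesis using rep_eq[OF y z True] const[OF y z True] z by (auto simp: b_def)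
      next
        case False
        then show ?thesis using r by auto
      qed
    qed
    also have "\<dots> = a y" using r finite_G by simp
    finally show ?thesis ..
  next
    case False
    then show ?thesis using carrier_R_D[OF a(1)] by (simp add: mult_R)
  qed
  then show ?thesis using b by blast
qed

text \<open>Peel off one factor \<open>t\<close>: if \<open>a t\<^sup>e\<^sup>+\<^sup>1 = 0\<close>, then \<open>a t\<^sup>e = b t\<^sup>q\<^sup>-\<^sup>1\<close> for some \<open>b\<close>, and \<open>t\<^sup>e\<close> annihilates the
  difference of \<open>a\<close> and \<open>b t\<^sup>q\<^sup>-\<^sup>e\<^sup>-\<^sup>1\<close>.\<close>

lemma annihilator_tpow:
  assumes "e \<le> q" "a \<in> carrier R" "a \<otimes>\<^bsub>R\<^esub> tpow e = \<zero>\<^bsub>R\<^esub>"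
  shows "\<exists>b\<in>carrier R. a = b \<otimes>\<^bsub>R\<^esub> tpow (q - e)"
  using assms
proof (induction e arbitrary: a)
  case 0
  then show ?case by (intro bexI[of _ "\<zero>\<^bsub>R\<^esub>"]) simp_all
next
  case (Suc e)
  have "(a \<otimes>\<^bsub>R\<^esub> tpow e) \<otimes>\<^bsub>R\<^esub> t = \<zero>\<^bsub>R\<^esub>" using Suc.prems by (simp add: R.m_assoc)
  then obtain b where b: "b \<in> carrier R" "a \<otimes>\<^bsub>R\<^esub> tpow e = b \<otimes>\<^bsub>R\<^esub> tpow (q - 1)"
    using annihilator_t[of "a \<otimes>\<^bsub>R\<^esub> tpow e"] Suc.prems(2) by auto
  let ?c = "b \<otimes>\<^bsub>R\<^esub> tpow (q - Suc e)"
  have c: "?c \<in> carrier R" using b by simp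
  have "?c \<otimes>\<^bsub>R\<^esub> tpow e = b \<otimes>\<^bsub>R\<^esub> tpow (q - 1)"
    using Suc.prems(1) b(1) by (simp add: tpow_add')
  then have "(a \<ominus>\<^bsub>R\<^esub> ?c) \<otimes>\<^bsub>R\<^esub> tpow e = \<zero>\<^bsub>R\<^esub>"
    using Suc.prems(2) c b by (simp add: a_minus_def R.l_distr R.l_minus R.r_neg)
  then obtain d where d: "d \<in> carrier R" "a \<ominus>\<^bsub>R\<^esub> ?c = d \<otimes>\<^bsub>R\<^esub> tpow (q - e)"
    using Suc.IH[of "a \<ominus>\<^bsub>R\<^esub> ?c"] Suc.prems c by auto
  have "tpow (q - e) = t \<otimes>\<^bsub>R\<^esub> tpow (q - Suc e)"
    using Suc.prems(1) tpow_add[of 1 "q - Suc e"] by (simp add: Suc_diff_Suc)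
  then have "d \<otimes>\<^bsub>R\<^esub> tpow (q - e) = (d \<otimes>\<^bsub>R\<^esub> t) \<otimes>\<^bsub>R\<^esub> tpow (q - Suc e)"
    using d by (simp add: R.m_assoc)
  then have "a = (d \<otimes>\<^bsub>R\<^esub> t \<oplus>\<^bsub>R\<^esub> b) \<otimes>\<^bsub>R\<^esub> tpow (q - Suc e)"
    using R.diff_add_cancel[OF Suc.prems(2) c] d b by (simp add: R.l_distr)
  then show ?case using d b by (intro bexI[of _ "d \<otimes>\<^bsub>R\<^esub> t \<oplus>\<^bsub>R\<^esub> b"]) simp_all
qed

lemma annihilator_tpow_iff:
  assumes "e \<le> q" "a \<in> carrier R"
  shows "a \<otimes>\<^bsub>R\<^esub> tpow e = \<zero>\<^bsub>R\<^esub> \<longleftrightarrow> (\<exists>b\<in>carrier R. a = b \<otimes>\<^bsub>R\<^esub> tpow (q - e))"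
  using annihilator_tpow[OF assms] assms tpow_q by (auto simp: tpow_add')

subsection \<open>Normality\<close>

lemma power_minus_one:
  "\<exists>u\<in>carrier R. ga_single (g [^] (s::nat)) 1 \<ominus>\<^bsub>R\<^esub> \<one>\<^bsub>R\<^esub> = t \<otimes>\<^bsub>R\<^esub> u
     \<and> ga_single (g [^] s) 1 \<ominus>\<^bsub>R\<^esub> \<one>\<^bsub>R\<^esub> = u \<otimes>\<^bsub>R\<^esub> t"
proof (induction s)
  case 0
  then show ?case by (intro bexI[of _ "\<zero>\<^bsub>R\<^esub>"]) (simp_all add: one_R R.minus_self)
next
  case (Suc s)
  then obtain u where u: "u \<in> carrier R" "ga_single (g [^] s) 1 \<ominus>\<^bsub>R\<^esub> \<one>\<^bsub>R\<^esub> = t \<otimes>\<^bsub>R\<^esub> u"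
    "ga_single (g [^] s) 1 \<ominus>\<^bsub>R\<^esub> \<one>\<^bsub>R\<^esub> = u \<otimes>\<^bsub>R\<^esub> t" by blast
  let ?s = "ga_single (g [^] s) (1 :: 'k)" and ?g = "ga_single g (1::'k)"
  have gs: "g \<otimes> g [^] s = g [^] Suc s" using nat_pow_mult[of g 1 s] by simp
  have T: "t = ?g \<ominus>\<^bsub>R\<^esub> \<one>\<^bsub>R\<^esub>" by (simp add: t_def minus_one_R)
  have 1: "t \<otimes>\<^bsub>R\<^esub> ?s = ga_single (g [^] Suc s) 1 \<ominus>\<^bsub>R\<^esub> ?s"
    unfolding T by (simp add: a_minus_def R.l_distr R.l_minus single_mult gs del: nat_pow_Suc)
  have 2: "?s \<otimes>\<^bsub>R\<^esub> t = ga_single (g [^] Suc s) 1 \<ominus>\<^bsub>R\<^esub> ?s"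
    unfolding T by (simp add: a_minus_def R.r_distr R.r_minus single_mult)
  have 3: "ga_single (g [^] Suc s) (1::'k) \<ominus>\<^bsub>R\<^esub> \<one>\<^bsub>R\<^esub> =
      (ga_single (g [^] Suc s) 1 \<ominus>\<^bsub>R\<^esub> ?s) \<oplus>\<^bsub>R\<^esub> (?s \<ominus>\<^bsub>R\<^esub> \<one>\<^bsub>R\<^esub>)"
    by (rule ext) (simp add: add_R diff_R del: nat_pow_Suc)
  have "ga_single (g [^] Suc s) (1::'k) \<ominus>\<^bsub>R\<^esub> \<one>\<^bsub>R\<^esub> = t \<otimes>\<^bsub>R\<^esub> (?s \<oplus>\<^bsub>R\<^esub> u)"
    unfolding 3 1[symmetric] u(2) using u(1) by (simp add: R.r_distr)
  moreover have "ga_single (g [^] Suc s) (1::'k) \<ominus>\<^bsub>R\<^esub> \<one>\<^bsub>R\<^esub> = (?s \<oplus>\<^bsub>R\<^esub> u) \<otimes>\<^bsub>R\<^esub> t"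
    unfolding 3 2[symmetric] u(3) using u(1) by (simp add: R.l_distr)
  ultimately show ?case using u(1) by (intro bexI[of _ "?s \<oplus>\<^bsub>R\<^esub> u"]) auto
qed

text \<open>By normality \<open>x g x\<inverse>\<close> is a power of \<open>g\<close>, say \<open>g\<^sup>s\<close>, and \<open>x (g - 1) = (g\<^sup>s - 1) x\<close>, where \<open>g\<^sup>s - 1\<close> is a
  multiple of \<open>g - 1\<close>.\<close>

lemma t_swap_right:
  assumes "a \<in> carrier R"
  shows "\<exists>b\<in>carrier R. a \<otimes>\<^bsub>R\<^esub> t = t \<otimes>\<^bsub>R\<^esub> b"
  using assms
proof (induction a rule: R_induct)
  case zero
  then show ?case by (intro bexI[of _ "\<zero>\<^bsub>R\<^esub>"]) simp_all
next
  case (single x c)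
  interpret C: normal C G by (rule C_normal)
  have "x \<otimes> g \<otimes> inv x \<in> C" by (rule C.inv_op_closed2[OF single g_C])
  then obtain s :: nat where s: "x \<otimes> g \<otimes> inv x = g [^] s" using C_pow by (auto simp: bij_betw_def)
  have gx: "g [^] s \<otimes> x = x \<otimes> g" unfolding s[symmetric] using single by (simp add: m_assoc)
  obtain u where u: "u \<in> carrier R" "ga_single (g [^] s) 1 \<ominus>\<^bsub>R\<^esub> \<one>\<^bsub>R\<^esub> = t \<otimes>\<^bsub>R\<^esub> u"
    using power_minus_one[of s] by blast
  have "ga_single x c \<otimes>\<^bsub>R\<^esub> t = ga_single (x \<otimes> g) c \<ominus>\<^bsub>R\<^esub> ga_single x c"
    using single by (simp add: t_def minus_one_R a_minus_def R.r_distr R.r_minus single_mult)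
  also have "\<dots> = (ga_single (g [^] s) 1 \<ominus>\<^bsub>R\<^esub> \<one>\<^bsub>R\<^esub>) \<otimes>\<^bsub>R\<^esub> ga_single x c"
    using single by (simp add: a_minus_def R.l_distr R.l_minus single_mult gx)
  also have "\<dots> = t \<otimes>\<^bsub>R\<^esub> (u \<otimes>\<^bsub>R\<^esub> ga_single x c)" unfolding u(2) using u single by (simp add: R.m_assoc)
  finally show ?case using u single by (intro bexI[of _ "u \<otimes>\<^bsub>R\<^esub> ga_single x c"]) simp_all
next
  case (add a b)
  then obtain a' b' where "a' \<in> carrier R" "b' \<in> carrier R" "a \<otimes>\<^bsub>R\<^esub> t = t \<otimes>\<^bsub>R\<^esub> a'"
    "b \<otimes>\<^bsub>R\<^esub> t = t \<otimes>\<^bsub>R\<^esub> b'" by blast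
  then show ?case using add by (intro bexI[of _ "a' \<oplus>\<^bsub>R\<^esub> b'"]) (simp_all add: R.l_distr R.r_distr)
qed

lemma t_swap_left:
  assumes "a \<in> carrier R"
  shows "\<exists>b\<in>carrier R. t \<otimes>\<^bsub>R\<^esub> a = b \<otimes>\<^bsub>R\<^esub> t"
  using assms
proof (induction a rule: R_induct)
  case zero
  then show ?case by (intro bexI[of _ "\<zero>\<^bsub>R\<^esub>"]) simp_all
next
  case (single x c)
  interpret C: normal C G by (rule C_normal)
  have "inv x \<otimes> g \<otimes> x \<in> C" by (rule C.inv_op_closed1[OF single g_C])
  then obtain s :: nat where s: "inv x \<otimes> g \<otimes> x = g [^] s" using C_pow by (auto simp: bij_betw_def)
  have gx: "x \<otimes> g [^] s = g \<otimes> x" unfolding s[symmetric] using single by (simp add: m_assoc[symmetric])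
  obtain u where u: "u \<in> carrier R" "ga_single (g [^] s) 1 \<ominus>\<^bsub>R\<^esub> \<one>\<^bsub>R\<^esub> = u \<otimes>\<^bsub>R\<^esub> t"
    using power_minus_one[of s] by blast
  have "t \<otimes>\<^bsub>R\<^esub> ga_single x c = ga_single (g \<otimes> x) c \<ominus>\<^bsub>R\<^esub> ga_single x c"
    using single by (simp add: t_def minus_one_R a_minus_def R.l_distr R.l_minus single_mult)
  also have "\<dots> = ga_single x c \<otimes>\<^bsub>R\<^esub> (ga_single (g [^] s) 1 \<ominus>\<^bsub>R\<^esub> \<one>\<^bsub>R\<^esub>)"
    using single by (simp add: a_minus_def R.r_distr R.r_minus single_mult gx)
  also have "\<dots> = (ga_single x c \<otimes>\<^bsub>R\<^esub> u) \<otimes>\<^bsub>R\<^esub> t" unfolding u(2) using u single by (simp add: R.m_assoc)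
  finally show ?case using u single by (intro bexI[of _ "ga_single x c \<otimes>\<^bsub>R\<^esub> u"]) simp_all
next
  case (add a b)
  then obtain a' b' where "a' \<in> carrier R" "b' \<in> carrier R" "t \<otimes>\<^bsub>R\<^esub> a = a' \<otimes>\<^bsub>R\<^esub> t"
    "t \<otimes>\<^bsub>R\<^esub> b = b' \<otimes>\<^bsub>R\<^esub> t" by blast
  then show ?case using add by (intro bexI[of _ "a' \<oplus>\<^bsub>R\<^esub> b'"]) (simp_all add: R.l_distr R.r_distr)
qed

lemma tpow_swap_right:
  assumes "a \<in> carrier R"
  shows "\<exists>b\<in>carrier R. a \<otimes>\<^bsub>R\<^esub> tpow e = tpow e \<otimes>\<^bsub>R\<^esub> b"
proof (induction e)
  case 0
  then show ?case using assms by (intro bexI[of _ a]) simp_all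
next
  case (Suc e)
  then obtain b where b: "b \<in> carrier R" "a \<otimes>\<^bsub>R\<^esub> tpow e = tpow e \<otimes>\<^bsub>R\<^esub> b" by blast
  obtain c where c: "c \<in> carrier R" "b \<otimes>\<^bsub>R\<^esub> t = t \<otimes>\<^bsub>R\<^esub> c" using t_swap_right[OF b(1)] by blast
  have "a \<otimes>\<^bsub>R\<^esub> tpow (Suc e) = (a \<otimes>\<^bsub>R\<^esub> tpow e) \<otimes>\<^bsub>R\<^esub> t" using assms by (simp add: R.m_assoc)
  also have "\<dots> = tpow e \<otimes>\<^bsub>R\<^esub> (b \<otimes>\<^bsub>R\<^esub> t)" unfolding b(2) using b by (simp add: R.m_assoc)
  also have "\<dots> = tpow (Suc e) \<otimes>\<^bsub>R\<^esub> c" unfolding c(2) using c by (simp add: R.m_assoc)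
  finally show ?case using c by blast
qed

lemma tpow_swap_left:
  assumes "a \<in> carrier R"
  shows "\<exists>b\<in>carrier R. tpow e \<otimes>\<^bsub>R\<^esub> a = b \<otimes>\<^bsub>R\<^esub> tpow e"
  using assms
proof (induction e arbitrary: a)
  case 0
  then show ?case by (intro bexI[of _ a]) simp_all
next
  case (Suc e)
  obtain b where b: "b \<in> carrier R" "t \<otimes>\<^bsub>R\<^esub> a = b \<otimes>\<^bsub>R\<^esub> t" using t_swap_left[OF Suc.prems] by blast
  obtain c where c: "c \<in> carrier R" "tpow e \<otimes>\<^bsub>R\<^esub> b = c \<otimes>\<^bsub>R\<^esub> tpow e" using Suc.IH[OF b(1)] by blast
  have "tpow (Suc e) \<otimes>\<^bsub>R\<^esub> a = tpow e \<otimes>\<^bsub>R\<^esub> (t \<otimes>\<^bsub>R\<^esub> a)" using Suc.prems by (simp add: R.m_assoc)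
  also have "\<dots> = (tpow e \<otimes>\<^bsub>R\<^esub> b) \<otimes>\<^bsub>R\<^esub> t" unfolding b(2) using b by (simp add: R.m_assoc)
  also have "\<dots> = c \<otimes>\<^bsub>R\<^esub> tpow (Suc e)" unfolding c(2) using c by (simp add: R.m_assoc)
  finally show ?case using c by blast
qed

text \<open>If \<open>y t\<^sup>e = t\<^sup>e y'\<close> with \<open>y\<close> but not \<open>y'\<close> in the augmentation ideal, then \<open>y'\<close> is a unit and
  \<open>t\<^sup>e = y d t\<^sup>e\<close> for some \<open>d\<close>, where \<open>1 - y d\<close> is a unit. So \<open>t\<^sup>e = 0\<close>, and \<open>0\<close> can take the place
  of \<open>y'\<close>.\<close>

lemma J_swap_right:
  assumes y: "y \<in> J"
  shows "\<exists>y'\<in>J. y \<otimes>\<^bsub>R\<^esub> tpow e = tpow e \<otimes>\<^bsub>R\<^esub> y'"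
proof -
  have yR: "y \<in> carrier R" using y J_R by blast
  obtain y' where y': "y' \<in> carrier R" "y \<otimes>\<^bsub>R\<^esub> tpow e = tpow e \<otimes>\<^bsub>R\<^esub> y'"
    using tpow_swap_right[OF yR] by blast
  show ?thesis
  proof (cases "y' \<in> J")
    case False
    then obtain c where c: "c \<in> carrier R" "y' \<otimes>\<^bsub>R\<^esub> c = \<one>\<^bsub>R\<^esub>"
      using unit_if_aug_nonzero[OF y'(1)] y'(1) by (auto simp: J_def)
    obtain d where d: "d \<in> carrier R" "tpow e \<otimes>\<^bsub>R\<^esub> c = d \<otimes>\<^bsub>R\<^esub> tpow e" using tpow_swap_left[OF c(1)] by blast
    have "tpow e = (tpow e \<otimes>\<^bsub>R\<^esub> y') \<otimes>\<^bsub>R\<^esub> c" using y' c by (simp add: R.m_assoc)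
    also have "\<dots> = y \<otimes>\<^bsub>R\<^esub> (d \<otimes>\<^bsub>R\<^esub> tpow e)"
      unfolding y'(2)[symmetric] d(2)[symmetric] using yR c by (simp add: R.m_assoc)
    finally have e: "tpow e = (y \<otimes>\<^bsub>R\<^esub> d) \<otimes>\<^bsub>R\<^esub> tpow e" using yR d by (simp add: R.m_assoc)
    let ?z = "\<one>\<^bsub>R\<^esub> \<ominus>\<^bsub>R\<^esub> y \<otimes>\<^bsub>R\<^esub> d"
    have z: "?z \<in> carrier R" "aug ?z \<noteq> 0"
      using yR d y by (auto simp: aug_diff aug_one aug_mult J_def)
    obtain u where u: "u \<in> carrier R" "u \<otimes>\<^bsub>R\<^esub> ?z = \<one>\<^bsub>R\<^esub>" using unit_if_aug_nonzero[OF z] by blast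
    have "?z \<otimes>\<^bsub>R\<^esub> tpow e = \<zero>\<^bsub>R\<^esub>"
      using e yR d by (simp add: a_minus_def R.l_distr R.l_minus R.r_neg)
    then have "u \<otimes>\<^bsub>R\<^esub> (?z \<otimes>\<^bsub>R\<^esub> tpow e) = \<zero>\<^bsub>R\<^esub>" using u(1) by simp
    moreover have "u \<otimes>\<^bsub>R\<^esub> (?z \<otimes>\<^bsub>R\<^esub> tpow e) = (u \<otimes>\<^bsub>R\<^esub> ?z) \<otimes>\<^bsub>R\<^esub> tpow e"
      by (rule R.m_assoc[symmetric]) (use u(1) z(1) in simp_all)
    ultimately have "tpow e = \<zero>\<^bsub>R\<^esub>" unfolding u(2) by simp
    then show ?thesis using J_zero yR by (intro bexI[of _ "\<zero>\<^bsub>R\<^esub>"]) simp_all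
  qed (use y' in blast)
qed

lemma J_swap_left:
  assumes y: "y \<in> J"
  shows "\<exists>y'\<in>J. tpow e \<otimes>\<^bsub>R\<^esub> y = y' \<otimes>\<^bsub>R\<^esub> tpow e"
proof -
  have yR: "y \<in> carrier R" using y J_R by blast
  obtain y' where y': "y' \<in> carrier R" "tpow e \<otimes>\<^bsub>R\<^esub> y = y' \<otimes>\<^bsub>R\<^esub> tpow e"
    using tpow_swap_left[OF yR] by blast
  show ?thesis
  proof (cases "y' \<in> J")
    case False
    then obtain c where c: "c \<in> carrier R" "c \<otimes>\<^bsub>R\<^esub> y' = \<one>\<^bsub>R\<^esub>"
      using unit_if_aug_nonzero[OF y'(1)] y'(1) by (auto simp: J_def)
    obtain d where d: "d \<in> carrier R" "c \<otimes>\<^bsub>R\<^esub> tpow e = tpow e \<otimes>\<^bsub>R\<^esub> d" using tpow_swap_right[OF c(1)] by blast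
    have "tpow e = c \<otimes>\<^bsub>R\<^esub> (y' \<otimes>\<^bsub>R\<^esub> tpow e)" using y' c by (simp add: R.m_assoc[symmetric])
    also have "\<dots> = (tpow e \<otimes>\<^bsub>R\<^esub> d) \<otimes>\<^bsub>R\<^esub> y"
      unfolding y'(2)[symmetric] d(2)[symmetric] using yR c by (simp add: R.m_assoc)
    finally have e: "tpow e = tpow e \<otimes>\<^bsub>R\<^esub> (d \<otimes>\<^bsub>R\<^esub> y)" using yR d by (simp add: R.m_assoc)
    let ?z = "\<one>\<^bsub>R\<^esub> \<ominus>\<^bsub>R\<^esub> d \<otimes>\<^bsub>R\<^esub> y"
    have z: "?z \<in> carrier R" "aug ?z \<noteq> 0"
      using yR d y by (auto simp: aug_diff aug_one aug_mult J_def)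
    obtain u where u: "u \<in> carrier R" "?z \<otimes>\<^bsub>R\<^esub> u = \<one>\<^bsub>R\<^esub>" using unit_if_aug_nonzero[OF z] by blast
    have "tpow e \<otimes>\<^bsub>R\<^esub> ?z = \<zero>\<^bsub>R\<^esub>"
      using e yR d by (simp add: a_minus_def R.r_distr R.r_minus R.r_neg)
    then have "(tpow e \<otimes>\<^bsub>R\<^esub> ?z) \<otimes>\<^bsub>R\<^esub> u = \<zero>\<^bsub>R\<^esub>" using u(1) by simp
    moreover have "(tpow e \<otimes>\<^bsub>R\<^esub> ?z) \<otimes>\<^bsub>R\<^esub> u = tpow e \<otimes>\<^bsub>R\<^esub> (?z \<otimes>\<^bsub>R\<^esub> u)"
      by (rule R.m_assoc) (use u(1) z(1) in simp_all)
    ultimately have "tpow e = \<zero>\<^bsub>R\<^esub>" unfolding u(2) by simp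
    then show ?thesis using J_zero yR by (intro bexI[of _ "\<zero>\<^bsub>R\<^esub>"]) simp_all
  qed (use y' in blast)
qed

end

section \<open>The ideals generated by powers of \<open>g - 1\<close>\<close>

context cyclic_normal_subgroup
begin

abbreviation Nt :: "nat \<Rightarrow> ('g \<Rightarrow> 'k, 'g \<Rightarrow> 'k) module" where
  "Nt e \<equiv> principal_left_ideal R (tpow e)"

lemma Nt_eq: "Nt e = regR\<lparr>carrier := (\<lambda>b. b \<otimes>\<^bsub>R\<^esub> tpow e) ` carrier regR\<rparr>"
  by (simp add: principal_left_ideal_def Setcompr_eq_image)

lemma Nt_sel [simp]: "\<zero>\<^bsub>Nt e\<^esub> = \<zero>\<^bsub>R\<^esub>" "a \<oplus>\<^bsub>Nt e\<^esub> b = a \<oplus>\<^bsub>R\<^esub> b" "a \<odot>\<^bsub>Nt e\<^esub> b = a \<otimes>\<^bsub>R\<^esub> b"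
  by (simp_all add: Nt_eq)

lemma Nt_carrier: "a \<in> carrier (Nt e) \<longleftrightarrow> (\<exists>b\<in>carrier R. a = b \<otimes>\<^bsub>R\<^esub> tpow e)"
  by (auto simp: Nt_eq)

lemma Nt_R: "a \<in> carrier (Nt e) \<Longrightarrow> a \<in> carrier R"
  by (auto simp: Nt_carrier)

lemma mult_tpow_hom: "(\<lambda>b. b \<otimes>\<^bsub>R\<^esub> tpow e) \<in> lmod_hom R regR regR"
  by (rule lmod_homI) (auto simp: R.l_distr R.m_assoc)

lemma Nt_left_module: "left_module R (Nt e)"
  unfolding Nt_eq by (rule submodule_left_module[OF regR image_submodule[OF regR regR mult_tpow_hom]])

lemma mult_tpow_Nt: "(\<lambda>b. b \<otimes>\<^bsub>R\<^esub> tpow e) \<in> lmod_hom R regR (Nt e)"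
  by (rule lmod_homI) (auto simp: Nt_carrier R.l_distr R.m_assoc)

lemma mult_tpow_Nt_surj: "(\<lambda>b. b \<otimes>\<^bsub>R\<^esub> tpow e) ` carrier regR = carrier (Nt e)"
  by (simp add: Nt_eq)

lemma Nt_incl: "(\<lambda>a. a) \<in> lmod_hom R (Nt e) regR"
  by (rule lmod_homI) (auto dest: Nt_R)

lemma Nt_mult_right:
  assumes "a \<in> carrier (Nt e)" "y \<in> carrier R"
  shows "a \<otimes>\<^bsub>R\<^esub> y \<in> carrier (Nt e)"
proof -
  obtain b where b: "b \<in> carrier R" "a = b \<otimes>\<^bsub>R\<^esub> tpow e" using assms(1) by (auto simp: Nt_carrier)
  obtain y' where y': "y' \<in> carrier R" "tpow e \<otimes>\<^bsub>R\<^esub> y = y' \<otimes>\<^bsub>R\<^esub> tpow e"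
    using tpow_swap_left[OF assms(2)] by blast
  have "a \<otimes>\<^bsub>R\<^esub> y = b \<otimes>\<^bsub>R\<^esub> (tpow e \<otimes>\<^bsub>R\<^esub> y)" using b assms(2) by (simp add: R.m_assoc)
  also have "\<dots> = (b \<otimes>\<^bsub>R\<^esub> y') \<otimes>\<^bsub>R\<^esub> tpow e" unfolding y'(2) using b y' by (simp add: R.m_assoc)
  finally show ?thesis using b y' by (auto simp: Nt_carrier)
qed

lemma Nt_right_mult_hom:
  assumes "y \<in> carrier R"
  shows "(\<lambda>a. a \<otimes>\<^bsub>R\<^esub> y) \<in> lmod_hom R (Nt e) (Nt e)"
  using assms Nt_mult_right Nt_R by (intro lmod_homI) (auto simp: R.l_distr R.m_assoc)

lemma Nt_tpow: "tpow e \<in> carrier (Nt e)"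
  unfolding Nt_carrier by (intro bexI[of _ "\<one>\<^bsub>R\<^esub>"]) simp_all

lemma Nt_iff_annihilated:
  assumes "e \<le> q" "a \<in> carrier R"
  shows "a \<in> carrier (Nt e) \<longleftrightarrow> a \<otimes>\<^bsub>R\<^esub> tpow (q - e) = \<zero>\<^bsub>R\<^esub>"
  unfolding Nt_carrier using annihilator_tpow_iff[of "q - e" a] assms by simp

lemma into_regR_trace:
  assumes "left_module R A" "f \<in> lmod_hom R A regR"
  shows "trace_map A regR f"
  using trace_map_comp_right[OF assms(1) regR regR trace_map_id_reg assms(2)] .

lemma into_Nt_regR: "f \<in> lmod_hom R A (Nt e) \<Longrightarrow> f \<in> lmod_hom R A regR"
  using lmod_hom_comp[OF _ Nt_incl] .

text \<open>The key to the lower bound. If right multiplication by \<open>z\<close> on the ideal generated by \<open>t\<^sup>e\<close> is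
  a trace, it lifts along \<open>kG \<rightarrow> kG t\<^sup>e\<close> and extends to a map \<open>kG \<rightarrow> kG\<close>, that is, to right
  multiplication by some \<open>c\<close>, so that \<open>t\<^sup>e z = t\<^sup>e c t\<^sup>e\<close> is a multiple of \<open>t\<^sup>2\<^sup>e\<close>.\<close>

lemma right_mult_trace_zero:
  assumes e: "q \<le> 2 * e" and z: "z \<in> carrier R" and tm: "trace_map (Nt e) (Nt e) (\<lambda>a. a \<otimes>\<^bsub>R\<^esub> z)"
  shows "tpow e \<otimes>\<^bsub>R\<^esub> z = \<zero>\<^bsub>R\<^esub>"
proof -
  obtain F where F: "F \<in> lmod_hom R (Nt e) regR" "trace_map (Nt e) regR F"
    "\<And>a. a \<in> carrier (Nt e) \<Longrightarrow> F a \<otimes>\<^bsub>R\<^esub> tpow e = a \<otimes>\<^bsub>R\<^esub> z"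
    using trace_map_lift[OF regR Nt_left_module Nt_left_module mult_tpow_Nt mult_tpow_Nt_surj tm] by blast
  have "inj_on (\<lambda>a. a) (carrier (Nt e))" by simp
  then obtain F' where F': "F' \<in> lmod_hom R regR regR" "\<And>a. a \<in> carrier (Nt e) \<Longrightarrow> F' a = F a"
    using trace_map_extend[OF Nt_left_module regR regR Nt_incl _ F(2)] by blast
  define c where "c = F' \<one>\<^bsub>R\<^esub>"
  have c: "c \<in> carrier R" using lmod_hom_closed[OF F'(1), of "\<one>\<^bsub>R\<^esub>"] by (simp add: c_def)
  have "F' (tpow e \<odot>\<^bsub>regR\<^esub> \<one>\<^bsub>R\<^esub>) = tpow e \<odot>\<^bsub>regR\<^esub> c"
    unfolding c_def by (rule lmod_hom_smult[OF F'(1)]) simp_all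
  then have "F (tpow e) = tpow e \<otimes>\<^bsub>R\<^esub> c" using F'(2)[OF Nt_tpow] by simp
  then have "tpow e \<otimes>\<^bsub>R\<^esub> z = (tpow e \<otimes>\<^bsub>R\<^esub> c) \<otimes>\<^bsub>R\<^esub> tpow e" using F(3)[OF Nt_tpow] by simp
  also obtain d where d: "d \<in> carrier R" "tpow e \<otimes>\<^bsub>R\<^esub> c = d \<otimes>\<^bsub>R\<^esub> tpow e"
    using tpow_swap_left[OF c] by blast
  have "(tpow e \<otimes>\<^bsub>R\<^esub> c) \<otimes>\<^bsub>R\<^esub> tpow e = \<zero>\<^bsub>R\<^esub>"
    unfolding d(2) tpow_add'[OF d(1)] using e d(1) by (simp add: tpow_ge_q)
  finally show ?thesis .
qed

lemma ideal_power_swap: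
  assumes "a \<in> ideal_power R J n"
  shows "\<exists>b\<in>ideal_power R J n. a \<otimes>\<^bsub>R\<^esub> tpow e = tpow e \<otimes>\<^bsub>R\<^esub> b"
  using assms
proof (induction n arbitrary: a)
  case 0
  then show ?case using tpow_swap_right by (simp add: ideal_power_def)
next
  case (Suc n)
  from Suc.prems have "a \<in> ideal_prod R J (ideal_power R J n)" by (simp add: ideal_power_Suc)
  then show ?case
    unfolding ideal_power_Suc
  proof induction
    case (prod i j)
    have ij: "i \<in> carrier R" "j \<in> carrier R" using prod J_R ideal_power_J_R by auto
    obtain j' where j': "j' \<in> ideal_power R J n" "j \<otimes>\<^bsub>R\<^esub> tpow e = tpow e \<otimes>\<^bsub>R\<^esub> j'"
      using Suc.IH[OF prod(2)] by blast
    obtain i' where i': "i' \<in> J" "i \<otimes>\<^bsub>R\<^esub> tpow e = tpow e \<otimes>\<^bsub>R\<^esub> i'" using J_swap_right[OF prod(1)] by blast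
    have ij': "i' \<in> carrier R" "j' \<in> carrier R" using i' j' J_R ideal_power_J_R by auto
    have "(i \<otimes>\<^bsub>R\<^esub> j) \<otimes>\<^bsub>R\<^esub> tpow e = i \<otimes>\<^bsub>R\<^esub> (j \<otimes>\<^bsub>R\<^esub> tpow e)" using ij by (simp add: R.m_assoc)
    also have "\<dots> = (i \<otimes>\<^bsub>R\<^esub> tpow e) \<otimes>\<^bsub>R\<^esub> j'" unfolding j'(2) using ij ij' by (simp add: R.m_assoc)
    also have "\<dots> = tpow e \<otimes>\<^bsub>R\<^esub> (i' \<otimes>\<^bsub>R\<^esub> j')" unfolding i'(2) using ij' by (simp add: R.m_assoc)
    finally show ?case using ideal_prod.prod[OF i'(1) j'(1)] by blast
  next
    case (sum a b)
    then obtain a' b' where ab: "a' \<in> ideal_prod R J (ideal_power R J n)" "b' \<in> ideal_prod R J (ideal_power R J n)"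
      "a \<otimes>\<^bsub>R\<^esub> tpow e = tpow e \<otimes>\<^bsub>R\<^esub> a'" "b \<otimes>\<^bsub>R\<^esub> tpow e = tpow e \<otimes>\<^bsub>R\<^esub> b'" by blast
    have "a \<in> carrier R" "b \<in> carrier R" "a' \<in> carrier R" "b' \<in> carrier R"
      using sum(1,2) ab(1,2) ideal_power_J_R[of "Suc n"] by (auto simp: ideal_power_Suc)
    then show ?case using ab ideal_prod.sum[OF ab(1,2)] by (intro bexI[of _ "a' \<oplus>\<^bsub>R\<^esub> b'"]) (simp_all add: R.l_distr R.r_distr)
  qed
qed

text \<open>The products themselves, without their sums: these are the elements by which right multiplication
  is a composite of ghosts.\<close>

fun J_products :: "nat \<Rightarrow> ('g \<Rightarrow> 'k) set" where
  "J_products 0 = {\<one>\<^bsub>R\<^esub>}"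
| "J_products (Suc n) = {y \<otimes>\<^bsub>R\<^esub> z | y z. y \<in> J \<and> z \<in> J_products n}"

lemma J_products_R: "z \<in> J_products n \<Longrightarrow> z \<in> carrier R"
  by (induction n arbitrary: z) (auto dest: J_R)

lemma ideal_power_annihilates_if:
  assumes "u \<in> carrier R" "\<And>z. z \<in> J_products n \<Longrightarrow> u \<otimes>\<^bsub>R\<^esub> z = \<zero>\<^bsub>R\<^esub>" "a \<in> ideal_power R J n"
  shows "u \<otimes>\<^bsub>R\<^esub> a = \<zero>\<^bsub>R\<^esub>"
  using assms
proof (induction n arbitrary: u a)
  case 0
  then have "u = \<zero>\<^bsub>R\<^esub>" by simp
  then show ?case using 0 by (simp add: ideal_power_def)
next
  case (Suc n)
  from Suc.prems(3) have "a \<in> ideal_prod R J (ideal_power R J n)" by (simp add: ideal_power_Suc)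
  then show ?case
  proof induction
    case (prod i j)
    have ij: "i \<in> carrier R" "j \<in> carrier R" using prod J_R ideal_power_J_R by auto
    have "(u \<otimes>\<^bsub>R\<^esub> i) \<otimes>\<^bsub>R\<^esub> j = \<zero>\<^bsub>R\<^esub>"
    proof (rule Suc.IH[OF _ _ prod(2)])
      fix z assume z: "z \<in> J_products n"
      then have "u \<otimes>\<^bsub>R\<^esub> (i \<otimes>\<^bsub>R\<^esub> z) = \<zero>\<^bsub>R\<^esub>" using Suc.prems(2)[of "i \<otimes>\<^bsub>R\<^esub> z"] prod(1) by auto
      then show "(u \<otimes>\<^bsub>R\<^esub> i) \<otimes>\<^bsub>R\<^esub> z = \<zero>\<^bsub>R\<^esub>" using Suc.prems(1) ij J_products_R[OF z] by (simp add: R.m_assoc)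
    qed (use Suc.prems(1) ij in simp)
    then show ?case using Suc.prems(1) ij by (simp add: R.m_assoc)
  next
    case (sum a b)
    then have "a \<in> carrier R" "b \<in> carrier R"
      using ideal_power_J_R[of "Suc n"] by (auto simp: ideal_power_Suc)
    then show ?case using sum Suc.prems(1) by (simp add: R.r_distr)
  qed
qed

end

locale cyclic_normal_universe = cyclic_normal_subgroup G R p C g q + p_group_universe G R p U
  for G :: "('g, 'x) monoid_scheme" (structure) and R :: "('g \<Rightarrow> 'k::field) ring" and p :: nat
    and C :: "'g set" and g :: 'g and q :: nat and U :: "'u itself"
begin

lemma fixed_if_iso_trivial:
  fixes A :: "('g \<Rightarrow> 'k, 'u) module"
  assumes A: "left_module R A" and \<psi>: "\<psi> \<in> lmod_iso R A (trivial_module G)" and m: "m \<in> carrier A"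
  shows "fixed A m"
  unfolding fixed_def
proof (intro conjI ballI m)
  interpret A: left_module R A by (rule A)
  fix a assume a: "a \<in> carrier R"
  have "\<psi> (a \<odot>\<^bsub>A\<^esub> m) = aug a * \<psi> m"
    using lmod_hom_smult[OF lmod_isoD(1)[OF \<psi>] a m] by (simp add: trivial_module_def aug_def)
  moreover have "\<psi> (ga_single \<one> (aug a) \<odot>\<^bsub>A\<^esub> m) = aug (ga_single \<one> (aug a)) * \<psi> m"
    using lmod_hom_smult[OF lmod_isoD(1)[OF \<psi>] _ m, of "ga_single \<one> (aug a)"]
    by (simp add: trivial_module_def aug_def)
  ultimately have "\<psi> (a \<odot>\<^bsub>A\<^esub> m) = \<psi> (ga_single \<one> (aug a) \<odot>\<^bsub>A\<^esub> m)" by (simp add: aug_single)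
  then show "a \<odot>\<^bsub>A\<^esub> m = ga_single \<one> (aug a) \<odot>\<^bsub>A\<^esub> m"
    using a m by (intro inj_onD[OF lmod_isoD(3)[OF \<psi>]]) (auto intro!: A.smult_closed)
qed

text \<open>A map \<open>k \<rightarrow> kG t\<^sup>e\<close> has image in the socle, which is annihilated by the augmentation ideal. The other
  desuspensions follow by dimension shifting: \<open>kG t\<^sup>e\<close> and \<open>kG t\<^sup>q\<^sup>-\<^sup>e\<close> are syzygies of each other, by the
  exact sequence \<open>kG t\<^sup>e \<rightarrow> kG \<rightarrow> kG t\<^sup>q\<^sup>-\<^sup>e\<close>, and right multiplication by \<open>y\<close> corresponds under this shift
  to right multiplication by some \<open>y'\<close> in the augmentation ideal.\<close>

lemma right_mult_ghost_Nt:
  fixes A :: "('g \<Rightarrow> 'k, 'u) module"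
  assumes "omega_trivial G i A" "e \<le> q" "y \<in> J" "h \<in> lmod_hom R A (Nt e)"
  shows "trace_map A (Nt e) (\<lambda>m. h m \<otimes>\<^bsub>R\<^esub> y)"
  using assms
proof (induction arbitrary: e y h rule: omega_trivial.induct)
  case (omega_zero A)
  have A: "left_module R A" and "lmod_iso R A (trivial_module G) \<noteq> {}"
    using omega_zero(1,2) by (simp_all add: R_def)
  then obtain \<psi> where \<psi>: "\<psi> \<in> lmod_iso R A (trivial_module G)" by blast
  show ?case
  proof (rule trace_map_cong[OF trace_map_zero[OF A Nt_left_module]])
    fix m assume m: "m \<in> carrier A"
    have f: "fixed A m" by (rule fixed_if_iso_trivial[OF A \<psi> m])
    have "fixed regR (h m)"
      unfolding fixed_def
    proof (intro conjI ballI)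
      show "h m \<in> carrier regR" using lmod_hom_closed[OF omega_zero(5) m] Nt_R by simp
      fix a assume a: "a \<in> carrier R"
      have "h (a \<odot>\<^bsub>A\<^esub> m) = h (ga_single \<one> (aug a) \<odot>\<^bsub>A\<^esub> m)" using fixed_smult[OF f a] by simp
      then show "a \<odot>\<^bsub>regR\<^esub> h m = ga_single \<one> (aug a) \<odot>\<^bsub>regR\<^esub> h m"
        using a m by (simp add: lmod_hom_smult[OF omega_zero(5)])
    qed
    then show "\<zero>\<^bsub>Nt e\<^esub> = h m \<otimes>\<^bsub>R\<^esub> y" using fixed_regular_mult_J omega_zero(4) by simp
  qed
next
  case (omega_succ i A B)
  note h = omega_succ.prems(3) and y = omega_succ.prems(2) and e = omega_succ.prems(1)
  have "syzygy R B A" using omega_succ(2) by (simp add: R_def)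
  then obtain P :: "('g \<Rightarrow> 'k, 'u) module" and j s where P: "trace_map P P (\<lambda>x. x)"
    and se: "short_exact R B j P s A"
    unfolding syzygy_def projective_iff by blast
  note se = short_exactD[OF se]
  interpret A: left_module R A by (rule se)
  interpret B: left_module R B by (rule se)
  interpret P: left_module R P by (rule se)
  interpret L: left_module R regR by (rule regR)
  have hR: "h \<in> lmod_hom R B regR" by (rule into_Nt_regR[OF h])
  \<comment> \<open>Extend \<open>h\<close> to \<open>P\<close>. Followed by multiplication with \<open>t\<^sup>q\<^sup>-\<^sup>e\<close>, the extension vanishes on \<open>B\<close> and
    descends to \<open>A\<close>.\<close>
  obtain h' where h': "h' \<in> lmod_hom R P regR" "\<And>b. b \<in> carrier B \<Longrightarrow> h' (j b) = h b"
    using trace_map_extend[OF se(1,2) regR se(4,6) into_regR_trace[OF se(1) hR]] by blast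
  have h'R: "h' x \<in> carrier R" if "x \<in> carrier P" for x using lmod_hom_closed[OF h'(1) that] by simp
  let ?d = "q - e"
  have f: "(\<lambda>x. h' x \<otimes>\<^bsub>R\<^esub> tpow ?d) \<in> lmod_hom R P (Nt ?d)" by (rule lmod_hom_comp[OF h'(1) mult_tpow_Nt])
  have k: "h' x \<otimes>\<^bsub>R\<^esub> tpow ?d = \<zero>\<^bsub>Nt ?d\<^esub>" if x: "x \<in> carrier P" "s x = \<zero>\<^bsub>A\<^esub>" for x
  proof -
    have "x \<in> j ` carrier B" unfolding se(8) using x by simp
    then obtain b where b: "b \<in> carrier B" "x = j b" by auto
    have hb: "h b \<in> carrier (Nt e)" using lmod_hom_closed[OF h b(1)] .
    show ?thesis using b h'(2) Nt_iff_annihilated[OF e Nt_R[OF hb]] hb by simp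
  qed
  obtain h2 where h2: "h2 \<in> lmod_hom R A (Nt ?d)" "\<And>x. x \<in> carrier P \<Longrightarrow> h2 (s x) = h' x \<otimes>\<^bsub>R\<^esub> tpow ?d"
    using factor_through_surjection[OF se(2,3) Nt_left_module se(5,7) f k] by blast
  obtain y' where y': "y' \<in> J" "y \<otimes>\<^bsub>R\<^esub> tpow ?d = tpow ?d \<otimes>\<^bsub>R\<^esub> y'" using J_swap_right[OF y] by blast
  have yR: "y \<in> carrier R" "y' \<in> carrier R" using y y' J_R by auto
  have tm: "trace_map A (Nt ?d) (\<lambda>m. h2 m \<otimes>\<^bsub>R\<^esub> y')"
    by (rule omega_succ.IH[OF _ y'(1) h2(1)]) simp
  obtain E where E: "E \<in> lmod_hom R A regR" "\<And>m. m \<in> carrier A \<Longrightarrow> E m \<otimes>\<^bsub>R\<^esub> tpow ?d = h2 m \<otimes>\<^bsub>R\<^esub> y'"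
    using trace_map_lift[OF regR Nt_left_module se(3) mult_tpow_Nt mult_tpow_Nt_surj tm] by blast
  have ry: "(\<lambda>a. a \<otimes>\<^bsub>R\<^esub> y) \<in> lmod_hom R regR regR"
    using yR by (intro lmod_homI) (auto simp: R.l_distr R.m_assoc)
  \<comment> \<open>Multiplication by \<open>t\<^sup>q\<^sup>-\<^sup>e\<close> makes the two terms equal, so the difference has values in \<open>kG t\<^sup>e\<close>; on
    \<open>B\<close> it is \<open>h y\<close>.\<close>
  let ?F = "\<lambda>x. h' x \<otimes>\<^bsub>R\<^esub> y \<ominus>\<^bsub>R\<^esub> E (s x)"
  have minus: "a \<ominus>\<^bsub>regR\<^esub> b = a \<ominus>\<^bsub>R\<^esub> b" if "a \<in> carrier R" "b \<in> carrier R" for a b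
  proof -
    have "\<ominus>\<^bsub>regR\<^esub> b = \<ominus>\<^bsub>R\<^esub> b" by (rule L.M.minus_equality) (use that in \<open>simp_all add: R.l_neg\<close>)
    then show ?thesis by (simp add: a_minus_def)
  qed
  have sP: "s x \<in> carrier A" if "x \<in> carrier P" for x using lmod_hom_closed[OF se(5) that] .
  have ER: "E m \<in> carrier R" if "m \<in> carrier A" for m using lmod_hom_closed[OF E(1) that] by simp
  have "(\<lambda>x. h' x \<otimes>\<^bsub>R\<^esub> y \<ominus>\<^bsub>regR\<^esub> E (s x)) \<in> lmod_hom R P regR"
    by (intro lmod_hom_diff_fun[OF regR] lmod_hom_comp[OF h'(1) ry] lmod_hom_comp[OF se(5) E(1)])
  then have F: "?F \<in> lmod_hom R P regR"
    by (rule lmod_hom_cong[OF se(2)]) (use minus h'R yR ER sP in simp)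
  have FN: "?F x \<in> carrier (Nt e)" if x: "x \<in> carrier P" for x
  proof -
    have FR: "?F x \<in> carrier R" using lmod_hom_closed[OF F x] by simp
    have "?F x \<otimes>\<^bsub>R\<^esub> tpow ?d = (h' x \<otimes>\<^bsub>R\<^esub> y) \<otimes>\<^bsub>R\<^esub> tpow ?d \<ominus>\<^bsub>R\<^esub> E (s x) \<otimes>\<^bsub>R\<^esub> tpow ?d"
      using h'R[OF x] yR ER[OF sP[OF x]] by (simp add: a_minus_def R.l_distr R.l_minus)
    also have "(h' x \<otimes>\<^bsub>R\<^esub> y) \<otimes>\<^bsub>R\<^esub> tpow ?d = (h' x \<otimes>\<^bsub>R\<^esub> tpow ?d) \<otimes>\<^bsub>R\<^esub> y'"
      using h'R[OF x] yR y'(2) by (simp add: R.m_assoc)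
    also have "E (s x) \<otimes>\<^bsub>R\<^esub> tpow ?d = (h' x \<otimes>\<^bsub>R\<^esub> tpow ?d) \<otimes>\<^bsub>R\<^esub> y'"
      using E(2)[OF sP[OF x]] h2(2)[OF x] by simp
    also have "(h' x \<otimes>\<^bsub>R\<^esub> tpow ?d) \<otimes>\<^bsub>R\<^esub> y' \<ominus>\<^bsub>R\<^esub> (h' x \<otimes>\<^bsub>R\<^esub> tpow ?d) \<otimes>\<^bsub>R\<^esub> y' = \<zero>\<^bsub>R\<^esub>"
      using h'R[OF x] yR by (simp add: R.minus_self)
    finally show ?thesis using Nt_iff_annihilated[OF e FR] by simp
  qed
  have F': "?F \<in> lmod_hom R P (Nt e)"
    using FN lmod_hom_add[OF F] lmod_hom_smult[OF F] by (intro lmod_homI) auto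
  have "trace_map B (Nt e) (\<lambda>b. ?F (j b))"
    by (rule trace_map_comp_right[OF se(1,2) Nt_left_module trace_map_comp_left[OF se(2,2) Nt_left_module P F'] se(4)])
  then show ?case
  proof (rule trace_map_cong)
    fix b assume b: "b \<in> carrier B"
    have "j b \<in> j ` carrier B" using b by simp
    then have "s (j b) = \<zero>\<^bsub>A\<^esub>" unfolding se(8) by simp
    then have "E (s (j b)) = \<zero>\<^bsub>R\<^esub>" using lmod_hom_zero[OF A.M.abelian_group_axioms L.M.abelian_group_axioms E(1)] by simp
    moreover have "h b \<otimes>\<^bsub>R\<^esub> y \<in> carrier R" using lmod_hom_closed[OF hR b] yR by simp
    ultimately show "?F (j b) = h b \<otimes>\<^bsub>R\<^esub> y" using h'(2)[OF b] R.add_diff_cancel_right[of "h b \<otimes>\<^bsub>R\<^esub> y" "\<zero>\<^bsub>R\<^esub>"] by simp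
  qed
next
  case (omega_pred i A B)
  note h = omega_pred.prems(3) and y = omega_pred.prems(2) and e = omega_pred.prems(1)
  have "syzygy R A B" using omega_pred(2) by (simp add: R_def)
  then obtain P :: "('g \<Rightarrow> 'k, 'u) module" and j s where P: "trace_map P P (\<lambda>x. x)"
    and se: "short_exact R A j P s B"
    unfolding syzygy_def projective_iff by blast
  note se = short_exactD[OF se]
  interpret A: left_module R A by (rule se)
  interpret B: left_module R B by (rule se)
  interpret P: left_module R P by (rule se)
  interpret L: left_module R regR by (rule regR)
  interpret N: left_module R "Nt e" by (rule Nt_left_module)
  let ?d = "q - e"
  have hs: "(\<lambda>x. h (s x)) \<in> lmod_hom R P (Nt e)" by (rule lmod_hom_comp[OF se(5) h])
  have ths: "trace_map P (Nt e) (\<lambda>x. h (s x))" by (rule trace_map_comp_left[OF se(2,2) Nt_left_module P hs])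
  \<comment> \<open>Lift \<open>h s\<close> along multiplication by \<open>t\<^sup>e\<close>. On \<open>A\<close> the lift has values in \<open>kG t\<^sup>q\<^sup>-\<^sup>e\<close>.\<close>
  obtain h' where h': "h' \<in> lmod_hom R P regR" "\<And>x. x \<in> carrier P \<Longrightarrow> h' x \<otimes>\<^bsub>R\<^esub> tpow e = h (s x)"
    using trace_map_lift[OF regR Nt_left_module se(2) mult_tpow_Nt mult_tpow_Nt_surj ths] by blast
  have h'R: "h' x \<in> carrier R" if "x \<in> carrier P" for x using lmod_hom_closed[OF h'(1) that] by simp
  have jP: "j a \<in> carrier P" if "a \<in> carrier A" for a using lmod_hom_closed[OF se(4) that] .
  have sj: "s (j a) = \<zero>\<^bsub>B\<^esub>" if "a \<in> carrier A" for a
  proof -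
    have "j a \<in> j ` carrier A" using that by simp
    then show ?thesis unfolding se(8) by simp
  qed
  have h0: "h \<zero>\<^bsub>B\<^esub> = \<zero>\<^bsub>R\<^esub>" using lmod_hom_zero[OF B.M.abelian_group_axioms N.M.abelian_group_axioms h] by simp
  have dd: "?d \<le> q" "q - ?d = e" using e by auto
  have h2N: "h' (j a) \<in> carrier (Nt ?d)" if a: "a \<in> carrier A" for a
    using Nt_iff_annihilated[OF dd(1) h'R[OF jP[OF a]]] h'(2)[OF jP[OF a]] sj[OF a] h0 dd(2) by simp
  have hj: "(\<lambda>a. h' (j a)) \<in> lmod_hom R A regR" by (rule lmod_hom_comp[OF se(4) h'(1)])
  have h2: "(\<lambda>a. h' (j a)) \<in> lmod_hom R A (Nt ?d)"
    using h2N lmod_hom_add[OF hj] lmod_hom_smult[OF hj] by (intro lmod_homI) auto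
  obtain y' where y': "y' \<in> J" "tpow e \<otimes>\<^bsub>R\<^esub> y = y' \<otimes>\<^bsub>R\<^esub> tpow e" using J_swap_left[OF y] by blast
  have yR: "y \<in> carrier R" "y' \<in> carrier R" using y y' J_R by auto
  have tm: "trace_map A (Nt ?d) (\<lambda>a. h' (j a) \<otimes>\<^bsub>R\<^esub> y')"
    by (rule omega_pred.IH[OF dd(1) y'(1) h2])
  obtain E where E: "E \<in> lmod_hom R P (Nt ?d)" "\<And>a. a \<in> carrier A \<Longrightarrow> E (j a) = h' (j a) \<otimes>\<^bsub>R\<^esub> y'"
    using trace_map_extend[OF se(1,2) Nt_left_module se(4,6) tm] by blast
  have ER: "E x \<in> carrier R" if "x \<in> carrier P" for x using lmod_hom_closed[OF E(1) that] Nt_R by simp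
  have E0: "E x \<otimes>\<^bsub>R\<^esub> tpow e = \<zero>\<^bsub>R\<^esub>" if "x \<in> carrier P" for x
    using Nt_iff_annihilated[OF dd(1) ER[OF that]] lmod_hom_closed[OF E(1) that] dd(2) by simp
  have ry: "(\<lambda>a. a \<otimes>\<^bsub>R\<^esub> y') \<in> lmod_hom R regR regR"
    using yR by (intro lmod_homI) (auto simp: R.l_distr R.m_assoc)
  \<comment> \<open>The difference vanishes on \<open>A\<close> and descends to \<open>B\<close>; multiplication by \<open>t\<^sup>e\<close> kills its second term.\<close>
  let ?F = "\<lambda>x. h' x \<otimes>\<^bsub>R\<^esub> y' \<ominus>\<^bsub>R\<^esub> E x"
  have minus: "a \<ominus>\<^bsub>regR\<^esub> b = a \<ominus>\<^bsub>R\<^esub> b" if "a \<in> carrier R" "b \<in> carrier R" for a b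
  proof -
    have "\<ominus>\<^bsub>regR\<^esub> b = \<ominus>\<^bsub>R\<^esub> b" by (rule L.M.minus_equality) (use that in \<open>simp_all add: R.l_neg\<close>)
    then show ?thesis by (simp add: a_minus_def)
  qed
  have "(\<lambda>x. h' x \<otimes>\<^bsub>R\<^esub> y' \<ominus>\<^bsub>regR\<^esub> E x) \<in> lmod_hom R P regR"
    by (intro lmod_hom_diff_fun[OF regR] lmod_hom_comp[OF h'(1) ry] into_Nt_regR[OF E(1)])
  then have F: "?F \<in> lmod_hom R P regR"
    by (rule lmod_hom_cong[OF se(2)]) (use minus h'R yR ER in simp)
  have Fk: "?F x = \<zero>\<^bsub>regR\<^esub>" if x: "x \<in> carrier P" "s x = \<zero>\<^bsub>B\<^esub>" for x
  proof -
    have "x \<in> j ` carrier A" unfolding se(8) using x by simp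
    then obtain a where a: "a \<in> carrier A" "x = j a" by auto
    then show ?thesis using E(2)[OF a(1)] h'R[OF x(1)] yR by (simp add: R.minus_self)
  qed
  obtain f where f: "f \<in> lmod_hom R B regR" "\<And>x. x \<in> carrier P \<Longrightarrow> f (s x) = ?F x"
    using factor_through_surjection[OF se(2,3) regR se(5,7) F Fk] by blast
  have "trace_map B (Nt e) (\<lambda>b. f b \<otimes>\<^bsub>R\<^esub> tpow e)"
    by (rule trace_map_comp_left[OF se(3) regR Nt_left_module into_regR_trace[OF se(3) f(1)] mult_tpow_Nt])
  then show ?case
  proof (rule trace_map_cong)
    fix b assume "b \<in> carrier B"
    then obtain x where x: "x \<in> carrier P" "b = s x" using se(7) by auto
    have "f b \<otimes>\<^bsub>R\<^esub> tpow e = (h' x \<otimes>\<^bsub>R\<^esub> y') \<otimes>\<^bsub>R\<^esub> tpow e \<ominus>\<^bsub>R\<^esub> E x \<otimes>\<^bsub>R\<^esub> tpow e"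
      using f(2)[OF x(1)] x h'R[OF x(1)] yR ER[OF x(1)] by (simp add: a_minus_def R.l_distr R.l_minus)
    also have "\<dots> = (h' x \<otimes>\<^bsub>R\<^esub> y') \<otimes>\<^bsub>R\<^esub> tpow e"
      using E0[OF x(1)] h'R[OF x(1)] yR
        R.add_diff_cancel_right[of "(h' x \<otimes>\<^bsub>R\<^esub> y') \<otimes>\<^bsub>R\<^esub> tpow e" "\<zero>\<^bsub>R\<^esub>"] by simp
    also have "\<dots> = (h' x \<otimes>\<^bsub>R\<^esub> tpow e) \<otimes>\<^bsub>R\<^esub> y" using h'R[OF x(1)] yR y'(2) by (simp add: R.m_assoc)
    also have "\<dots> = h b \<otimes>\<^bsub>R\<^esub> y" using h'(2)[OF x(1)] x by simp
    finally show "f b \<otimes>\<^bsub>R\<^esub> tpow e = h b \<otimes>\<^bsub>R\<^esub> y" .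
  qed
qed

context
  fixes M :: "('g \<Rightarrow> 'k, 'u) module" and \<phi> and e :: nat
  assumes M: "left_module R M" and \<phi>: "\<phi> \<in> lmod_iso R M (Nt e)"
begin

abbreviation rmult :: "('g \<Rightarrow> 'k) \<Rightarrow> 'u \<Rightarrow> 'u" where
  "rmult y \<equiv> (\<lambda>m. inv_into (carrier M) \<phi> (\<phi> m \<otimes>\<^bsub>R\<^esub> y))"

lemma inv_\<phi>: "inv_into (carrier M) \<phi> \<in> lmod_hom R (Nt e) M"
  by (rule lmod_isoD(1)[OF inv_into_lmod_iso[OF \<phi> M]])

lemma \<phi>_inv: "a \<in> carrier (Nt e) \<Longrightarrow> \<phi> (inv_into (carrier M) \<phi> a) = a"
  using lmod_isoD(4)[OF \<phi>] by (simp add: f_inv_into_f)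

lemma rmult_hom: "y \<in> carrier R \<Longrightarrow> rmult y \<in> lmod_hom R M M"
  using lmod_hom_comp[OF lmod_hom_comp[OF lmod_isoD(1)[OF \<phi>] Nt_right_mult_hom] inv_\<phi>] .

lemma \<phi>_rmult: "y \<in> carrier R \<Longrightarrow> m \<in> carrier M \<Longrightarrow> \<phi> (rmult y m) = \<phi> m \<otimes>\<^bsub>R\<^esub> y"
  using \<phi>_inv Nt_mult_right lmod_hom_closed[OF lmod_isoD(1)[OF \<phi>]] by simp

lemma rmult_ghost:
  assumes e: "e \<le> q" and y: "y \<in> J"
  shows "ghost G M M (rmult y)"
  unfolding ghost_iff
proof (intro conjI M allI impI ballI)
  show "rmult y \<in> lmod_hom R M M" by (rule rmult_hom[OF J_R[OF y]])
  fix i h and A :: "('g \<Rightarrow> 'k, 'u) module"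
  assume A: "omega_trivial G i A" and h: "h \<in> lmod_hom R A M"
  have "trace_map A (Nt e) (\<lambda>x. \<phi> (h x) \<otimes>\<^bsub>R\<^esub> y)"
    by (rule right_mult_ghost_Nt[OF A e y lmod_hom_comp[OF h lmod_isoD(1)[OF \<phi>]]])
  from trace_map_comp_left[OF omega_trivial_left_module[OF A] Nt_left_module M this inv_\<phi>]
  show "trace_map A M (\<lambda>x. rmult y (h x))" .
qed

lemma ghost_composite_products:
  assumes e: "e \<le> q" and th: "thick_trivial G M" and z: "z \<in> J_products n"
  shows "\<exists>f. ghost_composite G n M M f \<and> (\<forall>m\<in>carrier M. \<phi> (f m) = \<phi> m \<otimes>\<^bsub>R\<^esub> z)"
  using z
proof (induction n arbitrary: z)
  case 0
  have "ghost_composite G 0 M M (\<lambda>m. m)"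
    using composite_0[OF th th] lmod_hom_id[of R M] by (simp add: R_def)
  moreover have "\<phi> m \<otimes>\<^bsub>R\<^esub> \<one>\<^bsub>R\<^esub> = \<phi> m" if "m \<in> carrier M" for m
    using lmod_hom_closed[OF lmod_isoD(1)[OF \<phi>] that] Nt_R by simp
  ultimately show ?case using 0 by (intro exI[of _ "\<lambda>m. m"]) simp
next
  case (Suc n)
  then obtain y w where yw: "z = y \<otimes>\<^bsub>R\<^esub> w" "y \<in> J" "w \<in> J_products n" by auto
  obtain f where f: "ghost_composite G n M M f" "\<And>m. m \<in> carrier M \<Longrightarrow> \<phi> (f m) = \<phi> m \<otimes>\<^bsub>R\<^esub> w"
    using Suc.IH[OF yw(3)] by blast
  have "ghost_composite G (Suc n) M M (f \<circ> rmult y)"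
    by (rule composite_Suc[OF th th rmult_ghost[OF e yw(2)] f(1)])
  moreover have "\<phi> ((f \<circ> rmult y) m) = \<phi> m \<otimes>\<^bsub>R\<^esub> z" if m: "m \<in> carrier M" for m
  proof -
    have yR: "y \<in> carrier R" "w \<in> carrier R" using yw J_R J_products_R by auto
    have "\<phi> (f (rmult y m)) = \<phi> (rmult y m) \<otimes>\<^bsub>R\<^esub> w"
      by (rule f(2)[OF lmod_hom_closed[OF rmult_hom[OF yR(1)] m]])
    also have "\<dots> = (\<phi> m \<otimes>\<^bsub>R\<^esub> y) \<otimes>\<^bsub>R\<^esub> w" unfolding \<phi>_rmult[OF yR(1) m] ..
    also have "\<dots> = \<phi> m \<otimes>\<^bsub>R\<^esub> z"
      unfolding yw(1) using lmod_hom_closed[OF lmod_isoD(1)[OF \<phi>] m] Nt_R yR by (simp add: R.m_assoc)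
    finally show ?thesis by simp
  qed
  ultimately show ?case by blast
qed

lemma spans_M: "spans M (carrier G) (\<lambda>x. inv_into (carrier M) \<phi> (ga_single x 1 \<otimes>\<^bsub>R\<^esub> tpow e))"
proof -
  interpret M: left_module R M by (rule M)
  let ?b = "\<lambda>x. inv_into (carrier M) \<phi> (ga_single x 1 \<otimes>\<^bsub>R\<^esub> tpow e)"
  let ?f = "\<lambda>a. inv_into (carrier M) \<phi> (a \<otimes>\<^bsub>R\<^esub> tpow e)"
  have f: "?f \<in> lmod_hom R regR M" by (rule lmod_hom_comp[OF mult_tpow_Nt inv_\<phi>])
  have b: "?b \<in> carrier G \<rightarrow> carrier M" using lmod_hom_closed[OF f] by auto
  have "\<exists>c. m = lc M (carrier G) ?b c" if m: "m \<in> carrier M" for m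
  proof -
    have "\<phi> m \<in> carrier (Nt e)" using lmod_hom_closed[OF lmod_isoD(1)[OF \<phi>] m] .
    then obtain a where a: "a \<in> carrier R" "\<phi> m = a \<otimes>\<^bsub>R\<^esub> tpow e" by (auto simp: Nt_carrier)
    have "inv_into (carrier M) \<phi> (\<phi> m) = m" using lmod_isoD(3)[OF \<phi>] m by simp
    then have "m = ?f a" using a(2) by simp
    moreover have "\<exists>c. ?f a = lc M (carrier G) ?b c" using a(1)
    proof (induction a rule: R_induct)
      case zero
      have "?f \<zero>\<^bsub>R\<^esub> = \<zero>\<^bsub>M\<^esub>"
        using lmod_hom_zero[OF left_module_abelian_group[OF regR] M.M.abelian_group_axioms f] by simp
      moreover have "lc M (carrier G) ?b (\<lambda>_. 0) = \<zero>\<^bsub>M\<^esub>" by (rule lc_zero[OF M b]) simp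
      ultimately show ?case by metis
    next
      case (single x c)
      have bx: "?b x \<in> carrier M" using b single by blast
      have "ga_single x c = ga_single \<one> c \<odot>\<^bsub>regR\<^esub> ga_single x 1" using single by (simp add: single_mult)
      then have 1: "?f (ga_single x c) = ga_single \<one> c \<odot>\<^bsub>M\<^esub> ?b x"
        using lmod_hom_smult[OF f, of "ga_single \<one> c" "ga_single x 1"] single by simp
      have "lc M (carrier G) ?b (\<lambda>y. if y = x then c else 0) = lc M {x} ?b (\<lambda>y. if y = x then c else 0)"
        by (rule lc_subset[OF M b finite_G]) (use single in auto)
      also have "\<dots> = ga_single \<one> c \<odot>\<^bsub>M\<^esub> ?b x"
        unfolding lc_def using M.M.finsum_insert[of "{}" x] bx by (simp add: M.smult_closed)
      finally show ?case using 1 by metis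
    next
      case (add a a')
      then obtain c c' where c: "?f a = lc M (carrier G) ?b c" "?f a' = lc M (carrier G) ?b c'" by blast
      have "?f (a \<oplus>\<^bsub>R\<^esub> a') = ?f a \<oplus>\<^bsub>M\<^esub> ?f a'" using lmod_hom_add[OF f] add by simp
      also have "\<dots> = lc M (carrier G) ?b (\<lambda>x. c x + c' x)" unfolding c by (rule lc_add[OF M b, symmetric])
      finally show ?case by blast
    qed
    ultimately show ?thesis by metis
  qed
  then show ?thesis unfolding spans_def using finite_G b by blast
qed

lemma thick_M:
  assumes "e < q"
  shows "thick_trivial G M"
proof (rule thick_trivial_if_spans[OF M spans_M])
  interpret M: left_module R M by (rule M)
  show "carrier M \<noteq> {\<zero>\<^bsub>M\<^esub>}"
  proof
    assume z: "carrier M = {\<zero>\<^bsub>M\<^esub>}"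
    have "\<phi> \<zero>\<^bsub>M\<^esub> = \<zero>\<^bsub>R\<^esub>"
      using lmod_hom_zero[OF M.M.abelian_group_axioms left_module_abelian_group[OF Nt_left_module]
        lmod_isoD(1)[OF \<phi>]] by simp
    then have "carrier (Nt e) = {\<zero>\<^bsub>R\<^esub>}" using lmod_isoD(4)[OF \<phi>] z by simp
    then show False using Nt_tpow tpow_nonzero[OF assms] by auto
  qed
qed

text \<open>Right multiplication by a product \<open>w\<close> of \<open>n\<close> elements of \<open>J\<close> is a composite of \<open>n\<close> ghosts, so the
  hypothesis gives \<open>t\<^sup>e w = 0\<close>. Hence \<open>t\<^sup>e J\<^sup>n = 0\<close> and \<open>J\<^sup>n kG t\<^sup>e = 0\<close>, because \<open>t\<^sup>e\<close> can be moved past \<open>J\<^sup>n\<close> and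
  \<open>kG\<close>.\<close>

lemma ideal_power_annihilates_if_composites_zero:
  assumes e: "e < q" "q \<le> 2 * e"
    and z: "\<And>N f. ghost_composite G n M N f \<Longrightarrow> stably_zero R M N f"
    and a: "a \<in> ideal_power R J n" and m: "m \<in> carrier M"
  shows "a \<odot>\<^bsub>M\<^esub> m = \<zero>\<^bsub>M\<^esub>"
proof -
  interpret M: left_module R M by (rule M)
  have "tpow e \<otimes>\<^bsub>R\<^esub> w = \<zero>\<^bsub>R\<^esub>" if w: "w \<in> J_products n" for w
  proof -
    obtain f where f: "ghost_composite G n M M f" "\<And>m. m \<in> carrier M \<Longrightarrow> \<phi> (f m) = \<phi> m \<otimes>\<^bsub>R\<^esub> w"
      using ghost_composite_products[OF _ thick_M w] e by auto
    have "trace_map M M f" using z[OF f(1)] stably_zero_iff[OF M M] by simp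
    then have "trace_map M (Nt e) (\<lambda>m. \<phi> (f m))"
      by (rule trace_map_comp_left[OF M M Nt_left_module _ lmod_isoD(1)[OF \<phi>]])
    from trace_map_comp_right[OF Nt_left_module M Nt_left_module this inv_\<phi>]
    have "trace_map (Nt e) (Nt e) (\<lambda>a. a \<otimes>\<^bsub>R\<^esub> w)"
      by (rule trace_map_cong) (use f(2) \<phi>_inv lmod_hom_closed[OF inv_\<phi>] in simp)
    then show ?thesis by (rule right_mult_trace_zero[OF e(2) J_products_R[OF w]])
  qed
  then have ann: "tpow e \<otimes>\<^bsub>R\<^esub> b = \<zero>\<^bsub>R\<^esub>" if "b \<in> ideal_power R J n" for b
    using ideal_power_annihilates_if[OF tpow_R _ that] by blast
  have aR: "a \<in> carrier R" using a ideal_power_J_R by auto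
  have \<phi>m: "\<phi> m \<in> carrier (Nt e)" using lmod_hom_closed[OF lmod_isoD(1)[OF \<phi>] m] .
  obtain b where b: "b \<in> carrier R" "\<phi> m = b \<otimes>\<^bsub>R\<^esub> tpow e" using \<phi>m by (auto simp: Nt_carrier)
  obtain b' where b': "b' \<in> carrier R" "b \<otimes>\<^bsub>R\<^esub> tpow e = tpow e \<otimes>\<^bsub>R\<^esub> b'" using tpow_swap_right[OF b(1)] by blast
  obtain a' where a': "a' \<in> ideal_power R J n" "a \<otimes>\<^bsub>R\<^esub> tpow e = tpow e \<otimes>\<^bsub>R\<^esub> a'"
    using ideal_power_swap[OF a] by blast
  have "\<phi> (a \<odot>\<^bsub>M\<^esub> m) = a \<otimes>\<^bsub>R\<^esub> (tpow e \<otimes>\<^bsub>R\<^esub> b')"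
    using lmod_hom_smult[OF lmod_isoD(1)[OF \<phi>] aR m] b b' by simp
  also have "\<dots> = (tpow e \<otimes>\<^bsub>R\<^esub> a') \<otimes>\<^bsub>R\<^esub> b'" unfolding a'(2)[symmetric] using aR b' by (simp add: R.m_assoc)
  also have "\<dots> = \<zero>\<^bsub>R\<^esub>" using ann[OF a'(1)] b' by simp
  also have "\<dots> = \<phi> \<zero>\<^bsub>M\<^esub>"
    using lmod_hom_zero[OF M.M.abelian_group_axioms left_module_abelian_group[OF Nt_left_module]
        lmod_isoD(1)[OF \<phi>]] by simp
  finally show ?thesis
    using aR m by (intro inj_onD[OF lmod_isoD(3)[OF \<phi>]]) (simp_all add: M.smult_closed)
qed

text \<open>For each number \<open>n\<close>, annihilation by \<open>J\<^sup>n\<close>, membership in \<open>\<F>\<^sub>n\<close> and vanishing of the composites of \<open>n\<close>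
  ghosts imply each other cyclically.\<close>

theorem lengths_equal:
  assumes e: "e < q" "q \<le> 2 * e"
  shows "ghost_length G M = generating_length G M \<and> generating_length G M = radical_length R M"
proof -
  let ?rad = "\<lambda>n. \<forall>a\<in>ideal_power R J n. \<forall>m\<in>carrier M. a \<odot>\<^bsub>M\<^esub> m = \<zero>\<^bsub>M\<^esub>"
  let ?gh = "\<lambda>n. \<forall>N f. ghost_composite G n M N f \<longrightarrow> stably_zero R M N f"
  have 1: "gen_class G n M" if "?rad n" for n
    by (rule gen_class_if_ideal_power_annihilates[OF M]) (use that in blast)
  have 2: "?gh n" if "gen_class G n M" for n
  proof (intro allI impI)
    fix N :: "('g \<Rightarrow> 'k, 'u) module" and f assume "ghost_composite G n M N f"
    then have f: "ghost_chain n M N f" by (rule ghost_composite_chain)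
    then have "left_module R N" using ghost_chain_hom by blast
    then show "stably_zero R M N f" using stably_zero_iff[OF M] ghost_lemma[OF that f] by simp
  qed
  have 3: "?rad n" if "?gh n" for n
    using ideal_power_annihilates_if_composites_zero[OF e, of n] that by blast
  have "?gh n \<longleftrightarrow> gen_class G n M" "gen_class G n M \<longleftrightarrow> ?rad n" for n using 1 2 3 by blast+
  then show ?thesis
    unfolding ghost_length_def generating_length_def radical_length_def jacobson_radical_eq
      R_def[symmetric] by simp
qed

end

end

section \<open>Indecomposable modules of cyclic p-groups\<close>

text \<open>Gaussian elimination of the last equation with a pivot \<open>i0\<close>.\<close>

lemma underdetermined_system:
  fixes A :: "'i \<Rightarrow> nat \<Rightarrow> 'k::field"
  assumes "finite I" "card I > n"
  shows "\<exists>c. (\<exists>i\<in>I. c i \<noteq> 0) \<and> (\<forall>j<n. (\<Sum>i\<in>I. c i * A i j) = 0)"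
  using assms
proof (induction n arbitrary: I A)
  case 0
  then have "I \<noteq> {}" by auto
  then show ?case by (intro exI[of _ "\<lambda>_. 1"]) auto
next
  case (Suc n)
  show ?case
  proof (cases "\<forall>i\<in>I. A i n = 0")
    case True
    obtain c where c: "\<exists>i\<in>I. c i \<noteq> 0" "\<forall>j<n. (\<Sum>i\<in>I. c i * A i j) = 0"
      using Suc.IH[of I A] Suc.prems by auto
    have "(\<Sum>i\<in>I. c i * A i j) = 0" if "j < Suc n" for j
      using that c(2) True by (cases "j = n") auto
    then show ?thesis using c(1) by blast
  next
    case False
    then obtain i0 where i0: "i0 \<in> I" "A i0 n \<noteq> 0" by blast
    let ?I = "I - {i0}"
    define B where "B i j = A i j - A i n / A i0 n * A i0 j" for i j
    have "finite ?I" "card ?I > n" using Suc.prems i0 by auto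
    then obtain c where c: "\<exists>i\<in>?I. c i \<noteq> 0" "\<forall>j<n. (\<Sum>i\<in>?I. c i * B i j) = 0"
      using Suc.IH[of ?I B] by blast
    define l where "l = - (\<Sum>i\<in>?I. c i * A i n) / A i0 n"
    define d where "d = (\<lambda>i. if i = i0 then l else c i)"
    have s: "(\<Sum>i\<in>I. d i * A i j) = l * A i0 j + (\<Sum>i\<in>?I. c i * A i j)" for j
    proof -
      have "(\<Sum>i\<in>I. d i * A i j) = d i0 * A i0 j + (\<Sum>i\<in>?I. d i * A i j)"
        by (rule sum.remove[OF Suc.prems(1) i0(1)])
      also have "(\<Sum>i\<in>?I. d i * A i j) = (\<Sum>i\<in>?I. c i * A i j)"
        by (intro sum.cong) (auto simp: d_def)
      finally show ?thesis by (simp add: d_def)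
    qed
    have "(\<Sum>i\<in>I. d i * A i j) = 0" if j: "j < Suc n" for j
    proof (cases "j = n")
      case True
      then show ?thesis using i0 by (simp add: s l_def)
    next
      case False
      have "l * A i0 j = - (\<Sum>i\<in>?I. c i * (A i n / A i0 n * A i0 j))"
        by (simp add: l_def sum_distrib_right sum_divide_distrib mult.assoc)
      then have "(\<Sum>i\<in>I. d i * A i j) = (\<Sum>i\<in>?I. c i * B i j)"
        by (simp add: s B_def right_diff_distrib sum_subtractf)
      then show ?thesis using c(2) j False by simp
    qed
    moreover have "\<exists>i\<in>I. d i \<noteq> 0" using c(1) by (auto simp: d_def)
    ultimately show ?thesis by blast
  qed
qed

context finite_group_algebra
begin

lemma lc_insert:
  assumes "left_module R M" "b \<in> insert i I \<rightarrow> carrier M" "finite I" "i \<notin> I"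
  shows "lc M (insert i I) b c = ga_single \<one> (c i) \<odot>\<^bsub>M\<^esub> b i \<oplus>\<^bsub>M\<^esub> lc M I b c"
proof -
  interpret M: left_module R M by fact
  show ?thesis
    unfolding lc_def
    by (rule M.M.finsum_insert) (use assms lc_term_closed[of M b "insert i I"] in \<open>auto simp: Pi_iff\<close>)
qed

lemma lc_cong:
  assumes "left_module R M" "b \<in> I \<rightarrow> carrier M" "\<And>i. i \<in> I \<Longrightarrow> c i = d i" "\<And>i. i \<in> I \<Longrightarrow> b' i = b i"
  shows "lc M I b' c = lc M I b d"
proof -
  interpret M: left_module R M by fact
  show ?thesis
    unfolding lc_def
    by (rule M.M.finsum_cong') (use assms(3,4) lc_term_closed[OF assms(1,2)] in auto)
qed

lemma lc_lc:
  assumes M: "left_module R M" and b: "b \<in> H \<rightarrow> carrier M" and H: "finite H" and I: "finite I"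
    and w: "\<And>i. i \<in> I \<Longrightarrow> w i = lc M H b (A i)"
  shows "lc M I w c = lc M H b (\<lambda>j. \<Sum>i\<in>I. c i * A i j)"
  using I w
proof (induction I)
  case empty
  interpret M: left_module R M by (rule M)
  show ?case using lc_zero[OF M b, of "\<lambda>_. 0"] by (simp add: lc_def)
next
  case (insert i I)
  have wM: "w \<in> insert i I \<rightarrow> carrier M" using insert(4) lc_closed[OF M b] by auto
  have "lc M (insert i I) w c = ga_single \<one> (c i) \<odot>\<^bsub>M\<^esub> w i \<oplus>\<^bsub>M\<^esub> lc M I w c"
    by (rule lc_insert[OF M wM insert(1,2)])
  also have "\<dots> = lc M H b (\<lambda>j. c i * A i j) \<oplus>\<^bsub>M\<^esub> lc M H b (\<lambda>j. \<Sum>i\<in>I. c i * A i j)"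
    using insert(3)[OF insert(4)] insert(4)[of i] lc_scale[OF M b H, of "c i" "A i"] by simp
  also have "\<dots> = lc M H b (\<lambda>j. c i * A i j + (\<Sum>i\<in>I. c i * A i j))" by (rule lc_add[OF M b, symmetric])
  also have "\<dots> = lc M H b (\<lambda>j. \<Sum>i\<in>insert i I. c i * A i j)" using insert(1,2) by simp
  finally show ?case .
qed

text \<open>If \<open>m > n\<close>, the coefficients of \<open>w\<close> with respect to \<open>b\<close> form an underdetermined system, whose
  nonzero solution is a linear relation.\<close>

lemma independent_le_spanning:
  fixes m n :: nat
  assumes M: "left_module R M" and s: "spans M {..<n} b" and w: "w \<in> {..<m} \<rightarrow> carrier M"
    and ind: "\<And>c. lc M {..<m} w c = \<zero>\<^bsub>M\<^esub> \<Longrightarrow> \<forall>i<m. c i = 0"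
  shows "m \<le> n"
proof (rule ccontr)
  assume "\<not> m \<le> n"
  have b: "b \<in> {..<n} \<rightarrow> carrier M" and sp: "\<And>x. x \<in> carrier M \<Longrightarrow> \<exists>c. x = lc M {..<n} b c"
    using s by (auto simp: spans_def)
  have "\<exists>A. \<forall>i\<in>{..<m}. w i = lc M {..<n} b (A i)"
    by (rule bchoice) (use w sp in auto)
  then obtain A where A: "\<And>i. i \<in> {..<m} \<Longrightarrow> w i = lc M {..<n} b (A i)" by blast
  obtain c where c: "\<exists>i\<in>{..<m}. c i \<noteq> 0" "\<forall>j<n. (\<Sum>i<m. c i * A i j) = 0"
    using underdetermined_system[of "{..<m}" n A] \<open>\<not> m \<le> n\<close> by auto
  have "lc M {..<m} w c = lc M {..<n} b (\<lambda>j. \<Sum>i<m. c i * A i j)"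
    by (rule lc_lc[OF M b _ _ A]) auto
  also have "\<dots> = \<zero>\<^bsub>M\<^esub>" by (rule lc_zero[OF M b]) (use c(2) in auto)
  finally show False using ind[of c] c(1) by auto
qed

end

locale cyclic_p_group = cyclic_normal_subgroup G R p C g q
  for G :: "('g, 'x) monoid_scheme" (structure) and R :: "('g \<Rightarrow> 'k::field) ring" and p :: nat
    and C :: "'g set" and g :: 'g and q :: nat +
  assumes C_eq: "C = carrier G"
begin

text \<open>The power \<open>t\<^sup>q\<^sup>-\<^sup>1\<close> is the sum of all group elements and is annihilated by the augmentation ideal; so
  the elements of the augmentation ideal are multiples of \<open>t\<close> by \<open>annihilator_tpow\<close>.\<close>

lemma J_eq_multiples:
  assumes "d \<in> J"
  shows "\<exists>b\<in>carrier R. d = b \<otimes>\<^bsub>R\<^esub> t"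
proof -
  have d: "d \<in> carrier R" "aug d = 0" using assms by (auto simp: J_def)
  have "d \<otimes>\<^bsub>R\<^esub> tpow (q - 1) = \<zero>\<^bsub>R\<^esub>"
  proof
    fix x
    show "(d \<otimes>\<^bsub>R\<^esub> tpow (q - 1)) x = \<zero>\<^bsub>R\<^esub> x"
      unfolding tpow_q_minus_1 using d(2) by (simp add: mult_R zero_R C_eq aug_def)
  qed
  then obtain b where "b \<in> carrier R" "d = b \<otimes>\<^bsub>R\<^esub> tpow (q - (q - 1))"
    using annihilator_tpow[of "q - 1" d] d(1) by auto
  moreover have "q - (q - 1) = 1" using q_pos by simp
  ultimately show ?thesis by auto
qed

lemma division_step:
  assumes "b \<in> carrier R"
  shows "\<exists>b'\<in>carrier R. b = ga_single \<one> (aug b) \<oplus>\<^bsub>R\<^esub> b' \<otimes>\<^bsub>R\<^esub> t"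
proof -
  have "b \<ominus>\<^bsub>R\<^esub> ga_single \<one> (aug b) \<in> J" using assms by (simp add: J_def aug_diff aug_single)
  then obtain b' where b': "b' \<in> carrier R" "b \<ominus>\<^bsub>R\<^esub> ga_single \<one> (aug b) = b' \<otimes>\<^bsub>R\<^esub> t"
    using J_eq_multiples by blast
  have "b = (b \<ominus>\<^bsub>R\<^esub> ga_single \<one> (aug b)) \<oplus>\<^bsub>R\<^esub> ga_single \<one> (aug b)"
    using R.diff_add_cancel[OF assms, of "ga_single \<one> (aug b)"] by simp
  then show ?thesis using b' by (intro bexI[of _ b']) (simp_all add: R.a_comm)
qed

text \<open>Split off factors \<open>t\<close> as long as the augmentation is zero. This ends because \<open>t\<^sup>q = 0\<close>.\<close>

lemma unit_times_tpow:
  assumes "a \<in> carrier R" "a \<noteq> \<zero>\<^bsub>R\<^esub>"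
  obtains d j where "d \<in> carrier R" "aug d \<noteq> 0" "j < q" "a = d \<otimes>\<^bsub>R\<^esub> tpow j"
proof -
  have "(\<exists>b\<in>carrier R. a = b \<otimes>\<^bsub>R\<^esub> tpow e) \<or>
      (\<exists>j<e. \<exists>d\<in>carrier R. aug d \<noteq> 0 \<and> a = d \<otimes>\<^bsub>R\<^esub> tpow j)" for e
  proof (induction e)
    case 0
    then show ?case using assms(1) by (intro disjI1 bexI[of _ a]) simp_all
  next
    case (Suc e)
    show ?case
    proof (cases "\<exists>j<e. \<exists>d\<in>carrier R. aug d \<noteq> 0 \<and> a = d \<otimes>\<^bsub>R\<^esub> tpow j")
      case True
      then show ?thesis using less_SucI by blast
    next
      case False
      then obtain b where b: "b \<in> carrier R" "a = b \<otimes>\<^bsub>R\<^esub> tpow e" using Suc by blast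
      show ?thesis
      proof (cases "aug b = 0")
        case True
        then obtain b' where b': "b' \<in> carrier R" "b = b' \<otimes>\<^bsub>R\<^esub> t"
          using J_eq_multiples[of b] b(1) by (auto simp: J_def)
        have "a = b' \<otimes>\<^bsub>R\<^esub> tpow (Suc e)"
          unfolding b(2) b'(2) using b'(1) tpow_add'[of b' 1 e] by simp
        then show ?thesis using b'(1) by blast
      qed (use b in blast)
    qed
  qed
  from this[of q] show ?thesis
  proof
    assume "\<exists>b\<in>carrier R. a = b \<otimes>\<^bsub>R\<^esub> tpow q"
    then show ?thesis using assms(2) by (auto simp: tpow_q)
  qed (use that in blast)
qed

text \<open>Iterated division by \<open>t\<close>, with the augmentation as remainder.\<close>

lemma tpow_expansion:
  assumes "a \<in> carrier R"
  shows "\<exists>c. a = lc regR {..<q} tpow c"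
proof -
  interpret L: left_module R regR by (rule regR)
  have tp: "tpow \<in> I \<rightarrow> carrier regR" for I by simp
  have "\<exists>c. \<exists>b\<in>carrier R. a = lc regR {..<e} tpow c \<oplus>\<^bsub>R\<^esub> b \<otimes>\<^bsub>R\<^esub> tpow e" for e
  proof (induction e)
    case 0
    have "lc regR {..<0::nat} tpow c = \<zero>\<^bsub>R\<^esub>" for c by (simp add: lc_def finsum_regR)
    then show ?case using assms by (intro exI bexI[of _ a]) simp_all
  next
    case (Suc e)
    then obtain c b where b: "b \<in> carrier R" and a: "a = lc regR {..<e} tpow c \<oplus>\<^bsub>R\<^esub> b \<otimes>\<^bsub>R\<^esub> tpow e" by blast
    obtain b' where b': "b' \<in> carrier R" "b = ga_single \<one> (aug b) \<oplus>\<^bsub>R\<^esub> b' \<otimes>\<^bsub>R\<^esub> t"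
      using division_step[OF b] by blast
    define c' where "c' = c(e := aug b)"
    have cl: "lc regR {..<e} tpow c \<in> carrier R" using lc_closed[OF regR tp] by simp
    have "lc regR {..<Suc e} tpow c' =
        ga_single \<one> (c' e) \<odot>\<^bsub>regR\<^esub> tpow e \<oplus>\<^bsub>regR\<^esub> lc regR {..<e} tpow c'"
      unfolding lessThan_Suc by (rule lc_insert[OF regR tp]) auto
    moreover have "lc regR {..<e} tpow c' = lc regR {..<e} tpow c"
      by (rule lc_cong[OF regR tp]) (auto simp: c'_def)
    ultimately have 1: "lc regR {..<Suc e} tpow c' =
        ga_single \<one> (aug b) \<otimes>\<^bsub>R\<^esub> tpow e \<oplus>\<^bsub>R\<^esub> lc regR {..<e} tpow c" by (simp add: c'_def)
    have "b \<otimes>\<^bsub>R\<^esub> tpow e = (ga_single \<one> (aug b) \<oplus>\<^bsub>R\<^esub> b' \<otimes>\<^bsub>R\<^esub> t) \<otimes>\<^bsub>R\<^esub> tpow e" using b'(2) by simp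
    also have "\<dots> = ga_single \<one> (aug b) \<otimes>\<^bsub>R\<^esub> tpow e \<oplus>\<^bsub>R\<^esub> b' \<otimes>\<^bsub>R\<^esub> tpow (Suc e)"
      using b'(1) tpow_add'[of b' 1 e] by (simp add: R.l_distr)
    finally have "a = lc regR {..<Suc e} tpow c' \<oplus>\<^bsub>R\<^esub> b' \<otimes>\<^bsub>R\<^esub> tpow (Suc e)"
      unfolding a 1 using cl b'(1) by (simp add: R.a_ac del: R.nat_pow_Suc)
    then show ?case using b'(1) by blast
  qed
  from this[of q] show ?thesis using lc_closed[OF regR tp] by (auto simp: tpow_q)
qed

text \<open>\<open>v\<close> generates \<open>V\<close>, and its annihilator is generated by the \<open>n\<close>-th power of \<open>g - 1\<close>.\<close>

definition cyclic_generator :: "('g \<Rightarrow> 'k, 'v) module \<Rightarrow> 'v \<Rightarrow> nat \<Rightarrow> bool" where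
  "cyclic_generator V v n \<longleftrightarrow> v \<in> carrier V \<and> 1 \<le> n \<and> n \<le> q \<and> tpow n \<odot>\<^bsub>V\<^esub> v = \<zero>\<^bsub>V\<^esub>
     \<and> tpow (n - 1) \<odot>\<^bsub>V\<^esub> v \<noteq> \<zero>\<^bsub>V\<^esub> \<and> carrier V = (\<lambda>a. a \<odot>\<^bsub>V\<^esub> v) ` carrier R"

lemma tpow_smult_zero:
  assumes V: "left_module R V" and v: "v \<in> carrier V" "tpow n \<odot>\<^bsub>V\<^esub> v = \<zero>\<^bsub>V\<^esub>" and l: "n \<le> l"
  shows "tpow l \<odot>\<^bsub>V\<^esub> v = \<zero>\<^bsub>V\<^esub>"
proof -
  interpret V: left_module R V by (rule V)
  have "tpow l \<odot>\<^bsub>V\<^esub> v = tpow (l - n) \<odot>\<^bsub>V\<^esub> (tpow n \<odot>\<^bsub>V\<^esub> v)"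
    using v(1) l tpow_add[of "l - n" n] by (simp add: V.smult_assoc[symmetric])
  then show ?thesis using v(2) by (simp add: V.smult_zero_right)
qed

text \<open>A nonzero element \<open>a\<close> is a unit times a power of \<open>t\<close>; this power annihilates \<open>v\<close> along with \<open>a\<close>.\<close>

lemma annihilator_generator:
  assumes V: "left_module R V" and v: "v \<in> carrier V" "1 \<le> n" "tpow n \<odot>\<^bsub>V\<^esub> v = \<zero>\<^bsub>V\<^esub>"
    "tpow (n - 1) \<odot>\<^bsub>V\<^esub> v \<noteq> \<zero>\<^bsub>V\<^esub>" and a: "a \<in> carrier R" "a \<odot>\<^bsub>V\<^esub> v = \<zero>\<^bsub>V\<^esub>"
  shows "\<exists>b\<in>carrier R. a = b \<otimes>\<^bsub>R\<^esub> tpow n"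
proof (cases "a = \<zero>\<^bsub>R\<^esub>")
  case True
  then show ?thesis by (intro bexI[of _ "\<zero>\<^bsub>R\<^esub>"]) simp_all
next
  case False
  interpret V: left_module R V by (rule V)
  obtain d j where d: "d \<in> carrier R" "aug d \<noteq> 0" "a = d \<otimes>\<^bsub>R\<^esub> tpow j"
    using unit_times_tpow[OF a(1) False] by blast
  obtain u where u: "u \<in> carrier R" "u \<otimes>\<^bsub>R\<^esub> d = \<one>\<^bsub>R\<^esub>" using unit_if_aug_nonzero[OF d(1,2)] by blast
  have "tpow j \<odot>\<^bsub>V\<^esub> v = (u \<otimes>\<^bsub>R\<^esub> d) \<odot>\<^bsub>V\<^esub> (tpow j \<odot>\<^bsub>V\<^esub> v)" using u v(1) by (simp add: V.smult_one V.smult_closed)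
  also have "\<dots> = u \<odot>\<^bsub>V\<^esub> (a \<odot>\<^bsub>V\<^esub> v)" unfolding d(3) using u(1) d(1) v(1) by (simp add: V.smult_assoc V.smult_closed)
  also have "\<dots> = \<zero>\<^bsub>V\<^esub>" using a(2) u(1) by (simp add: V.smult_zero_right)
  finally have tj: "tpow j \<odot>\<^bsub>V\<^esub> v = \<zero>\<^bsub>V\<^esub>" .
  have "n \<le> j"
  proof (rule ccontr)
    assume "\<not> n \<le> j"
    then have "j \<le> n - 1" by simp
    then show False using tpow_smult_zero[OF V v(1) tj] v(4) by blast
  qed
  then have "a = (d \<otimes>\<^bsub>R\<^esub> tpow (j - n)) \<otimes>\<^bsub>R\<^esub> tpow n" using d by (simp add: tpow_add')
  then show ?thesis using d(1) by (intro bexI[of _ "d \<otimes>\<^bsub>R\<^esub> tpow (j - n)"]) simp_all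
qed

text \<open>Let \<open>U\<close> be the largest submodule in the kernel of the linear functional \<open>f\<close>. It meets the submodule
  generated by \<open>v\<close> trivially, since every nonzero multiple of \<open>v\<close> has \<open>t\<^sup>m\<^sup>-\<^sup>1 v\<close> among its multiples. Both
  together span \<open>V\<close>, since every vector can be moved into \<open>U\<close> by subtracting a multiple of \<open>v\<close>. So
  \<open>U = 0\<close> by indecomposability.\<close>

lemma indecomposable_cyclic:
  assumes V: "indecomposable R V" and f: "f \<in> lmod_hom K V (trivial_module G)"
    and w: "v \<in> carrier V" "1 \<le> m" "f (tpow (m - 1) \<odot>\<^bsub>V\<^esub> v) \<noteq> 0"
    and m: "\<And>u. u \<in> carrier V \<Longrightarrow> tpow m \<odot>\<^bsub>V\<^esub> u = \<zero>\<^bsub>V\<^esub>" "m \<le> q"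
  shows "cyclic_generator V v m"
proof -
  have Vm: "left_module R V" using V by (simp add: indecomposable_def)
  interpret V: left_module R V by (rule Vm)
  have f_add: "f (x \<oplus>\<^bsub>V\<^esub> y) = f x + f y" if "x \<in> carrier V" "y \<in> carrier V" for x y
    using lmod_hom_add[OF f that] by (simp add: trivial_module_def)
  have f_smult: "f (ga_single \<one> c \<odot>\<^bsub>V\<^esub> x) = c * f x" if "x \<in> carrier V" for x c
    using lmod_hom_smult[OF f _ that, of "ga_single \<one> c"] aug_single[of \<one> c]
    by (simp add: trivial_module_def aug_def)
  have "f \<zero>\<^bsub>V\<^esub> = f \<zero>\<^bsub>V\<^esub> + f \<zero>\<^bsub>V\<^esub>" using f_add[of "\<zero>\<^bsub>V\<^esub>" "\<zero>\<^bsub>V\<^esub>"] by (simp only: V.M.r_zero V.M.zero_closed)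
  then have f0: "f \<zero>\<^bsub>V\<^esub> = 0" by (metis add_cancel_right_right)
  let ?x = "tpow (m - 1) \<odot>\<^bsub>V\<^esub> v"
  have x: "?x \<in> carrier V" "?x \<noteq> \<zero>\<^bsub>V\<^esub>" using w f0 by (auto simp: V.smult_closed)
  define W where "W = (\<lambda>a. a \<odot>\<^bsub>V\<^esub> v) ` carrier R"
  define U where "U = {u \<in> carrier V. \<forall>a\<in>carrier R. f (a \<odot>\<^bsub>V\<^esub> u) = 0}"
  have "(\<lambda>a. a \<odot>\<^bsub>V\<^esub> v) \<in> lmod_hom R regR V"
    using w(1) by (intro lmod_homI) (auto simp: V.smult_closed V.smult_l_distr V.smult_assoc)
  from image_submodule[OF regR Vm this] have W: "submodule W R V" by (simp add: W_def)
  have U: "submodule U R V"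
    by (rule submoduleI[OF Vm])
      (auto simp: U_def V.smult_zero_right f0 V.smult_r_distr f_add V.smult_closed V.smult_assoc[symmetric])
  have WU: "W \<inter> U = {\<zero>\<^bsub>V\<^esub>}"
  proof
    show "W \<inter> U \<subseteq> {\<zero>\<^bsub>V\<^esub>}"
    proof
      fix y assume "y \<in> W \<inter> U"
      then obtain a where a: "a \<in> carrier R" "y = a \<odot>\<^bsub>V\<^esub> v" and yU: "y \<in> U" by (auto simp: W_def)
      show "y \<in> {\<zero>\<^bsub>V\<^esub>}"
      proof (cases "a = \<zero>\<^bsub>R\<^esub>")
        case True
        then show ?thesis using a w(1) by (simp add: V.smult_zero_left)
      next
        case False
        obtain d j where d: "d \<in> carrier R" "aug d \<noteq> 0" "a = d \<otimes>\<^bsub>R\<^esub> tpow j"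
          using unit_times_tpow[OF a(1) False] by blast
        obtain u where u: "u \<in> carrier R" "u \<otimes>\<^bsub>R\<^esub> d = \<one>\<^bsub>R\<^esub>" using unit_if_aug_nonzero[OF d(1,2)] by blast
        show ?thesis
        proof (cases "m \<le> j")
          case True
          then have "tpow j \<odot>\<^bsub>V\<^esub> v = \<zero>\<^bsub>V\<^esub>" using tpow_smult_zero[OF Vm w(1) m(1)[OF w(1)]] by blast
          then show ?thesis using a d w(1) by (simp add: V.smult_assoc V.smult_zero_right)
        next
          case False
          let ?r = "tpow (m - 1 - j) \<otimes>\<^bsub>R\<^esub> u"
          have "?r \<odot>\<^bsub>V\<^esub> y = (tpow (m - 1 - j) \<otimes>\<^bsub>R\<^esub> ((u \<otimes>\<^bsub>R\<^esub> d) \<otimes>\<^bsub>R\<^esub> tpow j)) \<odot>\<^bsub>V\<^esub> v"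
            unfolding a(2) d(3) using u(1) d(1) w(1) by (simp add: V.smult_assoc V.smult_closed)
          also have "\<dots> = ?x" using u(2) False w(2) by (simp add: tpow_add)
          finally have "f (?r \<odot>\<^bsub>V\<^esub> y) \<noteq> 0" using w(3) by simp
          then show ?thesis using yU u(1) by (auto simp: U_def)
        qed
      qed
    qed
  qed (use submoduleD(2)[OF W] submoduleD(2)[OF U] in auto)
  have sumV: "\<exists>y\<in>W. \<exists>u'\<in>U. u = y \<oplus>\<^bsub>V\<^esub> u'" if u: "u \<in> carrier V" for u
  proof -
    \<comment> \<open>Downward induction: correct \<open>u\<close> by multiples of \<open>v\<close> until \<open>f (t\<^sup>l u) = 0\<close> for all \<open>l \<ge> i\<close>.\<close>
    have "\<exists>a\<in>carrier R. \<forall>l\<ge>m - k. f (tpow l \<odot>\<^bsub>V\<^esub> (u \<ominus>\<^bsub>V\<^esub> a \<odot>\<^bsub>V\<^esub> v)) = 0" if "k \<le> m" for k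
      using that
    proof (induction k)
      case 0
      have "f (tpow l \<odot>\<^bsub>V\<^esub> (u \<ominus>\<^bsub>V\<^esub> \<zero>\<^bsub>R\<^esub> \<odot>\<^bsub>V\<^esub> v)) = 0" if "l \<ge> m" for l
      proof -
        have c: "u \<ominus>\<^bsub>V\<^esub> \<zero>\<^bsub>R\<^esub> \<odot>\<^bsub>V\<^esub> v \<in> carrier V" using u w(1) by (simp add: V.smult_closed)
        show ?thesis using tpow_smult_zero[OF Vm c m(1)[OF c] that] f0 by simp
      qed
      then show ?case by (intro bexI[of _ "\<zero>\<^bsub>R\<^esub>"]) simp_all
    next
      case (Suc k)
      then obtain a where a: "a \<in> carrier R" "\<And>l. l \<ge> m - k \<Longrightarrow> f (tpow l \<odot>\<^bsub>V\<^esub> (u \<ominus>\<^bsub>V\<^esub> a \<odot>\<^bsub>V\<^esub> v)) = 0"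
        by auto
      define i where "i = m - Suc k"
      have i: "m - k = Suc i" "i < m" "k = m - 1 - i" using Suc.prems by (auto simp: i_def)
      let ?y = "u \<ominus>\<^bsub>V\<^esub> a \<odot>\<^bsub>V\<^esub> v"
      have y: "?y \<in> carrier V" using u a(1) w(1) by (simp add: V.smult_closed)
      define c where "c = f (tpow i \<odot>\<^bsub>V\<^esub> ?y) / f ?x"
      let ?b = "ga_single \<one> c \<otimes>\<^bsub>R\<^esub> tpow k"
      have b: "?b \<in> carrier R" by simp
      have uy: "u \<ominus>\<^bsub>V\<^esub> (a \<oplus>\<^bsub>R\<^esub> ?b) \<odot>\<^bsub>V\<^esub> v = ?y \<ominus>\<^bsub>V\<^esub> ?b \<odot>\<^bsub>V\<^esub> v"
        using u a(1) w(1) b by (simp add: V.smult_l_distr a_minus_def V.M.minus_add V.M.a_assoc V.smult_closed)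
      have fl: "f (tpow l \<odot>\<^bsub>V\<^esub> (?y \<ominus>\<^bsub>V\<^esub> ?b \<odot>\<^bsub>V\<^esub> v)) = f (tpow l \<odot>\<^bsub>V\<^esub> ?y) - c * f (tpow (l + k) \<odot>\<^bsub>V\<^esub> v)" for l
      proof -
        have "tpow l \<otimes>\<^bsub>R\<^esub> ?b = ga_single \<one> c \<otimes>\<^bsub>R\<^esub> tpow (l + k)"
        proof -
          have "tpow l \<otimes>\<^bsub>R\<^esub> ?b = (tpow l \<otimes>\<^bsub>R\<^esub> ga_single \<one> c) \<otimes>\<^bsub>R\<^esub> tpow k" by (simp add: R.m_assoc)
          also have "\<dots> = (ga_single \<one> c \<otimes>\<^bsub>R\<^esub> tpow l) \<otimes>\<^bsub>R\<^esub> tpow k" by (simp add: scalar_central)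
          finally show ?thesis by (simp add: tpow_add')
        qed
        then have e: "tpow l \<odot>\<^bsub>V\<^esub> (?b \<odot>\<^bsub>V\<^esub> v) = ga_single \<one> c \<odot>\<^bsub>V\<^esub> (tpow (l + k) \<odot>\<^bsub>V\<^esub> v)"
          using w(1) by (simp add: V.smult_assoc[symmetric])
        have bv: "?b \<odot>\<^bsub>V\<^esub> v \<in> carrier V" using b w(1) by (rule V.smult_closed)
        have "f (tpow l \<odot>\<^bsub>V\<^esub> ?y) = f (tpow l \<odot>\<^bsub>V\<^esub> (?y \<ominus>\<^bsub>V\<^esub> ?b \<odot>\<^bsub>V\<^esub> v) \<oplus>\<^bsub>V\<^esub> tpow l \<odot>\<^bsub>V\<^esub> (?b \<odot>\<^bsub>V\<^esub> v))"
          using V.M.diff_add_cancel[OF y bv] y bv by (simp add: V.smult_r_distr[symmetric])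
        also have "\<dots> = f (tpow l \<odot>\<^bsub>V\<^esub> (?y \<ominus>\<^bsub>V\<^esub> ?b \<odot>\<^bsub>V\<^esub> v)) + c * f (tpow (l + k) \<odot>\<^bsub>V\<^esub> v)"
          using y bv w(1) by (simp add: f_add V.smult_closed e f_smult)
        finally show ?thesis by simp
      qed
      have "f (tpow l \<odot>\<^bsub>V\<^esub> (?y \<ominus>\<^bsub>V\<^esub> ?b \<odot>\<^bsub>V\<^esub> v)) = 0" if l: "l \<ge> i" for l
      proof (cases "l = i")
        case True
        then show ?thesis using fl[of l] w(3) i by (simp add: c_def)
      next
        case False
        then have l': "l \<ge> m - k" using l i(1) by simp
        then have "m \<le> l + k" by simp
        then have "tpow (l + k) \<odot>\<^bsub>V\<^esub> v = \<zero>\<^bsub>V\<^esub>" using tpow_smult_zero[OF Vm w(1) m(1)[OF w(1)]] by blast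
        then show ?thesis using fl[of l] a(2)[OF l'] f0 by simp
      qed
      then show ?case unfolding i_def[symmetric] using a(1) b uy by (intro bexI[of _ "a \<oplus>\<^bsub>R\<^esub> ?b"]) simp_all
    qed
    from this[of m] obtain a where a: "a \<in> carrier R" "\<And>l. f (tpow l \<odot>\<^bsub>V\<^esub> (u \<ominus>\<^bsub>V\<^esub> a \<odot>\<^bsub>V\<^esub> v)) = 0" by auto
    let ?y = "u \<ominus>\<^bsub>V\<^esub> a \<odot>\<^bsub>V\<^esub> v"
    have av: "a \<odot>\<^bsub>V\<^esub> v \<in> carrier V" using a(1) w(1) by (rule V.smult_closed)
    have y: "?y \<in> carrier V" using u av by simp
    have "f (r \<odot>\<^bsub>V\<^esub> ?y) = 0" if r: "r \<in> carrier R" for r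
    proof -
      obtain c where c: "r = lc regR {..<q} tpow c" using tpow_expansion[OF r] by blast
      have h: "(\<lambda>r. r \<odot>\<^bsub>V\<^esub> ?y) \<in> lmod_hom R regR V"
        using y by (intro lmod_homI) (auto simp: V.smult_closed V.smult_l_distr V.smult_assoc)
      have "r \<odot>\<^bsub>V\<^esub> ?y = lc V {..<q} (\<lambda>i. tpow i \<odot>\<^bsub>V\<^esub> ?y) c"
        unfolding c by (rule lc_hom[OF regR Vm h]) auto
      moreover have "f (lc V {..<e} (\<lambda>i. tpow i \<odot>\<^bsub>V\<^esub> ?y) c) = 0" for e
      proof (induction e)
        case 0
        then show ?case by (simp add: lc_def f0)
      next
        case (Suc e)
        have cl: "(\<lambda>i. tpow i \<odot>\<^bsub>V\<^esub> ?y) \<in> I \<rightarrow> carrier V" for I using y by (simp add: V.smult_closed)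
        have "lc V {..<Suc e} (\<lambda>i. tpow i \<odot>\<^bsub>V\<^esub> ?y) c =
            ga_single \<one> (c e) \<odot>\<^bsub>V\<^esub> (tpow e \<odot>\<^bsub>V\<^esub> ?y) \<oplus>\<^bsub>V\<^esub> lc V {..<e} (\<lambda>i. tpow i \<odot>\<^bsub>V\<^esub> ?y) c"
          unfolding lessThan_Suc by (rule lc_insert[OF Vm cl]) auto
        moreover have "lc V {..<e} (\<lambda>i. tpow i \<odot>\<^bsub>V\<^esub> ?y) c \<in> carrier V" by (rule lc_closed[OF Vm cl])
        ultimately show ?case using Suc y a(2) by (simp add: f_add f_smult V.smult_closed)
      qed
      ultimately show ?thesis by simp
    qed
    then have "?y \<in> U" using y by (simp add: U_def)
    moreover have "a \<odot>\<^bsub>V\<^esub> v \<in> W" using a(1) by (simp add: W_def)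
    moreover have "u = a \<odot>\<^bsub>V\<^esub> v \<oplus>\<^bsub>V\<^esub> ?y" using V.M.diff_add_cancel[OF u av] y av by (simp add: V.M.a_comm)
    ultimately show ?thesis by blast
  qed
  have WV: "W \<subseteq> carrier V" "U \<subseteq> carrier V" using submoduleD(1)[OF W] submoduleD(1)[OF U] by auto
  have "W <+>\<^bsub>V\<^esub> U = carrier V"
    unfolding set_add_def' using sumV WV by (auto simp: subset_iff)
  then have "W = {\<zero>\<^bsub>V\<^esub>} \<or> U = {\<zero>\<^bsub>V\<^esub>}" using V W U WU by (simp add: indecomposable_def)
  moreover have "W \<noteq> {\<zero>\<^bsub>V\<^esub>}"
  proof
    have "?x \<in> W" unfolding W_def by (rule imageI) simp
    moreover assume "W = {\<zero>\<^bsub>V\<^esub>}"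
    ultimately show False using x(2) by auto
  qed
  ultimately have "U = {\<zero>\<^bsub>V\<^esub>}" by blast
  have "u \<in> W" if u: "u \<in> carrier V" for u
  proof -
    obtain y u' where "y \<in> W" "u' \<in> U" "u = y \<oplus>\<^bsub>V\<^esub> u'" using sumV[OF u] by blast
    then show ?thesis using \<open>U = {\<zero>\<^bsub>V\<^esub>}\<close> WV by auto
  qed
  then have "carrier V = W" using WV by auto
  then show ?thesis
    unfolding cyclic_generator_def W_def[symmetric] using w(1,2) m x(2) by simp
qed

text \<open>Let \<open>c i\<close> be the first nonzero coefficient of a relation. Multiplication by \<open>t\<^sup>m\<^sup>-\<^sup>1\<^sup>-\<^sup>i\<close> kills all later
  terms and leaves \<open>c i t\<^sup>m\<^sup>-\<^sup>1 v\<close>.\<close>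

lemma cyclic_dimension:
  assumes V: "left_module R V" and cg: "cyclic_generator V v m"
  shows "spans V {..<m} (\<lambda>i. tpow i \<odot>\<^bsub>V\<^esub> v)"
    "lc V {..<m} (\<lambda>i. tpow i \<odot>\<^bsub>V\<^esub> v) c = \<zero>\<^bsub>V\<^esub> \<Longrightarrow> \<forall>i<m. c i = 0"
proof -
  interpret V: left_module R V by (rule V)
  have v: "v \<in> carrier V" "1 \<le> m" "m \<le> q" "tpow m \<odot>\<^bsub>V\<^esub> v = \<zero>\<^bsub>V\<^esub>" "tpow (m - 1) \<odot>\<^bsub>V\<^esub> v \<noteq> \<zero>\<^bsub>V\<^esub>"
    "carrier V = (\<lambda>a. a \<odot>\<^bsub>V\<^esub> v) ` carrier R"
    using cg by (auto simp: cyclic_generator_def)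
  let ?w = "\<lambda>i. tpow i \<odot>\<^bsub>V\<^esub> v"
  have w: "?w \<in> I \<rightarrow> carrier V" for I using v(1) by (simp add: V.smult_closed)
  have h: "(\<lambda>r. r \<odot>\<^bsub>V\<^esub> v) \<in> lmod_hom R regR V"
    using v(1) by (intro lmod_homI) (auto simp: V.smult_closed V.smult_l_distr V.smult_assoc)
  have "\<exists>c. x = lc V {..<m} ?w c" if x: "x \<in> carrier V" for x
  proof -
    obtain a where a: "a \<in> carrier R" "x = a \<odot>\<^bsub>V\<^esub> v" using x unfolding v(6) by (elim imageE)
    obtain c where c: "a = lc regR {..<q} tpow c" using tpow_expansion[OF a(1)] by blast
    have "x = lc V {..<q} ?w c" unfolding a(2) c by (rule lc_hom[OF regR V h]) auto
    also have "\<dots> = lc V {..<q} ?w (\<lambda>i. if i < m then c i else 0)"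
    proof -
      have "ga_single \<one> (c i) \<odot>\<^bsub>V\<^esub> ?w i = ga_single \<one> (if i < m then c i else 0) \<odot>\<^bsub>V\<^esub> ?w i" for i
        using tpow_smult_zero[OF V v(1,4), of i] by (auto simp: V.smult_zero_right)
      then show ?thesis by (simp only: lc_def)
    qed
    also have "\<dots> = lc V {..<m} ?w (\<lambda>i. if i < m then c i else 0)"
      by (rule lc_subset[OF V w]) (use v(3) in auto)
    finally show ?thesis by blast
  qed
  then show "spans V {..<m} ?w" using w by (simp add: spans_def)
  assume z: "lc V {..<m} ?w c = \<zero>\<^bsub>V\<^esub>"
  have "c i = 0" if "i < m" for i
    using that
  proof (induction i rule: less_induct)
    case (less i)
    let ?k = "m - 1 - i"
    have "\<zero>\<^bsub>V\<^esub> = tpow ?k \<odot>\<^bsub>V\<^esub> lc V {..<m} ?w c" using z by (simp add: V.smult_zero_right)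
    also have "\<dots> = (\<Oplus>\<^bsub>V\<^esub>j\<in>{..<m}. tpow ?k \<odot>\<^bsub>V\<^esub> (ga_single \<one> (c j) \<odot>\<^bsub>V\<^esub> ?w j))"
      unfolding lc_def by (rule V.finsum_smult[OF _ _ lc_term_closed[OF V w]]) auto
    also have "\<dots> = (\<Oplus>\<^bsub>V\<^esub>j\<in>{..<m}. if i = j then ga_single \<one> (c i) \<odot>\<^bsub>V\<^esub> ?w (m - 1) else \<zero>\<^bsub>V\<^esub>)"
    proof (rule V.M.finsum_cong')
      fix j assume j: "j \<in> {..<m}"
      have "tpow ?k \<odot>\<^bsub>V\<^esub> (ga_single \<one> (c j) \<odot>\<^bsub>V\<^esub> ?w j) = (tpow ?k \<otimes>\<^bsub>R\<^esub> ga_single \<one> (c j)) \<odot>\<^bsub>V\<^esub> ?w j"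
        using w v(1) by (simp add: V.smult_assoc V.smult_closed)
      also have "\<dots> = ga_single \<one> (c j) \<odot>\<^bsub>V\<^esub> (tpow (?k + j) \<odot>\<^bsub>V\<^esub> v)"
        using v(1) by (simp add: scalar_central[symmetric] V.smult_assoc V.smult_closed tpow_add[symmetric])
      finally have e: "tpow ?k \<odot>\<^bsub>V\<^esub> (ga_single \<one> (c j) \<odot>\<^bsub>V\<^esub> ?w j) = ga_single \<one> (c j) \<odot>\<^bsub>V\<^esub> (tpow (?k + j) \<odot>\<^bsub>V\<^esub> v)" .
      consider "j < i" | "j = i" | "j > i" by linarith
      then show "tpow ?k \<odot>\<^bsub>V\<^esub> (ga_single \<one> (c j) \<odot>\<^bsub>V\<^esub> ?w j) =
          (if i = j then ga_single \<one> (c i) \<odot>\<^bsub>V\<^esub> ?w (m - 1) else \<zero>\<^bsub>V\<^esub>)"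
      proof cases
        case 1
        then have "c j = 0" using less by simp
        then show ?thesis unfolding e using 1 v(1) by (simp add: single_zero V.smult_zero_left V.smult_closed)
      next
        case 2
        then have "?k + j = m - 1" using less.prems by simp
        then show ?thesis unfolding e using 2 by simp
      next
        case 3
        then have "m \<le> ?k + j" using less.prems by simp
        then have "tpow (?k + j) \<odot>\<^bsub>V\<^esub> v = \<zero>\<^bsub>V\<^esub>" by (rule tpow_smult_zero[OF V v(1,4)])
        then show ?thesis unfolding e using 3 by (simp add: V.smult_zero_right)
      qed
    qed (use v(1) in \<open>auto intro!: V.smult_closed\<close>)
    also have "\<dots> = ga_single \<one> (c i) \<odot>\<^bsub>V\<^esub> ?w (m - 1)"
      by (rule V.M.finsum_singleton) (use less.prems v(1) in \<open>auto intro!: V.smult_closed\<close>)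
    finally have cz: "ga_single \<one> (c i) \<odot>\<^bsub>V\<^esub> ?w (m - 1) = \<zero>\<^bsub>V\<^esub>" ..
    show "c i = 0"
    proof (rule ccontr)
      assume "c i \<noteq> 0"
      have wm: "?w (m - 1) \<in> carrier V" using v(1) by (simp add: V.smult_closed)
      have "ga_single \<one> (inverse (c i)) \<odot>\<^bsub>V\<^esub> (ga_single \<one> (c i) \<odot>\<^bsub>V\<^esub> ?w (m - 1)) =
          (ga_single \<one> (inverse (c i)) \<otimes>\<^bsub>R\<^esub> ga_single \<one> (c i)) \<odot>\<^bsub>V\<^esub> ?w (m - 1)"
        by (rule V.smult_assoc[symmetric]) (use wm in simp_all)
      also have "\<dots> = ?w (m - 1)"
        using \<open>c i \<noteq> 0\<close> V.smult_one[OF wm] by (simp add: single_mult one_R)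
      finally show False using cz v(5) by (simp add: V.smult_zero_right)
    qed
  qed
  then show "\<forall>i<m. c i = 0" by blast
qed

text \<open>Take the least \<open>m\<close> such that \<open>t\<^sup>m\<close> annihilates \<open>V\<close>, a vector with \<open>t\<^sup>m\<^sup>-\<^sup>1 v \<noteq> 0\<close>, and a coordinate function
  that is nonzero on \<open>t\<^sup>m\<^sup>-\<^sup>1 v\<close>. Then \<open>v\<close> generates \<open>V\<close>, and the powers \<open>t\<^sup>i v\<close> with
  \<open>i < m\<close> form a basis, so \<open>m = n\<close>.\<close>

lemma indecomposable_has_cyclic_generator:
  assumes V: "indecomposable R V" and dim: "has_dimension G V n"
  obtains v where "cyclic_generator V v n"
proof -
  have Vm: "left_module R V" using V by (simp add: indecomposable_def)
  interpret V: left_module R V by (rule Vm)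
  obtain b where b: "b \<in> {..<n} \<rightarrow> carrier V"
    and ex1: "\<And>v. v \<in> carrier V \<Longrightarrow> \<exists>!c. c \<in> {..<n} \<rightarrow>\<^sub>E (UNIV :: 'k set) \<and> v = lc V {..<n} b c"
    using dim[unfolded has_dimension_def, folded lc_def] by (elim exE conjE) (rule that, assumption, erule bspec)
  define co where "co v = (THE c. c \<in> {..<n} \<rightarrow>\<^sub>E (UNIV :: 'k set) \<and> v = lc V {..<n} b c)" for v
  have co: "co v \<in> {..<n} \<rightarrow>\<^sub>E UNIV" "lc V {..<n} b (co v) = v" if "v \<in> carrier V" for v
    using theI'[OF ex1[OF that]] unfolding co_def[symmetric] by auto
  have co_eq: "co v i = c i" if "v \<in> carrier V" "v = lc V {..<n} b c" "i < n" for v c i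
  proof -
    have "v = lc V {..<n} b (restrict c {..<n})"
      unfolding that(2) by (rule lc_cong[OF Vm b]) auto
    then have "co v = restrict c {..<n}"
      unfolding co_def by (intro the1_equality[OF ex1[OF that(1)]]) auto
    then show ?thesis using that(3) by simp
  qed
  have coord: "(\<lambda>v. co v i) \<in> lmod_hom K V (trivial_module G)" if i: "i < n" for i
  proof (rule lmod_homI)
    fix x y assume xy: "x \<in> carrier V" "y \<in> carrier V"
    have "x \<oplus>\<^bsub>V\<^esub> y = lc V {..<n} b (\<lambda>i. co x i + co y i)"
      using lc_add[OF Vm b, of "co x" "co y"] co(2)[OF xy(1)] co(2)[OF xy(2)] by simp
    from co_eq[OF V.M.a_closed[OF xy] this i] have "co (x \<oplus>\<^bsub>V\<^esub> y) i = co x i + co y i" .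
    then show "co (x \<oplus>\<^bsub>V\<^esub> y) i = co x i \<oplus>\<^bsub>trivial_module G\<^esub> co y i" by (simp add: trivial_module_def)
  next
    fix a x assume "a \<in> carrier K" and x: "x \<in> carrier V"
    then obtain l where l: "a = ga_single \<one> l" by auto
    have "a \<odot>\<^bsub>V\<^esub> x = lc V {..<n} b (\<lambda>i. l * co x i)"
      using lc_scale[OF Vm b, of l "co x"] co(2)[OF x] l by simp
    from co_eq[OF _ this i] have "co (a \<odot>\<^bsub>V\<^esub> x) i = l * co x i" using x l by (simp add: V.smult_closed)
    then show "co (a \<odot>\<^bsub>V\<^esub> x) i = a \<odot>\<^bsub>trivial_module G\<^esub> co x i"
      using l aug_single[of \<one> l] by (simp add: trivial_module_def aug_def)
  qed (simp add: trivial_module_def)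
  define kills where "kills m \<longleftrightarrow> (\<forall>u\<in>carrier V. tpow m \<odot>\<^bsub>V\<^esub> u = \<zero>\<^bsub>V\<^esub>)" for m
  define m where "m = (LEAST m. kills m)"
  have kq: "kills q" by (simp add: kills_def tpow_q V.smult_zero_left)
  have km: "kills m" unfolding m_def using kq by (rule LeastI)
  have mq: "m \<le> q" unfolding m_def using kq by (rule Least_le)
  have "\<not> kills 0"
  proof
    assume "kills 0"
    then have "u = \<zero>\<^bsub>V\<^esub>" if "u \<in> carrier V" for u using that by (simp add: kills_def V.smult_one)
    then have "carrier V = {\<zero>\<^bsub>V\<^esub>}" by auto
    then show False using V by (simp add: indecomposable_def)
  qed
  then have m1: "1 \<le> m" using km by (cases m) auto
  then have "\<not> kills (m - 1)" unfolding m_def by (metis One_nat_def Suc_le_eq diff_less not_less_Least zero_less_one)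
  then obtain v where v: "v \<in> carrier V" "tpow (m - 1) \<odot>\<^bsub>V\<^esub> v \<noteq> \<zero>\<^bsub>V\<^esub>" by (auto simp: kills_def)
  let ?x = "tpow (m - 1) \<odot>\<^bsub>V\<^esub> v"
  have x: "?x \<in> carrier V" using v(1) by (simp add: V.smult_closed)
  have "\<exists>i<n. co ?x i \<noteq> 0"
    using v(2) co(2)[OF x] lc_zero[OF Vm b, of "co ?x"] by auto
  then obtain i where i: "i < n" "co ?x i \<noteq> 0" by blast
  have cg: "cyclic_generator V v m"
    by (rule indecomposable_cyclic[OF V coord[OF i(1)] v(1) m1 i(2) _ mq]) (use km in \<open>simp add: kills_def\<close>)
  have "spans V {..<n} b" unfolding spans_def using b co(2) by (metis finite_lessThan)
  then have "m \<le> n"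
    by (rule independent_le_spanning[OF Vm, of _ b "\<lambda>i. tpow i \<odot>\<^bsub>V\<^esub> v"])
      (use v(1) cyclic_dimension(2)[OF Vm cg] in \<open>auto simp: V.smult_closed\<close>)
  moreover have "n \<le> m"
  proof (rule independent_le_spanning[OF Vm cyclic_dimension(1)[OF Vm cg] b])
    fix c assume c: "lc V {..<n} b c = \<zero>\<^bsub>V\<^esub>"
    have "\<zero>\<^bsub>V\<^esub> = lc V {..<n} b (\<lambda>_. 0)" using lc_zero[OF Vm b, of "\<lambda>_. 0"] by simp
    from co_eq[OF V.M.zero_closed this] co_eq[OF V.M.zero_closed c[symmetric]]
    show "\<forall>i<n. c i = 0" by metis
  qed
  ultimately show ?thesis using cg that by auto
qed

end

section \<open>The induced module\<close>

context cyclic_normal_subgroup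
begin

abbreviation H :: "('g, 'x) monoid_scheme" where "H \<equiv> G\<lparr>carrier := C\<rparr>"
abbreviation RC :: "('g \<Rightarrow> 'k) ring" where "RC \<equiv> group_algebra H"

lemma subgroup_C: "subgroup C G"
  using C_normal normal_imp_subgroup by blast

lemma cyclic_p_group_C: "cyclic_p_group H RC p C g q"
proof -
  interpret C: subgroup C G by (rule subgroup_C)
  interpret H: group H by (rule C.subgroup_is_group) (rule is_group)
  have "finite C" using C_subset finite_G finite_subset by blast
  moreover have "C \<lhd> H" using H.normal_self by simp
  moreover have "generate H {g} = C" using generate_consistent[of "{g}" C] g_C subgroup_C generate_g by simp
  moreover have "\<exists>a. Coset.order H = p ^ a" using card_C q_power by (simp add: Coset.order_def)
  ultimately show ?thesis
    by (intro cyclic_p_group.intro cyclic_p_group_axioms.intro cyclic_normal_subgroup.intro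
        cyclic_normal_subgroup_axioms.intro p_group_algebra.intro p_group_algebra_axioms.intro
        finite_group_algebra.intro finite_group_algebra_axioms.intro)
      (assumption | rule H.is_group prime_p char_p card_C q_power g_C refl | simp)+
qed

end

text \<open>The group algebras \<open>kC\<close> and \<open>kG\<close> side by side: the facts on modules of a cyclic \<open>p\<close>-group apply to \<open>C\<close>
  under the qualifier \<open>HC\<close>.\<close>

locale cyclic_normal_pair =
  cyclic_normal_subgroup G R p C g q +
  HC: cyclic_p_group "G\<lparr>carrier := C\<rparr>" "group_algebra (G\<lparr>carrier := C\<rparr>) :: ('g \<Rightarrow> 'k) ring" p C g q
  for G :: "('g, 'x) monoid_scheme" (structure) and R :: "('g \<Rightarrow> 'k::field) ring" and p :: nat
    and C :: "'g set" and g :: 'g and q :: nat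
begin

lemma RC_R: "a \<in> carrier RC \<Longrightarrow> a \<in> carrier R"
  using C_subset by (auto simp: HC.carrier_R carrier_R)

lemma RC_add: "a \<oplus>\<^bsub>RC\<^esub> b = a \<oplus>\<^bsub>R\<^esub> b"
  by (auto simp: HC.add_R add_R)

lemma RC_one: "\<one>\<^bsub>RC\<^esub> = \<one>\<^bsub>R\<^esub>"
  by (simp add: HC.one_R one_R)

lemma RC_mult:
  assumes a: "a \<in> carrier RC" and b: "b \<in> carrier RC"
  shows "a \<otimes>\<^bsub>RC\<^esub> b = a \<otimes>\<^bsub>R\<^esub> b"
proof
  interpret C: subgroup C G by (rule subgroup_C)
  fix x
  have a0: "a y = 0" if "y \<notin> C" for y using a that by (simp add: HC.carrier_R)
  have b0: "b y = 0" if "y \<notin> C" for y using b that by (simp add: HC.carrier_R)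
  have inv: "inv\<^bsub>H\<^esub> y = inv y" if "y \<in> C" for y using m_inv_consistent[OF subgroup_C that] .
  show "(a \<otimes>\<^bsub>RC\<^esub> b) x = (a \<otimes>\<^bsub>R\<^esub> b) x"
  proof (cases "x \<in> C")
    case True
    have "(\<Sum>y\<in>C. a y * b (inv\<^bsub>H\<^esub> y \<otimes> x)) = (\<Sum>y\<in>C. a y * b (inv y \<otimes> x))"
      by (intro sum.cong) (auto simp: inv)
    also have "\<dots> = (\<Sum>y\<in>carrier G. a y * b (inv y \<otimes> x))"
      by (rule sum.mono_neutral_left[OF finite_G C_subset]) (auto simp: a0)
    finally show ?thesis using True C_subset by (auto simp: HC.mult_R mult_R)
  next
    case False
    have "a y * b (inv y \<otimes> x) = 0" if y: "y \<in> carrier G" and x: "x \<in> carrier G" for y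
    proof (cases "y \<in> C")
      case yC: True
      have "inv y \<otimes> x \<notin> C"
      proof
        assume "inv y \<otimes> x \<in> C"
        then have "y \<otimes> (inv y \<otimes> x) \<in> C" using yC by (rule C.m_closed[rotated])
        then show False using False x y by (simp add: m_assoc[symmetric])
      qed
      then show ?thesis using b0 by simp
    qed (simp add: a0)
    then have "(\<Sum>y\<in>carrier G. a y * b (inv y \<otimes> x)) = 0" if "x \<in> carrier G"
      using that by (intro sum.neutral) blast
    then show ?thesis using False by (simp add: HC.mult_R mult_R)
  qed
qed

lemma RC_t: "HC.t = t"
proof
  fix x
  show "HC.t x = t x"
    using g_C HC.one_R HC.single_R[of g 1] HC.R.one_closed
    by (simp add: HC.t_def HC.minus_one_R t_def minus_one_R diff_R HC.diff_R RC_one)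
qed

lemma RC_tpow: "HC.tpow e = tpow e"
proof (induction e)
  case (Suc e)
  have "HC.tpow (Suc e) = HC.tpow e \<otimes>\<^bsub>R\<^esub> HC.t" using RC_mult[OF HC.tpow_R HC.t_R] by simp
  then show ?case using Suc RC_t by simp
qed (simp add: RC_one)

end

lemma (in cyclic_normal_subgroup) cyclic_normal_pair: "cyclic_normal_pair G R p C g q"
  by (intro cyclic_normal_pair.intro cyclic_normal_subgroup_axioms cyclic_p_group_C)

lemma hom_diff_frag:
  assumes "abelian_group A" "h \<in> hom (free_Abelian_group S) (add_monoid A)"
    and "Poly_Mapping.keys x \<subseteq> S" "Poly_Mapping.keys y \<subseteq> S"
  shows "h (x - y) = h x \<ominus>\<^bsub>A\<^esub> h y"
proof -
  interpret A: abelian_group A by fact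
  have c: "h z \<in> carrier A" if "Poly_Mapping.keys z \<subseteq> S" for z
    using hom_in_carrier[OF assms(2), of z] that by simp
  have k: "Poly_Mapping.keys (x - y) \<subseteq> S" using assms(3,4) keys_diff[of x y] by blast
  have "h ((x - y) + y) = h (x - y) \<oplus>\<^bsub>A\<^esub> h y"
    using hom_mult[OF assms(2), of "x - y" y] k assms(4) by simp
  then have "h x = h (x - y) \<oplus>\<^bsub>A\<^esub> h y" by simp
  then show ?thesis using A.add_diff_cancel_right[OF c[OF k] c[OF assms(4)]] by simp
qed

context cyclic_normal_pair
begin

text \<open>The isomorphism sends \<open>a \<otimes> b v\<close> to \<open>a b t\<^sup>q\<^sup>-\<^sup>n\<close>, where \<open>v\<close>
  is a generator of \<open>V\<close>. Every element of the tensor product has the form \<open>a \<otimes> v\<close>; if it is mapped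
  to \<open>a t\<^sup>q\<^sup>-\<^sup>n = 0\<close>, then \<open>a = b t\<^sup>n\<close> and \<open>a \<otimes> v = b \<otimes> t\<^sup>n v = 0\<close>.\<close>

lemma induced_module_iso:
  fixes V :: "('g \<Rightarrow> 'k, 'v) module"
  assumes V: "left_module RC V" and v: "HC.cyclic_generator V v n"
  shows "lmod_iso R (induced_module G C V) (Nt (q - n)) \<noteq> {}"
proof -
  interpret V: left_module RC V by (rule V)
  have vV: "v \<in> carrier V" and n: "1 \<le> n" "n \<le> q" and tn: "tpow n \<odot>\<^bsub>V\<^esub> v = \<zero>\<^bsub>V\<^esub>"
    and tn1: "tpow (n - 1) \<odot>\<^bsub>V\<^esub> v \<noteq> \<zero>\<^bsub>V\<^esub>" and cV: "carrier V = (\<lambda>a. a \<odot>\<^bsub>V\<^esub> v) ` carrier RC"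
    using v unfolding HC.cyclic_generator_def RC_tpow by auto
  let ?e = "q - n"
  have tC: "tpow j \<in> carrier RC" for j using HC.tpow_R[of j] by (simp add: RC_tpow)
  have wd: "a \<otimes>\<^bsub>R\<^esub> tpow ?e = b \<otimes>\<^bsub>R\<^esub> tpow ?e"
    if ab: "a \<in> carrier RC" "b \<in> carrier RC" "a \<odot>\<^bsub>V\<^esub> v = b \<odot>\<^bsub>V\<^esub> v" for a b
  proof -
    have d: "a \<ominus>\<^bsub>RC\<^esub> b \<in> carrier RC" using ab by simp
    have "(a \<ominus>\<^bsub>RC\<^esub> b) \<odot>\<^bsub>V\<^esub> v = \<zero>\<^bsub>V\<^esub>"
      using ab vV V.smult_closed[OF ab(2) vV] by (simp add: V.smult_diff_left V.M.minus_self)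
    then obtain r where r: "r \<in> carrier RC" "a \<ominus>\<^bsub>RC\<^esub> b = r \<otimes>\<^bsub>RC\<^esub> HC.tpow n"
      using HC.annihilator_generator[OF V vV n(1) _ _ d] tn tn1 unfolding RC_tpow by blast
    have "a = (a \<ominus>\<^bsub>RC\<^esub> b) \<oplus>\<^bsub>RC\<^esub> b" using HC.R.diff_add_cancel[OF ab(1,2)] by simp
    also have "\<dots> = (r \<otimes>\<^bsub>R\<^esub> tpow n) \<oplus>\<^bsub>R\<^esub> b" unfolding r(2) RC_tpow RC_add RC_mult[OF r(1) tC] ..
    finally have "a \<otimes>\<^bsub>R\<^esub> tpow ?e = ((r \<otimes>\<^bsub>R\<^esub> tpow n) \<oplus>\<^bsub>R\<^esub> b) \<otimes>\<^bsub>R\<^esub> tpow ?e" by simp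
    then show ?thesis using n RC_R[OF r(1)] RC_R[OF ab(2)] by (simp add: R.l_distr tpow_add' tpow_q)
  qed
  define \<chi> where "\<chi> w = (SOME a. a \<in> carrier RC \<and> w = a \<odot>\<^bsub>V\<^esub> v) \<otimes>\<^bsub>R\<^esub> tpow ?e" for w
  have \<chi>: "\<chi> (a \<odot>\<^bsub>V\<^esub> v) = a \<otimes>\<^bsub>R\<^esub> tpow ?e" if a: "a \<in> carrier RC" for a
  proof -
    have "(SOME b. b \<in> carrier RC \<and> a \<odot>\<^bsub>V\<^esub> v = b \<odot>\<^bsub>V\<^esub> v) \<in> carrier RC \<and>
        a \<odot>\<^bsub>V\<^esub> v = (SOME b. b \<in> carrier RC \<and> a \<odot>\<^bsub>V\<^esub> v = b \<odot>\<^bsub>V\<^esub> v) \<odot>\<^bsub>V\<^esub> v"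
      by (rule someI[of _ a]) (use a in simp)
    then show ?thesis unfolding \<chi>_def by (intro wd) (use a in auto)
  qed
  have rep: "\<exists>a\<in>carrier RC. w = a \<odot>\<^bsub>V\<^esub> v" if "w \<in> carrier V" for w using that cV by auto
  have \<chi>N: "\<chi> w \<in> carrier (Nt ?e)" if w: "w \<in> carrier V" for w
  proof -
    obtain a where "a \<in> carrier RC" "w = a \<odot>\<^bsub>V\<^esub> v" using rep[OF w] by blast
    then show ?thesis using \<chi> RC_R by (auto simp: Nt_carrier)
  qed
  have \<chi>_add: "\<chi> (w \<oplus>\<^bsub>V\<^esub> w') = \<chi> w \<oplus>\<^bsub>R\<^esub> \<chi> w'" if ww: "w \<in> carrier V" "w' \<in> carrier V" for w w'
  proof -
    obtain a b where ab: "a \<in> carrier RC" "w = a \<odot>\<^bsub>V\<^esub> v" "b \<in> carrier RC" "w' = b \<odot>\<^bsub>V\<^esub> v"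
      using rep[OF ww(1)] rep[OF ww(2)] by blast
    then have "w \<oplus>\<^bsub>V\<^esub> w' = (a \<oplus>\<^bsub>RC\<^esub> b) \<odot>\<^bsub>V\<^esub> v" using vV by (simp add: V.smult_l_distr)
    then show ?thesis
      using \<chi>[OF HC.R.a_closed[OF ab(1,3)]] \<chi>[OF ab(1)] \<chi>[OF ab(3)] ab RC_R[OF ab(1)] RC_R[OF ab(3)]
      by (simp add: RC_add R.l_distr)
  qed
  have \<chi>_smult: "\<chi> (r \<odot>\<^bsub>V\<^esub> w) = r \<otimes>\<^bsub>R\<^esub> \<chi> w" if r: "r \<in> carrier RC" and w: "w \<in> carrier V" for r w
  proof -
    obtain a where a: "a \<in> carrier RC" "w = a \<odot>\<^bsub>V\<^esub> v" using rep[OF w] by blast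
    then have "r \<odot>\<^bsub>V\<^esub> w = (r \<otimes>\<^bsub>RC\<^esub> a) \<odot>\<^bsub>V\<^esub> v" using vV r by (simp add: V.smult_assoc)
    then show ?thesis
      using \<chi>[OF HC.R.m_closed[OF r a(1)]] \<chi>[OF a(1)] a RC_R[OF a(1)] RC_R[OF r]
      by (simp add: RC_mult[OF r a(1)] R.m_assoc)
  qed
  have \<chi>v: "\<chi> v = tpow ?e" using \<chi>[OF HC.R.one_closed] unfolding V.smult_one[OF vV] by (simp add: RC_one)
  note \<chi>R = Nt_R[OF \<chi>N]
  define S where "S = carrier R \<times> carrier V"
  define F where "F = free_Abelian_group S"
  interpret F: comm_group F unfolding F_def by (rule abelian_free_Abelian_group)
  have F_sel: "carrier F = {z. Poly_Mapping.keys z \<subseteq> S}" "x \<otimes>\<^bsub>F\<^esub> y = x + y" "\<one>\<^bsub>F\<^esub> = 0" for x y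
    by (auto simp: F_def)
  have Fdiff: "x - y \<in> carrier F" if "x \<in> carrier F" "y \<in> carrier F" for x y
    using that keys_diff[of x y] by (auto simp: F_sel)
  have inv_F: "inv\<^bsub>F\<^esub> x = - x" if "x \<in> carrier F" for x
    using that inv_free_Abelian_group[of x S] by (simp add: F_def)
  have fragF: "frag_of (a, w) \<in> carrier F" if "a \<in> carrier R" "w \<in> carrier V" for a w
    using that by (auto simp: F_sel S_def)
  have "(\<lambda>(a, w). a \<otimes>\<^bsub>R\<^esub> \<chi> w) ` S \<subseteq> carrier (add_monoid R)"
    using \<chi>R by (auto simp: S_def)
  then obtain h where h: "h \<in> hom F (add_monoid R)"
    and h_frag': "\<And>x. x \<in> S \<Longrightarrow> h (frag_of x) = (case x of (a, w) \<Rightarrow> a \<otimes>\<^bsub>R\<^esub> \<chi> w)"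
    unfolding F_def using comm_group.free_Abelian_group_universal[OF R.a_comm_group] by blast
  have h_frag: "h (frag_of (a, w)) = a \<otimes>\<^bsub>R\<^esub> \<chi> w" if "a \<in> carrier R" "w \<in> carrier V" for a w
    using h_frag'[of "(a, w)"] that by (simp add: S_def)
  have h_R: "h z \<in> carrier R" if "z \<in> carrier F" for z using hom_in_carrier[OF h that] by simp
  have h_add: "h (x + y) = h x \<oplus>\<^bsub>R\<^esub> h y" if "x \<in> carrier F" "y \<in> carrier F" for x y
    using hom_mult[OF h that] by (simp add: F_sel)
  have h_diff: "h (x - y) = h x \<ominus>\<^bsub>R\<^esub> h y" if "x \<in> carrier F" "y \<in> carrier F" for x y
    by (rule hom_diff_frag[OF R.abelian_group_axioms h[unfolded F_def]]) (use that in \<open>simp_all add: F_sel\<close>)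
  have h_0: "h 0 = \<zero>\<^bsub>R\<^esub>" using h_diff[of 0 0] h_R[of 0] F.one_closed by (simp add: F_sel R.minus_self)
  define rel where "rel =
     {frag_of (a \<oplus>\<^bsub>R\<^esub> b, w) - frag_of (a, w) - frag_of (b, w) | a b w.
         a \<in> carrier R \<and> b \<in> carrier R \<and> w \<in> carrier V}
    \<union> {frag_of (a, w \<oplus>\<^bsub>V\<^esub> w') - frag_of (a, w) - frag_of (a, w') | a w w'.
         a \<in> carrier R \<and> w \<in> carrier V \<and> w' \<in> carrier V}
    \<union> {frag_of (a \<otimes>\<^bsub>R\<^esub> r, w) - frag_of (a, r \<odot>\<^bsub>V\<^esub> w) | a r w.
         a \<in> carrier R \<and> r \<in> carrier RC \<and> w \<in> carrier V}"
  define N where "N = tensor_relations R RC V"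
  have N_gen: "N = generate F rel"
    by (simp add: N_def tensor_relations_def tensor_free_def F_def S_def rel_def)
  have rel1: "frag_of (a \<oplus>\<^bsub>R\<^esub> b, w) - frag_of (a, w) - frag_of (b, w) \<in> rel"
    if "a \<in> carrier R" "b \<in> carrier R" "w \<in> carrier V" for a b w
    using that unfolding rel_def by blast
  have rel2: "frag_of (a, w \<oplus>\<^bsub>V\<^esub> w') - frag_of (a, w) - frag_of (a, w') \<in> rel"
    if "a \<in> carrier R" "w \<in> carrier V" "w' \<in> carrier V" for a w w'
    using that unfolding rel_def by blast
  have rel3: "frag_of (a \<otimes>\<^bsub>R\<^esub> r, w) - frag_of (a, r \<odot>\<^bsub>V\<^esub> w) \<in> rel"
    if "a \<in> carrier R" "r \<in> carrier RC" "w \<in> carrier V" for a r w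
    using that unfolding rel_def by blast
  have relF: "rel \<subseteq> carrier F"
    unfolding rel_def by (auto intro!: Fdiff fragF intro: RC_R V.smult_closed)
  have N_sub: "subgroup N F" unfolding N_gen by (rule F.generate_is_subgroup[OF relF])
  interpret N: subgroup N F by (rule N_sub)
  have N_rel: "x \<in> N" if "x \<in> rel" for x unfolding N_gen by (rule generate.incl[OF that])
  have N_add: "x + y \<in> N" if "x \<in> N" "y \<in> N" for x y using N.m_closed[OF that] by (simp add: F_sel)
  have N_neg: "- x \<in> N" if "x \<in> N" for x
    using N.m_inv_closed[OF that] inv_F[OF N.mem_carrier[OF that]] by simp
  have N_diff: "x - y \<in> N" if "x \<in> N" "y \<in> N" for x y
    using N_add[OF that(1) N_neg[OF that(2)]] by simp
  have h_rel: "h x = \<zero>\<^bsub>R\<^esub>" if "x \<in> rel" for x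
    using that unfolding rel_def
  proof (elim UnE CollectE exE conjE)
    fix a b w assume x: "x = frag_of (a \<oplus>\<^bsub>R\<^esub> b, w) - frag_of (a, w) - frag_of (b, w)"
      and abw: "a \<in> carrier R" "b \<in> carrier R" "w \<in> carrier V"
    then show "h x = \<zero>\<^bsub>R\<^esub>"
      using \<chi>R[OF abw(3)]
      by (simp add: h_diff fragF Fdiff h_frag R.l_distr R.add_diff_cancel_left R.minus_self)
  next
    fix a w w' assume x: "x = frag_of (a, w \<oplus>\<^bsub>V\<^esub> w') - frag_of (a, w) - frag_of (a, w')"
      and abw: "a \<in> carrier R" "w \<in> carrier V" "w' \<in> carrier V"
    then show "h x = \<zero>\<^bsub>R\<^esub>"
      using \<chi>R[OF abw(2)] \<chi>R[OF abw(3)]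
      by (simp add: h_diff fragF Fdiff h_frag \<chi>_add R.r_distr R.add_diff_cancel_left R.minus_self)
  next
    fix a r w assume x: "x = frag_of (a \<otimes>\<^bsub>R\<^esub> r, w) - frag_of (a, r \<odot>\<^bsub>V\<^esub> w)"
      and abw: "a \<in> carrier R" "r \<in> carrier RC" "w \<in> carrier V"
    then show "h x = \<zero>\<^bsub>R\<^esub>"
      using \<chi>R[OF abw(3)] RC_R[OF abw(2)]
      by (simp add: h_diff fragF V.smult_closed h_frag \<chi>_smult R.m_assoc R.minus_self)
  qed
  have h_N: "h x = \<zero>\<^bsub>R\<^esub>" if "x \<in> N" for x
  proof -
    have "subgroup {x \<in> carrier F. h x = \<zero>\<^bsub>R\<^esub>} F"
    proof (rule subgroup.intro)
      fix x assume x: "x \<in> {x \<in> carrier F. h x = \<zero>\<^bsub>R\<^esub>}"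
      have "0 - x \<in> carrier F" by (rule Fdiff) (use x F.one_closed in \<open>auto simp: F_sel(3)\<close>)
      moreover have "h (0 - x) = \<zero>\<^bsub>R\<^esub>" using h_diff[of 0 x] x F.one_closed h_0 by (simp add: F_sel(3) R.minus_self)
      ultimately show "inv\<^bsub>F\<^esub> x \<in> {x \<in> carrier F. h x = \<zero>\<^bsub>R\<^esub>}" using inv_F x by simp
    next
      fix x y assume xy: "x \<in> {x \<in> carrier F. h x = \<zero>\<^bsub>R\<^esub>}" "y \<in> {x \<in> carrier F. h x = \<zero>\<^bsub>R\<^esub>}"
      then show "x \<otimes>\<^bsub>F\<^esub> y \<in> {x \<in> carrier F. h x = \<zero>\<^bsub>R\<^esub>}"
        using F.m_closed[of x y] h_add[of x y] by (simp add: F_sel(2))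
    qed (use h_0 F.one_closed in \<open>auto simp: F_sel(3)\<close>)
    then have "N \<subseteq> {x \<in> carrier F. h x = \<zero>\<^bsub>R\<^esub>}"
      unfolding N_gen using relF h_rel by (intro F.generate_subgroup_incl) auto
    then show ?thesis using that by auto
  qed
  \<comment> \<open>Modulo the relations, every element has the form \<open>a \<otimes> v\<close>.\<close>
  have red: "\<exists>a\<in>carrier R. z - frag_of (a, v) \<in> N" if z: "Poly_Mapping.keys z \<subseteq> S" for z
    using z
  proof (induction z rule: frag_induction)
    case zero
    have "frag_of (\<zero>\<^bsub>R\<^esub> \<oplus>\<^bsub>R\<^esub> \<zero>\<^bsub>R\<^esub>, v) - frag_of (\<zero>\<^bsub>R\<^esub>, v) - frag_of (\<zero>\<^bsub>R\<^esub>, v) \<in> N"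
      by (rule N_rel[OF rel1]) (use vV in auto)
    then show ?case by (intro bexI[of _ "\<zero>\<^bsub>R\<^esub>"]) simp_all
  next
    case (one x)
    then obtain a w where x: "x = (a, w)" "a \<in> carrier R" "w \<in> carrier V" by (auto simp: S_def)
    obtain r where r: "r \<in> carrier RC" "w = r \<odot>\<^bsub>V\<^esub> v" using rep[OF x(3)] by blast
    have "frag_of (a \<otimes>\<^bsub>R\<^esub> r, v) - frag_of (a, w) \<in> N"
      unfolding r(2) by (rule N_rel[OF rel3[OF x(2) r(1) vV]])
    from N_neg[OF this] show ?case using x RC_R[OF r(1)] by (intro bexI[of _ "a \<otimes>\<^bsub>R\<^esub> r"]) simp_all
  next
    case (diff z1 z2)
    then obtain a1 a2 where a: "a1 \<in> carrier R" "z1 - frag_of (a1, v) \<in> N" "a2 \<in> carrier R"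
      "z2 - frag_of (a2, v) \<in> N" by blast
    have "frag_of ((a1 \<ominus>\<^bsub>R\<^esub> a2) \<oplus>\<^bsub>R\<^esub> a2, v) - frag_of (a1 \<ominus>\<^bsub>R\<^esub> a2, v) - frag_of (a2, v) \<in> N"
      by (rule N_rel[OF rel1]) (use a vV in auto)
    then have "frag_of (a1, v) - frag_of (a1 \<ominus>\<^bsub>R\<^esub> a2, v) - frag_of (a2, v) \<in> N"
      using R.diff_add_cancel[OF a(1,3)] by simp
    from N_add[OF N_diff[OF a(2,4)] this]
    have "(z1 - z2) - frag_of (a1 \<ominus>\<^bsub>R\<^esub> a2, v) \<in> N" by (simp add: algebra_simps)
    then show ?case using a by (intro bexI[of _ "a1 \<ominus>\<^bsub>R\<^esub> a2"]) simp_all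
  qed
  have h_red: "\<exists>a\<in>carrier R. z - frag_of (a, v) \<in> N \<and> h z = a \<otimes>\<^bsub>R\<^esub> tpow ?e" if z: "z \<in> carrier F" for z
  proof -
    obtain a where a: "a \<in> carrier R" "z - frag_of (a, v) \<in> N" using red[of z] z by (auto simp: F_sel)
    have fF: "frag_of (a, v) \<in> carrier F" by (rule fragF[OF a(1) vV])
    have "h z \<ominus>\<^bsub>R\<^esub> h (frag_of (a, v)) = \<zero>\<^bsub>R\<^esub>" using h_N[OF a(2)] h_diff[OF z fF] by simp
    then have "h z = h (frag_of (a, v))" using R.minus_eq_zero_iff[OF h_R[OF z] h_R[OF fF]] by simp
    then show ?thesis using a h_frag[OF a(1) vV] \<chi>v by auto
  qed
  have ker: "z \<in> N" if z: "z \<in> carrier F" "h z = \<zero>\<^bsub>R\<^esub>" for z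
  proof -
    obtain a where a: "a \<in> carrier R" "z - frag_of (a, v) \<in> N" "a \<otimes>\<^bsub>R\<^esub> tpow ?e = \<zero>\<^bsub>R\<^esub>"
      using h_red[OF z(1)] z(2) by metis
    obtain b where b: "b \<in> carrier R" "a = b \<otimes>\<^bsub>R\<^esub> tpow n"
      using annihilator_tpow[of ?e a] a n by auto
    have 1: "frag_of (a, v) - frag_of (b, \<zero>\<^bsub>V\<^esub>) \<in> N"
      using N_rel[OF rel3[OF b(1) tC[of n] vV]] tn b(2) by simp
    have "frag_of (b, \<zero>\<^bsub>V\<^esub> \<oplus>\<^bsub>V\<^esub> \<zero>\<^bsub>V\<^esub>) - frag_of (b, \<zero>\<^bsub>V\<^esub>) - frag_of (b, \<zero>\<^bsub>V\<^esub>) \<in> N"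
      by (rule N_rel[OF rel2]) (use b in auto)
    then have "- frag_of (b, \<zero>\<^bsub>V\<^esub>) \<in> N" by simp
    from N_diff[OF N_add[OF a(2) 1] this] show ?thesis by simp
  qed
  interpret NF: normal N F by (rule F.subgroup_imp_normal[OF N_sub])
  have coset: "N #>\<^bsub>F\<^esub> z = {z' \<in> carrier F. h z' = h z}" if z: "z \<in> carrier F" for z
  proof
    show "N #>\<^bsub>F\<^esub> z \<subseteq> {z' \<in> carrier F. h z' = h z}"
      using z N.subset h_N h_R[OF z] F.m_closed by (auto simp: r_coset_def F_sel(2) h_add)
    show "{z' \<in> carrier F. h z' = h z} \<subseteq> N #>\<^bsub>F\<^esub> z"
    proof
      fix z' assume z': "z' \<in> {z' \<in> carrier F. h z' = h z}"
      then have "z' - z \<in> N" using z h_R[OF z] Fdiff by (intro ker) (auto simp: h_diff R.minus_self)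
      then have "(z' - z) \<otimes>\<^bsub>F\<^esub> z \<in> N #>\<^bsub>F\<^esub> z" unfolding r_coset_def by blast
      then show "z' \<in> N #>\<^bsub>F\<^esub> z" by (simp add: F_sel(2))
    qed
  qed
  define I where "I = induced_module G C V"
  have I_eq: "I = \<lparr>carrier = carrier (F Mod N), monoid.mult = undefined, one = undefined,
      ring.zero = \<one>\<^bsub>F Mod N\<^esub>, add = (\<otimes>\<^bsub>F Mod N\<^esub>),
      smult = (\<lambda>s T. \<Union>z\<in>T. N #>\<^bsub>F\<^esub> frag_extend (\<lambda>(a, v). frag_of (s \<otimes>\<^bsub>R\<^esub> a, v)) z)\<rparr>"
    by (simp add: I_def induced_module_def extend_scalars_def Let_def N_def F_def S_def tensor_free_def R_def[symmetric])
  have I_sel: "carrier I = rcosets\<^bsub>F\<^esub> N" "T \<oplus>\<^bsub>I\<^esub> T' = T <#>\<^bsub>F\<^esub> T'"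
    "s \<odot>\<^bsub>I\<^esub> T = (\<Union>z\<in>T. N #>\<^bsub>F\<^esub> frag_extend (\<lambda>(a, v). frag_of (s \<otimes>\<^bsub>R\<^esub> a, v)) z)" for s T T'
    by (simp_all add: I_eq FactGroup_def)
  have I_rep: "\<exists>z\<in>carrier F. T = N #>\<^bsub>F\<^esub> z" if "T \<in> carrier I" for T
    using that by (auto simp: I_sel(1) RCOSETS_def)
  have I_mem: "N #>\<^bsub>F\<^esub> z \<in> carrier I" if "z \<in> carrier F" for z
    using that by (auto simp: I_sel(1) RCOSETS_def)
  define \<Theta> where "\<Theta> T = h (SOME z. z \<in> T)" for T
  have \<Theta>: "\<Theta> (N #>\<^bsub>F\<^esub> z) = h z" if z: "z \<in> carrier F" for z
  proof -
    have "(SOME z'. z' \<in> N #>\<^bsub>F\<^esub> z) \<in> N #>\<^bsub>F\<^esub> z"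
      by (rule someI[of _ z]) (use z coset[OF z] in simp)
    then show ?thesis unfolding \<Theta>_def using coset[OF z] by simp
  qed
  have ext: "frag_extend (\<lambda>(a, v). frag_of (s \<otimes>\<^bsub>R\<^esub> a, v)) z \<in> carrier F \<and>
      h (frag_extend (\<lambda>(a, v). frag_of (s \<otimes>\<^bsub>R\<^esub> a, v)) z) = s \<otimes>\<^bsub>R\<^esub> h z"
    if s: "s \<in> carrier R" and z: "Poly_Mapping.keys z \<subseteq> S" for s z
  proof -
    let ?E = "frag_extend (\<lambda>(a, v). frag_of (s \<otimes>\<^bsub>R\<^esub> a, v :: 'v))"
    have "z \<in> carrier F \<and> ?E z \<in> carrier F \<and> h (?E z) = s \<otimes>\<^bsub>R\<^esub> h z"
      using z
    proof (induction z rule: frag_induction)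
      case zero
      then show ?case using F.one_closed h_0 s by (simp add: F_sel(3))
    next
      case (one x)
      then obtain a w where x: "x = (a, w)" "a \<in> carrier R" "w \<in> carrier V" by (auto simp: S_def)
      have "?E (frag_of x) = frag_of (s \<otimes>\<^bsub>R\<^esub> a, w)" unfolding x(1) frag_extend_of by simp
      then show ?case using x s fragF h_frag \<chi>R[OF x(3)] by (simp add: R.m_assoc)
    next
      case (diff a b)
      then show ?case using s h_R by (simp add: frag_extend_diff h_diff Fdiff a_minus_def R.r_distr R.r_minus)
    qed
    then show ?thesis by blast
  qed
  have "\<Theta> \<in> lmod_hom R I (Nt ?e)"
  proof (rule lmod_homI)
    fix T assume "T \<in> carrier I"
    then obtain z where z: "z \<in> carrier F" "T = N #>\<^bsub>F\<^esub> z" using I_rep by blast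
    obtain a where "a \<in> carrier R" "h z = a \<otimes>\<^bsub>R\<^esub> tpow ?e" using h_red[OF z(1)] by blast
    then show "\<Theta> T \<in> carrier (Nt ?e)" unfolding z(2) \<Theta>[OF z(1)] Nt_carrier by blast
  next
    fix T T' assume "T \<in> carrier I" "T' \<in> carrier I"
    then obtain z z' where z: "z \<in> carrier F" "T = N #>\<^bsub>F\<^esub> z" "z' \<in> carrier F" "T' = N #>\<^bsub>F\<^esub> z'"
      using I_rep by metis
    have "T \<oplus>\<^bsub>I\<^esub> T' = N #>\<^bsub>F\<^esub> (z \<otimes>\<^bsub>F\<^esub> z')" unfolding I_sel(2) z(2,4) by (rule NF.rcos_sum[OF z(1,3)])
    then show "\<Theta> (T \<oplus>\<^bsub>I\<^esub> T') = \<Theta> T \<oplus>\<^bsub>Nt ?e\<^esub> \<Theta> T'"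
      using \<Theta>[OF F.m_closed[OF z(1,3)]] \<Theta>[OF z(1)] \<Theta>[OF z(3)] h_add[OF z(1,3)] z by (simp add: F_sel(2))
  next
    fix s T assume s: "s \<in> carrier R" and "T \<in> carrier I"
    then obtain z where z: "z \<in> carrier F" "T = N #>\<^bsub>F\<^esub> z" using I_rep by blast
    let ?E = "frag_extend (\<lambda>(a, v). frag_of (s \<otimes>\<^bsub>R\<^esub> a, v :: 'v))"
    have E: "?E z' \<in> carrier F" "h (?E z') = s \<otimes>\<^bsub>R\<^esub> h z'" if "z' \<in> carrier F" for z'
      using ext[OF s, of z'] that by (auto simp: F_sel(1))
    have "N #>\<^bsub>F\<^esub> ?E z' = N #>\<^bsub>F\<^esub> ?E z" if "z' \<in> T" for z'
    proof -
      have "z' \<in> carrier F" "h z' = h z" using that coset[OF z(1)] z(2) by auto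
      then show ?thesis using coset E z(1) by simp
    qed
    moreover have "z \<in> T" using z coset[OF z(1)] by simp
    ultimately have "s \<odot>\<^bsub>I\<^esub> T = N #>\<^bsub>F\<^esub> ?E z" unfolding I_sel(3) by blast
    then show "\<Theta> (s \<odot>\<^bsub>I\<^esub> T) = s \<odot>\<^bsub>Nt ?e\<^esub> \<Theta> T"
      using \<Theta>[OF E(1)[OF z(1)]] \<Theta>[OF z(1)] E(2)[OF z(1)] z(2) by simp
  qed
  moreover have "bij_betw \<Theta> (carrier I) (carrier (Nt ?e))"
    unfolding bij_betw_def
  proof
    show "inj_on \<Theta> (carrier I)"
    proof (rule inj_onI)
      fix T T' assume "T \<in> carrier I" "T' \<in> carrier I" and e: "\<Theta> T = \<Theta> T'"
      then obtain z z' where z: "z \<in> carrier F" "T = N #>\<^bsub>F\<^esub> z" "z' \<in> carrier F" "T' = N #>\<^bsub>F\<^esub> z'"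
        using I_rep by metis
      then have "h z = h z'" using e \<Theta> by simp
      then show "T = T'" unfolding z(2,4) coset[OF z(1)] coset[OF z(3)] by simp
    qed
    show "\<Theta> ` carrier I = carrier (Nt ?e)"
    proof
      show "\<Theta> ` carrier I \<subseteq> carrier (Nt ?e)" using lmod_hom_closed[OF calculation] by auto
      show "carrier (Nt ?e) \<subseteq> \<Theta> ` carrier I"
      proof
        fix y assume "y \<in> carrier (Nt ?e)"
        then obtain b where b: "b \<in> carrier R" "y = b \<otimes>\<^bsub>R\<^esub> tpow ?e" by (auto simp: Nt_carrier)
        have f: "frag_of (b, v) \<in> carrier F" by (rule fragF[OF b(1) vV])
        have "y = \<Theta> (N #>\<^bsub>F\<^esub> frag_of (b, v))"
          unfolding \<Theta>[OF f] h_frag[OF b(1) vV] \<chi>v by (rule b(2))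
        then show "y \<in> \<Theta> ` carrier I" using I_mem[OF f] by (rule image_eqI)
      qed
    qed
  qed
  ultimately have "\<Theta> \<in> lmod_iso R I (Nt ?e)" by (simp add: lmod_iso_def)
  then show ?thesis unfolding I_def by blast
qed

end

section \<open>The lengths of the induced module\<close>

theorem theorem4p15:
  fixes G :: "('g, 'x) monoid_scheme" and C :: "'g set" and g :: 'g and p r n :: nat
    and V :: "('g \<Rightarrow> 'k::field, 'v) module"
    and M :: "('g \<Rightarrow> 'k, 'u) module"
  assumes p: "Factorial_Ring.prime p" and char: "CHAR('k) = p"
    and G: "group G" "\<exists>a. order G = p ^ a"
    and C: "C \<lhd> G" "card C = p ^ r"
    and g: "g \<in> C" "generate G {g} = C"
    and V: "indecomposable (group_algebra (G\<lparr>carrier := C\<rparr>)) V"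
      "has_dimension (G\<lparr>carrier := C\<rparr>) V n"
    and universe: "infinite (UNIV :: 'u set)" "\<exists>e :: 'k \<Rightarrow> 'u. inj e"
    and M: "left_module (group_algebra G) M"
      "lmod_iso (group_algebra G) M (induced_module G C V) \<noteq> {}"
  defines "L \<equiv> principal_left_ideal (group_algebra G)
      (minus_one G g [^]\<^bsub>group_algebra G\<^esub> (p ^ r - n) :: 'g \<Rightarrow> 'k)"
  shows "lmod_iso (group_algebra G) M L \<noteq> {}
    \<and> (\<forall>x\<in>carrier G. (\<lambda>m. m \<otimes>\<^bsub>group_algebra G\<^esub> minus_one G x) \<in> lmod_hom (group_algebra G) L L)
    \<and> (\<forall>x\<in>carrier G. \<forall>\<phi>\<in>lmod_iso (group_algebra G) M L.
          ghost G M M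
            (\<lambda>m. inv_into (carrier M) \<phi> (\<phi> m \<otimes>\<^bsub>group_algebra G\<^esub> minus_one G x)))
    \<and> (int n \<le> \<lceil>(real (p ^ r) - 1) / 2\<rceil> \<longrightarrow>
          ghost_length G M = generating_length G M
          \<and> generating_length G M = radical_length (group_algebra G) M)"
proof -
  have fin: "finite (carrier G)"
  proof (rule ccontr)
    assume "infinite (carrier G)"
    then have "Coset.order G = 0" by (simp add: Coset.order_def)
    then show False using G(2) prime_gt_0_nat[OF p] by auto
  qed
  interpret G: group G by (rule G(1))
  interpret cyclic_normal_universe G "group_algebra G :: ('g \<Rightarrow> 'k) ring" p C g "p ^ r" "TYPE('u)"
    by (intro cyclic_normal_universe.intro p_group_universe.intro finite_group_universe.intro
        cyclic_normal_subgroup.intro cyclic_normal_subgroup_axioms.intro p_group_algebra.intro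
        p_group_algebra_axioms.intro finite_group_algebra.intro finite_group_algebra_axioms.intro
        finite_group_universe_axioms.intro)
      (assumption | rule p char G fin C g universe(1) refl exI)+
  interpret cyclic_normal_pair G "group_algebra G :: ('g \<Rightarrow> 'k) ring" p C g "p ^ r"
    by (rule cyclic_normal_pair)
  have L: "L = Nt (p ^ r - n)" by (simp add: L_def t_def)
  obtain v where v: "HC.cyclic_generator V v n"
    using HC.indecomposable_has_cyclic_generator[OF V] .
  have n: "1 \<le> n" "n \<le> p ^ r" using v by (auto simp: HC.cyclic_generator_def)
  have "left_module RC V" using V(1) by (simp add: indecomposable_def)
  then obtain \<theta> where \<theta>: "\<theta> \<in> lmod_iso (group_algebra G) (induced_module G C V) L"
    using induced_module_iso[OF _ v] unfolding L by blast
  obtain \<psi> where \<psi>: "\<psi> \<in> lmod_iso (group_algebra G) M (induced_module G C V)" using M(2) by blast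
  note \<phi> = lmod_iso_comp[OF \<psi> \<theta>]
  show ?thesis
  proof (intro conjI ballI impI)
    show "lmod_iso (group_algebra G) M L \<noteq> {}" using \<phi> by blast
    fix x assume x: "x \<in> carrier G"
    show "(\<lambda>m. m \<otimes>\<^bsub>group_algebra G\<^esub> minus_one G x) \<in> lmod_hom (group_algebra G) L L"
      unfolding L by (rule Nt_right_mult_hom[OF J_R[OF minus_one_J[OF x]]])
    fix \<phi> assume \<phi>: "\<phi> \<in> lmod_iso (group_algebra G) M L"
    show "ghost G M M (\<lambda>m. inv_into (carrier M) \<phi> (\<phi> m \<otimes>\<^bsub>group_algebra G\<^esub> minus_one G x))"
      by (rule rmult_ghost[OF M(1) \<phi>[unfolded L] _ minus_one_J[OF x]]) simp
  next
    assume "int n \<le> \<lceil>(real (p ^ r) - 1) / 2\<rceil>"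
    \<comment> \<open>The bound on \<open>n\<close> amounts to \<open>2 n \<le> q\<close>, for \<open>q\<close> odd and even.\<close>
    then have "real n - 1 < (real (p ^ r) - 1) / 2" unfolding le_ceiling_iff by simp
    then have "real (2 * n) < real (p ^ r + 1)" by simp
    then have "2 * n \<le> p ^ r" unfolding of_nat_less_iff by simp
    then have e: "p ^ r - n < p ^ r" "p ^ r \<le> 2 * (p ^ r - n)" using n by linarith+
    from lengths_equal[OF M(1) \<phi>[unfolded L] e]
    show "ghost_length G M = generating_length G M"
      and "generating_length G M = radical_length (group_algebra G) M" by blast+
  qed
qed

end
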